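(* Let $d_{\ell}\in(d^{(\ell)}_{\min},\gamma_X)$. Then \[ r^{(\ell)}(d_{\ell})=\overline{r}^{(\ell)}(d_{\ell})=\frac{1}{2\ell}\log\frac{(\lambda^{(\ell)}_{S,1}+\lambda^{(\ell)}_Q)(\lambda_{S,2}+\lambda^{(\ell)}_Q)^{\ell-1}}{(\lambda^{(\ell)}_Q)^{\ell}} \] if either of the following conditions is satisfied: \begin{enumerate} \item $\rho_S\geq 0$ and \[ (\ell-1)\lambda^2_{X,2}(\lambda^{(\ell)}_{S,1})^2\mu^{(\ell)}(\mu^{(\ell)}-1)+\ell(\lambda^{(\ell)}_{X,1})^2\lambda^2_{S,2}\geq 0, \] where \[ \mu^{(\ell)}=\frac{\lambda_{S,2}-\lambda_{S,2}(\lambda_{S,2}+\lambda^{(\ell)}_Q)^{-1}\lambda_{S,2}}{\lambda^{(\ell)}_{S,1}-\lambda^{(\ell)}_{S,1}(\lambda^{(\ell)}_{S,1}+\lambda^{(\ell)}_Q)^{-1}\lambda^{(\ell)}_{S,1}}; \] \item $\rho_S\leq 0$ and \[ (\lambda^{(\ell)}_{X,1})^2\lambda^2_{S,2}\nu^{(\ell)}(\nu^{(\ell)}-1)+\ell\lambda^2_{X,2}(\lambda^{(\ell)}_{S,1})^2\geq 0, \] where \[ \nu^{(\ell)}=\frac{\lambda^{(\ell)}_{S,1}-\lambda^{(\ell)}_{S,1}(\lambda^{(\ell)}_{S,1}+\lambda^{(\ell)}_Q)^{-1}\lambda^{(\ell)}_{S,1}}{\lambda_{S,2}-\lambda_{S,2}(\lambda_{S,2}+\lambda^{(\ell)}_Q)^{-1}\lambda_{S,2}}.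 \] \end{enumerate}
   Context: Fix an integer $\ell\geq 2$. Let $X=(X_1,\dots,X_\ell)^T$ (target signals) and $Z=(Z_1,\dots,Z_\ell)^T$ (noises) be mutually independent zero-mean Gaussian random vectors, and $S=X+Z$ (observed sources). $\Gamma_X$ is the $\ell\times\ell$ covariance matrix of $X$ with all diagonal entries $\gamma_X$ and all off-diagonal entries $\rho_X\gamma_X$; $\Gamma_Z$ likewise with $\gamma_Z,\rho_Z$; and $\Gamma_S=\Gamma_X+\Gamma_Z$ has diagonal entries $\gamma_S$ and off-diagonal entries $\rho_S\gamma_S$. These matrices are assumed positive semidefinite, and $\gamma_X>0$. For $j\in\{1,\dots,\ell\}$ set $\lambda^{(j)}_{X,1}=(1+(j-1)\rho_X)\gamma_X$, $\lambda_{X,2}=(1-\rho_X)\gamma_X$, $\lambda^{(j)}_{Z,1}=(1+(j-1)\rho_Z)\gamma_Z$, $\lambda_{Z,2}=(1-\rho_Z)\gamma_Z$, $\lambda^{(j)}_{S,1}=(1+(j-1)\rho_S)\gamma_S$, $\lambda_{S,2}=(1-\rho_S)\gamma_S$. Let $\{(X(t),Z(t),S(t))\}_{t\ge1}$ be i.i.d. with each $(X(t),Z(t),S(t))$ distributed as $(X,Z,S)$; write $S_i^n=(S_i(1),\dots,S_i(n))$. Logarithms are natural. Achievable region: for $k\in\{1,\dots,\ell\}$, a tuple $(r,d_k,\dots,d_\ell)$ is achievable if for every $\epsilon>0$ there exist $n$ and encoding functions $\phi^{(n)}_i:\mathbb{R}^n\to\mathcal{C}^{(n)}_i$ (finite sets),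 $i=1,\dots,\ell$, such that $\frac{1}{kn}\sum_{i\in\mathcal{A}}\log|\mathcal{C}^{(n)}_i|\le r+\epsilon$ for every $\mathcal{A}\subseteq\{1,\dots,\ell\}$ with $|\mathcal{A}|=k$, and $\frac{1}{|\mathcal{A}|n}\sum_{i\in\mathcal{A}}\sum_{t=1}^n\mathbb{E}[(X_i(t)-\hat X_{i,\mathcal{A}}(t))^2]\le d_{|\mathcal{A}|}+\epsilon$ for every $\mathcal{A}\subseteq\{1,\dots,\ell\}$ with $|\mathcal{A}|\ge k$, where $\hat X_{i,\mathcal{A}}(t)=\mathbb{E}[X_i(t)\mid(\phi^{(n)}_{i'}(S^n_{i'}))_{i'\in\mathcal{A}}]$. The set of achievable tuples is $\mathcal{RD}_k$. Define $r^{(\ell)}(d_\ell)=\min\{r:(r,d_\ell)\in\mathcal{RD}_\ell\}$. For $j\in\{1,\dots,\ell\}$: $d^{(j)}_{\min}=\frac1j d^{(j)}_{\min,1}+\frac{j-1}{j}d_{\min,2}$, where $d^{(j)}_{\min,1}=0$ if $\lambda^{(j)}_{S,1}=0$ and $=\lambda^{(j)}_{X,1}\lambda^{(j)}_{Z,1}/\lambda^{(j)}_{S,1}$ otherwise, and $d_{\min,2}=0$ if $\lambda_{S,2}=0$ and $=\lambda_{X,2}\lambda_{Z,2}/\lambda_{S,2}$ otherwise (this equals $\frac1j\sum_{i=1}^j\mathbb{E}[(X_i-\mathbb{E}[X_i|S_1,\dots,S_j])^2]$). For $k\in\{1,\dots,\ell\}$ and $d_k\in(d^{(k)}_{\min},\gamma_X)$,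 $\lambda^{(k)}_Q$ is the unique positive number satisfying \[ \frac{\lambda^{(k)}_{X,1}(\lambda^{(k)}_{Z,1}+\lambda^{(k)}_Q)}{k(\lambda^{(k)}_{S,1}+\lambda^{(k)}_Q)}+\frac{(k-1)\lambda_{X,2}(\lambda_{Z,2}+\lambda^{(k)}_Q)}{k(\lambda_{S,2}+\lambda^{(k)}_Q)}=d_k, \] and $\overline{r}^{(k)}(d_k)=\frac{1}{2k}\log\frac{(\lambda^{(k)}_{S,1}+\lambda^{(k)}_Q)(\lambda_{S,2}+\lambda^{(k)}_Q)^{k-1}}{(\lambda^{(k)}_Q)^k}$. *)

theory Defs
  imports "HOL-Probability.Probability"
begin

definition equicov :: "real \<Rightarrow> real \<Rightarrow> nat \<Rightarrow> nat \<Rightarrow> real" where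
  "equicov g rho i j = (if i = j then g else rho * g)"

definition psd_mat :: "nat \<Rightarrow> (nat \<Rightarrow> nat \<Rightarrow> real) \<Rightarrow> bool" where
  "psd_mat l G \<longleftrightarrow> (\<forall>a::nat \<Rightarrow> real. 0 \<le> (\<Sum>i<l. \<Sum>j<l. a i * G i j * a j))"

definition gS :: "real \<Rightarrow> real \<Rightarrow> real" where
  "gS gX gZ = gX + gZ"

definition rS :: "real \<Rightarrow> real \<Rightarrow> real \<Rightarrow> real \<Rightarrow> real" where
  "rS gX rX gZ rZ = (rX * gX + rZ * gZ) / (gX + gZ)"

definition lam1 :: "nat \<Rightarrow> real \<Rightarrow> real \<Rightarrow> real" where
  "lam1 j g rho = (1 + (real j - 1) * rho) * g"

definition lam2 :: "real \<Rightarrow> real \<Rightarrow> real" where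
  "lam2 g rho = (1 - rho) * g"

definition dmin :: "nat \<Rightarrow> real \<Rightarrow> real \<Rightarrow> real \<Rightarrow> real \<Rightarrow> real" where
  "dmin j gX rX gZ rZ =
     (let xs1 = lam1 j gX rX; zs1 = lam1 j gZ rZ; s1 = lam1 j (gS gX gZ) (rS gX rX gZ rZ);
          x2 = lam2 gX rX; z2 = lam2 gZ rZ; s2 = lam2 (gS gX gZ) (rS gX rX gZ rZ);
          d1 = (if s1 = 0 then 0 else xs1 * zs1 / s1);
          d2 = (if s2 = 0 then 0 else x2 * z2 / s2)
      in d1 / real j + (real j - 1) / real j * d2)"

definition lamQ :: "nat \<Rightarrow> real \<Rightarrow> real \<Rightarrow> real \<Rightarrow> real \<Rightarrow> real \<Rightarrow> real" where
  "lamQ k gX rX gZ rZ d =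
     (THE q. 0 < q \<and>
        lam1 k gX rX * (lam1 k gZ rZ + q) / (real k * (lam1 k (gS gX gZ) (rS gX rX gZ rZ) + q))
      + (real k - 1) * lam2 gX rX * (lam2 gZ rZ + q) / (real k * (lam2 (gS gX gZ) (rS gX rX gZ rZ) + q))
      = d)"

definition rbar :: "nat \<Rightarrow> real \<Rightarrow> real \<Rightarrow> real \<Rightarrow> real \<Rightarrow> real \<Rightarrow> real" where
  "rbar k gX rX gZ rZ d =
     (let q = lamQ k gX rX gZ rZ d;
          s1 = lam1 k (gS gX gZ) (rS gX rX gZ rZ); s2 = lam2 (gS gX gZ) (rS gX rX gZ rZ)
      in 1 / (2 * real k) * ln ((s1 + q) * (s2 + q) ^ (k - 1) / q ^ k))"

(* Y is a zero-mean Gaussian random vector in R^l with covariance G: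
   each component is a random variable and every linear combination a^T Y is
   N(0, a^T G a) (degenerate = a.s. zero when the variance is 0). *)
definition gaussian_vec :: "'a measure \<Rightarrow> nat \<Rightarrow> ('a \<Rightarrow> nat \<Rightarrow> real) \<Rightarrow> (nat \<Rightarrow> nat \<Rightarrow> real) \<Rightarrow> bool" where
  "gaussian_vec M l Y G \<longleftrightarrow>
     (\<forall>i<l. (\<lambda>\<omega>. Y \<omega> i) \<in> borel_measurable M) \<and>
     (\<forall>a::nat \<Rightarrow> real.
        let v = (\<Sum>i<l. \<Sum>j<l. a i * G i j * a j); L = (\<lambda>\<omega>. \<Sum>i<l. a i * Y \<omega> i) in
        (0 < v \<longrightarrow> distributed M lborel L (\<lambda>x. ennreal (normal_density 0 (sqrt v) x))) \<and>
        (v = 0 \<longrightarrow> (AE \<omega> in M. L \<omega> = 0)))"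

abbreviation vecM :: "nat \<Rightarrow> (nat \<Rightarrow> real) measure" where
  "vecM l \<equiv> PiM {..<l} (\<lambda>_. (borel :: real measure))"

(* The standing model: X t i, Z t i = i-th component (i < l) at time t (t = 0,1,2,...).
   For each t, X(t) ~ N(0,Gamma_X), Z(t) ~ N(0,Gamma_Z), X(t) and Z(t) independent;
   the pairs (X(t),Z(t)) are i.i.d. over t. *)
definition gauss_model ::
  "'a measure \<Rightarrow> nat \<Rightarrow> real \<Rightarrow> real \<Rightarrow> real \<Rightarrow> real \<Rightarrow>
   (nat \<Rightarrow> nat \<Rightarrow> 'a \<Rightarrow> real) \<Rightarrow> (nat \<Rightarrow> nat \<Rightarrow> 'a \<Rightarrow> real) \<Rightarrow> bool" where
  "gauss_model M l gX rX gZ rZ X Z \<longleftrightarrow>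
     prob_space M \<and>
     (\<forall>t. gaussian_vec M l (\<lambda>\<omega> i. X t i \<omega>) (equicov gX rX)) \<and>
     (\<forall>t. gaussian_vec M l (\<lambda>\<omega> i. Z t i \<omega>) (equicov gZ rZ)) \<and>
     (\<forall>t. prob_space.indep_var M
            (vecM l) (\<lambda>\<omega>. restrict (\<lambda>i. X t i \<omega>) {..<l})
            (vecM l) (\<lambda>\<omega>. restrict (\<lambda>i. Z t i \<omega>) {..<l})) \<and>
     prob_space.indep_vars M (\<lambda>_. vecM l \<Otimes>\<^sub>M vecM l)
        (\<lambda>t \<omega>. (restrict (\<lambda>i. X t i \<omega>) {..<l}, restrict (\<lambda>i. Z t i \<omega>) {..<l})) UNIV \<and>
     (\<forall>t. distr M (vecM l \<Otimes>\<^sub>M vecM l)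
             (\<lambda>\<omega>. (restrict (\<lambda>i. X t i \<omega>) {..<l}, restrict (\<lambda>i. Z t i \<omega>) {..<l}))
         = distr M (vecM l \<Otimes>\<^sub>M vecM l)
             (\<lambda>\<omega>. (restrict (\<lambda>i. X 0 i \<omega>) {..<l}, restrict (\<lambda>i. Z 0 i \<omega>) {..<l})))"

definition Sblock :: "(nat \<Rightarrow> nat \<Rightarrow> 'a \<Rightarrow> real) \<Rightarrow> (nat \<Rightarrow> nat \<Rightarrow> 'a \<Rightarrow> real) \<Rightarrow> nat \<Rightarrow> nat \<Rightarrow> 'a \<Rightarrow> nat \<Rightarrow> real" where
  "Sblock X Z n i \<omega> = restrict (\<lambda>t. X t i \<omega> + Z t i \<omega>) {..<n}"

definition code_sigma :: "'a measure \<Rightarrow> (nat \<Rightarrow> nat \<Rightarrow> 'a \<Rightarrow> real) \<Rightarrow> (nat \<Rightarrow> nat \<Rightarrow> 'a \<Rightarrow> real) \<Rightarrow>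
    nat \<Rightarrow> (nat \<Rightarrow> (nat \<Rightarrow> real) \<Rightarrow> nat) \<Rightarrow> nat set \<Rightarrow> 'a measure" where
  "code_sigma M X Z n \<phi> A =
     vimage_algebra (space M) (\<lambda>\<omega>. restrict (\<lambda>i. \<phi> i (Sblock X Z n i \<omega>)) A) (count_space UNIV)"

(* (r, d_k, ..., d_l) in RD_k; d j is d_j (only j = k..l matter) *)
definition achievable ::
  "'a measure \<Rightarrow> nat \<Rightarrow> (nat \<Rightarrow> nat \<Rightarrow> 'a \<Rightarrow> real) \<Rightarrow> (nat \<Rightarrow> nat \<Rightarrow> 'a \<Rightarrow> real) \<Rightarrow>
   nat \<Rightarrow> real \<Rightarrow> (nat \<Rightarrow> real) \<Rightarrow> bool" where
  "achievable M l X Z k r d \<longleftrightarrow>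
     (\<forall>\<epsilon>>0. \<exists>n>0. \<exists>(\<phi> :: nat \<Rightarrow> (nat \<Rightarrow> real) \<Rightarrow> nat) (C :: nat \<Rightarrow> nat set).
        (\<forall>i<l. finite (C i) \<and> \<phi> i \<in> measurable (vecM n) (count_space UNIV) \<and>
               (\<forall>x \<in> space (vecM n). \<phi> i x \<in> C i)) \<and>
        (\<forall>A. A \<subseteq> {..<l} \<and> card A = k \<longrightarrow>
           1 / (real k * real n) * (\<Sum>i\<in>A. ln (real (card (C i)))) \<le> r + \<epsilon>) \<and>
        (\<forall>A. A \<subseteq> {..<l} \<and> k \<le> card A \<longrightarrow>
           1 / (real (card A) * real n) *
             (\<Sum>i\<in>A. \<Sum>t<n. integral\<^sup>L M (\<lambda>\<omega>.
                (X t i \<omega> - real_cond_exp M (code_sigma M X Z n \<phi> A) (X t i) \<omega>)\<^sup>2))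
           \<le> d (card A) + \<epsilon>))"

end

theory Submission
  imports Defs
begin

text \<open>
  Achievability. Encoder \<open>i\<close> and the decoder run a race between common exponential clocks, the encoder
  with the weights of the Gaussian channel \<open>U\<^sub>i = S\<^sub>i + N(0, q)\<close>, the decoder with those of \<open>U\<^sub>i\<close> given its
  predecessors, restricted to the announced bin. Both see the same winner except with a probability
  bounded by a small moment of the information density, so that for quantised channels any sum
  rate above \<open>I(S; U)\<close> suffices. With \<open>q = \<lambda>\<^sub>Q\<close> this is the claimed rate.

  Converse. Let \<open>\<sigma>\<close> be the smaller eigenvalue of the source covariance and write \<open>S = R G + \<surd>\<sigma> H\<close> with
  \<open>G\<close>, \<open>H\<close> white, so that the messages are independent given \<open>G\<close>. For every message tuple tilt the law of
  \<open>(G, H)\<close> to a Gaussian law centred at estimates based on that tuple: jointly for \<open>G\<close>, and separately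
  for each \<open>H\<^sub>i\<close> given \<open>G\<close> and the \<open>i\<close>-th message. By Jensen's inequality the expected log-density is at most the
  logarithm of the number of tuples, and it is a function of squared estimation errors. Since
  the errors of the \<open>H\<^sub>i\<close> are uncorrelated given \<open>G\<close>, their total power may be bounded by any quadratic form
  with eigenvalues \<open>w\<^sub>1, w\<^sub>2 \<ge> 0\<close> of mean one (counted with multiplicity). For suitable \<open>w\<^sub>1, w\<^sub>2\<close> all errors combine into a multiple
  of the distortion, and the hypothesis of the theorem is what makes these weights non-negative.
\<close>

section \<open>Laws determined by characteristic functions\<close>

text \<open>The direct part needs neither joint typicality nor a Markov lemma: the failure bound of
  the race is a power of a likelihood ratio, and powers factor over users and letters, so a block is
  governed by single-letter exponential moments. Quantisation keeps the alphabets finite and the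
  denominators of these ratios bounded below; the squared error is unbounded, so failures are paid
  through truncated second moments. The converse forms no conditional density of a continuous source
  given its messages. Its constants are those of the Gaussian channel U = S + N(0, q): the tilts
  carry the posterior covariances of G given U and of H_i given (G, U_i), and an estimate of S from
  the messages stands in for U once the shrinkage s / (s + q) of each eigenvalue s has been undone.
  The number \<sigma> is the largest white part that can be split off the covariance of S. The two
  stationarity equations, one per eigenvalue, say that the weight of the estimation error of S in
  the rate bound is proportional to its weight in the distortion; the factor \<Lambda> is a Lagrange
  multiplier.\<close>

lemma weighted_char_unique:
  fixes y w :: "'a \<Rightarrow> real" and y' w' :: "'b \<Rightarrow> real"
  assumes P: "prob_space P" and Q: "prob_space Q"
    and [measurable]: "y \<in> borel_measurable P" "w \<in> borel_measurable P"
      "y' \<in> borel_measurable Q" "w' \<in> borel_measurable Q"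
    and w: "\<And>x. 0 \<le> w x" "\<And>x. w x \<le> b" and w': "\<And>x. 0 \<le> w' x" "\<And>x. w' x \<le> b"
    and eq: "\<And>t. (CLINT x|P. w x * iexp (t * y x)) = (CLINT x|Q. w' x * iexp (t * y' x))"
    and [measurable]: "B \<in> sets borel"
  shows "(LINT x|P. w x * indicator B (y x)) = (LINT x|Q. w' x * indicator B (y' x))"
proof -
  interpret P: prob_space P by fact
  interpret Q: prob_space Q by fact
  have intw: "integrable P w" "integrable Q w'"
    by (rule P.integrable_const_bound[where B=b]; use w in auto)
       (rule Q.integrable_const_bound[where B=b]; use w' in auto)
  have m: "(LINT x|P. w x) = (LINT x|Q. w' x)"
  proof -
    have "(CLINT x|P. complex_of_real (w x)) = (CLINT x|Q. complex_of_real (w' x))"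
      using eq[of 0] by simp
    then show ?thesis by simp
  qed
  define m where "m = (LINT x|P. w x)"
  have m0: "0 \<le> m" unfolding m_def using w by (intro integral_nonneg_AE) auto
  show ?thesis
  proof (cases "m = 0")
    case True
    then have "AE x in P. w x = 0" "AE x in Q. w' x = 0"
      using integral_nonneg_eq_0_iff_AE[OF intw(1)] integral_nonneg_eq_0_iff_AE[OF intw(2)] w w' m
      by (auto simp: m_def)
    then have "(LINT x|P. w x * indicator B (y x)) = 0" "(LINT x|Q. w' x * indicator B (y' x)) = 0"
      by (auto intro!: integral_eq_zero_AE elim: eventually_mono)
    then show ?thesis by simp
  next
    case False
    with m0 have mp: "0 < m" by simp
    \<comment> \<open>Dividing by the common mass m, equal on both sides by \<open>eq\<close> at t =
      0, turns the weights into probability densities, to which Levy's uniqueness theorem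
      applies.\<close>
    let ?D1 = "distr (density P (\<lambda>x. ennreal (w x / m))) borel y"
    let ?D2 = "distr (density Q (\<lambda>x. ennreal (w' x / m))) borel y'"
    have nn1: "(\<integral>\<^sup>+x. ennreal (w x / m) \<partial>P) = 1"
      using mp w intw by (subst nn_integral_eq_integral) (auto simp: m_def)
    have nn2: "(\<integral>\<^sup>+x. ennreal (w' x / m) \<partial>Q) = 1"
      using mp w' intw m by (subst nn_integral_eq_integral) (auto simp: m_def)
    have d1: "prob_space (density P (\<lambda>x. ennreal (w x / m)))"
      by (rule prob_spaceI) (use nn1 in \<open>simp add: emeasure_density cong: nn_integral_cong\<close>)
    have d2: "prob_space (density Q (\<lambda>x. ennreal (w' x / m)))"
      by (rule prob_spaceI) (use nn2 in \<open>simp add: emeasure_density cong: nn_integral_cong\<close>)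
    have r1: "real_distribution ?D1" "real_distribution ?D2"
      by (auto simp: real_distribution_def real_distribution_axioms_def intro!: prob_space.prob_space_distr d1 d2)
    have c1: "char ?D1 t = (CLINT x|P. w x * iexp (t * y x)) / m" for t
    proof -
      have "char ?D1 t = (CLINT x|density P (\<lambda>x. ennreal (w x / m)). iexp (t * y x))"
        unfolding char_def by (subst integral_distr) auto
      also have "\<dots> = (CLINT x|P. (w x / m) *\<^sub>R iexp (t * y x))"
        using mp w by (intro integral_density) auto
      also have "\<dots> = (CLINT x|P. (w x * iexp (t * y x)) / m)"
        by (intro Bochner_Integration.integral_cong) (auto simp: scaleR_conv_of_real)
      finally show ?thesis by simp
    qed
    have c2: "char ?D2 t = (CLINT x|Q. w' x * iexp (t * y' x)) / m" for t
    proof -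
      have "char ?D2 t = (CLINT x|density Q (\<lambda>x. ennreal (w' x / m)). iexp (t * y' x))"
        unfolding char_def by (subst integral_distr) auto
      also have "\<dots> = (CLINT x|Q. (w' x / m) *\<^sub>R iexp (t * y' x))"
        using mp w' by (intro integral_density) auto
      also have "\<dots> = (CLINT x|Q. (w' x * iexp (t * y' x)) / m)"
        by (intro Bochner_Integration.integral_cong) (auto simp: scaleR_conv_of_real)
      finally show ?thesis by simp
    qed
    have "?D1 = ?D2"
      using r1 by (intro Levy_uniqueness ext) (simp_all only: c1 c2 eq)
    then have "(LINT x|?D1. indicator B x) = (LINT x|?D2. indicator B x :: real)" by simp
    also have "(LINT x|?D1. indicator B x :: real) = (LINT x|P. (w x / m) *\<^sub>R indicator B (y x))"
      by (subst integral_distr, simp, simp, subst integral_density) (use mp w in auto)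
    also have "(LINT x|?D2. indicator B x :: real) = (LINT x|Q. (w' x / m) *\<^sub>R indicator B (y' x))"
      by (subst integral_distr, simp, simp, subst integral_density) (use mp w' in auto)
    finally show ?thesis using mp by simp
  qed
qed

text \<open>The weights \<open>1\<close>, \<open>1 + cos u\<close> and \<open>1 + sin u\<close> are non-negative, so the one-dimensional
  uniqueness theorem converts one coordinate at a time from a frequency into a Borel set.\<close>

lemma char_family_rectangles:
  fixes Y :: "'i \<Rightarrow> 'a \<Rightarrow> real" and Y' :: "'i \<Rightarrow> 'b \<Rightarrow> real"
  assumes P: "prob_space P" and Q: "prob_space Q" and fin: "finite I"
    and Y[measurable]: "\<And>i. i \<in> I \<Longrightarrow> Y i \<in> borel_measurable P"
    and Y'[measurable]: "\<And>i. i \<in> I \<Longrightarrow> Y' i \<in> borel_measurable Q"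
    and eq: "\<And>a. (CLINT x|P. iexp (\<Sum>i\<in>I. a i * Y i x)) = (CLINT x|Q. iexp (\<Sum>i\<in>I. a i * Y' i x))"
    and B: "\<And>i. i \<in> I \<Longrightarrow> B i \<in> sets borel" and J: "J \<subseteq> I"
  shows "(CLINT x|P. (\<Prod>j\<in>J. indicator (B j) (Y j x)) * iexp (\<Sum>i\<in>I-J. a i * Y i x)) =
         (CLINT x|Q. (\<Prod>j\<in>J. indicator (B j) (Y' j x)) * iexp (\<Sum>i\<in>I-J. a i * Y' i x))"
  using finite_subset[OF J fin] J
proof (induction J arbitrary: a)
  case empty
  then show ?case using eq[of a] by simp
next
  case (insert j J)
  interpret P: prob_space P by fact
  interpret Q: prob_space Q by fact
  have jI: "j \<in> I" "J \<subseteq> I" using insert.prems by auto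
  have IJ: "I - J = insert j (I - insert j J)" using jI insert.hyps by auto
  have [measurable]: "B i \<in> sets borel" if "i \<in> J" for i using B that jI by auto
  have [measurable]: "B j \<in> sets borel" using B jI by auto
  have [measurable]: "Y i \<in> borel_measurable P" "Y' i \<in> borel_measurable Q"
    if "i \<in> J \<or> i = j \<or> i \<in> I - insert j J" for i
    using that Y Y' jI by auto
  define u where "u x = (\<Sum>i\<in>I - insert j J. a i * Y i x)" for x
  define u' where "u' x = (\<Sum>i\<in>I - insert j J. a i * Y' i x)" for x
  define w where "w x = (\<Prod>j\<in>J. indicator (B j) (Y j x) :: real)" for x
  define w' where "w' x = (\<Prod>j\<in>J. indicator (B j) (Y' j x) :: real)" for x
  have [measurable]: "u \<in> borel_measurable P" "u' \<in> borel_measurable Q"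
     "w \<in> borel_measurable P" "w' \<in> borel_measurable Q"
    using Y Y' jI unfolding u_def u'_def w_def w'_def by measurable
  have w01: "0 \<le> w x" "w x \<le> 1" for x
    unfolding w_def by (auto intro!: prod_nonneg prod_le_1 simp: indicator_def)
  have w01': "0 \<le> w' x" "w' x \<le> 1" for x
    unfolding w'_def by (auto intro!: prod_nonneg prod_le_1 simp: indicator_def)
  have iP: "integrable P (\<lambda>x. w x * iexp (f x))" if [measurable]: "f \<in> borel_measurable P" for f
    by (rule P.integrable_const_bound[where B=1]) (use w01 in \<open>auto simp: norm_mult\<close>)
  have iQ: "integrable Q (\<lambda>x. w' x * iexp (f x))" if [measurable]: "f \<in> borel_measurable Q" for f
    by (rule Q.integrable_const_bound[where B=1]) (use w01' in \<open>auto simp: norm_mult\<close>)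
  have i1: "integrable P (\<lambda>x. w x * iexp (t * Y j x + r * u x))"
      "integrable Q (\<lambda>x. w' x * iexp (t * Y' j x + r * u' x))" for t r
    by (rule iP, use Y jI in measurable) (rule iQ, use Y' jI in measurable)
  \<comment> \<open>The factor r scales all remaining frequencies at once; r = 0, 1 and -1 produce
    the weights 1, cos and sin.\<close>
  have ih: "(CLINT x|P. w x * iexp (t * Y j x + r * u x)) = (CLINT x|Q. w' x * iexp (t * Y' j x + r * u' x))" for t r
  proof -
    have h: "(CLINT x|P. (\<Prod>j\<in>J. indicator (B j) (Y j x)) * iexp (\<Sum>i\<in>I-J. ((\<lambda>i. r * a i)(j := t)) i * Y i x)) =
         (CLINT x|Q. (\<Prod>j\<in>J. indicator (B j) (Y' j x)) * iexp (\<Sum>i\<in>I-J. ((\<lambda>i. r * a i)(j := t)) i * Y' i x))"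
      by (rule insert.IH[OF jI(2)])
    have s1: "(\<Sum>i\<in>I-J. ((\<lambda>i. r * a i)(j := t)) i * Y i x) = t * Y j x + r * u x" for x
      unfolding IJ u_def sum_distrib_left using fin
      by (subst sum.insert) (auto intro!: sum.cong simp: ac_simps)
    have s2: "(\<Sum>i\<in>I-J. ((\<lambda>i. r * a i)(j := t)) i * Y' i x) = t * Y' j x + r * u' x" for x
      unfolding IJ u'_def sum_distrib_left using fin
      by (subst sum.insert) (auto intro!: sum.cong simp: ac_simps)
    have s3: "of_real (w x) = (\<Prod>j\<in>J. indicator (B j) (Y j x) :: complex)" for x
      unfolding w_def of_real_prod by (intro prod.cong) (auto simp: indicator_def)
    have s4: "of_real (w' x) = (\<Prod>j\<in>J. indicator (B j) (Y' j x) :: complex)" for x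
      unfolding w'_def of_real_prod by (intro prod.cong) (auto simp: indicator_def)
    show ?thesis using h unfolding s1 s2 s3[symmetric] s4[symmetric] .
  qed
  have ex: "iexp (x + 0 * y) = iexp x" "iexp (x + 1 * y) = iexp x * iexp y"
      "iexp (x + (-1) * y) = iexp x * iexp (- y)" for x y :: real
    by (auto simp: ring_distribs exp_add exp_diff exp_minus divide_inverse)
  have cosx: "complex_of_real (cos x) = (iexp x + iexp (- x)) / 2"
   and sinx: "complex_of_real (sin x) = (iexp x - iexp (- x)) / (2 * \<i>)" for x :: real
    by (auto simp: cos_of_real[symmetric] sin_of_real[symmetric] cos_exp_eq sin_exp_eq mult_minus_right)
  have E0: "(CLINT x|P. w x * iexp (t * Y j x)) = (CLINT x|Q. w' x * iexp (t * Y' j x))" for t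
    using ih[of t 0] by simp
  have Ec: "(CLINT x|P. (w x * (1 + cos (u x))) * iexp (t * Y j x)) =
            (CLINT x|Q. (w' x * (1 + cos (u' x))) * iexp (t * Y' j x))" for t
  proof -
    have "(CLINT x|P. (w x * (1 + cos (u x))) * iexp (t * Y j x)) =
       (CLINT x|P. w x * iexp (t * Y j x + 0 * u x) + (w x * iexp (t * Y j x + 1 * u x) + w x * iexp (t * Y j x + (-1) * u x)) / 2)"
      by (intro Bochner_Integration.integral_cong refl) (unfold ex, simp add: cosx field_simps)
    also have "\<dots> = (CLINT x|P. w x * iexp (t * Y j x + 0 * u x)) + ((CLINT x|P. w x * iexp (t * Y j x + 1 * u x)) + (CLINT x|P. w x * iexp (t * Y j x + (-1) * u x))) / 2"
      by (simp only: Bochner_Integration.integral_add Bochner_Integration.integral_diff integral_divide_zero i1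
          Bochner_Integration.integrable_add Bochner_Integration.integrable_diff integrable_divide)
    also have "\<dots> = (CLINT x|Q. w' x * iexp (t * Y' j x + 0 * u' x)) + ((CLINT x|Q. w' x * iexp (t * Y' j x + 1 * u' x)) + (CLINT x|Q. w' x * iexp (t * Y' j x + (-1) * u' x))) / 2"
      unfolding ih ..
    also have "\<dots> = (CLINT x|Q. w' x * iexp (t * Y' j x + 0 * u' x) + (w' x * iexp (t * Y' j x + 1 * u' x) + w' x * iexp (t * Y' j x + (-1) * u' x)) / 2)"
      by (simp only: Bochner_Integration.integral_add Bochner_Integration.integral_diff integral_divide_zero i1
          Bochner_Integration.integrable_add Bochner_Integration.integrable_diff integrable_divide)
    also have "\<dots> = (CLINT x|Q. (w' x * (1 + cos (u' x))) * iexp (t * Y' j x))"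
      by (intro Bochner_Integration.integral_cong refl) (unfold ex, simp add: cosx field_simps)
    finally show ?thesis .
  qed
  have Es: "(CLINT x|P. (w x * (1 + sin (u x))) * iexp (t * Y j x)) =
            (CLINT x|Q. (w' x * (1 + sin (u' x))) * iexp (t * Y' j x))" for t
  proof -
    have "(CLINT x|P. (w x * (1 + sin (u x))) * iexp (t * Y j x)) =
       (CLINT x|P. w x * iexp (t * Y j x + 0 * u x) + (w x * iexp (t * Y j x + 1 * u x) - w x * iexp (t * Y j x + (-1) * u x)) / (2 * \<i>))"
      by (intro Bochner_Integration.integral_cong refl) (unfold ex, simp add: sinx field_simps)
    also have "\<dots> = (CLINT x|P. w x * iexp (t * Y j x + 0 * u x)) + ((CLINT x|P. w x * iexp (t * Y j x + 1 * u x)) - (CLINT x|P. w x * iexp (t * Y j x + (-1) * u x))) / (2 * \<i>)"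
      by (simp only: Bochner_Integration.integral_add Bochner_Integration.integral_diff integral_divide_zero i1
          Bochner_Integration.integrable_add Bochner_Integration.integrable_diff integrable_divide)
    also have "\<dots> = (CLINT x|Q. w' x * iexp (t * Y' j x + 0 * u' x)) + ((CLINT x|Q. w' x * iexp (t * Y' j x + 1 * u' x)) - (CLINT x|Q. w' x * iexp (t * Y' j x + (-1) * u' x))) / (2 * \<i>)"
      unfolding ih ..
    also have "\<dots> = (CLINT x|Q. w' x * iexp (t * Y' j x + 0 * u' x) + (w' x * iexp (t * Y' j x + 1 * u' x) - w' x * iexp (t * Y' j x + (-1) * u' x)) / (2 * \<i>))"
      by (simp only: Bochner_Integration.integral_add Bochner_Integration.integral_diff integral_divide_zero i1
          Bochner_Integration.integrable_add Bochner_Integration.integrable_diff integrable_divide)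
    also have "\<dots> = (CLINT x|Q. (w' x * (1 + sin (u' x))) * iexp (t * Y' j x))"
      by (intro Bochner_Integration.integral_cong refl) (unfold ex, simp add: sinx field_simps)
    finally show ?thesis .
  qed
  have bd: "0 \<le> w x * (1 + v)" "w x * (1 + v) \<le> 2" if "-1 \<le> v" "v \<le> 1" for x v
    using w01[of x] that mult_mono[of "w x" 1 "1+v" 2] by auto
  have bd': "0 \<le> w' x * (1 + v)" "w' x * (1 + v) \<le> 2" if "-1 \<le> v" "v \<le> 1" for x v
    using w01'[of x] that mult_mono[of "w' x" 1 "1+v" 2] by auto
  define I1 where "I1 x = w x * indicator (B j) (Y j x)" for x
  define I2 where "I2 x = w' x * indicator (B j) (Y' j x)" for x
  have [measurable]: "I1 \<in> borel_measurable P" "I2 \<in> borel_measurable Q"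
    unfolding I1_def I2_def by measurable
  have I1b: "0 \<le> I1 x" "I1 x \<le> 1" "0 \<le> I2 y" "I2 y \<le> 1" for x y
    using w01 w01' by (auto simp: I1_def I2_def indicator_def)
  have int[simp]: "integrable P I1" "integrable Q I2" "integrable P (\<lambda>x. I1 x * cos (u x))" "integrable Q (\<lambda>x. I2 x * cos (u' x))"
     "integrable P (\<lambda>x. I1 x * sin (u x))" "integrable Q (\<lambda>x. I2 x * sin (u' x))"
    using I1b by (auto intro!: P.integrable_const_bound[where B=1] Q.integrable_const_bound[where B=1] AE_I2
        mult_le_one simp: abs_mult)
  have F0: "(LINT x|P. I1 x) = (LINT x|Q. I2 x)"
    unfolding I1_def I2_def
    by (rule weighted_char_unique[OF P Q, where b=1]) (use w01 w01' E0 in auto)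
  have Fc: "(LINT x|P. I1 x * cos (u x)) = (LINT x|Q. I2 x * cos (u' x))"
  proof -
    have "(LINT x|P. (w x * (1 + cos (u x))) * indicator (B j) (Y j x)) = (LINT x|Q. (w' x * (1 + cos (u' x))) * indicator (B j) (Y' j x))"
      by (rule weighted_char_unique[OF P Q, where b=2]) (use bd bd' Ec in auto)
    then have "(LINT x|P. I1 x + I1 x * cos (u x)) = (LINT x|Q. I2 x + I2 x * cos (u' x))"
      by (simp add: I1_def I2_def algebra_simps)
    then show ?thesis using F0 by simp
  qed
  have Fs: "(LINT x|P. I1 x * sin (u x)) = (LINT x|Q. I2 x * sin (u' x))"
  proof -
    have "(LINT x|P. (w x * (1 + sin (u x))) * indicator (B j) (Y j x)) = (LINT x|Q. (w' x * (1 + sin (u' x))) * indicator (B j) (Y' j x))"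
      by (rule weighted_char_unique[OF P Q, where b=2]) (use bd bd' Es in auto)
    then have "(LINT x|P. I1 x + I1 x * sin (u x)) = (LINT x|Q. I2 x + I2 x * sin (u' x))"
      by (simp add: I1_def I2_def algebra_simps)
    then show ?thesis using F0 by simp
  qed
  have ie: "iexp v = complex_of_real (cos v) + \<i> * complex_of_real (sin v)" for v :: real
    by (simp add: exp_Euler cos_of_real sin_of_real)
  have ob: "complex_of_real (of_bool b) = of_bool b" for b by (cases b) auto
  have "(CLINT x|P. (\<Prod>j\<in>insert j J. indicator (B j) (Y j x)) * iexp (u x)) = (CLINT x|P. complex_of_real (I1 x * cos (u x)) + \<i> * complex_of_real (I1 x * sin (u x)))"
    using insert.hyps unfolding I1_def w_def ie
    by (intro Bochner_Integration.integral_cong refl) (auto simp: algebra_simps of_real_prod indicator_def ob)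
  also have "\<dots> = (CLINT x|Q. complex_of_real (I2 x * cos (u' x)) + \<i> * complex_of_real (I2 x * sin (u' x)))"
    using Fc Fs by (subst (1 2) Bochner_Integration.integral_add) (auto simp del: of_real_mult simp: complex_of_real_integrable_eq)
  also have "\<dots> = (CLINT x|Q. (\<Prod>j\<in>insert j J. indicator (B j) (Y' j x)) * iexp (u' x))"
    using insert.hyps unfolding I2_def w'_def ie
    by (intro Bochner_Integration.integral_cong refl) (auto simp: algebra_simps of_real_prod indicator_def ob)
  finally show ?case unfolding u_def u'_def .
qed

text \<open>The Cramer-Wold device. Rectangles are an intersection-stable generator of the product
  sigma-algebra, and \<open>char_family_rectangles\<close> with \<open>J = I\<close> leaves no
  frequency behind.\<close>

theorem char_family_unique:
  fixes Y :: "'i \<Rightarrow> 'a \<Rightarrow> real" and Y' :: "'i \<Rightarrow> 'b \<Rightarrow> real"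
  assumes P: "prob_space P" and Q: "prob_space Q" and fin: "finite I"
    and Y[measurable]: "\<And>i. i \<in> I \<Longrightarrow> Y i \<in> borel_measurable P"
    and Y'[measurable]: "\<And>i. i \<in> I \<Longrightarrow> Y' i \<in> borel_measurable Q"
    and eq: "\<And>a. (CLINT x|P. iexp (\<Sum>i\<in>I. a i * Y i x)) = (CLINT x|Q. iexp (\<Sum>i\<in>I. a i * Y' i x))"
  shows "distr P (PiM I (\<lambda>_. borel)) (\<lambda>x. \<lambda>i\<in>I. Y i x) = distr Q (PiM I (\<lambda>_. borel)) (\<lambda>x. \<lambda>i\<in>I. Y' i x)"
proof -
  interpret P: prob_space P by fact
  interpret Q: prob_space Q by fact
  have mY: "(\<lambda>x. \<lambda>i\<in>I. Y i x) \<in> P \<rightarrow>\<^sub>M PiM I (\<lambda>_. borel)" and mY': "(\<lambda>x. \<lambda>i\<in>I. Y' i x) \<in> Q \<rightarrow>\<^sub>M PiM I (\<lambda>_. borel)"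
    by (intro measurable_restrict; simp)+
  interpret D1: prob_space "distr P (PiM I (\<lambda>_. borel)) (\<lambda>x. \<lambda>i\<in>I. Y i x)" by (rule P.prob_space_distr) fact
  interpret D2: prob_space "distr Q (PiM I (\<lambda>_. borel)) (\<lambda>x. \<lambda>i\<in>I. Y' i x)" by (rule Q.prob_space_distr) fact
  show ?thesis
  proof (rule measure_eqI_PiM_finite[OF fin, where A="\<lambda>_. space (PiM I (\<lambda>_. borel))"])
    fix A :: "'i \<Rightarrow> real set" assume A: "\<And>i. i \<in> I \<Longrightarrow> A i \<in> sets borel"
    have [measurable]: "Pi\<^sub>E I A \<in> sets (PiM I (\<lambda>_. borel))"
      using A fin by (intro sets_PiM_I_finite) auto
    have *: "(CLINT x|P. (\<Prod>j\<in>I. indicator (A j) (Y j x))) = (CLINT x|Q. (\<Prod>j\<in>I. indicator (A j) (Y' j x)))"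
      using char_family_rectangles[OF P Q fin Y Y' eq A subset_refl] by simp
    have ind: "complex_of_real (indicator (Pi\<^sub>E I A) (\<lambda>i\<in>I. f i)) = (\<Prod>j\<in>I. indicator (A j) (f j))" for f
      by (cases "\<forall>i\<in>I. f i \<in> A i") (auto simp: indicator_def PiE_iff fin)
    have e1: "D1.prob (Pi\<^sub>E I A) = (LINT x|P. indicator (Pi\<^sub>E I A) (\<lambda>i\<in>I. Y i x))"
      using mY integral_distr[OF mY, of "indicator (Pi\<^sub>E I A) :: _ \<Rightarrow> real"] by simp
    have e2: "D2.prob (Pi\<^sub>E I A) = (LINT x|Q. indicator (Pi\<^sub>E I A) (\<lambda>i\<in>I. Y' i x))"
      using mY' integral_distr[OF mY', of "indicator (Pi\<^sub>E I A) :: _ \<Rightarrow> real"] by simp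
    have "complex_of_real (D1.prob (Pi\<^sub>E I A)) = (CLINT x|P. complex_of_real (indicator (Pi\<^sub>E I A) (\<lambda>i\<in>I. Y i x)))"
      unfolding e1 by simp
    also have "\<dots> = (CLINT x|Q. complex_of_real (indicator (Pi\<^sub>E I A) (\<lambda>i\<in>I. Y' i x)))"
      unfolding ind by (rule *)
    also have "\<dots> = complex_of_real (D2.prob (Pi\<^sub>E I A))"
      unfolding e2 by simp
    finally show "emeasure (distr P (PiM I (\<lambda>_. borel)) (\<lambda>x. \<lambda>i\<in>I. Y i x)) (Pi\<^sub>E I A) =
       emeasure (distr Q (PiM I (\<lambda>_. borel)) (\<lambda>x. \<lambda>i\<in>I. Y' i x)) (Pi\<^sub>E I A)"
      by (simp add: D1.emeasure_eq_measure D2.emeasure_eq_measure)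
  qed (use fin in \<open>auto intro!: prod_algebraI_finite simp: space_PiM\<close>)
qed

text \<open>Equal characteristic functions for b and -b mean that (Y, S) and (-Y, S) have the same
  law, so the integral equals its own negative. For jointly Gaussian variables this turns zero
  correlation into orthogonality to every measurable function of S, without a theory of conditional
  Gaussian laws.\<close>

theorem reflection_orthogonal:
  fixes Y :: "'a \<Rightarrow> real" and S :: "'i \<Rightarrow> 'a \<Rightarrow> real"
  assumes P: "prob_space P" and fin: "finite I"
    and Y[measurable]: "Y \<in> borel_measurable P"
    and S[measurable]: "\<And>i. i \<in> I \<Longrightarrow> S i \<in> borel_measurable P"
    and eq: "\<And>b a. (CLINT x|P. iexp (b * Y x + (\<Sum>i\<in>I. a i * S i x))) = (CLINT x|P. iexp (- b * Y x + (\<Sum>i\<in>I. a i * S i x)))"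
    and h[measurable]: "h \<in> borel_measurable (PiM I (\<lambda>_. borel))"
  shows "(LINT x|P. Y x * h (\<lambda>i\<in>I. S i x)) = 0"
proof -
  \<comment> \<open>\<open>None\<close> carries Y with the sign c and \<open>Some i\<close> carries
    \<open>S i\<close>; only c = 1 and c = -1 are compared.\<close>
  define F where "F = (\<lambda>c::real. case_option (\<lambda>x. c * Y x) S)"
  let ?I = "insert None (Some ` I)"
  have mF: "F c i \<in> borel_measurable P" if "i \<in> ?I" for c i
    using that by (auto simp: F_def)
  have sum: "(\<Sum>i\<in>?I. a i * F c i x) = c * a None * Y x + (\<Sum>i\<in>I. a (Some i) * S i x)" for a c x
    using fin by (simp add: F_def sum.reindex)
  have "distr P (PiM ?I (\<lambda>_. borel)) (\<lambda>x. \<lambda>i\<in>?I. F 1 i x) = distr P (PiM ?I (\<lambda>_. borel)) (\<lambda>x. \<lambda>i\<in>?I. F (-1) i x)"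
  proof (rule char_family_unique[OF P P])
    show "(CLINT x|P. iexp (\<Sum>i\<in>?I. a i * F 1 i x)) = (CLINT x|P. iexp (\<Sum>i\<in>?I. a i * F (-1) i x))" for a
      unfolding sum using eq[of "a None" "\<lambda>i. a (Some i)"] by (simp only: mult_1 mult_minus1)
  qed (use fin mF in auto)
  moreover define k where "k v = v None * h (\<lambda>i\<in>I. v (Some i))" for v :: "'i option \<Rightarrow> real"
  have [measurable]: "k \<in> borel_measurable (PiM ?I (\<lambda>_. borel))"
    unfolding k_def by (intro borel_measurable_times measurable_component_singleton measurable_compose[OF _ h] measurable_restrict) auto
  ultimately have "(LINT v|distr P (PiM ?I (\<lambda>_. borel)) (\<lambda>x. \<lambda>i\<in>?I. F 1 i x). k v) = (LINT v|distr P (PiM ?I (\<lambda>_. borel)) (\<lambda>x. \<lambda>i\<in>?I. F (-1) i x). k v)"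
    by simp
  moreover have "(LINT v|distr P (PiM ?I (\<lambda>_. borel)) (\<lambda>x. \<lambda>i\<in>?I. F c i x). k v) = (LINT x|P. c * (Y x * h (\<lambda>i\<in>I. S i x)))" for c
  proof -
    have "(LINT v|distr P (PiM ?I (\<lambda>_. borel)) (\<lambda>x. \<lambda>i\<in>?I. F c i x). k v) = (LINT x|P. k (\<lambda>i\<in>?I. F c i x))"
      using mF by (intro integral_distr measurable_restrict) auto
    also have "\<dots> = (LINT x|P. c * (Y x * h (\<lambda>i\<in>I. S i x)))"
      by (intro Bochner_Integration.integral_cong refl) (simp add: k_def F_def cong: restrict_cong)
    finally show ?thesis .
  qed
  ultimately show ?thesis by simp
qed

section \<open>Poisson matching\<close>

abbreviation exp1 :: "real measure" where
  "exp1 \<equiv> density lborel (exponential_density 1)"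

definition clocks :: "'k set \<Rightarrow> ('k \<Rightarrow> real) measure" where
  "clocks K = PiM K (\<lambda>_. exp1)"

text \<open>Cross-multiplied form of T u / p u < T v / p v: up to null sets a letter of weight zero
  behaves like a clock that never rings. Strictness makes the winner unique; a tie has no
  winner.\<close>

definition wins :: "'k set \<Rightarrow> ('k \<Rightarrow> real) \<Rightarrow> 'k \<Rightarrow> ('k \<Rightarrow> real) \<Rightarrow> bool" where
  "wins K p u T \<longleftrightarrow> 0 < p u \<and> (\<forall>v\<in>K - {u}. p v * T u < p u * T v)"

lemma prob_space_exp1: "prob_space exp1"
  by (rule prob_space_exponential_density) simp

lemma prob_space_clocks: "prob_space (clocks K)"
  unfolding clocks_def by (intro prob_space_PiM prob_space_exp1)

lemma sets_clocks[measurable_cong]: "sets (clocks K) = sets (PiM K (\<lambda>_. borel))"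
  unfolding clocks_def by (rule sets_PiM_cong) auto

lemma space_clocks: "space (clocks K) = PiE K (\<lambda>_. UNIV)"
  unfolding clocks_def space_PiM by simp

lemma clocks_component[measurable (raw)]: "u \<in> K \<Longrightarrow> (\<lambda>T. T u) \<in> borel_measurable (clocks K)"
  unfolding clocks_def using measurable_component_singleton[of u K "\<lambda>_. exp1"] by simp

lemma measurable_wins:
  assumes "finite K" "u \<in> K" "\<And>v. v \<in> K \<Longrightarrow> (\<lambda>x. p x v) \<in> borel_measurable M"
  shows "Measurable.pred (M \<Otimes>\<^sub>M clocks K) (\<lambda>x. wins K (p (fst x)) u (snd x))"
proof -
  have [measurable]: "(\<lambda>x. snd x v) \<in> borel_measurable (M \<Otimes>\<^sub>M clocks K)" if "v \<in> K" for v
    using that by measurable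
  have [measurable]: "(\<lambda>x. p (fst x) v) \<in> borel_measurable (M \<Otimes>\<^sub>M clocks K)" if "v \<in> K" for v
    using assms(3)[OF that] by measurable
  have [measurable]: "Measurable.pred (M \<Otimes>\<^sub>M clocks K) (\<lambda>x. p (fst x) v * snd x u < p (fst x) u * snd x v)" if "v \<in> K" for v
    using that assms(2) by measurable
  have [measurable]: "(\<lambda>x. p (fst x) u) \<in> borel_measurable (M \<Otimes>\<^sub>M clocks K)"
    using assms(2,3) by measurable
  show ?thesis unfolding wins_def using assms(1)
    by (intro pred_intros_logic(2,3,5) pred_intros_finite(3,4)) auto
qed

lemma measurable_wins1[measurable]:
  assumes "finite K" "u \<in> K"
  shows "Measurable.pred (clocks K) (wins K p u)"
proof -
  have "Measurable.pred (clocks K) (\<lambda>x. p v * x u < p u * x v)" if "v \<in> K" for v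
    using that assms(2) by measurable
  then have "Measurable.pred (clocks K) (\<lambda>T. \<forall>v\<in>K-{u}. p v * T u < p u * T v)"
    using assms(1) by (intro pred_intros_finite) auto
  then show ?thesis unfolding wins_def[abs_def] by measurable
qed

lemma wins_unique: "wins K q u T \<Longrightarrow> wins K q u' T \<Longrightarrow> u \<in> K \<Longrightarrow> u' \<in> K \<Longrightarrow> u = u'"
  unfolding wins_def by (metis DiffI order_less_asym' singletonD)

lemma AE_exp1_nonneg: "AE y in exp1. 0 \<le> y"
  by (subst AE_density) (auto simp: exponential_density_def)

lemma exp1_greater: "0 \<le> a \<Longrightarrow> measure exp1 {x. a < x} = exp (- a)"
proof -
  assume a: "0 \<le> a"
  interpret prob_space exp1 by (rule prob_space_exp1)
  have "distributed exp1 lborel (\<lambda>x. x) (exponential_density 1)"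
    unfolding distributed_def by (auto simp: distr_id2 exponential_density_nonneg)
  from exponential_distributedD_gt[OF this a] show ?thesis by simp
qed

lemma exp1_laplace:
  assumes "0 \<le> s" shows "(\<integral>\<^sup>+y. ennreal (exp (- s * y)) \<partial>exp1) = ennreal (1 / (1 + s))"
proof -
  interpret prob_space "density lborel (exponential_density (1 + s))"
    using assms by (intro prob_space_exponential_density) simp
  have "(\<integral>\<^sup>+y. ennreal (exp (- s * y)) \<partial>exp1) = (\<integral>\<^sup>+y. ennreal (1 / (1 + s)) * ennreal (exponential_density (1 + s) y) \<partial>lborel)"
    using assms by (subst nn_integral_density)
      (auto intro!: nn_integral_cong simp: ennreal_mult'[symmetric] exponential_density_def exp_add[symmetric] distrib_left)
  also have "\<dots> = ennreal (1 / (1 + s)) * (\<integral>\<^sup>+y. ennreal (exponential_density (1 + s) y) \<partial>lborel)"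
    by (rule nn_integral_cmult) auto
  also have "(\<integral>\<^sup>+y. ennreal (exponential_density (1 + s) y) \<partial>lborel) = 1"
    using emeasure_space_1 by (simp add: emeasure_density cong: nn_integral_cong)
  finally show ?thesis by simp
qed

text \<open>Given that clock u rings at y, the other clocks are independent and clock v exceeds m v
  * y with probability exp (- m v * y). Averaging the product over y is a Laplace transform of the
  exponential law.\<close>

lemma race_probability:
  assumes K: "finite K" "u \<in> K" and m: "\<And>v. v \<in> K \<Longrightarrow> 0 \<le> m v"
  shows "measure (clocks K) {T \<in> space (clocks K). \<forall>v\<in>K-{u}. m v * T u < T v} = 1 / (1 + (\<Sum>v\<in>K-{u}. m v))"
proof -
  interpret E: prob_space exp1 by (rule prob_space_exp1)
  interpret P: product_sigma_finite "\<lambda>_::'a. exp1" by standard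
  interpret C: prob_space "clocks K" by (rule prob_space_clocks)
  let ?K = "K - {u}"
  let ?A = "{T \<in> space (clocks K). \<forall>v\<in>?K. m v * T u < T v}"
  have Kins: "insert u ?K = K" using K by auto
  have A[measurable]: "?A \<in> sets (clocks K)" using K(2)
    by (intro sets.sets_Collect_finite_All' predE) (use K(1) in auto)
  have s0: "0 \<le> (\<Sum>v\<in>?K. m v)" using m by (intro sum_nonneg) auto
  have "emeasure (clocks K) ?A = (\<integral>\<^sup>+T. indicator ?A T \<partial>PiM (insert u ?K) (\<lambda>_. exp1))"
    using A unfolding Kins by (simp add: clocks_def)
  also have "\<dots> = (\<integral>\<^sup>+y. (\<integral>\<^sup>+x. indicator ?A (x(u := y)) \<partial>PiM ?K (\<lambda>_. exp1)) \<partial>exp1)"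
    using K A by (intro P.product_nn_integral_insert_rev) (auto simp: insert_absorb clocks_def)
  also have "\<dots> = (\<integral>\<^sup>+y. (\<integral>\<^sup>+x. (\<Prod>v\<in>?K. indicator {z. m v * y < z} (x v)) \<partial>PiM ?K (\<lambda>_. exp1)) \<partial>exp1)"
  proof (intro nn_integral_cong)
    fix y :: real and x assume x: "x \<in> space (PiM ?K (\<lambda>_. exp1))"
    have "x(u := y) \<in> space (clocks K)" using x K by (auto simp: space_clocks space_PiM PiE_iff extensional_def)
    then have "indicator ?A (x(u := y)) = (of_bool (\<forall>v\<in>?K. m v * y < x v) :: ennreal)"
      by (auto simp: indicator_def)
    also have "\<dots> = (\<Prod>v\<in>?K. indicator {z. m v * y < z} (x v))"
      using K by (auto simp: indicator_def)
    finally show "indicator ?A (x(u := y)) = (\<Prod>v\<in>?K. indicator {z. m v * y < z} (x v) :: ennreal)" .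
  qed
  also have "\<dots> = (\<integral>\<^sup>+y. (\<Prod>v\<in>?K. \<integral>\<^sup>+x. indicator {z. m v * y < z} x \<partial>exp1) \<partial>exp1)"
    using K by (intro nn_integral_cong P.product_nn_integral_prod) auto
  also have "\<dots> = (\<integral>\<^sup>+y. ennreal (exp (- (\<Sum>v\<in>?K. m v) * y)) \<partial>exp1)"
  proof (intro nn_integral_cong_AE)
    show "AE y in exp1. (\<Prod>v\<in>?K. \<integral>\<^sup>+x. indicator {z. m v * y < z} x \<partial>exp1) = ennreal (exp (- (\<Sum>v\<in>?K. m v) * y))"
      using AE_exp1_nonneg
    proof eventually_elim
      fix y :: real assume y: "0 \<le> y"
      have "(\<Prod>v\<in>?K. \<integral>\<^sup>+x. indicator {z. m v * y < z} x \<partial>exp1) = (\<Prod>v\<in>?K. ennreal (exp (- (m v * y))))"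
      proof (intro prod.cong refl)
        fix v assume "v \<in> ?K"
        then have "0 \<le> m v * y" using m y by auto
        then show "(\<integral>\<^sup>+x. indicator {z. m v * y < z} x \<partial>exp1) = ennreal (exp (- (m v * y)))"
          by (simp add: E.emeasure_eq_measure exp1_greater)
      qed
      then show "(\<Prod>v\<in>?K. \<integral>\<^sup>+x. indicator {z. m v * y < z} x \<partial>exp1) = ennreal (exp (- (\<Sum>v\<in>?K. m v) * y))"
        using K by (simp add: prod_ennreal exp_sum[symmetric] sum_negf[symmetric] sum_distrib_right)
    qed
  qed
  also have "\<dots> = ennreal (1 / (1 + (\<Sum>v\<in>?K. m v)))" by (rule exp1_laplace[OF s0])
  finally show ?thesis using s0 by (simp add: C.emeasure_eq_measure)
qed

lemma wins_probability:
  assumes K: "finite K" "u \<in> K" and p: "\<And>v. v \<in> K \<Longrightarrow> 0 \<le> p v" "0 < p u"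
  shows "measure (clocks K) {T \<in> space (clocks K). wins K p u T} = p u / (\<Sum>v\<in>K. p v)"
proof -
  have "{T \<in> space (clocks K). wins K p u T} = {T \<in> space (clocks K). \<forall>v\<in>K-{u}. (p v / p u) * T u < T v}"
    using p by (auto simp: wins_def field_simps)
  then have "measure (clocks K) {T \<in> space (clocks K). wins K p u T} = 1 / (1 + (\<Sum>v\<in>K-{u}. p v / p u))"
    using p race_probability[OF K, of "\<lambda>v. p v / p u"] by simp
  also have "1 + (\<Sum>v\<in>K-{u}. p v / p u) = (\<Sum>v\<in>K. p v) / p u"
    using K p by (simp add: sum.remove[of K u] add_divide_distrib sum_divide_distrib)
  finally show ?thesis by simp
qed

text \<open>Whenever \<open>u\<close> wins a single race against the summed relative weights of \<open>p\<close> and \<open>q\<close>, it wins both races.\<close>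

lemma matching_probability:
  assumes K: "finite K" "u \<in> K" and p: "\<And>v. v \<in> K \<Longrightarrow> 0 \<le> p v" "(\<Sum>v\<in>K. p v) = 1"
    and q: "\<And>v. v \<in> K \<Longrightarrow> 0 \<le> q v" "(\<Sum>v\<in>K. q v) \<le> 1" "0 < p u \<Longrightarrow> 0 < q u"
    and th: "0 < \<theta>" "\<theta> \<le> 1"
  shows "p u * (1 - (p u / q u) powr \<theta>) \<le> measure (clocks K) {T \<in> space (clocks K). wins K p u T \<and> wins K q u T}"
proof (cases "p u = 0")
  case False
  interpret C: prob_space "clocks K" by (rule prob_space_clocks)
  have pu: "0 < p u" using False p(1)[OF K(2)] by simp
  then have qu: "0 < q u" using q by simp
  define m where "m v = p v / p u + q v / q u" for v
  have m0: "0 \<le> m v" if "v \<in> K" for v using that p q pu qu by (simp add: m_def)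
  \<comment> \<open>Putting back v = u adds p u / p u + q u / q u = 2, hence the correction -
    1.\<close>
  have "1 + (\<Sum>v\<in>K-{u}. m v) = (\<Sum>v\<in>K. p v) / p u + (\<Sum>v\<in>K. q v) / q u - 1"
    using K pu qu by (simp add: m_def sum.remove[of K u] add_divide_distrib sum_divide_distrib sum.distrib)
  also have "\<dots> \<le> 1 / p u + 1 / q u"
    using p q(2) qu divide_right_mono[OF q(2), of "q u"] by simp
  finally have le: "1 + (\<Sum>v\<in>K-{u}. m v) \<le> 1 / p u + 1 / q u" .
  have s0: "0 \<le> (\<Sum>v\<in>K-{u}. m v)" using m0 by (intro sum_nonneg) auto
  define r where "r = p u / q u"
  have r: "0 < r" using pu qu by (simp add: r_def)
  \<comment> \<open>The value 1 / (1 + r) is traded for a power of r because powers of block ratios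
    factor over the letters. For r > 1 the left side is at most 0.\<close>
  have "1 - r powr \<theta> \<le> 1 / (1 + r)"
  proof (cases "r \<le> 1")
    case True
    have "r = r powr 1" using r by simp
    also have "\<dots> \<le> r powr \<theta>" using True r th by (intro powr_mono') auto
    finally have "1 - r powr \<theta> \<le> 1 - r" by simp
    also have "\<dots> \<le> 1 / (1 + r)" using r by (simp add: field_simps)
    finally show ?thesis .
  next
    case False
    then have "1 \<le> r powr \<theta>" using th by (intro ge_one_powr_ge_zero) auto
    then show ?thesis using r by (smt (verit) divide_nonneg_nonneg)
  qed
  then have "p u * (1 - r powr \<theta>) \<le> p u * (1 / (1 + r))" using pu by (intro mult_left_mono) auto
  also have "\<dots> = 1 / (1 / p u + 1 / q u)" using pu qu by (simp add: r_def field_simps)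
  also have "\<dots> \<le> 1 / (1 + (\<Sum>v\<in>K-{u}. m v))"
    using le s0 by (intro divide_left_mono) (auto intro!: mult_pos_pos add_pos_pos simp: pu qu)
  also have "\<dots> = measure (clocks K) {T \<in> space (clocks K). \<forall>v\<in>K-{u}. m v * T u < T v}"
    using m0 by (simp add: race_probability[OF K])
  also have "\<dots> \<le> measure (clocks K) {T \<in> space (clocks K). (wins K p u T \<and> wins K q u T)}"
  proof (rule C.finite_measure_mono_AE)
    have "AE T in clocks K. 0 \<le> T u"
      unfolding clocks_def using K AE_exp1_nonneg by (intro AE_PiM_component prob_space_exp1) auto
    then show "AE T in clocks K. T \<in> {T \<in> space (clocks K). \<forall>v\<in>K-{u}. m v * T u < T v} \<longrightarrow>
        T \<in> {T \<in> space (clocks K). (wins K p u T \<and> wins K q u T)}"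
    proof (eventually_elim, safe)
      fix T :: "'a \<Rightarrow> real" assume T: "0 \<le> T u" "\<forall>v\<in>K-{u}. m v * T u < T v"
      have "p v / p u * T u < T v" "q v / q u * T u < T v" if "v \<in> K - {u}" for v
      proof -
        have "0 \<le> p v / p u * T u" "0 \<le> q v / q u * T u" using that p q pu qu T by auto
        moreover have "p v / p u * T u + q v / q u * T u < T v" using T(2) that by (auto simp: m_def ring_distribs)
        ultimately show "p v / p u * T u < T v" "q v / q u * T u < T v" by auto
      qed
      then show "wins K p u T" "wins K q u T" using pu qu by (auto simp: wins_def field_simps)
    qed
    show "{T \<in> space (clocks K). (wins K p u T \<and> wins K q u T)} \<in> sets (clocks K)"
      using K by measurable
  qed
  finally show ?thesis by (simp add: r_def)
qed simp

lemma wins_probability_le: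
  assumes K: "finite K" "u \<in> K" and p: "\<And>v. v \<in> K \<Longrightarrow> 0 \<le> p v" "(\<Sum>v\<in>K. p v) = 1"
  shows "measure (clocks K) {T \<in> space (clocks K). wins K p u T} \<le> p u"
proof (cases "p u = 0")
  case True
  then show ?thesis by (simp add: wins_def)
next
  case False
  then have "0 < p u" using p(1)[OF K(2)] by simp
  then show ?thesis using wins_probability[OF K p(1)] p(2) by simp
qed

section \<open>Random binning and successive decoding\<close>

lemma one_minus_sum_le_prod:
  fixes r :: "'i \<Rightarrow> real"
  assumes "finite I" "\<And>i. i \<in> I \<Longrightarrow> 0 \<le> r i"
  shows "1 - (\<Sum>i\<in>I. r i) \<le> (\<Prod>i\<in>I. max 0 (1 - r i))"
  using assms
proof (induction I)
  case (insert i I)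
  let ?P = "\<Prod>i\<in>I. max 0 (1 - r i)"
  have P: "0 \<le> ?P" "?P \<le> 1" using insert.prems by (auto intro!: prod_nonneg prod_le_1)
  have "1 - (\<Sum>i\<in>insert i I. r i) \<le> ?P - r i" using insert by simp
  also have "\<dots> \<le> ?P - r i * ?P" using P insert.prems mult_left_le[of ?P "r i"] by auto
  also have "\<dots> = (1 - r i) * ?P" by (simp add: algebra_simps)
  also have "\<dots> \<le> max 0 (1 - r i) * ?P" using P by (intro mult_right_mono) auto
  finally show ?case using insert by simp
qed simp

text \<open>Random binning is put into the race itself: the competing keys are pairs of a letter and
  a bin label, and the encoder spreads the weight of a letter evenly over the labels.
  \<open>binsel\<close> is the decoder's counterpart, with all weight on the label that was
  received.\<close>

definition binned :: "nat \<Rightarrow> ('u \<Rightarrow> real) \<Rightarrow> 'u \<times> nat \<Rightarrow> real" where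
  "binned L p = (\<lambda>(v, b). p v / real L)"

definition binsel :: "nat \<Rightarrow> ('u \<Rightarrow> real) \<Rightarrow> 'u \<times> nat \<Rightarrow> real" where
  "binsel b0 q = (\<lambda>(v, b). q v * of_bool (b = b0))"

lemma sum_binned: "0 < L \<Longrightarrow> (\<Sum>k\<in>U \<times> {..<L}. binned L p k) = (\<Sum>v\<in>U. p v)"
  unfolding binned_def by (simp add: sum.cartesian_product[symmetric])

lemma sum_binsel: "b0 < L \<Longrightarrow> (\<Sum>k\<in>U \<times> {..<L}. binsel b0 q k) = (\<Sum>v\<in>U. q v)"
  unfolding binsel_def by (simp add: sum.cartesian_product[symmetric] sum_distrib_left[symmetric] of_bool_def)

text \<open>\<open>p i x\<close> is the law by which encoder i draws its codeword in state x,
  \<open>q i w\<close> the decoder's prediction from the earlier codewords w, and \<open>L i\<close>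
  the number of bins. By \<open>pq\<close> the decoder never rules out a codeword that the encoder
  may choose, as \<open>matching_probability\<close> demands.\<close>

locale matching =
  fixes M :: "'a measure" and l :: nat and U :: "nat \<Rightarrow> 'u set" and L :: "nat \<Rightarrow> nat"
    and p :: "nat \<Rightarrow> 'a \<Rightarrow> 'u \<Rightarrow> real" and q :: "nat \<Rightarrow> (nat \<Rightarrow> 'u) \<Rightarrow> 'u \<Rightarrow> real" and \<theta> :: real
  assumes M: "prob_space M"
    and U: "\<And>i. i < l \<Longrightarrow> finite (U i)" and L: "\<And>i. 0 < L i"
    and p_meas[measurable]: "\<And>i u. i < l \<Longrightarrow> u \<in> U i \<Longrightarrow> (\<lambda>x. p i x u) \<in> borel_measurable M"
    and p_nonneg: "\<And>i x u. i < l \<Longrightarrow> 0 \<le> p i x u"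
    and p_sum: "\<And>i x. i < l \<Longrightarrow> (\<Sum>u\<in>U i. p i x u) = 1"
    and q_nonneg: "\<And>i w u. i < l \<Longrightarrow> 0 \<le> q i w u"
    and q_sum: "\<And>i w. i < l \<Longrightarrow> (\<Sum>u\<in>U i. q i w u) \<le> 1"
    and pq: "\<And>i w x u. i < l \<Longrightarrow> 0 < p i x u \<Longrightarrow> 0 < q i w u"
    and th: "0 < \<theta>" "\<theta> \<le> 1"
begin

abbreviation "K i \<equiv> U i \<times> {..<L i}"
abbreviation "UU \<equiv> PiE {..<l} U"
abbreviation "BB \<equiv> PiE {..<l} (\<lambda>i. {..<L i})"
abbreviation "CL \<equiv> PiM {..<l} (\<lambda>i. clocks (K i))"

text \<open>Success for codewords u and labels b: every encoder race, and every decoder race run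
  with the true predecessors, ends in the same key, so that no error propagates along the successive
  decoding.\<close>

definition hit :: "'a \<Rightarrow> (nat \<Rightarrow> 'u \<times> nat \<Rightarrow> real) \<Rightarrow> (nat \<Rightarrow> 'u) \<Rightarrow> (nat \<Rightarrow> nat) \<Rightarrow> bool" where
  "hit x T u b \<longleftrightarrow> (\<forall>i<l. wins (K i) (binned (L i) (p i x)) (u i, b i) (T i) \<and>
       wins (K i) (binsel (b i) (q i (restrict u {..<i}))) (u i, b i) (T i))"

text \<open>A union bound over the encoders for the failure probability in state x, averaged over
  the codewords drawn from the laws \<open>p i x\<close>. Each inner summand is the loss of one race
  in \<open>matching_probability\<close>; binning divides the ratio by \<open>L i\<close>.\<close>

definition err :: "'a \<Rightarrow> real" where
  "err x = (\<Sum>u\<in>UU. (\<Prod>i<l. p i x (u i)) *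
      (\<Sum>i<l. (p i x (u i) / (real (L i) * q i (restrict u {..<i}) (u i))) powr \<theta>))"

text \<open>When no key wins, the message defaults to 0, a legal label because \<open>L i\<close> is
  positive.\<close>

definition enc :: "(nat \<Rightarrow> 'u \<times> nat \<Rightarrow> real) \<Rightarrow> nat \<Rightarrow> ('u \<Rightarrow> real) \<Rightarrow> nat" where
  "enc T i r = (if \<exists>k\<in>K i. wins (K i) (binned (L i) r) k (T i)
      then snd (SOME k. k \<in> K i \<and> wins (K i) (binned (L i) r) k (T i)) else 0)"

text \<open>Successive decoding is written as a consistency condition on the whole tuple, race i
  being run with the tuple's own predecessors, instead of as a recursion; by \<open>dec_eq\<close>
  the condition has only one solution after a hit.\<close>

definition dec :: "(nat \<Rightarrow> 'u \<times> nat \<Rightarrow> real) \<Rightarrow> (nat \<Rightarrow> nat) \<Rightarrow> nat \<Rightarrow> 'u" where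
  "dec T b = (SOME u. u \<in> UU \<and> (\<forall>i<l. wins (K i) (binsel (b i) (q i (restrict u {..<i}))) (u i, b i) (T i)))"

lemma UU: "finite UU" using U by (intro finite_PiE) auto
lemma BB: "finite BB" by (intro finite_PiE) auto

lemma K: "i < l \<Longrightarrow> finite (K i)" using U by auto

text \<open>The clocks of different encoders are independent, so the probability is a product. The
  upper bound keeps only the encoder's race in each factor; the lower bound clips the factors of
  \<open>matching_probability\<close> at 0 and applies \<open>one_minus_sum_le_prod\<close>.\<close>

lemma hit_prob_bounds:
  assumes u: "u \<in> UU" and b: "b \<in> BB"
  shows "measure CL {T \<in> space CL. hit x T u b} \<le> (\<Prod>i<l. p i x (u i) / L i)" (is ?A)
    and "(\<Prod>i<l. p i x (u i) / L i) * (1 - (\<Sum>i<l. (p i x (u i) / (real (L i) * q i (restrict u {..<i}) (u i))) powr \<theta>))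
        \<le> measure CL {T \<in> space CL. hit x T u b}" (is ?B)
proof -
  interpret P: product_prob_space "\<lambda>i. clocks (K i)" by (rule product_prob_spaceI) (rule prob_space_clocks)
  interpret C: finite_product_prob_space "\<lambda>i. clocks (K i)" "{..<l}" by unfold_locales simp
  define E where "E i = {T \<in> space (clocks (K i)). wins (K i) (binned (L i) (p i x)) (u i, b i) T \<and>
       wins (K i) (binsel (b i) (q i (restrict u {..<i}))) (u i, b i) T}" for i
  have ub: "(u i, b i) \<in> K i" if "i < l" for i using u b that by (auto simp: PiE_iff)
  have E[measurable]: "E i \<in> sets (clocks (K i))" if "i < l" for i
    unfolding E_def using ub[OF that] K[OF that] by measurable
  have "{T \<in> space CL. hit x T u b} = PiE {..<l} E"
    unfolding hit_def E_def space_PiM PiE_iff mem_Collect_eq set_eq_iff by blast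
  then have eq: "measure CL {T \<in> space CL. hit x T u b} = (\<Prod>i<l. measure (clocks (K i)) (E i))"
    using C.prob_times[of E] E by simp
  have b11: "0 \<le> binned (L i) (p i x) k" if "i < l" for i k
    using p_nonneg[OF that] by (auto simp: binned_def split: prod.splits)
  have b12: "(\<Sum>k\<in>K i. binned (L i) (p i x) k) = 1" if "i < l" for i
    by (subst sum_binned[OF L]) (rule p_sum[OF that])
  have b21: "0 \<le> binsel (b i) (q i w) k" if "i < l" for i k w
    using q_nonneg[OF that] by (auto simp: binsel_def split: prod.splits)
  have b22: "(\<Sum>k\<in>K i. binsel (b i) (q i w) k) \<le> 1" if "i < l" for i w
    using q_sum[OF that] ub[OF that] sum_binsel[of "b i" "L i" "q i w" "U i"] by simp
  note b1 = b11 b12 and b2 = b21 b22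
  have le: "measure (clocks (K i)) (E i) \<le> p i x (u i) / L i" if i: "i < l" for i
  proof -
    have "measure (clocks (K i)) (E i) \<le> measure (clocks (K i)) {T \<in> space (clocks (K i)). wins (K i) (binned (L i) (p i x)) (u i, b i) T}"
    proof (rule finite_measure.finite_measure_mono[OF prob_space.finite_measure[OF prob_space_clocks]])
      show "{T \<in> space (clocks (K i)). wins (K i) (binned (L i) (p i x)) (u i, b i) T} \<in> sets (clocks (K i))"
        using ub[OF i] K[OF i] by measurable
    qed (auto simp: E_def)
    also have "\<dots> \<le> binned (L i) (p i x) (u i, b i)"
      using ub[OF i] K[OF i] b1[OF i] by (intro wins_probability_le)
    finally show ?thesis by (simp add: binned_def)
  qed
  show ?A unfolding eq by (intro prod_mono) (use le in auto)
  define r where "r i = (p i x (u i) / (real (L i) * q i (restrict u {..<i}) (u i))) powr \<theta>" for i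
  have ge: "p i x (u i) / L i * max 0 (1 - r i) \<le> measure (clocks (K i)) (E i)" if i: "i < l" for i
  proof -
    have "binned (L i) (p i x) (u i, b i) * (1 - (binned (L i) (p i x) (u i, b i) / binsel (b i) (q i (restrict u {..<i})) (u i, b i)) powr \<theta>)
       \<le> measure (clocks (K i)) (E i)"
      unfolding E_def
    proof (rule matching_probability)
      assume "0 < binned (L i) (p i x) (u i, b i)"
      then have "0 < p i x (u i)" using L[of i] by (simp add: binned_def zero_less_divide_iff)
      from pq[OF i this] show "0 < binsel (b i) (q i (restrict u {..<i})) (u i, b i)" by (simp add: binsel_def)
    qed (use ub[OF i] K[OF i] b1[OF i] b2[OF i] th in auto)
    then have "p i x (u i) / L i * (1 - r i) \<le> measure (clocks (K i)) (E i)"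
      by (simp add: binned_def binsel_def r_def)
    then show ?thesis by (auto simp: max_def)
  qed
  have "(\<Prod>i<l. p i x (u i) / L i) * (1 - (\<Sum>i<l. r i)) \<le> (\<Prod>i<l. p i x (u i) / L i) * (\<Prod>i<l. max 0 (1 - r i))"
    using p_nonneg by (intro mult_left_mono one_minus_sum_le_prod prod_nonneg) (auto simp: r_def)
  also have "\<dots> = (\<Prod>i<l. p i x (u i) / L i * max 0 (1 - r i))" unfolding prod.distrib ..
  also have "\<dots> \<le> (\<Prod>i<l. measure (clocks (K i)) (E i))"
    using ge p_nonneg by (intro prod_mono) auto
  finally show ?B unfolding eq r_def .
qed

lemma sum_prod_p: "(\<Sum>u\<in>UU. \<Prod>i<l. p i x (u i)) = 1"
proof -
  have "(\<Prod>i<l. \<Sum>v\<in>U i. p i x v) = (\<Sum>u\<in>UU. \<Prod>i<l. p i x (u i))"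
    using U by (intro prod_sum_PiE) auto
  then show ?thesis by (simp add: p_sum)
qed

lemma sum_BB: "(\<Sum>b\<in>BB. \<Prod>i<l. f i / real (L i)) = (\<Prod>i<l. f i :: real)"
proof -
  have "(\<Sum>b\<in>BB. \<Prod>i<l. f i / real (L i)) = real (card BB) * (\<Prod>i<l. f i / real (L i))" by simp
  also have "card BB = (\<Prod>i<l. L i)" by (simp add: card_PiE)
  also have "real (\<Prod>i<l. L i) * (\<Prod>i<l. f i / real (L i)) = (\<Prod>i<l. real (L i) * (f i / real (L i)))"
    unfolding prod.distrib of_nat_prod ..
  also have "\<dots> = (\<Prod>i<l. f i)" using L by (intro prod.cong refl) (simp add: less_imp_neq)
  finally show ?thesis .
qed

lemma hit_unique:
  assumes "hit x T u b" "hit x T u' b'" "u \<in> UU" "u' \<in> UU" "b \<in> BB" "b' \<in> BB"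
  shows "u = u' \<and> b = b'"
proof -
  have "(u i, b i) = (u' i, b' i)" if "i < l" for i
    using assms that by (intro wins_unique[of "K i" "binned (L i) (p i x)" _ "T i"]) (auto simp: hit_def PiE_iff)
  then show ?thesis using PiE_ext[OF assms(3,4)] PiE_ext[OF assms(5,6)] by auto
qed

lemma enc_less: "enc T i r < L i"
proof (cases "\<exists>k\<in>K i. wins (K i) (binned (L i) r) k (T i)")
  case True
  then have "\<exists>k. k \<in> K i \<and> wins (K i) (binned (L i) r) k (T i)" by blast
  from someI_ex[OF this] have "(SOME k. k \<in> K i \<and> wins (K i) (binned (L i) r) k (T i)) \<in> K i" by (rule conjunct1)
  then have "snd (SOME k. k \<in> K i \<and> wins (K i) (binned (L i) r) k (T i)) < L i" by (simp only: mem_Times_iff lessThan_iff)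
  then show ?thesis unfolding enc_def using True by (simp only: if_True)
next
  case False
  then show ?thesis unfolding enc_def using L by (simp only: if_False)
qed

lemma enc_eq:
  assumes "k \<in> K i" "wins (K i) (binned (L i) r) k (T i)"
  shows "enc T i r = snd k"
proof -
  have "\<exists>k. k \<in> K i \<and> wins (K i) (binned (L i) r) k (T i)" using assms by blast
  note ex = someI_ex[OF this]
  have "(SOME k. k \<in> K i \<and> wins (K i) (binned (L i) r) k (T i)) = k"
    by (rule wins_unique[OF conjunct2[OF ex] assms(2) conjunct1[OF ex] assms(1)])
  moreover have "\<exists>k\<in>K i. wins (K i) (binned (L i) r) k (T i)" using assms by (rule bexI[rotated])
  ultimately show ?thesis unfolding enc_def by (simp only: if_True)
qed

lemma enc_measurable:
  assumes i: "i < l" and r: "\<And>v. v \<in> U i \<Longrightarrow> (\<lambda>x. r x v) \<in> borel_measurable N"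
  shows "(\<lambda>x. enc T i (r x)) \<in> N \<rightarrow>\<^sub>M count_space UNIV"
proof (rule measurable_count_space_eq2_countable[THEN iffD2], intro conjI ballI)
  fix b :: nat
  have m: "Measurable.pred N (\<lambda>x. wins (K i) (binned (L i) (r x)) k (T i))" if k: "k \<in> K i" for k
  proof -
    have bm: "(\<lambda>x. binned (L i) (r x) v) \<in> borel_measurable N" if "v \<in> K i" for v
      using that r by (auto simp: binned_def split: prod.splits)
    have "Measurable.pred N (\<lambda>x. binned (L i) (r x) v * T i k < binned (L i) (r x) k * T i v)" if "v \<in> K i" for v
      using bm[OF that] bm[OF k] by measurable
    moreover have "Measurable.pred N (\<lambda>x. 0 < binned (L i) (r x) k)" using bm[OF k] by measurable
    ultimately show ?thesis unfolding wins_def using K[OF i]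
      by (intro pred_intros_logic(2,3,5) pred_intros_finite(3,4)) auto
  qed
  \<comment> \<open>Since the winner is unique, the event is a finite union over the keys with label
    b, together with the default case.\<close>
  have iff: "enc T i (r x) = b \<longleftrightarrow> (\<exists>k\<in>K i. snd k = b \<and> wins (K i) (binned (L i) (r x)) k (T i)) \<or>
      (b = 0 \<and> \<not> (\<exists>k\<in>K i. wins (K i) (binned (L i) (r x)) k (T i)))" for x
  proof (cases "\<exists>k\<in>K i. wins (K i) (binned (L i) (r x)) k (T i)")
    case True
    then obtain k where k: "k \<in> K i" "wins (K i) (binned (L i) (r x)) k (T i)" by blast
    have "(\<exists>k\<in>K i. snd k = b \<and> wins (K i) (binned (L i) (r x)) k (T i)) \<longleftrightarrow> snd k = b"
      using k wins_unique[OF _ k(2) _ k(1)] by metis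
    then show ?thesis using enc_eq[of k i "r x" T, OF k] True by simp
  next
    case False
    then have "enc T i (r x) = 0" unfolding enc_def by simp
    with False show ?thesis by auto
  qed
  have "Measurable.pred N (\<lambda>x. (\<exists>k\<in>K i. snd k = b \<and> wins (K i) (binned (L i) (r x)) k (T i)) \<or>
      (b = 0 \<and> \<not> (\<exists>k\<in>K i. wins (K i) (binned (L i) (r x)) k (T i))))"
    using m K[OF i] by (intro pred_intros_logic(2,3,5) pred_intros_finite(3,4)) auto
  then have "Measurable.pred N (\<lambda>x. enc T i (r x) = b)" unfolding iff .
  then have "{x \<in> space N. enc T i (r x) = b} \<in> sets N" by (rule predE)
  moreover have "(\<lambda>x. enc T i (r x)) -` {b} \<inter> space N = {x \<in> space N. enc T i (r x) = b}" by blast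
  ultimately show "(\<lambda>x. enc T i (r x)) -` {b} \<inter> space N \<in> sets N" by (simp only:)
qed blast

text \<open>Strong induction along the encoders: once the predecessors agree, race i has the same
  weights for both tuples and therefore the same winner.\<close>

lemma dec_eq:
  assumes h: "hit x T u b" and u: "u \<in> UU" and b: "b \<in> BB"
  shows "dec T b = u"
proof -
  let ?P = "\<lambda>u. u \<in> UU \<and> (\<forall>i<l. wins (K i) (binsel (b i) (q i (restrict u {..<i}))) (u i, b i) (T i))"
  have Pu: "?P u" using h u by (auto simp: hit_def)
  have uniq: "u' = u" if u': "?P u'" for u'
  proof -
    have "i < l \<Longrightarrow> u' i = u i" for i
    proof (induction i rule: less_induct)
      case (less i)
      have "restrict u' {..<i} = restrict u {..<i}" using less by (auto simp: restrict_def)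
      then have "(u' i, b i) = (u i, b i)" using less.prems Pu u' b
        by (intro wins_unique[of "K i" "binsel (b i) (q i (restrict u {..<i}))" _ "T i"]) (auto simp: PiE_iff)
      then show ?case by simp
    qed
    then show ?thesis using u' u PiE_ext[of u' "{..<l}" U u] by auto
  qed
  show ?thesis unfolding dec_def
  proof (rule some_equality)
    show "?P u" by (rule Pu)
  next
    fix u' assume "?P u'"
    then show "u' = u" by (rule uniq)
  qed
qed

definition msg :: "(nat \<Rightarrow> 'u \<times> nat \<Rightarrow> real) \<Rightarrow> 'a \<Rightarrow> nat \<Rightarrow> nat" where
  "msg T x = (\<lambda>i\<in>{..<l}. enc T i (p i x))"

lemma msg_BB: "msg T x \<in> BB"
  using enc_less by (auto simp: msg_def)

lemma hit_msg:
  assumes h: "hit x T u b" and u: "u \<in> UU" and b: "b \<in> BB"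
  shows "msg T x = b"
proof (rule PiE_ext[OF msg_BB b])
  fix i assume i: "i \<in> {..<l}"
  then have "enc T i (p i x) = snd (u i, b i)"
    using h u b by (intro enc_eq) (auto simp: hit_def PiE_iff)
  then show "msg T x i = b i" using i by (simp add: msg_def)
qed

lemma sum_hit:
  fixes g :: "(nat \<Rightarrow> 'u) \<Rightarrow> real"
  assumes "hit x T u b" "u \<in> UU" "b \<in> BB"
  shows "(\<Sum>u\<in>UU. \<Sum>b\<in>BB. g u * of_bool (hit x T u b)) = g u"
proof -
  have "(\<Sum>b'\<in>BB. g u' * of_bool (hit x T u' b')) = (if u' = u then g u else 0)" if "u' \<in> UU" for u'
  proof -
    have "(\<Sum>b'\<in>BB. g u' * of_bool (hit x T u' b')) = (\<Sum>b'\<in>BB. if b' = b then (if u' = u then g u else 0) else 0)"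
    proof (intro sum.cong refl)
      fix b' assume "b' \<in> BB"
      with hit_unique[OF assms(1) _ assms(2) that assms(3), of b'] assms(1)
      have "hit x T u' b' \<longleftrightarrow> u' = u \<and> b' = b" by metis
      then show "g u' * of_bool (hit x T u' b') = (if b' = b then (if u' = u then g u else 0) else 0)" by simp
    qed
    then show ?thesis using BB assms(3) by simp
  qed
  then have "(\<Sum>u'\<in>UU. \<Sum>b'\<in>BB. g u' * of_bool (hit x T u' b')) = (\<Sum>u'\<in>UU. if u' = u then g u else 0)"
    by (rule sum.cong[OF refl])
  also have "\<dots> = g u" using UU assms(2) by simp
  finally show ?thesis .
qed

lemma hit_measurable[measurable]:
  assumes u: "u \<in> UU" and b: "b \<in> BB"
  shows "Measurable.pred (M \<Otimes>\<^sub>M CL) (\<lambda>z. hit (fst z) (snd z) u b)"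
proof -
  have comp: "(\<lambda>z. (fst z, snd z i)) \<in> M \<Otimes>\<^sub>M CL \<rightarrow>\<^sub>M M \<Otimes>\<^sub>M clocks (K i)" if "i < l" for i
    using that by (intro measurable_Pair measurable_fst measurable_compose[OF measurable_snd measurable_component_singleton]) auto
  have 1: "Measurable.pred (M \<Otimes>\<^sub>M CL) (\<lambda>z. wins (K i) (r (fst z)) (u i, b i) (snd z i))"
    if i: "i < l" and r: "\<And>v. v \<in> K i \<Longrightarrow> (\<lambda>x. r x v) \<in> borel_measurable M" for i r
  proof -
    have "(u i, b i) \<in> K i" using u b i by (auto simp: PiE_iff)
    from measurable_compose[OF comp[OF i] measurable_wins[OF K[OF i] this r]]
    show ?thesis by simp
  qed
  have "Measurable.pred (M \<Otimes>\<^sub>M CL) (\<lambda>z. \<forall>i\<in>{..<l}. wins (K i) (binned (L i) (p i (fst z))) (u i, b i) (snd z i) \<and>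
       wins (K i) (binsel (b i) (q i (restrict u {..<i}))) (u i, b i) (snd z i))"
  proof (intro pred_intros_finite(3) pred_intros_logic(3), simp)
    fix i assume "i \<in> {..<l}"
    then have i: "i < l" by simp
    show "Measurable.pred (M \<Otimes>\<^sub>M CL) (\<lambda>z. wins (K i) (binned (L i) (p i (fst z))) (u i, b i) (snd z i))"
      using i by (intro 1) (auto simp: binned_def)
    show "Measurable.pred (M \<Otimes>\<^sub>M CL) (\<lambda>z. wins (K i) (binsel (b i) (q i (restrict u {..<i}))) (u i, b i) (snd z i))"
      using i by (intro 1[of i "\<lambda>_. binsel (b i) (q i (restrict u {..<i}))"]) auto
  qed
  then show ?thesis unfolding hit_def by (simp only: Ball_def lessThan_iff)
qed

lemma prob_space_CL: "prob_space CL"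
  by (intro prob_space_PiM prob_space_clocks)

lemma hit_measurable_CL:
  assumes x: "x \<in> space M" and u: "u \<in> UU" and b: "b \<in> BB"
  shows "Measurable.pred CL (\<lambda>T. hit x T u b)"
  using measurable_compose[OF measurable_Pair1'[OF x] hit_measurable[OF u b]] by simp

lemma err_nonneg: "0 \<le> err x"
  unfolding err_def using p_nonneg by (intro sum_nonneg mult_nonneg_nonneg prod_nonneg) auto

lemma err_measurable[measurable]: "err \<in> borel_measurable M"
  unfolding err_def by (intro borel_measurable_sum borel_measurable_times borel_measurable_prod
    powr_real_measurable borel_measurable_divide) (auto simp: PiE_iff)

text \<open>The clocks are randomness shared by encoders and decoder. The cost is averaged over
  them, bounded by the ideal cost plus a price for failures, and then the clocks are frozen at a
  value that is no worse than the average. The minimum with 1 lets F dominate the price even where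
  \<open>err\<close> is large.\<close>

theorem matching_coding:
  assumes f_meas[measurable]: "\<And>u. (\<lambda>x. f x u) \<in> borel_measurable M"
    and f: "\<And>x u. 0 \<le> f x u" "\<And>x u. f x u \<le> F x" and F: "integrable M F"
  shows "\<exists>T. (LINT x|M. f x (dec T (msg T x))) \<le>
    (LINT x|M. (\<Sum>u\<in>UU. (\<Prod>i<l. p i x (u i)) * f x u)) + (LINT x|M. F x * min 1 (err x))"
proof -
  interpret M: prob_space M by (rule M)
  interpret CL: prob_space CL by (rule prob_space_CL)
  interpret MC: pair_prob_space M CL ..
  have F0: "0 \<le> F x" for x using f[of x undefined] by linarith
  have [measurable]: "F \<in> borel_measurable M" using F by auto
  define N where "N x T = (\<Sum>u\<in>UU. \<Sum>b\<in>BB. of_bool (hit x T u b) :: real)" for x T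
  \<comment> \<open>G charges \<open>f x u\<close> on a hit and the full bound \<open>F x\<close>
    otherwise. It is linear in the hit indicators, so its mean follows from the hit probabilities,
    and it dominates the cost of the actual decoder.\<close>
  define G where "G x T = (\<Sum>u\<in>UU. \<Sum>b\<in>BB. f x u * of_bool (hit x T u b)) + F x * (1 - N x T)" for x T
  have Gcases: "(\<exists>u b. u \<in> UU \<and> b \<in> BB \<and> hit x T u b \<and> G x T = f x u) \<or>
     ((\<forall>u\<in>UU. \<forall>b\<in>BB. \<not> hit x T u b) \<and> G x T = F x)" for x T
  proof (cases "\<exists>u\<in>UU. \<exists>b\<in>BB. hit x T u b")
    case True
    then obtain u b where ub: "hit x T u b" "u \<in> UU" "b \<in> BB" by blast
    have "G x T = f x u" unfolding G_def N_def using sum_hit[OF ub, of "f x"] sum_hit[OF ub, of "\<lambda>_. 1"] by simp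
    then show ?thesis using ub by blast
  next
    case False
    then have "G x T = F x" unfolding G_def N_def by simp
    then show ?thesis using False by blast
  qed
  have G: "0 \<le> G x T" "G x T \<le> F x" for x T
    using Gcases[of x T] f F0 by auto
  have G_meas[measurable]: "(\<lambda>z. G (fst z) (snd z)) \<in> borel_measurable (M \<Otimes>\<^sub>M CL)"
  proof -
    have [measurable]: "(\<lambda>z. of_bool (hit (fst z) (snd z) u b) :: real) \<in> borel_measurable (M \<Otimes>\<^sub>M CL)" if "u \<in> UU" "b \<in> BB" for u b
      using hit_measurable[OF that] by measurable
    have "(\<lambda>z. N (fst z) (snd z)) \<in> borel_measurable (M \<Otimes>\<^sub>M CL)"
      unfolding N_def by (intro borel_measurable_sum) auto
    moreover have "(\<lambda>z. \<Sum>u\<in>UU. \<Sum>b\<in>BB. f (fst z) u * of_bool (hit (fst z) (snd z) u b)) \<in> borel_measurable (M \<Otimes>\<^sub>M CL)"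
      by (intro borel_measurable_sum borel_measurable_times) auto
    ultimately show ?thesis unfolding G_def by measurable
  qed
  have Gint: "integrable (M \<Otimes>\<^sub>M CL) (\<lambda>(x, T). G x T)"
  proof (rule Bochner_Integration.integrable_bound)
    show "integrable (M \<Otimes>\<^sub>M CL) (\<lambda>z. F (fst z))"
      using integrable_distr[OF measurable_fst, of M CL F] F by (simp add: CL.distr_pair_fst)
    show "AE z in M \<Otimes>\<^sub>M CL. norm (case z of (x, T) \<Rightarrow> G x T) \<le> norm (F (fst z))"
      using G F0 by (auto simp: split_beta)
  qed (use G_meas in \<open>simp add: split_beta'\<close>)
  define B where "B = (LINT x|M. (\<Sum>u\<in>UU. (\<Prod>i<l. p i x (u i)) * f x u)) + (LINT x|M. F x * min 1 (err x))"
  have inner: "(LINT T|CL. G x T) \<le> (\<Sum>u\<in>UU. (\<Prod>i<l. p i x (u i)) * f x u) + F x * min 1 (err x)"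
    if x: "x \<in> space M" for x
  proof -
    define h where "h u b = measure CL {T \<in> space CL. hit x T u b}" for u b
    have ih: "integrable CL (\<lambda>T. of_bool (hit x T u b) :: real)" if "u \<in> UU" "b \<in> BB" for u b
      using hit_measurable_CL[OF x that] by (intro CL.integrable_const_bound[where B=1]) auto
    have eh: "(LINT T|CL. of_bool (hit x T u b)) = h u b" if "u \<in> UU" "b \<in> BB" for u b
    proof -
      have "(LINT T|CL. of_bool (hit x T u b)) = (LINT T|CL. indicator {T \<in> space CL. hit x T u b} T)"
        by (intro Bochner_Integration.integral_cong refl) (auto simp: indicator_def)
      also have "\<dots> = h u b" unfolding h_def using hit_measurable_CL[OF x that] by simp
      finally show ?thesis .
    qed
    have "(LINT T|CL. G x T) = (\<Sum>u\<in>UU. \<Sum>b\<in>BB. f x u * h u b) + F x * (1 - (\<Sum>u\<in>UU. \<Sum>b\<in>BB. h u b))"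
      unfolding G_def N_def using ih eh CL.prob_space
      by (simp add: Bochner_Integration.integral_add Bochner_Integration.integral_sum Bochner_Integration.integral_diff)
    also have "(\<Sum>u\<in>UU. \<Sum>b\<in>BB. f x u * h u b) \<le> (\<Sum>u\<in>UU. \<Sum>b\<in>BB. f x u * (\<Prod>i<l. p i x (u i) / L i))"
      unfolding h_def using f by (intro sum_mono mult_left_mono hit_prob_bounds(1)) auto
    also have "\<dots> = (\<Sum>u\<in>UU. (\<Prod>i<l. p i x (u i)) * f x u)"
      by (intro sum.cong refl, subst sum_distrib_left[symmetric], subst sum_BB) (rule mult.commute)
    finally have 1: "(LINT T|CL. G x T) \<le> (\<Sum>u\<in>UU. (\<Prod>i<l. p i x (u i)) * f x u) + F x * (1 - (\<Sum>u\<in>UU. \<Sum>b\<in>BB. h u b))"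
      by simp
    define r where "r u = (\<Sum>i<l. (p i x (u i) / (real (L i) * q i (restrict u {..<i}) (u i))) powr \<theta>)" for u
    have "1 - err x = (\<Sum>u\<in>UU. (\<Prod>i<l. p i x (u i)) * (1 - r u))"
      using sum_prod_p[of x] by (simp add: err_def r_def right_diff_distrib sum_subtractf)
    also have "\<dots> = (\<Sum>u\<in>UU. \<Sum>b\<in>BB. (\<Prod>i<l. p i x (u i) / L i) * (1 - r u))"
      by (intro sum.cong refl, subst sum_distrib_right[symmetric], subst sum_BB) (rule refl)
    also have "\<dots> \<le> (\<Sum>u\<in>UU. \<Sum>b\<in>BB. h u b)"
      unfolding h_def r_def by (intro sum_mono hit_prob_bounds(2)) auto
    finally have "1 - (\<Sum>u\<in>UU. \<Sum>b\<in>BB. h u b) \<le> err x" by simp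
    moreover have "0 \<le> (\<Sum>u\<in>UU. \<Sum>b\<in>BB. h u b)" unfolding h_def by (intro sum_nonneg) auto
    ultimately have "F x * (1 - (\<Sum>u\<in>UU. \<Sum>b\<in>BB. h u b)) \<le> F x * min 1 (err x)"
      using F0 by (intro mult_left_mono) auto
    with 1 show ?thesis by simp
  qed
  have int1: "integrable M (\<lambda>x. \<Sum>u\<in>UU. (\<Prod>i<l. p i x (u i)) * f x u)"
  proof (rule Bochner_Integration.integrable_bound[OF F])
    show "(\<lambda>x. \<Sum>u\<in>UU. (\<Prod>i<l. p i x (u i)) * f x u) \<in> borel_measurable M"
      by (intro borel_measurable_sum borel_measurable_times borel_measurable_prod) (auto simp: PiE_iff)
    have "(\<Sum>u\<in>UU. (\<Prod>i<l. p i x (u i)) * f x u) \<le> (\<Sum>u\<in>UU. (\<Prod>i<l. p i x (u i)) * F x)" for x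
      using f p_nonneg by (intro sum_mono mult_left_mono prod_nonneg) auto
    also have "\<dots> x = F x" for x using sum_prod_p[of x] by (simp add: sum_distrib_right[symmetric])
    finally have le: "(\<Sum>u\<in>UU. (\<Prod>i<l. p i x (u i)) * f x u) \<le> F x" for x .
    show "AE x in M. norm (\<Sum>u\<in>UU. (\<Prod>i<l. p i x (u i)) * f x u) \<le> norm (F x)"
    proof (intro AE_I2)
      fix x
      have "0 \<le> (\<Sum>u\<in>UU. (\<Prod>i<l. p i x (u i)) * f x u)"
        using f p_nonneg by (intro sum_nonneg mult_nonneg_nonneg prod_nonneg) auto
      with le[of x] F0[of x] show "norm (\<Sum>u\<in>UU. (\<Prod>i<l. p i x (u i)) * f x u) \<le> norm (F x)" by simp
    qed
  qed
  have int2: "integrable M (\<lambda>x. F x * min 1 (err x))"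
    by (rule Bochner_Integration.integrable_bound[OF F])
      (use F0 err_nonneg in \<open>auto simp: abs_mult intro!: mult_left_le\<close>)
  define g where "g T = (LINT x|M. G x T)" for T
  have gint: "integrable CL g" unfolding g_def
    using MC.integrable_snd[OF Gint] by simp
  have "(LINT T|CL. g T) = (LINT x|M. (LINT T|CL. G x T))"
    unfolding g_def by (rule MC.Fubini_integral[OF Gint])
  also have "\<dots> \<le> (LINT x|M. (\<Sum>u\<in>UU. (\<Prod>i<l. p i x (u i)) * f x u) + F x * min 1 (err x))"
    using MC.integrable_fst[OF Gint] int1 int2 inner by (intro integral_mono) auto
  also have "\<dots> = B" unfolding B_def using int1 int2 by simp
  finally have le: "(LINT T|CL. g T) \<le> B" .
  \<comment> \<open>Derandomisation: a mean of at most B is attained or undercut somewhere.\<close>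
  have "\<exists>T\<in>space CL. g T \<le> B"
  proof (rule ccontr)
    assume "\<not> ?thesis"
    then have gt: "AE T in CL. B < g T" by (auto simp: not_le)
    have "B < (LINT T|CL. g T)"
      using CL.expectation_greater[OF gint gt] .
    with le show False by simp
  qed
  then obtain T where T: "T \<in> space CL" "g T \<le> B" by blast
  have dec_le: "f x (dec T (msg T x)) \<le> G x T" for x
    using Gcases[of x T]
  proof (elim disjE exE conjE)
    fix u b assume "u \<in> UU" "b \<in> BB" "hit x T u b" "G x T = f x u"
    then show ?thesis using hit_msg dec_eq by simp
  qed (use f in simp)
  have GT_meas[measurable]: "(\<lambda>x. G x T) \<in> borel_measurable M"
    using measurable_compose[OF measurable_Pair2'[OF T(1)] G_meas] by simp
  have GT: "integrable M (\<lambda>x. G x T)"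
    by (rule Bochner_Integration.integrable_bound[OF F]) (use G F0 in auto)
  have encm: "(\<lambda>x. enc T i (p i x)) \<in> M \<rightarrow>\<^sub>M count_space UNIV" if "i < l" for i
    using that by (intro enc_measurable) auto
  have "(\<lambda>x. f x (dec T (msg T x))) = (\<lambda>x. \<Sum>b\<in>BB. of_bool (\<forall>i\<in>{..<l}. enc T i (p i x) = b i) * f x (dec T b))"
  proof
    fix x
    have "(\<forall>i\<in>{..<l}. enc T i (p i x) = b i) \<longleftrightarrow> b = msg T x" if "b \<in> BB" for b
    proof
      assume "\<forall>i\<in>{..<l}. enc T i (p i x) = b i"
      then show "b = msg T x" using that msg_BB by (intro PiE_ext[OF that msg_BB]) (auto simp: msg_def)
    qed (auto simp: msg_def)
    then have "(\<Sum>b\<in>BB. of_bool (\<forall>i\<in>{..<l}. enc T i (p i x) = b i) * f x (dec T b)) = (\<Sum>b\<in>BB. if b = msg T x then f x (dec T b) else 0)"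
      by (intro sum.cong refl) (auto simp: of_bool_def)
    also have "\<dots> = f x (dec T (msg T x))" using BB msg_BB by simp
    finally show "f x (dec T (msg T x)) = (\<Sum>b\<in>BB. of_bool (\<forall>i\<in>{..<l}. enc T i (p i x) = b i) * f x (dec T b))" ..
  qed
  also have "\<dots> \<in> borel_measurable M"
  proof (intro borel_measurable_sum borel_measurable_times f_meas)
    fix b
    have "Measurable.pred M (\<lambda>x. \<forall>i\<in>{..<l}. enc T i (p i x) = b i)"
      by (intro pred_intros_finite(3) pred_eq_const1[where N="count_space UNIV"] encm) auto
    then show "(\<lambda>x. of_bool (\<forall>i\<in>{..<l}. enc T i (p i x) = b i) :: real) \<in> borel_measurable M"
      by measurable
  qed
  finally have dm: "(\<lambda>x. f x (dec T (msg T x))) \<in> borel_measurable M" .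
  have "integrable M (\<lambda>x. f x (dec T (msg T x)))"
    by (rule Bochner_Integration.integrable_bound[OF F dm]) (use f F0 in auto)
  then have "(LINT x|M. f x (dec T (msg T x))) \<le> (LINT x|M. G x T)"
    using GT dec_le by (intro integral_mono)
  also have "\<dots> \<le> B" using T unfolding g_def by simp
  finally show ?thesis unfolding B_def by blast
qed

end

section \<open>Codes for memoryless sources from single-letter kernels\<close>

lemma sq_diff_le: "(x - y)\<^sup>2 \<le> 2 * x\<^sup>2 + 2 * y\<^sup>2" for x y :: real
  using zero_le_power2[of "x + y"] by (simp add: power2_sum power2_diff)

lemma abs_le_imp_sq_le: "\<bar>x\<bar> \<le> 2 * \<bar>y\<bar> \<Longrightarrow> x\<^sup>2 \<le> 4 * y\<^sup>2" for x y :: real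
  using power_mono[of "\<bar>x\<bar>" "2 * \<bar>y\<bar>" 2] by (simp add: power_mult_distrib)

text \<open>Codewords are indexed by user first, while the source is independent over time.
  Exchanging the two indices turns the sum over codeword tuples into a product over time of
  single-letter sums.\<close>

lemma sum_transpose_prod:
  fixes \<phi> :: "'t \<Rightarrow> ('i \<Rightarrow> 'b) \<Rightarrow> real"
  assumes fin: "finite I" "finite J" "finite A"
  shows "(\<Sum>u\<in>PiE I (\<lambda>_. PiE J (\<lambda>_. A)). \<Prod>t\<in>J. \<phi> t (\<lambda>i\<in>I. u i t)) = (\<Prod>t\<in>J. \<Sum>a\<in>PiE I (\<lambda>_. A). \<phi> t a)"
proof -
  have "(\<Prod>t\<in>J. \<Sum>a\<in>PiE I (\<lambda>_. A). \<phi> t a) = (\<Sum>g\<in>PiE J (\<lambda>_. PiE I (\<lambda>_. A)). \<Prod>t\<in>J. \<phi> t (g t))"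
    using fin by (intro prod_sum_PiE finite_PiE) auto
  also have "\<dots> = (\<Sum>u\<in>PiE I (\<lambda>_. PiE J (\<lambda>_. A)). \<Prod>t\<in>J. \<phi> t (\<lambda>i\<in>I. u i t))"
  proof (rule sum.reindex_bij_witness[where i="\<lambda>u. \<lambda>t\<in>J. \<lambda>i\<in>I. u i t" and j="\<lambda>g. \<lambda>i\<in>I. \<lambda>t\<in>J. g t i"])
    fix g assume g: "g \<in> PiE J (\<lambda>_. PiE I (\<lambda>_. A))"
    then show "(\<lambda>t\<in>J. \<lambda>i\<in>I. (\<lambda>i\<in>I. \<lambda>t\<in>J. g t i) i t) = g"
      by (fastforce simp: fun_eq_iff restrict_def PiE_iff extensional_def)
    show "(\<lambda>i\<in>I. \<lambda>t\<in>J. g t i) \<in> PiE I (\<lambda>_. PiE J (\<lambda>_. A))"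
      using g by (auto simp: PiE_iff)
    show "(\<Prod>t\<in>J. \<phi> t (\<lambda>i\<in>I. (\<lambda>i\<in>I. \<lambda>t\<in>J. g t i) i t)) = (\<Prod>t\<in>J. \<phi> t (g t))"
    proof (rule prod.cong[OF refl])
      fix t assume t: "t \<in> J"
      then have "(\<lambda>i\<in>I. (\<lambda>i\<in>I. \<lambda>t\<in>J. g t i) i t) = restrict (g t) I" by (auto simp: restrict_def)
      also have "\<dots> = g t" using g t by (intro PiE_restrict) auto
      finally show "\<phi> t (\<lambda>i\<in>I. (\<lambda>i\<in>I. \<lambda>t\<in>J. g t i) i t) = \<phi> t (g t)" by (rule arg_cong)
    qed
  next
    fix u assume u: "u \<in> PiE I (\<lambda>_. PiE J (\<lambda>_. A))"
    then show "(\<lambda>i\<in>I. \<lambda>t\<in>J. (\<lambda>t\<in>J. \<lambda>i\<in>I. u i t) t i) = u"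
      by (fastforce simp: fun_eq_iff restrict_def PiE_iff extensional_def)
    show "(\<lambda>t\<in>J. \<lambda>i\<in>I. u i t) \<in> PiE J (\<lambda>_. PiE I (\<lambda>_. A))"
      using u by (auto simp: PiE_iff)
  qed
  finally show ?thesis ..
qed

text \<open>Taylor's formula with remainder exp t at a point t between 0 and x; the maximum covers
  both signs of x.\<close>

lemma exp_quadratic_bound:
  fixes x :: real shows "exp x \<le> 1 + x + x\<^sup>2 * max 1 (exp x)"
proof -
  obtain t where t: "t \<le> max 0 x" "exp x = (\<Sum>m<2. x ^ m / fact m) + exp t / fact 2 * x ^ 2"
  proof (cases x "0::real" rule: linorder_cases)
    case less
    have "\<exists>t. x < t \<and> t < 0 \<and> exp x = (\<Sum>m<2. exp 0 / fact m * x ^ m) + exp t / fact 2 * x ^ 2"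
      using less by (intro Maclaurin_minus) (auto intro: DERIV_exp)
    then show ?thesis using that less by (auto simp: field_simps)
  next
    case greater
    have "\<exists>t. 0 < t \<and> t < x \<and> exp x = (\<Sum>m<2. exp 0 / fact m * x ^ m) + exp t / fact 2 * x ^ 2"
      using greater by (intro Maclaurin) (auto intro: DERIV_exp)
    then show ?thesis using that greater by (auto simp: field_simps)
  qed (use that[of 0] in \<open>auto simp: lessThan_Suc numeral_2_eq_2\<close>)
  have "exp t \<le> max 1 (exp x)" using t(1) by (auto simp: max_def split: if_splits)
  then have "exp t * x\<^sup>2 \<le> max 1 (exp x) * x\<^sup>2"
    by (intro mult_right_mono) auto
  moreover have "0 \<le> exp t * x\<^sup>2" by simp
  moreover have "exp x = 1 + x + exp t * x\<^sup>2 / 2" using t(2) by (simp add: lessThan_Suc numeral_2_eq_2)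
  moreover have "0 \<le> max 1 (exp x) * x\<^sup>2" by simp
  ultimately have "exp x \<le> 1 + x + max 1 (exp x) * x\<^sup>2" by linarith
  then show ?thesis by (simp only: mult.commute)
qed

text \<open>A second-order expansion in \<theta> whose remainder is uniform in p, although the
  log-ratio diverges as p tends to 0. With y = ln (p / q): for y \<le> 0 the factor p \<le> exp y
  absorbs y^2 \<le> 2 exp (-y), which gives the 2; for y > 0 one has y \<le> exp y \<le> 1 / q0, and
  three such factors give 1 / q0^3.\<close>

lemma weighted_log_ratio_bounds:
  fixes p q q0 \<theta> :: real
  assumes p: "0 < p" "p \<le> 1" and q: "0 < q0" "q0 \<le> q" "q \<le> 1" and th: "0 < \<theta>" "\<theta> \<le> 1"
  shows "p * (p / q) powr \<theta> \<le> p + \<theta> * (p * ln (p / q)) + \<theta>\<^sup>2 * (2 + 1 / q0 ^ 3)"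
    and "\<bar>p * ln (p / q)\<bar> \<le> 1 + 1 / q0"
proof -
  define y where "y = ln (p / q)"
  have q': "0 < q" using q by linarith
  have ey: "exp y = p / q" using p q' by (simp add: y_def)
  have pe: "p = q * exp y" using p q' by (simp add: y_def)
  have "p / q \<le> 1 / q0" using p q q' by (intro frac_le) auto
  then have eyle: "exp y \<le> 1 / q0" by (simp add: ey)
  have e_le: "p \<le> exp y" using pe q q' mult_right_mono[of q 1 "exp y"] by simp
  have quad: "p * (y\<^sup>2 * max 1 (exp (\<theta> * y))) \<le> 2 + 1 / q0 ^ 3"
  proof (cases "y \<le> 0")
    case True
    have "1 + (-y) + (-y)\<^sup>2 / 2 \<le> exp (- y)" using True by (intro exp_lower_Taylor_quadratic) auto
    then have "y\<^sup>2 \<le> 2 * exp (-y)" using True by (simp add: field_simps)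
    then have "p * y\<^sup>2 \<le> exp y * (2 * exp (- y))" using p e_le by (intro mult_mono) auto
    also have "\<dots> = 2" by (simp add: exp_minus)
    finally have "p * y\<^sup>2 \<le> 2" .
    moreover have "exp (\<theta> * y) \<le> 1" using True th by (simp add: mult_nonneg_nonpos)
    ultimately show ?thesis using q by (simp add: max_absorb1 add_increasing2)
  next
    case False
    have "y \<le> exp y" using exp_ge_add_one_self[of y] by linarith
    then have "y\<^sup>2 \<le> (1 / q0)\<^sup>2" using False eyle by (intro power_mono) auto
    moreover have "max 1 (exp (\<theta> * y)) \<le> 1 / q0"
    proof -
      have "exp (\<theta> * y) \<le> exp y" using th False by (simp add: mult_left_le_one_le)
      moreover have "1 \<le> exp y" using False by simp
      ultimately show ?thesis using eyle by linarith
    qed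
    ultimately have "y\<^sup>2 * max 1 (exp (\<theta> * y)) \<le> (1 / q0)\<^sup>2 * (1 / q0)"
      using q by (intro mult_mono) auto
    from mult_mono[OF p(2) this] have "p * (y\<^sup>2 * max 1 (exp (\<theta> * y))) \<le> 1 * ((1 / q0)\<^sup>2 * (1 / q0))"
      by simp
    then show ?thesis by (simp add: power2_eq_square power3_eq_cube)
  qed
  have "(p / q) powr \<theta> = exp (\<theta> * y)" using p q' by (simp add: powr_def y_def)
  also have "\<dots> \<le> 1 + \<theta> * y + (\<theta> * y)\<^sup>2 * max 1 (exp (\<theta> * y))" by (rule exp_quadratic_bound)
  finally have "p * (p / q) powr \<theta> \<le> p * (1 + \<theta> * y + (\<theta> * y)\<^sup>2 * max 1 (exp (\<theta> * y)))"
    using p by (intro mult_left_mono) auto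
  also have "\<dots> = p + \<theta> * (p * y) + \<theta>\<^sup>2 * (p * (y\<^sup>2 * max 1 (exp (\<theta> * y))))"
    by (simp add: algebra_simps power_mult_distrib)
  also have "\<dots> \<le> p + \<theta> * (p * y) + \<theta>\<^sup>2 * (2 + 1 / q0 ^ 3)"
    using mult_left_mono[OF quad, of "\<theta>\<^sup>2"] by simp
  finally show "p * (p / q) powr \<theta> \<le> p + \<theta> * (p * ln (p / q)) + \<theta>\<^sup>2 * (2 + 1 / q0 ^ 3)" by (simp add: y_def)
  show "\<bar>p * ln (p / q)\<bar> \<le> 1 + 1 / q0"
  proof (cases "y \<le> 0")
    case True
    have "- y \<le> exp (- y)" using exp_ge_add_one_self[of "-y"] by linarith
    then have "p * (- y) \<le> exp y * exp (- y)" using p e_le True by (intro mult_mono) auto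
    also have "\<dots> = 1" by (simp add: exp_minus)
    finally have "- (p * y) \<le> 1" by simp
    moreover have "0 \<le> 1 / q0" using q by simp
    moreover have "\<bar>p * y\<bar> = - (p * y)" using True p by (simp add: mult_nonneg_nonpos)
    ultimately show ?thesis unfolding y_def[symmetric] by linarith
  next
    case False
    have "y \<le> exp y" using exp_ge_add_one_self[of y] by linarith
    then have "p * y \<le> 1 * (1 / q0)" using p False eyle by (intro mult_mono) auto
    then show ?thesis using False p by (simp add: abs_mult y_def[symmetric])
  qed
qed

section \<open>Independent, identically distributed pairs of target and noise\<close>

locale iid_pairs =
  fixes M :: "'a measure" and l :: nat and X Z :: "nat \<Rightarrow> nat \<Rightarrow> 'a \<Rightarrow> real"
  assumes M: "prob_space M"
    and indep: "prob_space.indep_vars M (\<lambda>_. vecM l \<Otimes>\<^sub>M vecM l)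
        (\<lambda>t \<omega>. (restrict (\<lambda>i. X t i \<omega>) {..<l}, restrict (\<lambda>i. Z t i \<omega>) {..<l})) UNIV"
    and ident: "\<And>t. distr M (vecM l \<Otimes>\<^sub>M vecM l)
             (\<lambda>\<omega>. (restrict (\<lambda>i. X t i \<omega>) {..<l}, restrict (\<lambda>i. Z t i \<omega>) {..<l}))
         = distr M (vecM l \<Otimes>\<^sub>M vecM l)
             (\<lambda>\<omega>. (restrict (\<lambda>i. X 0 i \<omega>) {..<l}, restrict (\<lambda>i. Z 0 i \<omega>) {..<l}))"
begin

sublocale prob_space M by (rule M)

abbreviation "pairM \<equiv> vecM l \<Otimes>\<^sub>M vecM l"

definition W :: "nat \<Rightarrow> 'a \<Rightarrow> (nat \<Rightarrow> real) \<times> (nat \<Rightarrow> real)" where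
  "W t \<omega> = (restrict (\<lambda>i. X t i \<omega>) {..<l}, restrict (\<lambda>i. Z t i \<omega>) {..<l})"

lemma W_meas[measurable]: "W t \<in> M \<rightarrow>\<^sub>M pairM"
  using indep unfolding indep_vars_def W_def[abs_def] by auto

lemma fst_W: "i < l \<Longrightarrow> fst (W t \<omega>) i = X t i \<omega>" and snd_W: "i < l \<Longrightarrow> snd (W t \<omega>) i = Z t i \<omega>"
  by (auto simp: W_def)

lemma pair_fst_meas[measurable]: "i < l \<Longrightarrow> (\<lambda>w. fst w i) \<in> borel_measurable pairM"
  and pair_snd_meas[measurable]: "i < l \<Longrightarrow> (\<lambda>w. snd w i) \<in> borel_measurable pairM"
  by (auto intro!: measurable_compose[OF measurable_fst measurable_component_singleton]
     measurable_compose[OF measurable_snd measurable_component_singleton])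

lemma X_meas[measurable]: "i < l \<Longrightarrow> X t i \<in> borel_measurable M"
  and Z_meas[measurable]: "i < l \<Longrightarrow> Z t i \<in> borel_measurable M"
proof -
  assume i: "i < l"
  have "(\<lambda>\<omega>. fst (W t \<omega>) i) \<in> borel_measurable M" "(\<lambda>\<omega>. snd (W t \<omega>) i) \<in> borel_measurable M"
    using i by measurable
  then show "X t i \<in> borel_measurable M" "Z t i \<in> borel_measurable M"
    using i by (simp_all add: fst_W snd_W)
qed

lemma ident_integrable:
  fixes h :: "_ \<Rightarrow> 'b::{banach, second_countable_topology}"
  assumes [measurable]: "h \<in> borel_measurable pairM" and int: "integrable M (\<lambda>\<omega>. h (W 0 \<omega>))"
  shows "integrable M (\<lambda>\<omega>. h (W t \<omega>))"
proof -
  have "integrable (distr M pairM (W 0)) h" using int by (simp add: integrable_distr_eq)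
  then have "integrable (distr M pairM (W t)) h" using ident[of t] by (simp add: W_def[abs_def])
  then show ?thesis by (simp add: integrable_distr_eq)
qed

lemma ident_integral:
  fixes h :: "_ \<Rightarrow> 'b::{banach, second_countable_topology}"
  assumes [measurable]: "h \<in> borel_measurable pairM"
  shows "(LINT \<omega>|M. h (W t \<omega>)) = (LINT \<omega>|M. h (W 0 \<omega>))"
proof -
  have "(LINT \<omega>|M. h (W t \<omega>)) = (LINT w|distr M pairM (W t). h w)" by (simp add: integral_distr)
  also have "\<dots> = (LINT w|distr M pairM (W 0). h w)" using ident[of t] by (simp add: W_def[abs_def])
  also have "\<dots> = (LINT \<omega>|M. h (W 0 \<omega>))" by (simp add: integral_distr)
  finally show ?thesis .
qed

lemma iid_prod:
  fixes h :: "nat \<Rightarrow> _ \<Rightarrow> 'b::{real_normed_field, banach, second_countable_topology}"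
  assumes h[measurable]: "\<And>t. h t \<in> borel_measurable pairM" and int: "\<And>t. integrable M (\<lambda>\<omega>. h t (W 0 \<omega>))"
  shows "(LINT \<omega>|M. (\<Prod>t<n. h t (W t \<omega>))) = (\<Prod>t<n. LINT \<omega>|M. h t (W 0 \<omega>))"
    and "integrable M (\<lambda>\<omega>. (\<Prod>t<n. h t (W t \<omega>)))"
proof -
  have it: "integrable M (\<lambda>\<omega>. h t (W t \<omega>))" for t
    by (rule ident_integrable[OF h int])
  have "indep_vars (\<lambda>_. borel) (\<lambda>t \<omega>. h t (W t \<omega>)) UNIV"
    by (rule indep_vars_compose2[where Y=h and M'="\<lambda>_. pairM"]) (rule indep[folded W_def], rule h)
  then have iv: "indep_vars (\<lambda>_. borel) (\<lambda>t \<omega>. h t (W t \<omega>)) {..<n}"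
    by (rule indep_vars_subset) auto
  have "(LINT \<omega>|M. (\<Prod>t<n. h t (W t \<omega>))) = (\<Prod>t<n. LINT \<omega>|M. h t (W t \<omega>))"
    by (intro indep_vars_lebesgue_integral iv it) auto
  also have "\<dots> = (\<Prod>t<n. LINT \<omega>|M. h t (W 0 \<omega>))"
    by (rule prod.cong[OF refl]) (rule ident_integral, rule h)
  finally show "(LINT \<omega>|M. (\<Prod>t<n. h t (W t \<omega>))) = (\<Prod>t<n. LINT \<omega>|M. h t (W 0 \<omega>))" .
  show "integrable M (\<lambda>\<omega>. (\<Prod>t<n. h t (W t \<omega>)))"
    by (intro indep_vars_integrable iv it) auto
qed

end

text \<open>All encoders share the single-letter channel \<open>p1\<close>; \<open>q1 i\<close>
  predicts the letter of encoder i from its predecessors and \<open>g i\<close> reconstructs target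
  i from all letters. The bound \<open>q0\<close> makes the expansion in \<theta> uniform over all
  source values.\<close>

locale letter_code = iid_pairs +
  fixes A :: "real set" and p1 :: "real \<Rightarrow> real \<Rightarrow> real"
    and q1 :: "nat \<Rightarrow> (nat \<Rightarrow> real) \<Rightarrow> real \<Rightarrow> real" and q0 :: real and g :: "nat \<Rightarrow> (nat \<Rightarrow> real) \<Rightarrow> real"
  assumes A: "finite A"
    and p1_meas[measurable]: "\<And>a. (\<lambda>s. p1 s a) \<in> borel_measurable borel"
    and p1_nonneg: "\<And>s a. 0 \<le> p1 s a"
    and p1_sum: "\<And>s. (\<Sum>a\<in>A. p1 s a) = 1"
    and q1_nonneg: "\<And>i w a. 0 \<le> q1 i w a"
    and q1_sum: "\<And>i w. (\<Sum>a\<in>A. q1 i w a) \<le> 1"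
    and q1_pos: "\<And>i w s a. 0 < p1 s a \<Longrightarrow> 0 < q1 i w a"
    and q0: "0 < q0" "\<And>i w s a. i < l \<Longrightarrow> w \<in> PiE {..<i} (\<lambda>_. A) \<Longrightarrow> a \<in> A \<Longrightarrow> 0 < p1 s a \<Longrightarrow> q0 \<le> q1 i w a"
    and X2: "\<And>i. i < l \<Longrightarrow> integrable M (\<lambda>\<omega>. (X 0 i \<omega>)\<^sup>2)"
begin

abbreviation "AA \<equiv> PiE {..<l} (\<lambda>_. A)"

definition src :: "nat \<Rightarrow> (nat \<Rightarrow> real) \<times> (nat \<Rightarrow> real) \<Rightarrow> real" where
  "src i w = fst w i + snd w i"

definition law :: "(nat \<Rightarrow> real) \<times> (nat \<Rightarrow> real) \<Rightarrow> (nat \<Rightarrow> real) \<Rightarrow> real" where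
  "law w a = (\<Prod>j<l. p1 (src j w) (a j))"

definition ratio :: "nat \<Rightarrow> (nat \<Rightarrow> real) \<times> (nat \<Rightarrow> real) \<Rightarrow> (nat \<Rightarrow> real) \<Rightarrow> real" where
  "ratio i w a = p1 (src i w) (a i) / q1 i (restrict a {..<i}) (a i)"

text \<open>The mean divergence of the channel of encoder i from the prediction. If
  \<open>q1\<close> were the true conditional law, this would be the mutual information of source i
  and letter i given the earlier letters; a mismatched \<open>q1\<close> only makes it
  larger.\<close>

definition info :: "nat \<Rightarrow> real" where
  "info i = (LINT \<omega>|M. (\<Sum>a\<in>AA. law (W 0 \<omega>) a * ln (ratio i (W 0 \<omega>) a)))"

definition sqerr :: "(nat \<Rightarrow> real) \<times> (nat \<Rightarrow> real) \<Rightarrow> real" where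
  "sqerr w = (\<Sum>a\<in>AA. law w a * (\<Sum>i<l. (fst w i - g i a)\<^sup>2))"

definition dist :: real where
  "dist = (LINT \<omega>|M. sqerr (W 0 \<omega>))"

lemma AA: "finite AA" using A by (intro finite_PiE) auto

lemma src_meas[measurable]: "i < l \<Longrightarrow> src i \<in> borel_measurable pairM"
  unfolding src_def[abs_def] by measurable

lemma law_meas[measurable]: "(\<lambda>w. law w a) \<in> borel_measurable pairM"
  unfolding law_def by measurable

lemma ratio_meas[measurable]: "i < l \<Longrightarrow> (\<lambda>w. ratio i w a) \<in> borel_measurable pairM"
  unfolding ratio_def by measurable

lemma p1_le: "a \<in> A \<Longrightarrow> p1 s a \<le> 1"
  using member_le_sum[of a A "p1 s"] A p1_nonneg p1_sum[of s] by simp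

lemma q1_le: "a \<in> A \<Longrightarrow> q1 i w a \<le> 1"
  using member_le_sum[of a A "q1 i w"] A q1_nonneg q1_sum[of i w] by simp

lemma law_nonneg: "0 \<le> law w a"
  unfolding law_def using p1_nonneg by (intro prod_nonneg) auto

lemma sum_law: "(\<Sum>a\<in>AA. law w a) = 1"
proof -
  have "(\<Sum>a\<in>AA. law w a) = (\<Prod>j<l. \<Sum>a\<in>A. p1 (src j w) a)"
    unfolding law_def using A by (intro prod_sum_PiE[symmetric]) auto
  then show ?thesis by (simp add: p1_sum)
qed

definition Cq :: real where "Cq = 2 + 1 / q0 ^ 3"

text \<open>The scalar bounds are multiplied by the factor R of the other users, which lies between
  0 and 1. The last claim is ln t \<le> t - 1 at t = q / p and serves Gibbs' inequality in
  \<open>info_nonneg\<close>.\<close>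

lemma law_ratio:
  assumes i: "i < l" and a: "a \<in> AA"
  shows "\<bar>law w a * ln (ratio i w a)\<bar> \<le> 1 + 1 / q0"
    and "0 < \<theta> \<Longrightarrow> \<theta> \<le> 1 \<Longrightarrow> law w a * ratio i w a powr \<theta> \<le> law w a + \<theta> * (law w a * ln (ratio i w a)) + \<theta>\<^sup>2 * Cq"
    and "law w a - q1 i (restrict a {..<i}) (a i) * (\<Prod>j\<in>{..<l} - {i}. p1 (src j w) (a j)) \<le> law w a * ln (ratio i w a)"
proof -
  define R where "R = (\<Prod>j\<in>{..<l} - {i}. p1 (src j w) (a j))"
  have R: "law w a = R * p1 (src i w) (a i)" "0 \<le> R" "R \<le> 1"
  proof -
    show "law w a = R * p1 (src i w) (a i)"
      unfolding law_def R_def using i by (subst prod.remove[of _ i]) auto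
    show "0 \<le> R" "R \<le> 1"
      using p1_nonneg p1_le a unfolding R_def by (auto intro!: prod_nonneg prod_le_1 simp: PiE_iff)
  qed
  let ?p = "p1 (src i w) (a i)" and ?q = "q1 i (restrict a {..<i}) (a i)"
  have ai: "a i \<in> A" by (rule PiE_mem[OF a]) (simp add: i)
  have w: "restrict a {..<i} \<in> PiE {..<i} (\<lambda>_. A)"
    by (rule restrict_PiE_iff[THEN iffD2]) (use i in \<open>auto intro: PiE_mem[OF a]\<close>)
  have q00: "0 \<le> 1 / q0" "0 \<le> 1 / q0 ^ 3" using q0(1) by auto
  have "\<bar>law w a * ln (ratio i w a)\<bar> \<le> 1 + 1 / q0 \<and>
    (0 < \<theta> \<longrightarrow> \<theta> \<le> 1 \<longrightarrow> law w a * ratio i w a powr \<theta> \<le> law w a + \<theta> * (law w a * ln (ratio i w a)) + \<theta>\<^sup>2 * Cq) \<and>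
    law w a - ?q * R \<le> law w a * ln (ratio i w a)"
  proof (cases "?p = 0")
    case True
    then show ?thesis using q00 R(2) q1_nonneg[of i] by (simp add: Cq_def R(1))
  next
    case False
    then have p: "0 < ?p" using p1_nonneg[of "src i w" "a i"] by simp
    then have q: "q0 \<le> ?q" "0 < ?q" using q0(2)[OF i w ai p] q1_pos[OF p] by auto
    note b = weighted_log_ratio_bounds[OF p p1_le[OF ai] q0(1) q(1) q1_le[OF ai]]
    have "\<bar>law w a * ln (ratio i w a)\<bar> = R * \<bar>?p * ln (?p / ?q)\<bar>"
      using R by (simp add: R(1) ratio_def abs_mult)
    also have "\<dots> \<le> 1 * (1 + 1 / q0)"
      using R b(2)[of 1] by (intro mult_mono) auto
    finally have 1: "\<bar>law w a * ln (ratio i w a)\<bar> \<le> 1 + 1 / q0" by simp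
    have 2: "law w a * ratio i w a powr \<theta> \<le> law w a + \<theta> * (law w a * ln (ratio i w a)) + \<theta>\<^sup>2 * Cq"
      if th: "0 < \<theta>" "\<theta> \<le> 1"
    proof -
      have "law w a * ratio i w a powr \<theta> = R * (?p * (?p / ?q) powr \<theta>)"
        by (simp add: R(1) ratio_def)
      also have "\<dots> \<le> R * (?p + \<theta> * (?p * ln (?p / ?q)) + \<theta>\<^sup>2 * Cq)"
        using b(1)[OF th] R by (intro mult_left_mono) (auto simp: Cq_def)
      also have "\<dots> = law w a + \<theta> * (law w a * ln (ratio i w a)) + R * (\<theta>\<^sup>2 * Cq)"
        by (simp add: R(1) ratio_def algebra_simps)
      also have "R * (\<theta>\<^sup>2 * Cq) \<le> 1 * (\<theta>\<^sup>2 * Cq)" using R q00 by (intro mult_right_mono) (auto simp: Cq_def)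
      finally show ?thesis by simp
    qed
    have "ln (?q / ?p) \<le> ?q / ?p - 1" using p q by (intro ln_le_minus_one) auto
    then have "?p * (1 - ?q / ?p) \<le> ?p * ln (?p / ?q)"
      using p q by (intro mult_left_mono) (auto simp: ln_div)
    then have "R * (?p - ?q) \<le> R * (?p * ln (?p / ?q))"
      using p R by (intro mult_left_mono) (auto simp: right_diff_distrib)
    then have "law w a - ?q * R \<le> law w a * ln (ratio i w a)" by (simp add: R(1) ratio_def algebra_simps)
    with 1 2 show ?thesis by blast
  qed
  then show "\<bar>law w a * ln (ratio i w a)\<bar> \<le> 1 + 1 / q0"
    "0 < \<theta> \<Longrightarrow> \<theta> \<le> 1 \<Longrightarrow> law w a * ratio i w a powr \<theta> \<le> law w a + \<theta> * (law w a * ln (ratio i w a)) + \<theta>\<^sup>2 * Cq"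
    "law w a - q1 i (restrict a {..<i}) (a i) * (\<Prod>j\<in>{..<l} - {i}. p1 (src j w) (a j)) \<le> law w a * ln (ratio i w a)"
    unfolding R_def by blast+
qed

definition mgf :: "nat \<Rightarrow> real \<Rightarrow> (nat \<Rightarrow> real) \<times> (nat \<Rightarrow> real) \<Rightarrow> real" where
  "mgf i \<theta> w = (\<Sum>a\<in>AA. law w a * ratio i w a powr \<theta>)"

lemma mgf_meas[measurable]: "i < l \<Longrightarrow> mgf i \<theta> \<in> borel_measurable pairM"
  unfolding mgf_def[abs_def] by measurable

lemma info_integrand:
  assumes i: "i < l"
  shows "integrable M (\<lambda>\<omega>. \<Sum>a\<in>AA. law (W 0 \<omega>) a * ln (ratio i (W 0 \<omega>) a))"
proof (intro Bochner_Integration.integrable_sum)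
  fix a assume a: "a \<in> AA"
  have "(\<lambda>w. law w a * ln (ratio i w a)) \<in> borel_measurable pairM" using i by measurable
  from measurable_compose[OF W_meas this]
  have "(\<lambda>\<omega>. law (W 0 \<omega>) a * ln (ratio i (W 0 \<omega>) a)) \<in> borel_measurable M" .
  then show "integrable M (\<lambda>\<omega>. law (W 0 \<omega>) a * ln (ratio i (W 0 \<omega>) a))"
    using law_ratio(1)[OF i a] by (intro integrable_const_bound[where B="1 + 1 / q0"]) auto
qed

text \<open>1 + t \<le> exp t turns the expansion into an exponential, whose n-th power bounds a
  whole block. Its slope at \<theta> = 0 is \<open>info i\<close>, so that any rate above
  \<open>info i\<close> succeeds with a small \<theta>.\<close>

lemma mgf_bound:
  assumes i: "i < l" and th: "0 < \<theta>" "\<theta> \<le> 1"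
  shows "integrable M (\<lambda>\<omega>. mgf i \<theta> (W 0 \<omega>))"
    and "(LINT \<omega>|M. mgf i \<theta> (W 0 \<omega>)) \<le> exp (\<theta> * info i + \<theta>\<^sup>2 * (card AA * Cq))"
    and "0 \<le> (LINT \<omega>|M. mgf i \<theta> (W 0 \<omega>))"
proof -
  have nn: "0 \<le> mgf i \<theta> w" for w
    unfolding mgf_def using law_nonneg by (intro sum_nonneg) auto
  have le: "mgf i \<theta> w \<le> 1 + \<theta> * (\<Sum>a\<in>AA. law w a * ln (ratio i w a)) + \<theta>\<^sup>2 * (card AA * Cq)" for w
  proof -
    have "mgf i \<theta> w \<le> (\<Sum>a\<in>AA. law w a + \<theta> * (law w a * ln (ratio i w a)) + \<theta>\<^sup>2 * Cq)"
      unfolding mgf_def using law_ratio(2)[OF i _ th] by (intro sum_mono) auto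
    also have "\<dots> = 1 + \<theta> * (\<Sum>a\<in>AA. law w a * ln (ratio i w a)) + \<theta>\<^sup>2 * (card AA * Cq)"
      by (simp add: sum.distrib sum_law sum_distrib_left)
    finally show ?thesis .
  qed
  have m: "(\<lambda>\<omega>. mgf i \<theta> (W 0 \<omega>)) \<in> borel_measurable M"
    using measurable_compose[OF W_meas mgf_meas[OF i]] .
  have ib: "integrable M (\<lambda>\<omega>. 1 + \<theta> * (\<Sum>a\<in>AA. law (W 0 \<omega>) a * ln (ratio i (W 0 \<omega>) a)) + \<theta>\<^sup>2 * (card AA * Cq))"
    using info_integrand[OF i] by (intro Bochner_Integration.integrable_add integrable_mult_right) auto
  show int: "integrable M (\<lambda>\<omega>. mgf i \<theta> (W 0 \<omega>))"
    by (rule Bochner_Integration.integrable_bound[OF ib m])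
      (intro AE_I2, use nn le in \<open>simp add: order.trans[OF _ abs_ge_self]\<close>)
  have "(LINT \<omega>|M. mgf i \<theta> (W 0 \<omega>)) \<le> (LINT \<omega>|M. 1 + \<theta> * (\<Sum>a\<in>AA. law (W 0 \<omega>) a * ln (ratio i (W 0 \<omega>) a)) + \<theta>\<^sup>2 * (card AA * Cq))"
    by (rule integral_mono[OF int ib le])
  also have "\<dots> = 1 + (\<theta> * info i + \<theta>\<^sup>2 * (card AA * Cq))"
    unfolding info_def using info_integrand[OF i] by (simp add: prob_space)
  also have "\<dots> \<le> exp (\<theta> * info i + \<theta>\<^sup>2 * (card AA * Cq))" by (rule exp_ge_add_one_self)
  finally show "(LINT \<omega>|M. mgf i \<theta> (W 0 \<omega>)) \<le> exp (\<theta> * info i + \<theta>\<^sup>2 * (card AA * Cq))" .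
  show "0 \<le> (LINT \<omega>|M. mgf i \<theta> (W 0 \<omega>))" using nn by (rule Bochner_Integration.integral_nonneg)
qed

text \<open>Gibbs' inequality: the letters of the other users sum out and the prediction has total
  mass at most 1. It guarantees that the number of bins before rounding is at least 1, so that
  rounding up costs at most a factor 2.\<close>

lemma info_nonneg:
  assumes i: "i < l" shows "0 \<le> info i"
proof -
  have "0 \<le> (\<Sum>a\<in>AA. law w a * ln (ratio i w a))" for w
  proof -
    have "(\<Sum>a\<in>AA. q1 i (restrict a {..<i}) (a i) * (\<Prod>j\<in>{..<l} - {i}. p1 (src j w) (a j))) \<le> 1"
    proof -
      let ?I = "{..<l} - {i}"
      have ins: "{..<l} = insert i ?I" using i by auto
      have "(\<Sum>a\<in>AA. q1 i (restrict a {..<i}) (a i) * (\<Prod>j\<in>?I. p1 (src j w) (a j))) =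
        (\<Sum>(y, a)\<in>A \<times> PiE ?I (\<lambda>_. A). q1 i (restrict (a(i := y)) {..<i}) ((a(i := y)) i) * (\<Prod>j\<in>?I. p1 (src j w) ((a(i := y)) j)))"
        by (subst (1) ins, subst PiE_insert_eq, subst sum.reindex[OF inj_combinator])
           (auto simp: split_beta)
      also have "\<dots> = (\<Sum>(y, a)\<in>A \<times> PiE ?I (\<lambda>_. A). q1 i (restrict a {..<i}) y * (\<Prod>j\<in>?I. p1 (src j w) (a j)))"
      proof -
        have "restrict (a(i := y)) {..<i} = restrict a {..<i}" for a :: "nat \<Rightarrow> real" and y
          by (simp add: restrict_def fun_eq_iff)
        moreover have "(\<Prod>j\<in>?I. p1 (src j w) ((a(i := y)) j)) = (\<Prod>j\<in>?I. p1 (src j w) (a j))" for a y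
          by (intro prod.cong refl) simp
        ultimately show ?thesis by (simp only: fun_upd_same)
      qed
      also have "\<dots> = (\<Sum>a\<in>PiE ?I (\<lambda>_. A). (\<Sum>y\<in>A. q1 i (restrict a {..<i}) y) * (\<Prod>j\<in>?I. p1 (src j w) (a j)))"
        by (subst sum.cartesian_product[symmetric], subst sum.swap) (simp add: sum_distrib_right)
      also have "\<dots> \<le> (\<Sum>a\<in>PiE ?I (\<lambda>_. A). 1 * (\<Prod>j\<in>?I. p1 (src j w) (a j)))"
        using q1_sum p1_nonneg by (intro sum_mono mult_right_mono prod_nonneg) auto
      also have "\<dots> = (\<Prod>j\<in>?I. \<Sum>a\<in>A. p1 (src j w) a)"
        using A by (simp add: prod_sum_PiE)
      finally show ?thesis by (simp add: p1_sum)
    qed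
    then have "0 \<le> (\<Sum>a\<in>AA. law w a - q1 i (restrict a {..<i}) (a i) * (\<Prod>j\<in>{..<l} - {i}. p1 (src j w) (a j)))"
      by (simp add: sum_subtractf sum_law)
    also have "\<dots> \<le> (\<Sum>a\<in>AA. law w a * ln (ratio i w a))"
      using law_ratio(3)[OF i] by (intro sum_mono)
    finally show ?thesis .
  qed
  then show ?thesis unfolding info_def by (rule Bochner_Integration.integral_nonneg)
qed

lemma S_W: "i < l \<Longrightarrow> src i (W t \<omega>) = X t i \<omega> + Z t i \<omega>"
  by (simp add: src_def fst_W snd_W)

section \<open>Block codewords and the block error\<close>

abbreviation "Seq n \<equiv> PiE {..<n} (\<lambda>_. A)"

definition Pn :: "nat \<Rightarrow> (nat \<Rightarrow> real) \<Rightarrow> (nat \<Rightarrow> real) \<Rightarrow> real" where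
  "Pn n x u = (\<Prod>t<n. p1 (x t) (u t))"

definition Qn :: "nat \<Rightarrow> nat \<Rightarrow> (nat \<Rightarrow> nat \<Rightarrow> real) \<Rightarrow> (nat \<Rightarrow> real) \<Rightarrow> real" where
  "Qn n i w u = (\<Prod>t<n. q1 i (\<lambda>j\<in>{..<i}. w j t) (u t))"

definition srcn :: "nat \<Rightarrow> nat \<Rightarrow> 'a \<Rightarrow> nat \<Rightarrow> real" where
  "srcn n i \<omega> = (\<lambda>t. src i (W t \<omega>))"

lemma sum_seq: "(\<Sum>u\<in>Seq n. \<Prod>t<n. f t (u t)) = (\<Prod>t<n. \<Sum>a\<in>A. f t a)" for f :: "nat \<Rightarrow> real \<Rightarrow> real"
  using A by (intro prod_sum_PiE[symmetric]) auto

lemma matching_n: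
  assumes L: "\<And>i. 0 < L i" and th: "0 < \<theta>" "\<theta> \<le> 1"
  shows "matching M l (\<lambda>_. Seq n) L (\<lambda>i \<omega>. Pn n (srcn n i \<omega>)) (Qn n) \<theta>"
proof
  show "finite (Seq n)" using A by (intro finite_PiE) auto
  show "(\<lambda>x. Pn n (srcn n i x) u) \<in> borel_measurable M" if i: "i < l" for i u
    unfolding Pn_def srcn_def
    using measurable_compose[OF measurable_compose[OF W_meas src_meas[OF i]] p1_meas]
    by (intro borel_measurable_prod)
  show "(\<Sum>u\<in>Seq n. Pn n (srcn n i x) u) = 1" for i x
    unfolding Pn_def using sum_seq[of "\<lambda>t. p1 (srcn n i x t)" n] by (simp add: p1_sum)
  show "(\<Sum>u\<in>Seq n. Qn n i w u) \<le> 1" for i w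
    unfolding Qn_def sum_seq[of "\<lambda>t. q1 i (\<lambda>j\<in>{..<i}. w j t)" n]
    using q1_sum q1_nonneg by (intro prod_le_1) (auto intro: sum_nonneg)
  show "0 < Qn n i w u" if "0 < Pn n (srcn n i x) u" for i w x u
  proof -
    have "p1 (srcn n i x t) (u t) \<noteq> 0" if "t < n" for t
      using \<open>0 < Pn n (srcn n i x) u\<close> that unfolding Pn_def by (metis finite_lessThan lessThan_iff less_irrefl prod_zero)
    then have "0 < p1 (srcn n i x t) (u t)" if "t < n" for t
      using p1_nonneg that by (metis order_le_less)
    from q1_pos[OF this] show ?thesis unfolding Qn_def by (intro prod_pos) auto
  qed
qed (use L th p1_nonneg q1_nonneg in \<open>auto simp: Pn_def Qn_def intro!: prod_nonneg\<close>)

text \<open>\<open>dec\<close> is a choice and may return anything when its condition has no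
  solution; the default 0 keeps the reconstruction within the bound \<open>gmax\<close>.\<close>

definition recon :: "nat \<Rightarrow> nat \<Rightarrow> nat \<Rightarrow> (nat \<Rightarrow> nat \<Rightarrow> real) \<Rightarrow> real" where
  "recon n i t u = (if u \<in> PiE {..<l} (\<lambda>_. Seq n) then g i (\<lambda>j\<in>{..<l}. u j t) else 0)"

definition gmax :: real where "gmax = (\<Sum>i<l. \<Sum>a\<in>AA. (g i a)\<^sup>2)"

lemma gmax_bound: "i < l \<Longrightarrow> a \<in> AA \<Longrightarrow> (g i a)\<^sup>2 \<le> gmax"
proof -
  assume i: "i < l" and a: "a \<in> AA"
  have "(g i a)\<^sup>2 \<le> (\<Sum>a\<in>AA. (g i a)\<^sup>2)" using AA a by (intro member_le_sum) auto
  also have "\<dots> \<le> gmax" unfolding gmax_def using i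
    by (intro member_le_sum[of i "{..<l}" "\<lambda>i. \<Sum>a\<in>AA. (g i a)\<^sup>2"]) (auto intro: sum_nonneg)
  finally show ?thesis .
qed

lemma recon_bound: "i < l \<Longrightarrow> t < n \<Longrightarrow> (recon n i t u)\<^sup>2 \<le> gmax"
proof -
  assume i: "i < l" and t: "t < n"
  note g = gmax_bound[OF i]
  have "0 \<le> gmax" unfolding gmax_def by (intro sum_nonneg) auto
  moreover have "(\<lambda>j\<in>{..<l}. u j t) \<in> AA" if "u \<in> PiE {..<l} (\<lambda>_. Seq n)"
    using that t by (auto simp: PiE_iff)
  ultimately show ?thesis using g by (auto simp: recon_def)
qed

text \<open>Given the source, the letters are independent over users and over time, so summing a
  function that is a product over time gives a product of single-letter means.\<close>

lemma transpose_law: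
  "(\<Sum>u\<in>PiE {..<l} (\<lambda>_. Seq n). (\<Prod>i<l. Pn n (srcn n i \<omega>) (u i)) * (\<Prod>t<n. \<psi> t (\<lambda>i\<in>{..<l}. u i t))) =
   (\<Prod>t<n. \<Sum>a\<in>AA. law (W t \<omega>) a * \<psi> t a)"
proof -
  have "(\<Prod>i<l. Pn n (srcn n i \<omega>) (u i)) = (\<Prod>t<n. law (W t \<omega>) (\<lambda>i\<in>{..<l}. u i t))" for u
    unfolding Pn_def srcn_def law_def by (subst prod.swap) (intro prod.cong refl, simp)
  then have "(\<Sum>u\<in>PiE {..<l} (\<lambda>_. Seq n). (\<Prod>i<l. Pn n (srcn n i \<omega>) (u i)) * (\<Prod>t<n. \<psi> t (\<lambda>i\<in>{..<l}. u i t))) =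
     (\<Sum>u\<in>PiE {..<l} (\<lambda>_. Seq n). \<Prod>t<n. law (W t \<omega>) (\<lambda>i\<in>{..<l}. u i t) * \<psi> t (\<lambda>i\<in>{..<l}. u i t))"
    by (simp add: prod.distrib)
  also have "\<dots> = (\<Prod>t<n. \<Sum>a\<in>AA. law (W t \<omega>) a * \<psi> t a)"
    using A by (intro sum_transpose_prod) auto
  finally show ?thesis .
qed

lemma transpose_single:
  assumes t: "t < n"
  shows "(\<Sum>u\<in>PiE {..<l} (\<lambda>_. Seq n). (\<Prod>i<l. Pn n (srcn n i \<omega>) (u i)) * \<psi> (\<lambda>i\<in>{..<l}. u i t)) =
     (\<Sum>a\<in>AA. law (W t \<omega>) a * \<psi> a)"
proof -
  have "(\<Prod>s<n. (if s = t then \<psi> (\<lambda>i\<in>{..<l}. u i s) else 1)) = \<psi> (\<lambda>i\<in>{..<l}. u i t)" for u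
    using t by (simp add: prod.delta)
  then have "(\<Sum>u\<in>PiE {..<l} (\<lambda>_. Seq n). (\<Prod>i<l. Pn n (srcn n i \<omega>) (u i)) * \<psi> (\<lambda>i\<in>{..<l}. u i t)) =
     (\<Sum>u\<in>PiE {..<l} (\<lambda>_. Seq n). (\<Prod>i<l. Pn n (srcn n i \<omega>) (u i)) * (\<Prod>s<n. (\<lambda>s a. if s = t then \<psi> a else 1) s (\<lambda>i\<in>{..<l}. u i s)))"
    by simp
  also have "\<dots> = (\<Prod>s<n. \<Sum>a\<in>AA. law (W s \<omega>) a * (if s = t then \<psi> a else 1))"
    by (rule transpose_law)
  also have "\<dots> = (\<Prod>s<n. if s = t then (\<Sum>a\<in>AA. law (W t \<omega>) a * \<psi> a) else 1)"
    by (intro prod.cong refl) (simp add: sum_law)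
  also have "\<dots> = (\<Sum>a\<in>AA. law (W t \<omega>) a * \<psi> a)" using t by (simp add: prod.delta)
  finally show ?thesis .
qed

text \<open>The \<theta>-th power of a block ratio is a product over time. After the transposition
  each letter contributes one moment \<open>mgf\<close>, and the bins contribute the factor
  \<open>L i powr - \<theta>\<close>.\<close>

lemma err_n:
  assumes L: "\<And>i. 0 < L i" and th: "0 < \<theta>" "\<theta> \<le> 1"
  shows "matching.err l (\<lambda>_. Seq n) L (\<lambda>i \<omega>. Pn n (srcn n i \<omega>)) (Qn n) \<theta> \<omega> =
     (\<Sum>i<l. real (L i) powr (- \<theta>) * (\<Prod>t<n. mgf i \<theta> (W t \<omega>)))"
proof -
  interpret m: matching M l "\<lambda>_. Seq n" L "\<lambda>i \<omega>. Pn n (srcn n i \<omega>)" "Qn n" \<theta>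
    by (rule matching_n[OF L th])
  let ?UU = "PiE {..<l} (\<lambda>_. Seq n)"
  have r: "(Pn n (srcn n i \<omega>) (u i) / (real (L i) * Qn n i (restrict u {..<i}) (u i))) powr \<theta> =
     real (L i) powr (- \<theta>) * (\<Prod>t<n. ratio i (W t \<omega>) (\<lambda>i\<in>{..<l}. u i t) powr \<theta>)" if i: "i < l" for i u
  proof -
    have "(Pn n (srcn n i \<omega>) (u i) / (real (L i) * Qn n i (restrict u {..<i}) (u i))) =
      (1 / real (L i)) * (\<Prod>t<n. ratio i (W t \<omega>) (\<lambda>i\<in>{..<l}. u i t))"
    proof -
      have "ratio i (W t \<omega>) (\<lambda>i\<in>{..<l}. u i t) = p1 (srcn n i \<omega> t) (u i t) / q1 i (\<lambda>j\<in>{..<i}. restrict u {..<i} j t) (u i t)" for t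
      proof -
        have "restrict (\<lambda>i\<in>{..<l}. u i t) {..<i} = (\<lambda>j\<in>{..<i}. restrict u {..<i} j t)"
          using i by (auto simp: restrict_def fun_eq_iff)
        then show ?thesis using i by (simp add: ratio_def srcn_def)
      qed
      then show ?thesis by (simp add: Pn_def Qn_def prod_dividef)
    qed
    then have "(Pn n (srcn n i \<omega>) (u i) / (real (L i) * Qn n i (restrict u {..<i}) (u i))) powr \<theta> =
       (1 / real (L i)) powr \<theta> * (\<Prod>t<n. ratio i (W t \<omega>) (\<lambda>i\<in>{..<l}. u i t) powr \<theta>)"
      by (simp only: powr_mult prod_powr_distrib)
    also have "(1 / real (L i)) powr \<theta> = real (L i) powr (- \<theta>)"
      by (simp add: powr_minus_divide powr_divide)
    finally show ?thesis .
  qed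
  have "m.err \<omega> = (\<Sum>u\<in>?UU. \<Sum>i<l. real (L i) powr (- \<theta>) * ((\<Prod>i<l. Pn n (srcn n i \<omega>) (u i)) * (\<Prod>t<n. ratio i (W t \<omega>) (\<lambda>i\<in>{..<l}. u i t) powr \<theta>)))"
    unfolding m.err_def sum_distrib_left by (intro sum.cong refl) (simp add: r)
  also have "\<dots> = (\<Sum>i<l. real (L i) powr (- \<theta>) * (\<Sum>u\<in>?UU. (\<Prod>i<l. Pn n (srcn n i \<omega>) (u i)) * (\<Prod>t<n. ratio i (W t \<omega>) (\<lambda>i\<in>{..<l}. u i t) powr \<theta>)))"
    by (subst sum.swap) (simp add: sum_distrib_left)
  also have "\<dots> = (\<Sum>i<l. real (L i) powr (- \<theta>) * (\<Prod>t<n. mgf i \<theta> (W t \<omega>)))"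
    unfolding transpose_law[of n \<omega> "\<lambda>t a. ratio i (W t \<omega>) a powr \<theta>" for i] mgf_def ..
  finally show ?thesis .
qed

lemma expected_err:
  assumes L: "\<And>i. 0 < L i" and th: "0 < \<theta>" "\<theta> \<le> 1"
  shows "integrable M (matching.err l (\<lambda>_. Seq n) L (\<lambda>i \<omega>. Pn n (srcn n i \<omega>)) (Qn n) \<theta>)" (is ?A)
    and "(LINT \<omega>|M. matching.err l (\<lambda>_. Seq n) L (\<lambda>i \<omega>. Pn n (srcn n i \<omega>)) (Qn n) \<theta> \<omega>) \<le>
     (\<Sum>i<l. real (L i) powr (- \<theta>) * exp (real n * (\<theta> * info i + \<theta>\<^sup>2 * (card AA * Cq))))" (is ?B)
proof -
  have int: "integrable M (\<lambda>\<omega>. real (L i) powr (- \<theta>) * (\<Prod>t<n. mgf i \<theta> (W t \<omega>)))" if "i < l" for i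
    using iid_prod(2)[of "\<lambda>_. mgf i \<theta>" n, OF mgf_meas[OF that] mgf_bound(1)[OF that th]]
    by (rule integrable_mult_right)
  show ?A unfolding err_n[OF L th, abs_def] using int by (intro Bochner_Integration.integrable_sum) auto
  have "(LINT \<omega>|M. matching.err l (\<lambda>_. Seq n) L (\<lambda>i \<omega>. Pn n (srcn n i \<omega>)) (Qn n) \<theta> \<omega>) =
     (\<Sum>i<l. LINT \<omega>|M. real (L i) powr (- \<theta>) * (\<Prod>t<n. mgf i \<theta> (W t \<omega>)))"
    unfolding err_n[OF L th] using int by (intro Bochner_Integration.integral_sum) auto
  also have "\<dots> \<le> (\<Sum>i<l. real (L i) powr (- \<theta>) * exp (real n * (\<theta> * info i + \<theta>\<^sup>2 * (card AA * Cq))))"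
  proof (intro sum_mono)
    fix i assume "i \<in> {..<l}"
    then have i: "i < l" by simp
    have "(LINT \<omega>|M. (\<Prod>t<n. mgf i \<theta> (W t \<omega>))) = (LINT \<omega>|M. mgf i \<theta> (W 0 \<omega>)) ^ n"
      using iid_prod(1)[of "\<lambda>_. mgf i \<theta>" n, OF mgf_meas[OF i] mgf_bound(1)[OF i th]] by simp
    also have "\<dots> \<le> exp (\<theta> * info i + \<theta>\<^sup>2 * (card AA * Cq)) ^ n"
      using mgf_bound(2,3)[OF i th] by (intro power_mono)
    also have "\<dots> = exp (real n * (\<theta> * info i + \<theta>\<^sup>2 * (card AA * Cq)))"
      by (simp add: exp_of_nat_mult)
    finally have "real (L i) powr (- \<theta>) * (LINT \<omega>|M. (\<Prod>t<n. mgf i \<theta> (W t \<omega>))) \<le> real (L i) powr (- \<theta>) * exp (real n * (\<theta> * info i + \<theta>\<^sup>2 * (card AA * Cq)))"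
      by (intro mult_left_mono) auto
    then show "(LINT \<omega>|M. real (L i) powr (- \<theta>) * (\<Prod>t<n. mgf i \<theta> (W t \<omega>))) \<le> real (L i) powr (- \<theta>) * exp (real n * (\<theta> * info i + \<theta>\<^sup>2 * (card AA * Cq)))"
      by simp
  qed
  finally show ?B .
qed

lemma X_sq_integrable: "i < l \<Longrightarrow> integrable M (\<lambda>\<omega>. (X t i \<omega>)\<^sup>2)"
proof -
  assume i: "i < l"
  have m: "(\<lambda>w. (fst w i)\<^sup>2) \<in> borel_measurable pairM" using i by measurable
  show ?thesis using ident_integrable[OF m, of t] X2[OF i] i by (simp add: fst_W)
qed

text \<open>Failures are rare but squared errors are unbounded. Above the threshold K the power of
  the target is small by itself; below it the cost of a failure is at most a constant times
  \<open>err\<close>.\<close>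

definition tail :: "nat \<Rightarrow> nat \<Rightarrow> real" where
  "tail i K = (LINT \<omega>|M. (X 0 i \<omega>)\<^sup>2 * of_bool (real K < (X 0 i \<omega>)\<^sup>2))"

lemma tail_integrable: "i < l \<Longrightarrow> integrable M (\<lambda>\<omega>. (X t i \<omega>)\<^sup>2 * of_bool (real K < (X t i \<omega>)\<^sup>2))"
proof -
  assume i: "i < l"
  have [measurable]: "X t i \<in> borel_measurable M" using i by measurable
  show ?thesis
    by (rule Bochner_Integration.integrable_bound[OF X_sq_integrable[OF i, of t]]) (auto simp: of_bool_def)
qed

lemma tail_eq: "i < l \<Longrightarrow> (LINT \<omega>|M. (X t i \<omega>)\<^sup>2 * of_bool (real K < (X t i \<omega>)\<^sup>2)) = tail i K"
proof -
  assume i: "i < l"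
  have m: "(\<lambda>w. (fst w i)\<^sup>2 * of_bool (real K < (fst w i)\<^sup>2)) \<in> borel_measurable pairM" using i by measurable
  show ?thesis using ident_integral[OF m, of t] i by (simp add: fst_W tail_def)
qed

lemma tail_tendsto: "i < l \<Longrightarrow> tail i \<longlonglongrightarrow> 0"
proof -
  assume i: "i < l"
  have [measurable]: "X 0 i \<in> borel_measurable M" using i by measurable
  have "(\<lambda>K. LINT \<omega>|M. (X 0 i \<omega>)\<^sup>2 * of_bool (real K < (X 0 i \<omega>)\<^sup>2)) \<longlonglongrightarrow> (LINT \<omega>|M. 0)"
  proof (rule integral_dominated_convergence[where w="\<lambda>\<omega>. (X 0 i \<omega>)\<^sup>2"])
    show "AE \<omega> in M. (\<lambda>K. (X 0 i \<omega>)\<^sup>2 * of_bool (real K < (X 0 i \<omega>)\<^sup>2)) \<longlonglongrightarrow> 0"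
    proof (intro AE_I2 tendsto_eventually)
      fix \<omega>
      obtain k :: nat where "(X 0 i \<omega>)\<^sup>2 < real k" using reals_Archimedean2 by blast
      then show "\<forall>\<^sub>F K in sequentially. (X 0 i \<omega>)\<^sup>2 * of_bool (real K < (X 0 i \<omega>)\<^sup>2) = 0"
        by (intro eventually_sequentiallyI[of k]) (auto simp: of_bool_def)
    qed
  qed (use X2[OF i] in \<open>auto simp: of_bool_def\<close>)
  then show ?thesis by (simp add: tail_def[abs_def])
qed

lemma sqerr_meas[measurable]: "sqerr \<in> borel_measurable pairM"
  unfolding sqerr_def[abs_def] by measurable

lemma sqerr_bounds: "0 \<le> sqerr w" "sqerr w \<le> (\<Sum>i<l. 2 * (fst w i)\<^sup>2 + 2 * gmax)"
proof -
  show "0 \<le> sqerr w" unfolding sqerr_def using law_nonneg by (intro sum_nonneg mult_nonneg_nonneg) auto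
  have "(\<Sum>i<l. (fst w i - g i a)\<^sup>2) \<le> (\<Sum>i<l. 2 * (fst w i)\<^sup>2 + 2 * gmax)" if a: "a \<in> AA" for a
  proof (rule sum_mono)
    fix i assume "i \<in> {..<l}"
    then show "(fst w i - g i a)\<^sup>2 \<le> 2 * (fst w i)\<^sup>2 + 2 * gmax"
      using sq_diff_le[of "fst w i" "g i a"] gmax_bound[of i a] a by auto
  qed
  then have "sqerr w \<le> (\<Sum>a\<in>AA. law w a * (\<Sum>i<l. 2 * (fst w i)\<^sup>2 + 2 * gmax))"
    unfolding sqerr_def by (rule sum_mono[OF mult_left_mono[OF _ law_nonneg]])
  then show "sqerr w \<le> (\<Sum>i<l. 2 * (fst w i)\<^sup>2 + 2 * gmax)"
    by (simp only: sum_distrib_right[symmetric] sum_law mult_1)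
qed

lemma sqerr_integrable: "integrable M (\<lambda>\<omega>. sqerr (W t \<omega>))"
proof -
  have b: "integrable M (\<lambda>\<omega>. \<Sum>i<l. 2 * (X t i \<omega>)\<^sup>2 + 2 * gmax)"
    using X_sq_integrable by (intro Bochner_Integration.integrable_sum Bochner_Integration.integrable_add integrable_mult_right) auto
  show ?thesis
  proof (rule Bochner_Integration.integrable_bound[OF b])
    show "(\<lambda>\<omega>. sqerr (W t \<omega>)) \<in> borel_measurable M" by measurable
    have "sqerr (W t \<omega>) \<le> (\<Sum>i<l. 2 * (X t i \<omega>)\<^sup>2 + 2 * gmax)" for \<omega>
      using sqerr_bounds(2)[of "W t \<omega>"] by (simp add: fst_W)
    then show "AE \<omega> in M. norm (sqerr (W t \<omega>)) \<le> norm (\<Sum>i<l. 2 * (X t i \<omega>)\<^sup>2 + 2 * gmax)"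
      using sqerr_bounds(1) by (intro AE_I2) (simp add: order.trans[OF _ abs_ge_self])
  qed
qed

text \<open>The truncation level K and the exponent \<theta> are fixed before the block length n,
  because the decay of the error must beat a constant that grows with K.\<close>

theorem letter_coding:
  assumes \<delta>: "0 < \<delta>" and l: "0 < l"
  shows "\<exists>n>0. \<exists>(\<phi> :: nat \<Rightarrow> (nat \<Rightarrow> real) \<Rightarrow> nat) (C :: nat \<Rightarrow> nat set) h.
    (\<forall>i<l. finite (C i) \<and> \<phi> i \<in> vecM n \<rightarrow>\<^sub>M count_space UNIV \<and> (\<forall>x\<in>space (vecM n). \<phi> i x \<in> C i)) \<and>
    (\<Sum>i<l. ln (real (card (C i)))) \<le> real n * ((\<Sum>i<l. info i) + \<delta>) \<and>
    (LINT \<omega>|M. (\<Sum>i<l. \<Sum>t<n. (X t i \<omega> - h i t (\<lambda>i\<in>{..<l}. \<phi> i (Sblock X Z n i \<omega>)))\<^sup>2)) \<le> real n * (dist + \<delta>)"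
proof -
  \<comment> \<open>The rates will exceed \<open>info i\<close> by 2 \<delta>', which adds up to
    \<delta> / 2 over the encoders; the truncated tails, counted twice, also add up to at most
    \<delta> / 2.\<close>
  define \<delta>' where "\<delta>' = \<delta> / (4 * real l)"
  have \<delta>': "0 < \<delta>'" using \<delta> l by (simp add: \<delta>'_def)
  have "\<forall>\<^sub>F K in sequentially. \<forall>i\<in>{..<l}. tail i K < \<delta>'"
    using tail_tendsto \<delta>' by (intro eventually_ball_finite) (auto intro: order_tendstoD)
  then obtain K where K: "\<And>i. i < l \<Longrightarrow> tail i K < \<delta>'"
    unfolding eventually_sequentially by auto
  define C where "C = card AA * Cq + 1"
  have C: "0 < C" using q0(1) unfolding C_def Cq_def by (intro add_nonneg_pos mult_nonneg_nonneg) auto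
  \<comment> \<open>Makes the second-order term of the expansion at most \<theta> *
    \<delta>'.\<close>
  define \<theta> where "\<theta> = min 1 (\<delta>' / C)"
  have th: "0 < \<theta>" "\<theta> \<le> 1" using \<delta>' C by (auto simp: \<theta>_def)
  have "\<theta> \<le> \<delta>' / C" by (simp add: \<theta>_def)
  then have thC: "\<theta> * C \<le> \<delta>'" using C by (simp add: field_simps)
  have g0: "0 \<le> gmax" unfolding gmax_def by (intro sum_nonneg) auto
  have "(\<lambda>n. real l * (2 * real K + 2 * gmax) * (real l * exp (- (\<theta> * \<delta>') * real n))) \<longlonglongrightarrow> real l * (2 * real K + 2 * gmax) * (real l * 0)"
    using th \<delta>' by (intro tendsto_mult_left filterlim_compose[OF exp_at_bot]
      filterlim_tendsto_neg_mult_at_bot[OF tendsto_const _ filterlim_real_sequentially]) auto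
  then have "\<forall>\<^sub>F n in sequentially. real l * (2 * real K + 2 * gmax) * (real l * exp (- (\<theta> * \<delta>') * real n)) < \<delta> / 2"
    using \<delta> by (intro order_tendstoD) auto
  moreover have "\<forall>\<^sub>F n in sequentially. nat \<lceil>2 * real l * ln 2 / \<delta>\<rceil> \<le> n" by (rule eventually_ge_at_top)
  moreover have "\<forall>\<^sub>F n in sequentially. (0::nat) < n" by (rule eventually_gt_at_top)
  ultimately have "\<forall>\<^sub>F n in sequentially. real l * (2 * real K + 2 * gmax) * (real l * exp (- (\<theta> * \<delta>') * real n)) < \<delta> / 2 \<and>
     nat \<lceil>2 * real l * ln 2 / \<delta>\<rceil> \<le> n \<and> 0 < n"
    by eventually_elim simp
  then obtain n where n: "real l * (2 * real K + 2 * gmax) * (real l * exp (- (\<theta> * \<delta>') * real n)) < \<delta> / 2"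
      "nat \<lceil>2 * real l * ln 2 / \<delta>\<rceil> \<le> n" "0 < n"
    unfolding eventually_sequentially by auto
  have "2 * real l * ln 2 / \<delta> \<le> real n" using n(2) by linarith
  then have n2: "real l * ln 2 \<le> real n * \<delta> / 2" using \<delta> by (simp add: field_simps)
  \<comment> \<open>One \<delta>' cancels the second-order term, the other leaves the decay exp (-
    \<theta> * \<delta>' * n) of the error.\<close>
  define E where "E i = exp (real n * (info i + 2 * \<delta>'))" for i
  define L where "L i = nat \<lceil>E i\<rceil>" for i
  have Epos: "0 < E i" for i by (simp add: E_def)
  have LE: "E i \<le> real (L i)" "real (L i) \<le> E i + 1" for i
    unfolding L_def using Epos[of i] by linarith+
  have L: "0 < L i" for i using LE(1)[of i] Epos[of i] by (cases "L i") auto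
  interpret m: matching M l "\<lambda>_. Seq n" L "\<lambda>i \<omega>. Pn n (srcn n i \<omega>)" "Qn n" \<theta>
    by (rule matching_n[OF L th])
  define f where "f \<omega> u = (\<Sum>i<l. \<Sum>t<n. (X t i \<omega> - recon n i t u)\<^sup>2)" for \<omega> u
  define F where "F \<omega> = (\<Sum>i<l. \<Sum>t<n. 2 * (X t i \<omega>)\<^sup>2 + 2 * gmax)" for \<omega>
  have err: "integrable M m.err" "(LINT \<omega>|M. m.err \<omega>) \<le> real l * exp (- (\<theta> * \<delta>') * real n)"
  proof -
    show "integrable M m.err" by (rule expected_err(1)[OF L th])
    have "(LINT \<omega>|M. m.err \<omega>) \<le> (\<Sum>i<l. real (L i) powr (- \<theta>) * exp (real n * (\<theta> * info i + \<theta>\<^sup>2 * (card AA * Cq))))"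
      by (rule expected_err(2)[OF L th])
    also have "\<dots> \<le> (\<Sum>i<l. exp (- (\<theta> * \<delta>') * real n))"
    proof (rule sum_mono)
      fix i
      have "real (L i) powr (- \<theta>) \<le> E i powr (- \<theta>)"
        using LE(1)[of i] Epos[of i] th by (intro powr_mono2') auto
      also have "\<dots> = exp (- \<theta> * (real n * (info i + 2 * \<delta>')))" by (simp add: E_def powr_def)
      finally have "real (L i) powr (- \<theta>) * exp (real n * (\<theta> * info i + \<theta>\<^sup>2 * (card AA * Cq))) \<le>
          exp (- \<theta> * (real n * (info i + 2 * \<delta>'))) * exp (real n * (\<theta> * info i + \<theta>\<^sup>2 * (card AA * Cq)))"
        by (intro mult_right_mono) auto
      also have "\<dots> = exp (real n * \<theta> * (\<theta> * (card AA * Cq) - 2 * \<delta>'))"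
        unfolding exp_add[symmetric] by (rule arg_cong[where f=exp]) (simp add: algebra_simps power2_eq_square)
      also have "\<dots> \<le> exp (real n * \<theta> * (- \<delta>'))"
      proof -
        have "\<theta> * (card AA * Cq) \<le> \<delta>'" using thC th by (simp add: C_def algebra_simps)
        then show ?thesis using th by (simp only: exp_le_cancel_iff) (intro mult_left_mono, auto)
      qed
      also have "\<dots> = exp (- (\<theta> * \<delta>') * real n)" by (simp add: algebra_simps)
      finally show "real (L i) powr (- \<theta>) * exp (real n * (\<theta> * info i + \<theta>\<^sup>2 * (card AA * Cq))) \<le> exp (- (\<theta> * \<delta>') * real n)" .
    qed
    also have "\<dots> = real l * exp (- (\<theta> * \<delta>') * real n)" by simp
    finally show "(LINT \<omega>|M. m.err \<omega>) \<le> real l * exp (- (\<theta> * \<delta>') * real n)" .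
  qed
  have "\<exists>T. (LINT \<omega>|M. f \<omega> (m.dec T (m.msg T \<omega>))) \<le>
    (LINT \<omega>|M. (\<Sum>u\<in>m.UU. (\<Prod>i<l. Pn n (srcn n i \<omega>) (u i)) * f \<omega> u)) + (LINT \<omega>|M. F \<omega> * min 1 (m.err \<omega>))"
  proof (rule m.matching_coding)
    show "(\<lambda>\<omega>. f \<omega> u) \<in> borel_measurable M" for u unfolding f_def by measurable
    show "0 \<le> f \<omega> u" for \<omega> u unfolding f_def by (intro sum_nonneg) auto
    show "f \<omega> u \<le> F \<omega>" for \<omega> u unfolding f_def F_def
    proof (intro sum_mono)
      fix i t assume "i \<in> {..<l}" "t \<in> {..<n}"
      then show "(X t i \<omega> - recon n i t u)\<^sup>2 \<le> 2 * (X t i \<omega>)\<^sup>2 + 2 * gmax"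
        using sq_diff_le[of "X t i \<omega>" "recon n i t u"] recon_bound[of i t n u] by auto
    qed
    show "integrable M F" unfolding F_def using X_sq_integrable
      by (intro Bochner_Integration.integrable_sum Bochner_Integration.integrable_add integrable_mult_right) auto
  qed
  then obtain T where T: "(LINT \<omega>|M. f \<omega> (m.dec T (m.msg T \<omega>))) \<le>
    (LINT \<omega>|M. (\<Sum>u\<in>m.UU. (\<Prod>i<l. Pn n (srcn n i \<omega>) (u i)) * f \<omega> u)) + (LINT \<omega>|M. F \<omega> * min 1 (m.err \<omega>))"
    by blast
  have t1: "(LINT \<omega>|M. (\<Sum>u\<in>m.UU. (\<Prod>i<l. Pn n (srcn n i \<omega>) (u i)) * f \<omega> u)) = real n * dist"
  proof -
    have "(\<Sum>u\<in>m.UU. (\<Prod>i<l. Pn n (srcn n i \<omega>) (u i)) * f \<omega> u) = (\<Sum>t<n. sqerr (W t \<omega>))" for \<omega>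
    proof -
      have "(\<Sum>u\<in>m.UU. (\<Prod>i<l. Pn n (srcn n i \<omega>) (u i)) * f \<omega> u) =
        (\<Sum>u\<in>m.UU. \<Sum>t<n. (\<Prod>i<l. Pn n (srcn n i \<omega>) (u i)) * (\<lambda>a. \<Sum>i<l. (fst (W t \<omega>) i - g i a)\<^sup>2) (\<lambda>i\<in>{..<l}. u i t))"
        unfolding f_def by (intro sum.cong refl, subst sum.swap) (simp add: sum_distrib_left recon_def fst_W)
      also have "\<dots> = (\<Sum>t<n. \<Sum>u\<in>m.UU. (\<Prod>i<l. Pn n (srcn n i \<omega>) (u i)) * (\<lambda>a. \<Sum>i<l. (fst (W t \<omega>) i - g i a)\<^sup>2) (\<lambda>i\<in>{..<l}. u i t))"
        by (rule sum.swap)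
      also have "\<dots> = (\<Sum>t<n. sqerr (W t \<omega>))"
        unfolding sqerr_def by (intro sum.cong refl transpose_single) simp
      finally show ?thesis .
    qed
    then have "(LINT \<omega>|M. (\<Sum>u\<in>m.UU. (\<Prod>i<l. Pn n (srcn n i \<omega>) (u i)) * f \<omega> u)) = (\<Sum>t<n. LINT \<omega>|M. sqerr (W t \<omega>))"
      using sqerr_integrable by (simp add: Bochner_Integration.integral_sum)
    also have "\<dots> = (\<Sum>t<n. dist)"
      unfolding dist_def by (rule sum.cong[OF refl]) (rule ident_integral[OF sqerr_meas])
    also have "\<dots> = real n * dist" by simp
    finally show ?thesis .
  qed
  have t2: "(LINT \<omega>|M. F \<omega> * min 1 (m.err \<omega>)) \<le> real n * \<delta>"
  proof -
    define R where "R \<omega> = (\<Sum>i<l. \<Sum>t<n. 2 * ((X t i \<omega>)\<^sup>2 * of_bool (real K < (X t i \<omega>)\<^sup>2)) + (2 * real K + 2 * gmax) * m.err \<omega>)" for \<omega>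
    have Rint: "integrable M R" unfolding R_def using tail_integrable err(1)
      by (intro Bochner_Integration.integrable_sum Bochner_Integration.integrable_add integrable_mult_right) auto
    have R0: "0 \<le> R \<omega>" for \<omega> unfolding R_def using g0 m.err_nonneg by (intro sum_nonneg add_nonneg_nonneg mult_nonneg_nonneg) auto
    have F0: "0 \<le> F \<omega>" for \<omega> unfolding F_def using g0 by (intro sum_nonneg) auto
    have le: "F \<omega> * min 1 (m.err \<omega>) \<le> R \<omega>" for \<omega>
      unfolding F_def R_def sum_distrib_right
    proof (intro sum_mono)
      fix i t
      let ?x = "(X t i \<omega>)\<^sup>2" and ?e = "m.err \<omega>"
      have e: "0 \<le> ?e" by (rule m.err_nonneg)
      show "(2 * ?x + 2 * gmax) * min 1 ?e \<le> 2 * (?x * of_bool (real K < ?x)) + (2 * real K + 2 * gmax) * ?e"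
      proof (cases "real K < ?x")
        case True
        have "2 * ?x * min 1 ?e \<le> 2 * ?x * 1" by (intro mult_left_mono) auto
        moreover have "2 * gmax * min 1 ?e \<le> 2 * gmax * ?e" using g0 by (intro mult_left_mono) auto
        moreover have "0 \<le> real K * ?e" using e by simp
        ultimately show ?thesis using True by (simp add: ring_distribs)
      next
        case False
        then have "(2 * ?x + 2 * gmax) * min 1 ?e \<le> (2 * real K + 2 * gmax) * ?e"
          using g0 e by (intro mult_mono) auto
        then show ?thesis using False by simp
      qed
    qed
    have "(LINT \<omega>|M. F \<omega> * min 1 (m.err \<omega>)) \<le> (LINT \<omega>|M. R \<omega>)"
    proof (rule integral_mono[OF _ Rint le])
      have "F \<in> borel_measurable M" unfolding F_def[abs_def] by measurable
      then have "(\<lambda>\<omega>. F \<omega> * min 1 (m.err \<omega>)) \<in> borel_measurable M" using err(1) by measurable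
      then show "integrable M (\<lambda>\<omega>. F \<omega> * min 1 (m.err \<omega>))"
        by (rule Bochner_Integration.integrable_bound[OF Rint])
          (intro AE_I2, use le R0 F0 m.err_nonneg in \<open>simp add: abs_mult\<close>)
    qed
    also have "(LINT \<omega>|M. R \<omega>) = (\<Sum>i<l. \<Sum>t<n. 2 * tail i K + (2 * real K + 2 * gmax) * (LINT \<omega>|M. m.err \<omega>))"
      unfolding R_def using tail_integrable err(1)
      by (subst Bochner_Integration.integral_sum, simp, intro sum.cong refl,
          subst Bochner_Integration.integral_sum, simp, intro sum.cong refl) (simp add: tail_eq)
    also have "\<dots> \<le> (\<Sum>i<l. \<Sum>t<n. 2 * \<delta>' + (2 * real K + 2 * gmax) * (real l * exp (- (\<theta> * \<delta>') * real n)))"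
      using K err(2) g0 by (intro sum_mono add_mono mult_left_mono) (auto intro: less_imp_le)
    also have "\<dots> = real n * (real l * (2 * \<delta>') + real l * (2 * real K + 2 * gmax) * (real l * exp (- (\<theta> * \<delta>') * real n)))"
      by (simp add: algebra_simps)
    also have "\<dots> \<le> real n * (\<delta> / 2 + \<delta> / 2)"
      using n(1) l by (intro mult_left_mono add_mono) (auto simp: \<delta>'_def)
    finally show ?thesis by simp
  qed
  have Pn_eq: "Pn n (srcn n i \<omega>) = Pn n (Sblock X Z n i \<omega>)" if "i < l" for i \<omega>
    using that unfolding Pn_def by (intro ext prod.cong refl) (simp add: Sblock_def srcn_def S_W)
  define \<phi> where "\<phi> i x = m.enc T i (Pn n x)" for i x
  have msg: "m.msg T \<omega> = (\<lambda>i\<in>{..<l}. \<phi> i (Sblock X Z n i \<omega>))" for \<omega>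
    unfolding m.msg_def \<phi>_def by (intro restrict_ext) (simp add: Pn_eq)
  have "(LINT \<omega>|M. (\<Sum>i<l. \<Sum>t<n. (X t i \<omega> - recon n i t (m.dec T (\<lambda>i\<in>{..<l}. \<phi> i (Sblock X Z n i \<omega>))))\<^sup>2)) \<le> real n * (dist + \<delta>)"
    using T t1 t2 unfolding f_def msg by (simp add: algebra_simps)
  moreover have "(\<Sum>i<l. ln (real (card {..<L i}))) \<le> real n * ((\<Sum>i<l. info i) + \<delta>)"
  proof -
    \<comment> \<open>The ln 2 pays for rounding up to an integer; n was chosen large enough to
      absorb it.\<close>
    have "ln (real (L i)) \<le> ln 2 + real n * (info i + 2 * \<delta>')" if "i < l" for i
    proof -
      have "1 \<le> E i" unfolding E_def using info_nonneg[OF that] \<delta>' by simp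
      then have "real (L i) \<le> 2 * E i" using LE(2)[of i] by simp
      then have "ln (real (L i)) \<le> ln (2 * E i)" using L[of i] Epos[of i] by (subst ln_le_cancel_iff) auto
      also have "\<dots> = ln 2 + real n * (info i + 2 * \<delta>')" using Epos[of i] by (simp add: ln_mult E_def)
      finally show ?thesis .
    qed
    then have "(\<Sum>i<l. ln (real (card {..<L i}))) \<le> (\<Sum>i<l. ln 2 + real n * (info i + 2 * \<delta>'))"
      by (intro sum_mono) auto
    also have "\<dots> = real l * ln 2 + real n * ((\<Sum>i<l. info i) + real l * (2 * \<delta>'))"
      by (simp add: sum.distrib sum_distrib_left ring_distribs)
    also have "real l * (2 * \<delta>') = \<delta> / 2" using l by (simp add: \<delta>'_def)
    also have "real l * ln 2 + real n * ((\<Sum>i<l. info i) + \<delta> / 2) \<le> real n * ((\<Sum>i<l. info i) + \<delta>)"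
      using n2 by (simp add: algebra_simps)
    finally show ?thesis .
  qed
  moreover have "\<phi> i \<in> vecM n \<rightarrow>\<^sub>M count_space UNIV" if "i < l" for i
    unfolding \<phi>_def
  proof (rule m.enc_measurable[OF that])
    fix v
    show "(\<lambda>x. Pn n x v) \<in> borel_measurable (vecM n)"
      unfolding Pn_def
    proof (rule borel_measurable_prod)
      fix t assume "t \<in> {..<n}"
      then show "(\<lambda>x. p1 (x t) (v t)) \<in> borel_measurable (vecM n)"
        by (intro measurable_compose[OF _ p1_meas, where f="\<lambda>x. x t"] measurable_component_singleton)
    qed
  qed
  moreover have "\<phi> i x \<in> {..<L i}" for i x unfolding \<phi>_def using m.enc_less by simp
  ultimately show ?thesis using n(3)
    by (intro exI[of _ n] conjI exI[of _ \<phi>] exI[of _ "\<lambda>i. {..<L i}"] exI[of _ "\<lambda>i t b. recon n i t (m.dec T b)"]) auto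
qed

end

section \<open>The quantised Gaussian test channel\<close>

lemma sum_PiE_insert:
  fixes f :: "('i \<Rightarrow> 'b) \<Rightarrow> 'c::comm_monoid_add"
  assumes "i \<notin> I"
  shows "(\<Sum>a\<in>PiE (insert i I) B. f a) = (\<Sum>a\<in>PiE I B. \<Sum>y\<in>B i. f (a(i := y)))"
proof -
  have "(\<Sum>a\<in>PiE (insert i I) B. f a) = (\<Sum>(y, a)\<in>B i \<times> PiE I B. f (a(i := y)))"
    unfolding PiE_insert_eq by (subst sum.reindex[OF inj_combinator[OF assms]]) (simp add: split_beta)
  also have "\<dots> = (\<Sum>a\<in>PiE I B. \<Sum>y\<in>B i. f (a(i := y)))"
    by (subst sum.cartesian_product[symmetric], rule sum.swap)
  finally show ?thesis .
qed

text \<open>Squared mean plus variance for an affine form in independent letters. Only the first two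
  moments of the letters enter, so the quantised channel is felt solely through \<open>mu\<close>
  and \<open>ka\<close>.\<close>

lemma pmf_quadratic:
  fixes p :: "'i \<Rightarrow> real \<Rightarrow> real" and \<beta> :: "'i \<Rightarrow> real"
  assumes "finite I" and A: "finite A" and p: "\<And>i. i \<in> I \<Longrightarrow> (\<Sum>a\<in>A. p i a) = 1"
  shows "(\<Sum>a\<in>PiE I (\<lambda>_. A). (\<Prod>i\<in>I. p i (a i)) * (c + (\<Sum>i\<in>I. \<beta> i * a i))\<^sup>2) =
    (c + (\<Sum>i\<in>I. \<beta> i * (\<Sum>a\<in>A. p i a * a)))\<^sup>2 +
    (\<Sum>i\<in>I. (\<beta> i)\<^sup>2 * ((\<Sum>a\<in>A. p i a * a\<^sup>2) - (\<Sum>a\<in>A. p i a * a)\<^sup>2))"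
  using assms(1) p
proof (induction I arbitrary: c rule: finite_induct)
  case empty
  then show ?case by simp
next
  case (insert k J)
  define \<mu> where "\<mu> i = (\<Sum>a\<in>A. p i a * a)" for i
  define V where "V = (\<Sum>i\<in>J. (\<beta> i)\<^sup>2 * ((\<Sum>a\<in>A. p i a * a\<^sup>2) - (\<mu> i)\<^sup>2))"
  define m where "m = (\<Sum>i\<in>J. \<beta> i * \<mu> i)"
  have pk: "(\<Sum>a\<in>A. p k a) = 1" using insert.prems by simp
  have IH: "(\<Sum>a\<in>PiE J (\<lambda>_. A). (\<Prod>i\<in>J. p i (a i)) * (c' + (\<Sum>i\<in>J. \<beta> i * a i))\<^sup>2) = (c' + m)\<^sup>2 + V" for c'
    unfolding m_def V_def \<mu>_def using insert.prems by (intro insert.IH) auto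
  have "(\<Sum>a\<in>PiE (insert k J) (\<lambda>_. A). (\<Prod>i\<in>insert k J. p i (a i)) * (c + (\<Sum>i\<in>insert k J. \<beta> i * a i))\<^sup>2)
    = (\<Sum>y\<in>A. \<Sum>a\<in>PiE J (\<lambda>_. A). p k y * ((\<Prod>i\<in>J. p i (a i)) * ((c + \<beta> k * y) + (\<Sum>i\<in>J. \<beta> i * a i))\<^sup>2))"
  proof -
    have 1: "(\<Prod>i\<in>J. p i (if i = k then y else a i)) = (\<Prod>i\<in>J. p i (a i))" for a y
      using insert.hyps by (intro prod.cong) auto
    have 2: "(\<Sum>i\<in>J. \<beta> i * (if i = k then y else a i)) = (\<Sum>i\<in>J. \<beta> i * a i)" for a y
      using insert.hyps by (intro sum.cong) auto
    show ?thesis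
      by (subst sum_PiE_insert[OF insert.hyps(2)], subst sum.swap)
        (simp add: insert.hyps 1 2 mult.assoc add.assoc)
  qed
  also have "\<dots> = (\<Sum>y\<in>A. p k y * (((c + \<beta> k * y) + m)\<^sup>2 + V))"
    by (simp only: sum_distrib_left[symmetric] IH)
  also have "\<dots> = (\<Sum>y\<in>A. ((c + m)\<^sup>2 + V) * p k y + 2 * (c + m) * \<beta> k * (p k y * y) + (\<beta> k)\<^sup>2 * (p k y * y\<^sup>2))"
    by (intro sum.cong refl) (simp add: power2_eq_square algebra_simps)
  also have "\<dots> = ((c + m)\<^sup>2 + V) + 2 * (c + m) * \<beta> k * \<mu> k + (\<beta> k)\<^sup>2 * (\<Sum>a\<in>A. p k a * a\<^sup>2)"
    by (simp add: sum.distrib sum_distrib_left[symmetric] pk \<mu>_def)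
  also have "\<dots> = (c + (\<beta> k * \<mu> k + m))\<^sup>2 + ((\<beta> k)\<^sup>2 * ((\<Sum>a\<in>A. p k a * a\<^sup>2) - (\<mu> k)\<^sup>2) + V)"
    by (simp add: power2_eq_square algebra_simps)
  also have "\<beta> k * \<mu> k + m = (\<Sum>i\<in>insert k J. \<beta> i * \<mu> i)" using insert.hyps by (simp add: m_def)
  also have "(\<beta> k)\<^sup>2 * ((\<Sum>a\<in>A. p k a * a\<^sup>2) - (\<mu> k)\<^sup>2) + V = (\<Sum>i\<in>insert k J. (\<beta> i)\<^sup>2 * ((\<Sum>a\<in>A. p i a * a\<^sup>2) - (\<mu> i)\<^sup>2))"
    using insert.hyps by (simp add: V_def)
  finally show ?case unfolding \<mu>_def .
qed

text \<open>The quantised channel: the probability that a normal letter with mean s and variance v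
  is mapped to the value a.\<close>

definition cell :: "(real \<Rightarrow> real) \<Rightarrow> real \<Rightarrow> real \<Rightarrow> real \<Rightarrow> real" where
  "cell r v s a = (LBINT y. of_bool (r y = a) * normal_density s (sqrt v) y)"

context
  fixes r :: "real \<Rightarrow> real" and v :: real
  assumes r[measurable]: "r \<in> borel_measurable borel" and fin: "finite (range r)" and v: "0 < v"
begin

lemma normal_sqrt: "0 < sqrt v" using v by simp

lemma cell_integrable: "integrable lborel (\<lambda>y. of_bool (r y = a) * normal_density s (sqrt v) y)"
  by (rule Bochner_Integration.integrable_bound[OF integrable_normal_density[OF normal_sqrt, of s]]) (auto simp: of_bool_def)

lemma cell_nonneg: "0 \<le> cell r v s a"
  unfolding cell_def by (intro Bochner_Integration.integral_nonneg) auto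

lemma sum_cell_integrand:
  "(\<Sum>a\<in>range r. f a * (of_bool (r y = a) * z)) = f (r y) * (z::real)"
proof -
  have "(\<Sum>a\<in>range r. f a * (of_bool (r y = a) * z)) = (\<Sum>a\<in>range r. if a = r y then f a * z else 0)"
    by (intro sum.cong refl) (auto simp: of_bool_def)
  also have "\<dots> = f (r y) * z" using fin by simp
  finally show ?thesis .
qed

lemma sum_cell:
  "(\<Sum>a\<in>range r. f a * cell r v s a) = (LBINT y. f (r y) * normal_density s (sqrt v) y)"
proof -
  have "(\<Sum>a\<in>range r. f a * cell r v s a) = (LBINT y. \<Sum>a\<in>range r. f a * (of_bool (r y = a) * normal_density s (sqrt v) y))"
    unfolding cell_def using cell_integrable by (subst Bochner_Integration.integral_sum) auto
  then show ?thesis by (simp only: sum_cell_integrand)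
qed

lemma sum_cell_1: "(\<Sum>a\<in>range r. cell r v s a) = 1"
  using sum_cell[of "\<lambda>_. 1"] integral_normal_density[OF normal_sqrt] by simp

lemma cell_meas: "(\<lambda>s. cell r v s a) \<in> borel_measurable borel"
  unfolding cell_def normal_density_def
  by (rule lborel.borel_measurable_lebesgue_integral) measurable

text \<open>A normal density is positive everywhere, so a cell has probability zero exactly when it
  is Lebesgue null, whatever s and v are. Hence the encoder's channel and the decoder's prediction
  charge the same cells.\<close>

lemma cell_zero_iff: "cell r v s a = 0 \<longleftrightarrow> (AE y in lborel. r y \<noteq> a)"
proof -
  have "cell r v s a = 0 \<longleftrightarrow> (AE y in lborel. of_bool (r y = a) * normal_density s (sqrt v) y = 0)"
    unfolding cell_def by (rule integral_nonneg_eq_0_iff_AE[OF cell_integrable]) auto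
  also have "\<dots> \<longleftrightarrow> (AE y in lborel. r y \<noteq> a)"
    using normal_density_pos[OF normal_sqrt, of s] by (intro AE_cong) (auto simp: less_imp_neq[THEN not_sym])
  finally show ?thesis .
qed

end

text \<open>The right-hand side is the divergence of the unquantised laws; the inequality is the log-sum inequality.\<close>

lemma cell_divergence:
  fixes r :: "real \<Rightarrow> real"
  assumes r[measurable]: "r \<in> borel_measurable borel" and fin: "finite (range r)" and v: "0 < v" and q: "0 < q"
  shows "(\<Sum>a\<in>range r. cell r q s a * ln (cell r q s a / cell r v m a)) \<le>
     ln (v / q) / 2 - 1 / 2 + (q + (s - m)\<^sup>2) / (2 * v)"
proof -
  define n where "n = normal_density s (sqrt q)"
  define k where "k = normal_density m (sqrt v)"
  define P where "P y = cell r q s (r y)" for y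
  define K where "K y = cell r v m (r y)" for y
  have [measurable]: "n \<in> borel_measurable borel" "k \<in> borel_measurable borel" by (auto simp: n_def k_def)
  have nk: "0 < n y" "0 < k y" for y unfolding n_def k_def using v q by (auto intro!: normal_density_pos)
  have nint: "integrable lborel n" "(LBINT y. n y) = 1" unfolding n_def using q by auto
  have kint: "integrable lborel k" unfolding k_def using v by auto
  have m1: "integrable lborel (\<lambda>y. n y * (y - s))" "(LBINT y. n y * (y - s)) = 0"
    using integrable_normal_moment[of "sqrt q" s 1] integral_normal_moment_odd[of "sqrt q" s 0] q by (auto simp: n_def)
  have m2: "integrable lborel (\<lambda>y. n y * (y - s)\<^sup>2)" "(LBINT y. n y * (y - s)\<^sup>2) = q"
    using integrable_normal_moment[of "sqrt q" s 2] integral_normal_moment_even[of "sqrt q" s 1] q by (auto simp: n_def)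
  have lnn: "ln (n y / k y) = ln (v / q) / 2 - (y - s)\<^sup>2 / (2 * q) + (y - m)\<^sup>2 / (2 * v)" for y
  proof -
    have ln1: "ln (n y) = - ln (2 * pi * q) / 2 - (y - s)\<^sup>2 / (2 * q)"
      unfolding n_def normal_density_def using q by (simp add: ln_mult ln_div ln_sqrt) (simp add: field_simps)
    have ln2: "ln (k y) = - ln (2 * pi * v) / 2 - (y - m)\<^sup>2 / (2 * v)"
      unfolding k_def normal_density_def using v by (simp add: ln_mult ln_div ln_sqrt) (simp add: field_simps)
    show ?thesis using nk[of y] v q by (simp add: ln1 ln2 ln_div ln_mult field_simps)
  qed
  have quad: "n y * ln (n y / k y) = (ln (v / q) / 2 + (s - m)\<^sup>2 / (2 * v)) * n y + (1 / (2 * v) - 1 / (2 * q)) * (n y * (y - s)\<^sup>2) + ((s - m) / v) * (n y * (y - s))" for y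
  proof -
    have "(y - m)\<^sup>2 = (y - s)\<^sup>2 + 2 * (s - m) * (y - s) + (s - m)\<^sup>2" by (simp add: power2_eq_square algebra_simps)
    moreover have "N * (A - B / (2 * q) + (B + 2 * d * e + D) / (2 * v)) =
        (A + D / (2 * v)) * N + (1 / (2 * v) - 1 / (2 * q)) * (N * B) + d / v * (N * e)" for A B D N d e
      using v q by (simp add: field_simps)
    ultimately show ?thesis unfolding lnn by (simp only:)
  qed
  have dint: "integrable lborel (\<lambda>y. n y * ln (n y / k y))"
    unfolding quad using m1 m2 nint by (intro Bochner_Integration.integrable_add integrable_mult_right)
  have dval: "(LBINT y. n y * ln (n y / k y)) = ln (v / q) / 2 - 1 / 2 + (q + (s - m)\<^sup>2) / (2 * v)"
  proof -
    have "(LBINT y. A * n y + B * (n y * (y - s)\<^sup>2) + C * (n y * (y - s))) = A + B * q" for A B C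
      using nint m1 m2 by (subst Bochner_Integration.integral_add, simp, simp, subst Bochner_Integration.integral_add) simp_all
    then show ?thesis unfolding quad using v q by (simp only:) (simp add: field_simps)
  qed
  have lhs: "(\<Sum>a\<in>range r. cell r q s a * ln (cell r q s a / cell r v m a)) = (LBINT y. ln (P y / K y) * n y)"
    using sum_cell[OF r fin q, of "\<lambda>a. ln (cell r q s a / cell r v m a)" s] by (simp add: n_def P_def K_def mult.commute)
  have Pm: "(\<lambda>y. ln (P y / K y)) \<in> borel_measurable lborel"
  proof -
    have "(\<lambda>y. ln (P y / K y)) = (\<lambda>y. \<Sum>a\<in>range r. ln (cell r q s a / cell r v m a) * (of_bool (r y = a) * 1))"
      using sum_cell_integrand[OF r fin q, where f="\<lambda>a. ln (cell r q s a / cell r v m a)" and z=1]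
      by (simp add: P_def K_def)
    then show ?thesis by simp
  qed
  have pint: "integrable lborel (\<lambda>y. ln (P y / K y) * n y)"
  proof -
    have eq: "(\<lambda>y. ln (P y / K y) * n y) = (\<lambda>y. \<Sum>a\<in>range r. ln (cell r q s a / cell r v m a) * (of_bool (r y = a) * n y))"
      by (simp only: sum_cell_integrand[OF r fin q] P_def K_def)
    show ?thesis unfolding eq
      using cell_integrable[OF r fin q, of _ s] by (intro Bochner_Integration.integrable_sum integrable_mult_right) (simp add: n_def)
  qed
  have PKint: "integrable lborel (\<lambda>y. P y / K y * k y)" "(LBINT y. P y / K y * k y) \<le> 1"
  proof -
    have eq: "(\<lambda>y. P y / K y * k y) = (\<lambda>y. \<Sum>a\<in>range r. cell r q s a / cell r v m a * (of_bool (r y = a) * k y))"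
      by (simp only: sum_cell_integrand[OF r fin q] P_def K_def)
    show "integrable lborel (\<lambda>y. P y / K y * k y)" unfolding eq
      using cell_integrable[OF r fin v, of _ m] by (intro Bochner_Integration.integrable_sum integrable_mult_right) (simp add: k_def)
    have "(LBINT y. P y / K y * k y) = (\<Sum>a\<in>range r. cell r q s a / cell r v m a * cell r v m a)"
      unfolding k_def P_def K_def using sum_cell[OF r fin v, of "\<lambda>a. cell r q s a / cell r v m a" m] by simp
    also have "\<dots> \<le> (\<Sum>a\<in>range r. cell r q s a)"
      using cell_nonneg[OF r fin q] by (intro sum_mono) auto
    finally show "(LBINT y. P y / K y * k y) \<le> 1" using sum_cell_1[OF r fin q] by simp
  qed
  \<comment> \<open>Almost every y avoids the finitely many null cells; on the remaining cells both
    probabilities are positive by \<open>cell_zero_iff\<close>.\<close>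
  have Pae: "AE y in lborel. 0 < P y \<and> 0 < K y"
  proof -
    have "AE y in lborel. cell r q s a \<noteq> 0 \<or> r y \<noteq> a" for a
      using cell_zero_iff[OF r fin q, of s a] by (cases "cell r q s a = 0") auto
    then have "AE y in lborel. \<forall>a\<in>range r. cell r q s a \<noteq> 0 \<or> r y \<noteq> a"
      by (intro AE_finite_allI fin)
    then show ?thesis
    proof eventually_elim
      fix y assume "\<forall>a\<in>range r. cell r q s a \<noteq> 0 \<or> r y \<noteq> a"
      then have nz: "cell r q s (r y) \<noteq> 0" by auto
      then have "cell r v m (r y) \<noteq> 0" using cell_zero_iff[OF r fin q] cell_zero_iff[OF r fin v] by metis
      with nz show "0 < P y \<and> 0 < K y"
        using cell_nonneg[OF r fin q, of s "r y"] cell_nonneg[OF r fin v, of m "r y"] by (simp add: P_def K_def)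
    qed
  qed
  have "(LBINT y. ln (P y / K y) * n y) - (LBINT y. n y * ln (n y / k y)) =
     (LBINT y. ln (P y / K y) * n y - n y * ln (n y / k y))"
    by (rule Bochner_Integration.integral_diff[symmetric, OF pint dint])
  \<comment> \<open>This is ln t \<le> t - 1 at t = (P y * k y) / (K y * n y). Reweighting k by the
    ratio of cell probabilities leaves a total mass of at most 1, while n has mass 1.\<close>
  also have "\<dots> \<le> (LBINT y. P y / K y * k y - n y)"
  proof (rule integral_mono_AE)
    show "AE y in lborel. ln (P y / K y) * n y - n y * ln (n y / k y) \<le> P y / K y * k y - n y"
      using Pae
    proof eventually_elim
      fix y assume PK: "0 < P y \<and> 0 < K y"
      have "ln (P y / K y) - ln (n y / k y) = ln (P y / K y * k y / n y)"
        using PK nk[of y] by (simp add: ln_mult ln_div)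
      also have "\<dots> \<le> P y / K y * k y / n y - 1"
        using PK nk[of y] by (intro ln_le_minus_one) auto
      finally have "n y * (ln (P y / K y) - ln (n y / k y)) \<le> n y * (P y / K y * k y / n y - 1)"
        using nk[of y] by (intro mult_left_mono) auto
      then show "ln (P y / K y) * n y - n y * ln (n y / k y) \<le> P y / K y * k y - n y"
        using nk[of y] by (simp add: algebra_simps)
    qed
  qed (use pint dint PKint nint in auto)
  also have "\<dots> \<le> 0" using PKint nint by (simp add: Bochner_Integration.integral_diff)
  finally show ?thesis unfolding lhs dval[symmetric] by simp
qed

section \<open>The Gaussian channel and the limit of fine quantisation\<close>

locale gauss_channel = iid_pairs +
  fixes q :: real and \<alpha> v :: "nat \<Rightarrow> real" and \<gamma> :: "nat \<Rightarrow> nat \<Rightarrow> real"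
  assumes q: "0 < q" and v: "\<And>i. 0 < v i"
    and sq: "\<And>i. i < l \<Longrightarrow> integrable M (\<lambda>\<omega>. (X 0 i \<omega>)\<^sup>2)" "\<And>i. i < l \<Longrightarrow> integrable M (\<lambda>\<omega>. (Z 0 i \<omega>)\<^sup>2)"
begin

abbreviation S0 :: "nat \<Rightarrow> 'a \<Rightarrow> real" where "S0 j \<omega> \<equiv> X 0 j \<omega> + Z 0 j \<omega>"

definition mu :: "(real \<Rightarrow> real) \<Rightarrow> real \<Rightarrow> real" where
  "mu r s = (\<Sum>a\<in>range r. cell r q s a * a)"

definition ka :: "(real \<Rightarrow> real) \<Rightarrow> real \<Rightarrow> real" where
  "ka r s = (\<Sum>a\<in>range r. cell r q s a * a\<^sup>2)"

text \<open>The mean, given the source s, of the square of c plus a linear combination of the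
  quantised letters with coefficients \<beta>: squared mean plus variances.\<close>

definition qform :: "(real \<Rightarrow> real) \<Rightarrow> (nat \<Rightarrow> real) \<Rightarrow> real \<Rightarrow> (nat \<Rightarrow> real) \<Rightarrow> real" where
  "qform r \<beta> c s = (c + (\<Sum>j<l. \<beta> j * mu r (s j)))\<^sup>2 + (\<Sum>j<l. (\<beta> j)\<^sup>2 * (ka r (s j) - (mu r (s j))\<^sup>2))"

definition prevcoef :: "nat \<Rightarrow> nat \<Rightarrow> real" where
  "prevcoef i j = (if j < i then - \<alpha> i else 0)"

text \<open>The factor 2 is the one that the simple functions in \<open>quantizer_sequence\<close>
  come with; it supplies integrable majorants that are the same for all quantisers.\<close>

definition quantizer :: "(real \<Rightarrow> real) \<Rightarrow> bool" where
  "quantizer r \<longleftrightarrow> r \<in> borel_measurable borel \<and> finite (range r) \<and> (\<forall>y. \<bar>r y\<bar> \<le> 2 * \<bar>y\<bar>)"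

text \<open>The prediction treats the quantised predecessors as if they were exact channel outputs.
  The mismatch is charged to \<open>info\<close> and disappears as the quantiser becomes
  fine.\<close>

definition qker :: "(real \<Rightarrow> real) \<Rightarrow> nat \<Rightarrow> (nat \<Rightarrow> real) \<Rightarrow> real \<Rightarrow> real" where
  "qker r i w a = cell r (v i) (\<alpha> i * (\<Sum>j<i. w j)) a"

text \<open>The least positive prediction among finitely many; the inserted 1 keeps the set
  nonempty.\<close>

definition qmin :: "(real \<Rightarrow> real) \<Rightarrow> real" where
  "qmin r = Min (insert 1 {x. 0 < x \<and> x \<in> (\<Union>i\<in>{..<l}. \<Union>w\<in>PiE {..<i} (\<lambda>_. range r). qker r i w ` range r)})"

definition est :: "nat \<Rightarrow> (nat \<Rightarrow> real) \<Rightarrow> real" where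
  "est i a = (\<Sum>j<l. \<gamma> i j * a j)"

lemma letter_code_channel:
  assumes "quantizer r"
  shows "letter_code M l X Z (range r) (cell r q) (qker r) (qmin r)"
proof -
  have r: "r \<in> borel_measurable borel" "finite (range r)" using assms by (auto simp: quantizer_def)
  let ?F = "{x. 0 < x \<and> x \<in> (\<Union>i\<in>{..<l}. \<Union>w\<in>PiE {..<i} (\<lambda>_. range r). qker r i w ` range r)}"
  have "finite (\<Union>i\<in>{..<l}. \<Union>w\<in>PiE {..<i} (\<lambda>_. range r). qker r i w ` range r)"
    by (rule finite_UN_I[OF finite_lessThan finite_UN_I[OF finite_PiE[OF finite_lessThan r(2)] finite_imageI[OF r(2)]]])
  then have F: "finite ?F" by (rule finite_subset[rotated]) auto
  have pos: "0 < qker r i w a" if "0 < cell r q s a" for i w s a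
  proof -
    have "\<not> (AE y in lborel. r y \<noteq> a)" using that cell_zero_iff[OF r q, of s a] by simp
    then have "cell r (v i) (\<alpha> i * (\<Sum>j<i. w j)) a \<noteq> 0"
      using cell_zero_iff[OF r v, of i "\<alpha> i * (\<Sum>j<i. w j)" a] by simp
    then show ?thesis
      using cell_nonneg[OF r v, of i "\<alpha> i * (\<Sum>j<i. w j)" a] unfolding qker_def by simp
  qed
  show ?thesis
  proof
    show "0 < qmin r" unfolding qmin_def using F by (subst Min_gr_iff) auto
    show "qmin r \<le> qker r i w a" if "i < l" "w \<in> PiE {..<i} (\<lambda>_. range r)" "a \<in> range r" "0 < cell r q s a" for i w a s
    proof -
      have "qker r i w a \<in> (\<Union>i\<in>{..<l}. \<Union>w\<in>PiE {..<i} (\<lambda>_. range r). qker r i w ` range r)"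
        using that(1-3) by (intro UN_I[of i] UN_I[of w] imageI) simp_all
      with pos[OF that(4), of i w] F show ?thesis unfolding qmin_def by (intro Min_le) auto
    qed
    show "(\<Sum>a\<in>range r. qker r i w a) \<le> 1" for i w
      unfolding qker_def using sum_cell_1[OF r v] by simp
    show "(\<Sum>a\<in>range r. cell r q s a) = 1" for s by (rule sum_cell_1[OF r q])
    show "(\<lambda>s. cell r q s a) \<in> borel_measurable borel" for a by (rule cell_meas[OF r q])
    show "0 \<le> cell r q s a" for s a by (rule cell_nonneg[OF r q])
    show "0 \<le> qker r i w a" for i w a unfolding qker_def by (rule cell_nonneg[OF r v])
  qed (use r sq pos in auto)
qed

lemma mu_integral: "quantizer r \<Longrightarrow> mu r s = (LBINT y. r y * normal_density s (sqrt q) y)"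
  using sum_cell[of r q "\<lambda>a. a" s] q by (simp add: quantizer_def mu_def mult.commute)

lemma ka_integral: "quantizer r \<Longrightarrow> ka r s = (LBINT y. (r y)\<^sup>2 * normal_density s (sqrt q) y)"
  using sum_cell[of r q "\<lambda>a. a\<^sup>2" s] q by (simp add: quantizer_def ka_def mult.commute)

lemma mu_meas[measurable]: "quantizer r \<Longrightarrow> mu r \<in> borel_measurable borel"
  unfolding mu_def[abs_def] quantizer_def using cell_meas[OF _ _ q, of r]
  by (intro borel_measurable_sum borel_measurable_times) auto

lemma ka_meas[measurable]: "quantizer r \<Longrightarrow> ka r \<in> borel_measurable borel"
  unfolding ka_def[abs_def] quantizer_def using cell_meas[OF _ _ q, of r]
  by (intro borel_measurable_sum borel_measurable_times) auto

lemma normal_second_moment: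
  "integrable lborel (\<lambda>y. y\<^sup>2 * normal_density s (sqrt q) y)" "(LBINT y. y\<^sup>2 * normal_density s (sqrt q) y) = s\<^sup>2 + q"
  "integrable lborel (\<lambda>y. y * normal_density s (sqrt q) y)" "(LBINT y. y * normal_density s (sqrt q) y) = s"
proof -
  let ?n = "normal_density s (sqrt q)"
  have sq0: "0 < sqrt q" using q by simp
  have nint: "integrable lborel ?n" "(LBINT y. ?n y) = 1" using sq0 by auto
  have m1: "integrable lborel (\<lambda>y. ?n y * y)" "(LBINT y. ?n y * y) = s"
    using integrable_normal_moment_nz_1[OF sq0] integral_normal_moment_nz_1[OF sq0] by auto
  have m2: "integrable lborel (\<lambda>y. ?n y * (y - s)\<^sup>2)" "(LBINT y. ?n y * (y - s)\<^sup>2) = q"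
    using integrable_normal_moment[OF sq0, of s 2] integral_normal_moment_even[OF sq0, of s 1] q by auto
  have e: "y\<^sup>2 * ?n y = ?n y * (y - s)\<^sup>2 + 2 * s * (?n y * y) + (- s\<^sup>2) * ?n y" for y
    by (simp add: power2_eq_square algebra_simps)
  show "integrable lborel (\<lambda>y. y\<^sup>2 * ?n y)" unfolding e using m1 m2 nint
    by (intro Bochner_Integration.integrable_add integrable_mult_right)
  have "(LBINT y. ?n y * (y - s)\<^sup>2 + A * (?n y * y) + B * ?n y) = q + A * s + B" for A B
    using nint m1 m2 by (subst Bochner_Integration.integral_add, simp, simp, subst Bochner_Integration.integral_add) simp_all
  then show "(LBINT y. y\<^sup>2 * ?n y) = s\<^sup>2 + q" unfolding e by (simp only:) (simp add: power2_eq_square)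
  show "integrable lborel (\<lambda>y. y * ?n y)" "(LBINT y. y * ?n y) = s" using m1 by (simp_all add: mult.commute)
qed

lemma ka_bound:
  assumes "quantizer r" shows "ka r s \<le> 4 * (s\<^sup>2 + q)"
proof -
  have r: "r \<in> borel_measurable borel" "\<And>y. (r y)\<^sup>2 \<le> 4 * y\<^sup>2"
    using assms by (auto simp: quantizer_def intro: abs_le_imp_sq_le)
  note [measurable] = r(1)
  have i4: "integrable lborel (\<lambda>y. 4 * (y\<^sup>2 * normal_density s (sqrt q) y))"
    using normal_second_moment(1) by (intro integrable_mult_right)
  have le: "(r y)\<^sup>2 * normal_density s (sqrt q) y \<le> 4 * (y\<^sup>2 * normal_density s (sqrt q) y)" for y
    using mult_right_mono[OF r(2)[of y] normal_density_nonneg[of s "sqrt q" y]] by simp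
  have "integrable lborel (\<lambda>y. (r y)\<^sup>2 * normal_density s (sqrt q) y)"
    by (rule Bochner_Integration.integrable_bound[OF i4]) (use le in auto)
  from integral_mono[OF this i4 le] have "ka r s \<le> (LBINT y. 4 * (y\<^sup>2 * normal_density s (sqrt q) y))"
    using ka_integral[OF assms] by simp
  then show ?thesis using normal_second_moment(2)[of s] by simp
qed

lemma mu_sq_le_ka:
  assumes "quantizer r" shows "(mu r s)\<^sup>2 \<le> ka r s"
proof -
  have r: "r \<in> borel_measurable borel" "finite (range r)" using assms by (auto simp: quantizer_def)
  have "0 \<le> (\<Sum>a\<in>range r. cell r q s a * (a - mu r s)\<^sup>2)"
    using cell_nonneg[OF r q] by (intro sum_nonneg) auto
  also have "\<dots> = (\<Sum>a\<in>range r. cell r q s a * a\<^sup>2 - 2 * mu r s * (cell r q s a * a) + (mu r s)\<^sup>2 * cell r q s a)"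
    by (intro sum.cong refl) (simp add: power2_eq_square algebra_simps)
  also have "\<dots> = ka r s - 2 * mu r s * mu r s + (mu r s)\<^sup>2"
    using sum_cell_1[OF r q] by (simp add: sum.distrib sum_subtractf sum_distrib_left[symmetric] ka_def mu_def)
  finally show ?thesis by (simp add: power2_eq_square)
qed

text \<open>By Cauchy-Schwarz and \<open>ka_bound\<close> the form has a majorant that does not
  involve the quantiser, as dominated convergence requires.\<close>

lemma qform_bound:
  assumes r: "quantizer r"
  shows "\<bar>qform r \<beta> c s\<bar> \<le> 2 * c\<^sup>2 + 3 * (\<Sum>j<l. (\<beta> j)\<^sup>2) * (\<Sum>j<l. 4 * ((s j)\<^sup>2 + q))"
proof -
  define B where "B = (\<Sum>j<l. (\<beta> j)\<^sup>2)"
  define U where "U = (\<Sum>j<l. 4 * ((s j)\<^sup>2 + q))"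
  have mU: "(mu r (s j))\<^sup>2 \<le> 4 * ((s j)\<^sup>2 + q)" for j
    using mu_sq_le_ka[OF r] ka_bound[OF r] order.trans by blast
  have B0: "0 \<le> B" unfolding B_def by (intro sum_nonneg) auto
  have "(\<Sum>j<l. \<beta> j * mu r (s j))\<^sup>2 \<le> B * (\<Sum>j<l. (mu r (s j))\<^sup>2)"
    unfolding B_def by (rule Cauchy_Schwarz_ineq_sum)
  also have "\<dots> \<le> B * U" unfolding U_def using mU B0 by (intro mult_left_mono sum_mono) auto
  finally have 1: "(\<Sum>j<l. \<beta> j * mu r (s j))\<^sup>2 \<le> B * U" .
  have "(c + (\<Sum>j<l. \<beta> j * mu r (s j)))\<^sup>2 \<le> 2 * c\<^sup>2 + 2 * (\<Sum>j<l. \<beta> j * mu r (s j))\<^sup>2"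
    using zero_le_power2[of "c - (\<Sum>j<l. \<beta> j * mu r (s j))"] by (simp add: power2_sum power2_diff)
  with 1 have 2: "(c + (\<Sum>j<l. \<beta> j * mu r (s j)))\<^sup>2 \<le> 2 * c\<^sup>2 + 2 * (B * U)" by linarith
  have "(\<Sum>j<l. (\<beta> j)\<^sup>2 * (ka r (s j) - (mu r (s j))\<^sup>2)) \<le> (\<Sum>j<l. (\<beta> j)\<^sup>2 * U)"
  proof (rule sum_mono[OF mult_left_mono])
    fix j assume "j \<in> {..<l}"
    then have "4 * ((s j)\<^sup>2 + q) \<le> U" unfolding U_def using q
      by (intro member_le_sum[of j "{..<l}" "\<lambda>j. 4 * ((s j)\<^sup>2 + q)"]) auto
    then show "ka r (s j) - (mu r (s j))\<^sup>2 \<le> U" using ka_bound[OF r, of "s j"] zero_le_power2[of "mu r (s j)"] by linarith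
  qed auto
  then have 3: "(\<Sum>j<l. (\<beta> j)\<^sup>2 * (ka r (s j) - (mu r (s j))\<^sup>2)) \<le> B * U"
    by (simp add: B_def sum_distrib_right)
  have "0 \<le> (\<Sum>j<l. (\<beta> j)\<^sup>2 * (ka r (s j) - (mu r (s j))\<^sup>2))"
    using mu_sq_le_ka[OF r] by (intro sum_nonneg mult_nonneg_nonneg) auto
  then have "\<bar>qform r \<beta> c s\<bar> = qform r \<beta> c s" unfolding qform_def by (intro abs_of_nonneg add_nonneg_nonneg) auto
  also have "\<dots> \<le> 2 * c\<^sup>2 + 3 * (B * U)" unfolding qform_def using 2 3 by linarith
  finally show ?thesis by (simp add: B_def U_def mult.assoc)
qed

lemma quantizer_sequence:
  obtains r :: "nat \<Rightarrow> real \<Rightarrow> real" where "\<And>m. quantizer (r m)" "\<And>y. (\<lambda>m. r m y) \<longlonglongrightarrow> y"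
proof -
  obtain F :: "nat \<Rightarrow> real \<Rightarrow> real" where F: "\<And>i. simple_function borel (F i)" "\<And>x. (\<lambda>i. F i x) \<longlonglongrightarrow> x"
      "\<And>i x. dist (F i x) 0 \<le> 2 * dist x 0"
    using borel_measurable_implies_sequence_metric[of "\<lambda>x::real. x" borel 0] by auto
  have "quantizer (F i)" for i
    using F(1)[of i] F(3)[of i] borel_measurable_simple_function[OF F(1)[of i]]
    by (auto simp: quantizer_def simple_function_def dist_real_def)
  then show ?thesis using F(2) that by blast
qed

lemma mu_tendsto:
  assumes r: "\<And>m. quantizer (r m)" "\<And>y. (\<lambda>m. r m y) \<longlonglongrightarrow> y"
  shows "(\<lambda>m. mu (r m) s) \<longlonglongrightarrow> s"
proof -
  have [measurable]: "r m \<in> borel_measurable borel" for m using r(1)[of m] by (auto simp: quantizer_def)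
  have b: "\<bar>r m y\<bar> \<le> 2 * \<bar>y\<bar>" for m y using r(1)[of m] by (auto simp: quantizer_def)
  have "(\<lambda>m. LBINT y. r m y * normal_density s (sqrt q) y) \<longlonglongrightarrow> (LBINT y. y * normal_density s (sqrt q) y)"
  proof (rule integral_dominated_convergence[where w="\<lambda>y. 2 * \<bar>y * normal_density s (sqrt q) y\<bar>"])
    show "integrable lborel (\<lambda>y. 2 * \<bar>y * normal_density s (sqrt q) y\<bar>)"
      using normal_second_moment(3) by (intro integrable_mult_right integrable_abs)
    show "AE y in lborel. (\<lambda>m. r m y * normal_density s (sqrt q) y) \<longlonglongrightarrow> y * normal_density s (sqrt q) y"
      using r(2) by (intro AE_I2 tendsto_mult_right)
    show "AE y in lborel. norm (r m y * normal_density s (sqrt q) y) \<le> 2 * \<bar>y * normal_density s (sqrt q) y\<bar>" for m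
      using mult_right_mono[OF b normal_density_nonneg[of s "sqrt q"]]
      by (intro AE_I2) (simp add: abs_mult mult.assoc[symmetric])
  qed auto
  then show ?thesis using normal_second_moment(4)[of s] by (simp add: mu_integral[OF r(1)])
qed

lemma ka_tendsto:
  assumes r: "\<And>m. quantizer (r m)" "\<And>y. (\<lambda>m. r m y) \<longlonglongrightarrow> y"
  shows "(\<lambda>m. ka (r m) s) \<longlonglongrightarrow> s\<^sup>2 + q"
proof -
  have [measurable]: "r m \<in> borel_measurable borel" for m using r(1)[of m] by (auto simp: quantizer_def)
  have b: "(r m y)\<^sup>2 \<le> 4 * y\<^sup>2" for m y using r(1)[of m] by (auto simp: quantizer_def intro: abs_le_imp_sq_le)
  have "(\<lambda>m. LBINT y. (r m y)\<^sup>2 * normal_density s (sqrt q) y) \<longlonglongrightarrow> (LBINT y. y\<^sup>2 * normal_density s (sqrt q) y)"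
  proof (rule integral_dominated_convergence[where w="\<lambda>y. 4 * (y\<^sup>2 * normal_density s (sqrt q) y)"])
    show "integrable lborel (\<lambda>y. 4 * (y\<^sup>2 * normal_density s (sqrt q) y))"
      using normal_second_moment(1) by (intro integrable_mult_right)
    show "AE y in lborel. (\<lambda>m. (r m y)\<^sup>2 * normal_density s (sqrt q) y) \<longlonglongrightarrow> y\<^sup>2 * normal_density s (sqrt q) y"
      using r(2) by (intro AE_I2 tendsto_mult_right tendsto_power)
    show "AE y in lborel. norm ((r m y)\<^sup>2 * normal_density s (sqrt q) y) \<le> 4 * (y\<^sup>2 * normal_density s (sqrt q) y)" for m
      using mult_right_mono[OF b normal_density_nonneg[of s "sqrt q"]]
      by (intro AE_I2) (simp add: abs_mult mult.assoc[symmetric])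
  qed auto
  then show ?thesis using normal_second_moment(2)[of s] by (simp add: ka_integral[OF r(1)])
qed

lemma S0_meas[measurable]: "j < l \<Longrightarrow> (\<lambda>\<omega>. S0 j \<omega>) \<in> borel_measurable M"
  by measurable

lemma S0_sq_integrable: "j < l \<Longrightarrow> integrable M (\<lambda>\<omega>. (S0 j \<omega>)\<^sup>2)"
proof -
  assume j: "j < l"
  have b: "integrable M (\<lambda>\<omega>. 2 * (X 0 j \<omega>)\<^sup>2 + 2 * (Z 0 j \<omega>)\<^sup>2)"
    using sq[OF j] by (intro Bochner_Integration.integrable_add integrable_mult_right)
  have "(S0 j \<omega>)\<^sup>2 \<le> 2 * (X 0 j \<omega>)\<^sup>2 + 2 * (Z 0 j \<omega>)\<^sup>2" for \<omega>
    using zero_le_power2[of "X 0 j \<omega> - Z 0 j \<omega>"] by (simp add: power2_sum power2_diff)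
  then show ?thesis using S0_meas[OF j] by (intro Bochner_Integration.integrable_bound[OF b]) auto
qed

lemma qform_meas:
  assumes r: "quantizer r" and [measurable]: "c \<in> borel_measurable M"
  shows "(\<lambda>\<omega>. qform r \<beta> (c \<omega>) (\<lambda>j. S0 j \<omega>)) \<in> borel_measurable M"
proof -
  have [measurable]: "(\<lambda>\<omega>. mu r (S0 j \<omega>)) \<in> borel_measurable M" "(\<lambda>\<omega>. ka r (S0 j \<omega>)) \<in> borel_measurable M" if "j < l" for j
    using measurable_compose[OF S0_meas[OF that] mu_meas[OF r]] measurable_compose[OF S0_meas[OF that] ka_meas[OF r]] .
  show ?thesis unfolding qform_def by measurable
qed

lemma qform_dom_integrable:
  assumes c2: "integrable M (\<lambda>\<omega>. (c \<omega>)\<^sup>2)"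
  shows "integrable M (\<lambda>\<omega>. 2 * (c \<omega>)\<^sup>2 + 3 * (\<Sum>j<l. (\<beta> j)\<^sup>2) * (\<Sum>j<l. 4 * ((S0 j \<omega>)\<^sup>2 + q)))"
  using c2 S0_sq_integrable
  by (intro Bochner_Integration.integrable_add integrable_mult_right Bochner_Integration.integrable_sum) auto

lemma qform_integrable:
  assumes r: "quantizer r" and c[measurable]: "c \<in> borel_measurable M" and c2: "integrable M (\<lambda>\<omega>. (c \<omega>)\<^sup>2)"
  shows "integrable M (\<lambda>\<omega>. qform r \<beta> (c \<omega>) (\<lambda>j. S0 j \<omega>))"
  by (rule Bochner_Integration.integrable_bound[OF qform_dom_integrable[OF c2, of \<beta>] qform_meas[OF r c]])
    (intro AE_I2, use qform_bound[OF r] in \<open>simp add: order.trans[OF _ abs_ge_self]\<close>)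

text \<open>As the quantiser becomes fine, \<open>mu\<close> tends to s and the conditional variance
  to q, so the form tends to its value for the unquantised channel, pointwise and then under the
  integral.\<close>

lemma qform_tendsto:
  assumes r: "\<And>m. quantizer (r m)" "\<And>y. (\<lambda>m. r m y) \<longlonglongrightarrow> y"
    and c[measurable]: "c \<in> borel_measurable M" and c2: "integrable M (\<lambda>\<omega>. (c \<omega>)\<^sup>2)"
  shows "(\<lambda>m. LINT \<omega>|M. qform (r m) \<beta> (c \<omega>) (\<lambda>j. S0 j \<omega>)) \<longlonglongrightarrow>
     (LINT \<omega>|M. (c \<omega> + (\<Sum>j<l. \<beta> j * S0 j \<omega>))\<^sup>2 + q * (\<Sum>j<l. (\<beta> j)\<^sup>2))"
proof (rule integral_dominated_convergence)
  show "integrable M (\<lambda>\<omega>. 2 * (c \<omega>)\<^sup>2 + 3 * (\<Sum>j<l. (\<beta> j)\<^sup>2) * (\<Sum>j<l. 4 * ((S0 j \<omega>)\<^sup>2 + q)))"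
    by (rule qform_dom_integrable[OF c2])
  show "AE \<omega> in M. norm (qform (r m) \<beta> (c \<omega>) (\<lambda>j. S0 j \<omega>)) \<le> 2 * (c \<omega>)\<^sup>2 + 3 * (\<Sum>j<l. (\<beta> j)\<^sup>2) * (\<Sum>j<l. 4 * ((S0 j \<omega>)\<^sup>2 + q))" for m
    by (intro AE_I2) (simp only: real_norm_def qform_bound[OF r(1)])
  show "AE \<omega> in M. (\<lambda>m. qform (r m) \<beta> (c \<omega>) (\<lambda>j. S0 j \<omega>)) \<longlonglongrightarrow> (c \<omega> + (\<Sum>j<l. \<beta> j * S0 j \<omega>))\<^sup>2 + q * (\<Sum>j<l. (\<beta> j)\<^sup>2)"
  proof (rule AE_I2)
    fix \<omega>
    have "(\<lambda>m. qform (r m) \<beta> (c \<omega>) (\<lambda>j. S0 j \<omega>)) \<longlonglongrightarrow> (c \<omega> + (\<Sum>j<l. \<beta> j * S0 j \<omega>))\<^sup>2 + (\<Sum>j<l. (\<beta> j)\<^sup>2 * (((S0 j \<omega>)\<^sup>2 + q) - (S0 j \<omega>)\<^sup>2))"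
      unfolding qform_def
      by (intro tendsto_add tendsto_power tendsto_const tendsto_sum tendsto_mult tendsto_diff mu_tendsto[OF r] ka_tendsto[OF r])
    then show "(\<lambda>m. qform (r m) \<beta> (c \<omega>) (\<lambda>j. S0 j \<omega>)) \<longlonglongrightarrow> (c \<omega> + (\<Sum>j<l. \<beta> j * S0 j \<omega>))\<^sup>2 + q * (\<Sum>j<l. (\<beta> j)\<^sup>2)"
      by (simp add: sum_distrib_left mult.commute)
  qed
qed (use qform_meas[OF r(1) c] in auto)

lemma pmf_quadratic_qform:
  assumes r: "quantizer r"
  shows "(\<Sum>a\<in>PiE {..<l} (\<lambda>_. range r). (\<Prod>j<l. cell r q (s j) (a j)) * (c + (\<Sum>j<l. \<beta> j * a j))\<^sup>2) = qform r \<beta> c s"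
proof -
  have r': "r \<in> borel_measurable borel" "finite (range r)" using r by (auto simp: quantizer_def)
  show ?thesis
    unfolding qform_def mu_def ka_def using sum_cell_1[OF r' q] by (intro pmf_quadratic r') auto
qed

text \<open>With the letters of the other users fixed, \<open>cell_divergence\<close> bounds the
  divergence of encoder i by a quadratic function of the predicted mean. Averaging over the
  predecessors therefore needs only the first two moments of the quantised letters, that is, a
  \<open>qform\<close>.\<close>

lemma info_le:
  assumes r: "quantizer r" and i: "i < l"
  shows "letter_code.info M l X Z (range r) (cell r q) (qker r) i \<le>
    ln (v i / q) / 2 - 1 / 2 + (q + (LINT \<omega>|M. qform r (prevcoef i) (S0 i \<omega>) (\<lambda>j. S0 j \<omega>))) / (2 * v i)"
proof -
  interpret c: letter_code M l X Z "range r" "cell r q" "qker r" "qmin r" est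
    by (rule letter_code_channel[OF r])
  have r': "r \<in> borel_measurable borel" "finite (range r)" using r by (auto simp: quantizer_def)
  let ?I = "{..<l} - {i}"
  have niI: "i \<notin> ?I" by simp
  have ins: "insert i ?I = {..<l}" using i by auto
  have pointwise: "(\<Sum>a\<in>c.AA. c.law (W 0 \<omega>) a * ln (c.ratio i (W 0 \<omega>) a)) \<le>
     ln (v i / q) / 2 - 1 / 2 + (q + qform r (prevcoef i) (S0 i \<omega>) (\<lambda>j. S0 j \<omega>)) / (2 * v i)" for \<omega>
  proof -
    define s where "s j = c.src j (W 0 \<omega>)" for j
    have s: "s j = S0 j \<omega>" if "j < l" for j using that by (simp add: s_def c.S_W)
    define bd where "bd m = ln (v i / q) / 2 - 1 / 2 + (q + (s i - \<alpha> i * m)\<^sup>2) / (2 * v i)" for m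
    define R where "R a = (\<Prod>j\<in>?I. cell r q (s j) (a j))" for a
    have R0: "0 \<le> R a" for a unfolding R_def using c.p1_nonneg by (intro prod_nonneg) auto
    have law: "c.law (W 0 \<omega>) (a(i := y)) = R a * cell r q (s i) y" for a y
    proof -
      have "c.law (W 0 \<omega>) (a(i := y)) = cell r q (s i) ((a(i := y)) i) * (\<Prod>j\<in>?I. cell r q (s j) ((a(i := y)) j))"
        unfolding c.law_def s_def using i by (subst prod.remove[of "{..<l}" i]) auto
      also have "(\<Prod>j\<in>?I. cell r q (s j) ((a(i := y)) j)) = R a" unfolding R_def by (intro prod.cong) auto
      finally show ?thesis by (simp only: fun_upd_same mult.commute)
    qed
    have prev: "(\<Sum>j<i. restrict (a(i := y)) {..<i} j) = (\<Sum>j<i. a j)" for a :: "nat \<Rightarrow> real" and y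
      by (intro sum.cong) auto
    have ratio: "c.ratio i (W 0 \<omega>) (a(i := y)) = cell r q (s i) y / cell r (v i) (\<alpha> i * (\<Sum>j<i. a j)) y" for a y
      unfolding c.ratio_def qker_def prev s_def by simp
    have "(\<Sum>a\<in>c.AA. c.law (W 0 \<omega>) a * ln (c.ratio i (W 0 \<omega>) a)) =
      (\<Sum>a\<in>PiE ?I (\<lambda>_. range r). \<Sum>y\<in>range r. c.law (W 0 \<omega>) (a(i := y)) * ln (c.ratio i (W 0 \<omega>) (a(i := y))))"
      using sum_PiE_insert[OF niI, of "\<lambda>a. c.law (W 0 \<omega>) a * ln (c.ratio i (W 0 \<omega>) a)" "\<lambda>_. range r", unfolded ins] .
    also have "\<dots> = (\<Sum>a\<in>PiE ?I (\<lambda>_. range r). R a * (\<Sum>y\<in>range r. cell r q (s i) y * ln (cell r q (s i) y / cell r (v i) (\<alpha> i * (\<Sum>j<i. a j)) y)))"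
      by (simp only: law ratio sum_distrib_left mult.assoc)
    also have "\<dots> \<le> (\<Sum>a\<in>PiE ?I (\<lambda>_. range r). R a * bd (\<Sum>j<i. a j))"
      unfolding bd_def by (rule sum_mono[OF mult_left_mono[OF cell_divergence[OF r' v q] R0]])
    also have "\<dots> = (\<Sum>a\<in>PiE ?I (\<lambda>_. range r). \<Sum>y\<in>range r. c.law (W 0 \<omega>) (a(i := y)) * bd (\<Sum>j<i. (a(i := y)) j))"
    proof (rule sum.cong[OF refl])
      fix a :: "nat \<Rightarrow> real"
      have "(\<Sum>j<i. (a(i := y)) j) = (\<Sum>j<i. a j)" for y by (intro sum.cong) auto
      then have "(\<Sum>y\<in>range r. c.law (W 0 \<omega>) (a(i := y)) * bd (\<Sum>j<i. (a(i := y)) j)) = (\<Sum>y\<in>range r. (R a * bd (\<Sum>j<i. a j)) * cell r q (s i) y)"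
        by (simp only: law) (simp add: mult.commute mult.left_commute)
      also have "\<dots> = R a * bd (\<Sum>j<i. a j)"
        by (simp only: sum_distrib_left[symmetric] sum_cell_1[OF r' q] mult_1_right)
      finally show "R a * bd (\<Sum>j<i. a j) = (\<Sum>y\<in>range r. c.law (W 0 \<omega>) (a(i := y)) * bd (\<Sum>j<i. (a(i := y)) j))" ..
    qed
    also have "\<dots> = (\<Sum>a\<in>c.AA. c.law (W 0 \<omega>) a * bd (\<Sum>j<i. a j))"
      using sum_PiE_insert[OF niI, of "\<lambda>a. c.law (W 0 \<omega>) a * bd (\<Sum>j<i. a j)" "\<lambda>_. range r", unfolded ins] by (rule sym)
    also have "\<dots> = (\<Sum>a\<in>c.AA. (ln (v i / q) / 2 - 1 / 2 + q / (2 * v i)) * c.law (W 0 \<omega>) a +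
        (1 / (2 * v i)) * ((\<Prod>j<l. cell r q (s j) (a j)) * (s i + (\<Sum>j<l. prevcoef i j * a j))\<^sup>2))"
    proof (rule sum.cong[OF refl])
      fix a :: "nat \<Rightarrow> real"
      have "(\<Sum>j<l. prevcoef i j * a j) = (\<Sum>j<i. - \<alpha> i * a j)"
        using i by (intro sum.mono_neutral_cong_right) (auto simp: prevcoef_def)
      also have "\<dots> = - \<alpha> i * (\<Sum>j<i. a j)" by (simp only: sum_distrib_left)
      finally have p: "s i + (\<Sum>j<l. prevcoef i j * a j) = s i - \<alpha> i * (\<Sum>j<i. a j)" by simp
      show "c.law (W 0 \<omega>) a * bd (\<Sum>j<i. a j) = (ln (v i / q) / 2 - 1 / 2 + q / (2 * v i)) * c.law (W 0 \<omega>) a +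
        (1 / (2 * v i)) * ((\<Prod>j<l. cell r q (s j) (a j)) * (s i + (\<Sum>j<l. prevcoef i j * a j))\<^sup>2)"
        unfolding p unfolding bd_def c.law_def s_def by (simp add: algebra_simps add_divide_distrib)
    qed
    also have "\<dots> = (ln (v i / q) / 2 - 1 / 2 + q / (2 * v i)) + (1 / (2 * v i)) * qform r (prevcoef i) (s i) s"
      by (simp only: sum.distrib sum_distrib_left[symmetric] c.sum_law pmf_quadratic_qform[OF r] mult_1_right)
    also have "qform r (prevcoef i) (s i) s = qform r (prevcoef i) (S0 i \<omega>) (\<lambda>j. S0 j \<omega>)"
      unfolding qform_def using s i by simp
    finally show ?thesis by (simp add: add_divide_distrib)
  qed
  have int: "integrable M (\<lambda>\<omega>. qform r (prevcoef i) (S0 i \<omega>) (\<lambda>j. S0 j \<omega>))"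
    by (rule qform_integrable[OF r S0_meas[OF i] S0_sq_integrable[OF i]])
  have "c.info i \<le> (LINT \<omega>|M. ln (v i / q) / 2 - 1 / 2 + (q + qform r (prevcoef i) (S0 i \<omega>) (\<lambda>j. S0 j \<omega>)) / (2 * v i))"
    unfolding c.info_def
    by (rule integral_mono[OF c.info_integrand[OF i] _ pointwise])
      (intro Bochner_Integration.integrable_add integrable_divide int, auto)
  also have "\<dots> = ln (v i / q) / 2 - 1 / 2 + (q + (LINT \<omega>|M. qform r (prevcoef i) (S0 i \<omega>) (\<lambda>j. S0 j \<omega>))) / (2 * v i)"
    using int by (simp add: prob_space)
  finally show ?thesis .
qed

lemma dist_le:
  assumes r: "quantizer r"
  shows "letter_code.dist M l X Z (range r) (cell r q) est = (\<Sum>i<l. LINT \<omega>|M. qform r (\<lambda>j. - \<gamma> i j) (X 0 i \<omega>) (\<lambda>j. S0 j \<omega>))"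
proof -
  interpret c: letter_code M l X Z "range r" "cell r q" "qker r" "qmin r" est
    by (rule letter_code_channel[OF r])
  have "c.sqerr (W 0 \<omega>) = (\<Sum>i<l. qform r (\<lambda>j. - \<gamma> i j) (X 0 i \<omega>) (\<lambda>j. S0 j \<omega>))" for \<omega>
  proof -
    have "c.law (W 0 \<omega>) a = (\<Prod>j<l. cell r q (S0 j \<omega>) (a j))" for a
      unfolding c.law_def by (intro prod.cong refl) (simp add: c.S_W)
    then have "c.sqerr (W 0 \<omega>) = (\<Sum>a\<in>c.AA. \<Sum>i<l. (\<Prod>j<l. cell r q (S0 j \<omega>) (a j)) * (X 0 i \<omega> + (\<Sum>j<l. - \<gamma> i j * a j))\<^sup>2)"
      unfolding c.sqerr_def est_def by (simp add: sum_distrib_left fst_W sum_negf)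
    also have "\<dots> = (\<Sum>i<l. \<Sum>a\<in>c.AA. (\<Prod>j<l. cell r q (S0 j \<omega>) (a j)) * (X 0 i \<omega> + (\<Sum>j<l. - \<gamma> i j * a j))\<^sup>2)"
      by (rule sum.swap)
    also have "\<dots> = (\<Sum>i<l. qform r (\<lambda>j. - \<gamma> i j) (X 0 i \<omega>) (\<lambda>j. S0 j \<omega>))"
      by (simp only: pmf_quadratic_qform[OF r])
    finally show ?thesis .
  qed
  moreover have "integrable M (\<lambda>\<omega>. qform r (\<lambda>j. - \<gamma> i j) (X 0 i \<omega>) (\<lambda>j. S0 j \<omega>))" if "i < l" for i
    by (rule qform_integrable[OF r X_meas[OF that] sq(1)[OF that]])
  ultimately show ?thesis unfolding c.dist_def by (simp add: Bochner_Integration.integral_sum)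
qed

text \<open>Not \<open>info\<close> itself but its upper bound from \<open>info_le\<close> is
  followed to the limit, which spares a proof that mutual information is continuous under
  quantisation. A fine quantiser costs \<delta> / 2 and the block code the other half.\<close>

theorem gaussian_coding:
  assumes \<delta>: "0 < \<delta>" and l: "0 < l"
  shows "\<exists>n>0. \<exists>(\<phi> :: nat \<Rightarrow> (nat \<Rightarrow> real) \<Rightarrow> nat) (C :: nat \<Rightarrow> nat set) h.
    (\<forall>i<l. finite (C i) \<and> \<phi> i \<in> vecM n \<rightarrow>\<^sub>M count_space UNIV \<and> (\<forall>x\<in>space (vecM n). \<phi> i x \<in> C i)) \<and>
    (\<Sum>i<l. ln (real (card (C i)))) \<le> real n * ((\<Sum>i<l. ln (v i / q) / 2 - 1 / 2 +
       (q + (LINT \<omega>|M. (S0 i \<omega> + (\<Sum>j<l. prevcoef i j * S0 j \<omega>))\<^sup>2 + q * (\<Sum>j<l. (prevcoef i j)\<^sup>2))) / (2 * v i)) + \<delta>) \<and>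
    (LINT \<omega>|M. (\<Sum>i<l. \<Sum>t<n. (X t i \<omega> - h i t (\<lambda>i\<in>{..<l}. \<phi> i (Sblock X Z n i \<omega>)))\<^sup>2)) \<le>
      real n * ((\<Sum>i<l. LINT \<omega>|M. (X 0 i \<omega> + (\<Sum>j<l. - \<gamma> i j * S0 j \<omega>))\<^sup>2 + q * (\<Sum>j<l. (- \<gamma> i j)\<^sup>2)) + \<delta>)"
proof -
  obtain r :: "nat \<Rightarrow> real \<Rightarrow> real" where r: "\<And>m. quantizer (r m)" "\<And>y. (\<lambda>m. r m y) \<longlonglongrightarrow> y"
    using quantizer_sequence by metis
  define I where "I m = (\<Sum>i<l. ln (v i / q) / 2 - 1 / 2 + (q + (LINT \<omega>|M. qform (r m) (prevcoef i) (S0 i \<omega>) (\<lambda>j. S0 j \<omega>))) / (2 * v i))" for m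
  define J where "J = (\<Sum>i<l. ln (v i / q) / 2 - 1 / 2 +
       (q + (LINT \<omega>|M. (S0 i \<omega> + (\<Sum>j<l. prevcoef i j * S0 j \<omega>))\<^sup>2 + q * (\<Sum>j<l. (prevcoef i j)\<^sup>2))) / (2 * v i))"
  define D where "D m = (\<Sum>i<l. LINT \<omega>|M. qform (r m) (\<lambda>j. - \<gamma> i j) (X 0 i \<omega>) (\<lambda>j. S0 j \<omega>))" for m
  define D' where "D' = (\<Sum>i<l. LINT \<omega>|M. (X 0 i \<omega> + (\<Sum>j<l. - \<gamma> i j * S0 j \<omega>))\<^sup>2 + q * (\<Sum>j<l. (- \<gamma> i j)\<^sup>2))"
  have "I \<longlonglongrightarrow> J" unfolding I_def J_def
  proof (rule tendsto_sum)
    fix i assume "i \<in> {..<l}"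
    then have i: "i < l" by simp
    show "(\<lambda>m. ln (v i / q) / 2 - 1 / 2 + (q + (LINT \<omega>|M. qform (r m) (prevcoef i) (S0 i \<omega>) (\<lambda>j. S0 j \<omega>))) / (2 * v i)) \<longlonglongrightarrow>
       ln (v i / q) / 2 - 1 / 2 + (q + (LINT \<omega>|M. (S0 i \<omega> + (\<Sum>j<l. prevcoef i j * S0 j \<omega>))\<^sup>2 + q * (\<Sum>j<l. (prevcoef i j)\<^sup>2))) / (2 * v i)"
      using v[of i] by (intro tendsto_add tendsto_divide tendsto_const qform_tendsto[OF r S0_meas[OF i] S0_sq_integrable[OF i]]) auto
  qed
  then have e1: "\<forall>\<^sub>F m in sequentially. I m < J + \<delta> / 2" using \<delta> by (intro order_tendstoD) auto
  have "D \<longlonglongrightarrow> D'" unfolding D_def D'_def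
  proof (rule tendsto_sum)
    fix i assume "i \<in> {..<l}"
    then have i: "i < l" by simp
    show "(\<lambda>m. LINT \<omega>|M. qform (r m) (\<lambda>j. - \<gamma> i j) (X 0 i \<omega>) (\<lambda>j. S0 j \<omega>)) \<longlonglongrightarrow>
      (LINT \<omega>|M. (X 0 i \<omega> + (\<Sum>j<l. - \<gamma> i j * S0 j \<omega>))\<^sup>2 + q * (\<Sum>j<l. (- \<gamma> i j)\<^sup>2))"
      by (rule qform_tendsto[OF r X_meas[OF i] sq(1)[OF i]])
  qed
  then have e2: "\<forall>\<^sub>F m in sequentially. D m < D' + \<delta> / 2" using \<delta> by (intro order_tendstoD) auto
  obtain m where m: "I m < J + \<delta> / 2" "D m < D' + \<delta> / 2"
    using eventually_happens[OF eventually_conj[OF e1 e2]] by auto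
  interpret c: letter_code M l X Z "range (r m)" "cell (r m) q" "qker (r m)" "qmin (r m)" est
    by (rule letter_code_channel[OF r(1)])
  have "0 < \<delta> / 2" using \<delta> by simp
  from c.letter_coding[OF this l]
  obtain n and \<phi> :: "nat \<Rightarrow> (nat \<Rightarrow> real) \<Rightarrow> nat" and C :: "nat \<Rightarrow> nat set" and h where n: "n > 0"
    and ok: "\<forall>i<l. finite (C i) \<and> \<phi> i \<in> vecM n \<rightarrow>\<^sub>M count_space UNIV \<and> (\<forall>x\<in>space (vecM n). \<phi> i x \<in> C i)"
    and R: "(\<Sum>i<l. ln (real (card (C i)))) \<le> real n * ((\<Sum>i<l. c.info i) + \<delta> / 2)"
    and E: "(LINT \<omega>|M. (\<Sum>i<l. \<Sum>t<n. (X t i \<omega> - h i t (\<lambda>i\<in>{..<l}. \<phi> i (Sblock X Z n i \<omega>)))\<^sup>2)) \<le> real n * (c.dist + \<delta> / 2)"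
    by (elim exE conjE) (rule that)
  have "(\<Sum>i<l. c.info i) \<le> I m" unfolding I_def using info_le[OF r(1)] by (intro sum_mono) auto
  then have "real n * ((\<Sum>i<l. c.info i) + \<delta> / 2) \<le> real n * (J + \<delta>)" using m by (intro mult_left_mono) auto
  from order.trans[OF R this] have "(\<Sum>i<l. ln (real (card (C i)))) \<le> real n * (J + \<delta>)" .
  moreover have "real n * (c.dist + \<delta> / 2) \<le> real n * (D' + \<delta>)"
    using m unfolding dist_le[OF r(1)] D_def by (intro mult_left_mono) auto
  from order.trans[OF E this] have "(LINT \<omega>|M. (\<Sum>i<l. \<Sum>t<n. (X t i \<omega> - h i t (\<lambda>i\<in>{..<l}. \<phi> i (Sblock X Z n i \<omega>)))\<^sup>2)) \<le> real n * (D' + \<delta>)" .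
  ultimately show ?thesis using n ok unfolding J_def[symmetric] D'_def[symmetric] by blast
qed

end

section \<open>Exchangeable Gaussian sources\<close>

lemma sum_unit: "i < l \<Longrightarrow> (\<Sum>j<l. of_bool (j = i) * f j) = f i" for f :: "nat \<Rightarrow> real"
proof -
  assume i: "i < l"
  have "(\<Sum>j<l. of_bool (j = i) * f j) = (\<Sum>j<l. if j = i then f i else 0)" by (intro sum.cong) auto
  then show ?thesis using i by simp
qed

text \<open>The quadratic form with eigenvalue \<open>e1\<close> on the constant vectors and \<open>e2\<close> on their complement; \<open>circ\<close>
  below is the corresponding operator.\<close>

definition qf :: "nat \<Rightarrow> real \<Rightarrow> real \<Rightarrow> (nat \<Rightarrow> real) \<Rightarrow> real" where
  "qf l e1 e2 a = e2 * (\<Sum>i<l. (a i)\<^sup>2) + (e1 - e2) * (\<Sum>i<l. a i)\<^sup>2 / real l"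

lemma qf_coef_add: "qf l e1 e2 a + qf l f1 f2 a = qf l (e1 + f1) (e2 + f2) a"
  by (simp add: qf_def algebra_simps add_divide_distrib diff_divide_distrib)

lemma qf_one: "qf l e e a = e * (\<Sum>i<l. (a i)\<^sup>2)"
  by (simp add: qf_def)

lemma qf_divide: "qf l (a / c) (b / c) x = qf l a b x / c"
  by (simp add: qf_def add_divide_distrib diff_divide_distrib left_diff_distrib mult.commute)

lemma qf_cong: "(\<And>i. i < l \<Longrightarrow> x i = y i) \<Longrightarrow> qf l e1 e2 x = qf l e1 e2 y"
  by (simp add: qf_def)

lemma qf_nonneg: "0 \<le> qf l e1 e2 a" if e: "0 \<le> e1" "0 \<le> e2"
proof (cases "l = 0")
  case False
  have "(\<Sum>i<l. 1 * a i)\<^sup>2 \<le> (\<Sum>i<l. 1\<^sup>2) * (\<Sum>i<l. (a i)\<^sup>2)" by (rule Cauchy_Schwarz_ineq_sum)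
  then have "0 \<le> (\<Sum>i<l. (a i)\<^sup>2) - (\<Sum>i<l. a i)\<^sup>2 / real l"
    using False by (simp add: field_simps)
  then have "0 \<le> e2 * ((\<Sum>i<l. (a i)\<^sup>2) - (\<Sum>i<l. a i)\<^sup>2 / real l)" using e by simp
  moreover have "0 \<le> e1 * ((\<Sum>i<l. a i)\<^sup>2 / real l)" using e by simp
  moreover have "qf l e1 e2 a = e1 * ((\<Sum>i<l. a i)\<^sup>2 / real l) + e2 * ((\<Sum>i<l. (a i)\<^sup>2) - (\<Sum>i<l. a i)\<^sup>2 / real l)"
    by (simp add: qf_def algebra_simps diff_divide_distrib)
  ultimately show ?thesis by linarith
qed (simp add: qf_def)

lemma equicov_form:
  assumes "0 < l"
  shows "(\<Sum>i<l. \<Sum>j<l. a i * equicov g rho i j * a j) = qf l (lam1 l g rho) (lam2 g rho) a"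
proof -
  have e: "equicov g rho i j = lam2 g rho * of_bool (i = j) + rho * g" for i j
    by (simp add: equicov_def lam2_def algebra_simps)
  have "(\<Sum>i<l. \<Sum>j<l. a i * equicov g rho i j * a j) =
     (\<Sum>i<l. \<Sum>j<l. lam2 g rho * (if j = i then a i * a i else 0) + rho * g * (a i * a j))"
    unfolding e by (intro sum.cong refl) (auto simp: algebra_simps)
  also have "\<dots> = lam2 g rho * (\<Sum>i<l. (a i)\<^sup>2) + rho * g * (\<Sum>i<l. a i)\<^sup>2"
    by (simp add: sum.distrib sum_distrib_left[symmetric] power2_eq_square sum_product)
  also have "rho * g = (lam1 l g rho - lam2 g rho) / real l"
    using assms by (simp add: lam1_def lam2_def field_simps)
  finally show ?thesis by (simp add: qf_def)
qed

section \<open>Linear estimation for a single eigenvalue\<close>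

lemma mmse_scalar:
  fixes x z q :: real
  assumes "0 < x + z + q"
  shows "x * (1 - x / (x + z + q))\<^sup>2 + (z + q) * (x / (x + z + q))\<^sup>2 = x * (z + q) / (x + z + q)"
proof -
  define m where "m = x + z + q"
  have m: "m \<noteq> 0" using assms by (simp add: m_def)
  have "1 - x / m = (z + q) / m" using m by (simp add: m_def field_simps)
  then have "x * (1 - x / m)\<^sup>2 + (z + q) * (x / m)\<^sup>2 = x * (z + q) * (x + z + q) / m\<^sup>2"
    by (simp add: power_divide add_divide_distrib[symmetric]) (simp add: power2_eq_square algebra_simps)
  then show ?thesis unfolding m_def[symmetric] using m by (simp add: power2_eq_square)
qed

lemma mmse_zero:
  fixes x z :: real
  assumes "0 \<le> x" "0 \<le> z"
  shows "x * (1 - x / (x + z)) + z * (- (x / (x + z))) = 0" "x * (1 - x / (x + z))\<^sup>2 + z * (- (x / (x + z)))\<^sup>2 = x * z / (x + z)"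
proof -
  have 0: "x = 0 \<and> z = 0" if "x + z = 0" using that assms by simp
  show "x * (1 - x / (x + z)) + z * (- (x / (x + z))) = 0"
    using 0 by (cases "x + z = 0") (auto simp: divide_simps algebra_simps)
  show "x * (1 - x / (x + z))\<^sup>2 + z * (- (x / (x + z)))\<^sup>2 = x * z / (x + z)"
    using 0 mmse_scalar[of x z 0] assms by (cases "x + z = 0") auto
qed

text \<open>x / (x + z) is the gain in estimating the target from the source, and s q / (s + q) with
  s = x + z is the variance of the source left by the channel output. The excess distortion is the
  squared gain times that variance; for x + z = 0 both sides vanish.\<close>

lemma gap_identity:
  fixes x z :: real
  assumes "0 \<le> x" "0 \<le> z" "0 < q"
  shows "x * (z + q) / (x + z + q) - x * z / (x + z) = (x / (x + z))\<^sup>2 * ((x + z) * q / (x + z + q))"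
proof (cases "x + z = 0")
  case False
  define s where "s = x + z"
  have s: "0 < s" "0 < s + q" using False assms by (auto simp: s_def)
  have z: "z = s - x" by (simp add: s_def)
  show ?thesis unfolding s_def[symmetric] unfolding z using s
    by (simp add: divide_simps power2_eq_square) (simp add: algebra_simps)
qed (use assms in auto)

lemma mmse_form: "x * (z + q) / (x + z + q) = x - x\<^sup>2 / (x + z + q)" if "0 < x + z + q" for x z q :: real
  using that by (simp add: field_simps power2_eq_square)

text \<open>Division by sqrt v reduces the claims to the standard normal law; for v = 0 the
  functional vanishes almost everywhere and the same formulas hold.\<close>

lemma gaussian_functional:
  fixes L :: "'a \<Rightarrow> real"
  assumes M: "prob_space M" and L[measurable]: "L \<in> borel_measurable M" and v: "0 \<le> v"
    and pos: "0 < v \<Longrightarrow> distributed M lborel L (\<lambda>x. ennreal (normal_density 0 (sqrt v) x))"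
    and zero: "v = 0 \<Longrightarrow> AE \<omega> in M. L \<omega> = 0"
  shows "(CLINT \<omega>|M. iexp (L \<omega>)) = exp (- v / 2)"
    and "integrable M L" "(LINT \<omega>|M. L \<omega>) = 0"
    and "integrable M (\<lambda>\<omega>. (L \<omega>)\<^sup>2)" "(LINT \<omega>|M. (L \<omega>)\<^sup>2) = v"
proof -
  interpret prob_space M by fact
  have "(CLINT \<omega>|M. iexp (L \<omega>)) = exp (- v / 2) \<and> integrable M L \<and> (LINT \<omega>|M. L \<omega>) = 0 \<and>
     integrable M (\<lambda>\<omega>. (L \<omega>)\<^sup>2) \<and> (LINT \<omega>|M. (L \<omega>)\<^sup>2) = v"
  proof (cases "v = 0")
    case True
    note ae = zero[OF True]
    have "(CLINT \<omega>|M. iexp (L \<omega>)) = (CLINT \<omega>|M. 1)"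
      by (rule integral_cong_AE) (use ae in \<open>auto elim: eventually_mono\<close>)
    moreover have "integrable M L \<longleftrightarrow> integrable M (\<lambda>_. 0::real)"
      by (rule integrable_cong_AE) (use ae in \<open>auto elim: eventually_mono\<close>)
    moreover have "integrable M (\<lambda>\<omega>. (L \<omega>)\<^sup>2) \<longleftrightarrow> integrable M (\<lambda>_. 0::real)"
      by (rule integrable_cong_AE) (use ae in \<open>auto elim: eventually_mono\<close>)
    moreover have "(LINT \<omega>|M. L \<omega>) = 0" "(LINT \<omega>|M. (L \<omega>)\<^sup>2) = 0"
      by (auto intro!: integral_eq_zero_AE ae[THEN eventually_mono])
    ultimately show ?thesis using True by (simp add: prob_space)
  next
    case False
    then have vp: "0 < v" using v by simp
    define N where "N \<omega> = L \<omega> / sqrt v" for \<omega>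
    have LN: "L \<omega> = sqrt v * N \<omega>" for \<omega> using vp by (simp add: N_def)
    have "distributed M lborel N std_normal_density"
      using pos[OF vp] normal_standard_normal_convert[of "sqrt v" L 0] vp by (simp add: N_def[abs_def])
    then have d: "distr M lborel N = std_normal_distribution" and [measurable]: "N \<in> borel_measurable M"
      unfolding distributed_def by auto
    then have d': "distr M borel N = std_normal_distribution" by (simp cong: distr_cong)
    have "(CLINT \<omega>|M. iexp (L \<omega>)) = char (distr M borel N) (sqrt v)"
      unfolding char_def by (subst integral_distr) (auto simp: LN)
    then have 1: "(CLINT \<omega>|M. iexp (L \<omega>)) = exp (- v / 2)"
      unfolding d' char_std_normal_distribution using vp by simp
    have i: "integrable M (\<lambda>\<omega>. N \<omega> ^ k)" for k
      using integrable_std_normal_distribution_moment[of k] unfolding d'[symmetric] by (simp add: integrable_distr_eq)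
    have e: "(LINT \<omega>|M. N \<omega> ^ k) = (LINT x|std_normal_distribution. x ^ k)" for k
      unfolding d'[symmetric] by (simp add: integral_distr)
    have "(LINT \<omega>|M. N \<omega>) = 0" using e[of 1] integral_std_normal_distribution_moment_odd[of 1] by simp
    moreover have "(LINT \<omega>|M. (N \<omega>)\<^sup>2) = 1" using e[of 2] std_normal_distribution_even_moments(1)[of 1] by simp
    moreover have "integrable M L"
    proof -
      have "integrable M (\<lambda>\<omega>. sqrt v * N \<omega>)" using i[of 1] by simp
      then show ?thesis unfolding LN[symmetric] .
    qed
    ultimately show ?thesis
      using 1 i[of 2] vp by (simp add: LN power_mult_distrib)
  qed
  then show "(CLINT \<omega>|M. iexp (L \<omega>)) = exp (- v / 2)" "integrable M L" "(LINT \<omega>|M. L \<omega>) = 0"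
    "integrable M (\<lambda>\<omega>. (L \<omega>)\<^sup>2)" "(LINT \<omega>|M. (L \<omega>)\<^sup>2) = v" by blast+
qed

lemma gaussian_vec_functional:
  assumes M: "prob_space M" and l: "0 < l" and Y: "gaussian_vec M l (\<lambda>\<omega> i. Y i \<omega>) (equicov g rho)" and psd: "psd_mat l (equicov g rho)"
  shows "(CLINT \<omega>|M. iexp (\<Sum>i<l. a i * Y i \<omega>)) = exp (- qf l (lam1 l g rho) (lam2 g rho) a / 2)"
    and "integrable M (\<lambda>\<omega>. \<Sum>i<l. a i * Y i \<omega>)" "(LINT \<omega>|M. (\<Sum>i<l. a i * Y i \<omega>)) = 0"
    and "integrable M (\<lambda>\<omega>. (\<Sum>i<l. a i * Y i \<omega>)\<^sup>2)"
    and "(LINT \<omega>|M. (\<Sum>i<l. a i * Y i \<omega>)\<^sup>2) = qf l (lam1 l g rho) (lam2 g rho) a"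
    and "0 \<le> qf l (lam1 l g rho) (lam2 g rho) a"
proof -
  have m: "(\<lambda>\<omega>. \<Sum>i<l. a i * Y i \<omega>) \<in> borel_measurable M"
    using Y unfolding gaussian_vec_def by (intro borel_measurable_sum borel_measurable_times) auto
  have "0 \<le> (\<Sum>i<l. \<Sum>j<l. a i * equicov g rho i j * a j)" using psd unfolding psd_mat_def by blast
  then show v: "0 \<le> qf l (lam1 l g rho) (lam2 g rho) a" unfolding equicov_form[OF l] .
  have p: "0 < qf l (lam1 l g rho) (lam2 g rho) a \<Longrightarrow> distributed M lborel (\<lambda>\<omega>. \<Sum>i<l. a i * Y i \<omega>) (\<lambda>x. ennreal (normal_density 0 (sqrt (qf l (lam1 l g rho) (lam2 g rho) a)) x))"
    and z: "qf l (lam1 l g rho) (lam2 g rho) a = 0 \<Longrightarrow> AE \<omega> in M. (\<Sum>i<l. a i * Y i \<omega>) = 0"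
    using Y unfolding gaussian_vec_def equicov_form[OF l] Let_def by blast+
  note g = gaussian_functional[OF M m v]
  show "(CLINT \<omega>|M. iexp (\<Sum>i<l. a i * Y i \<omega>)) = exp (- qf l (lam1 l g rho) (lam2 g rho) a / 2)"
    by (rule g(1); (erule p | erule z))
  show "integrable M (\<lambda>\<omega>. \<Sum>i<l. a i * Y i \<omega>)" by (rule g(2); (erule p | erule z))
  show "(LINT \<omega>|M. (\<Sum>i<l. a i * Y i \<omega>)) = 0" by (rule g(3); (erule p | erule z))
  show "integrable M (\<lambda>\<omega>. (\<Sum>i<l. a i * Y i \<omega>)\<^sup>2)" by (rule g(4); (erule p | erule z))
  show "(LINT \<omega>|M. (\<Sum>i<l. a i * Y i \<omega>)\<^sup>2) = qf l (lam1 l g rho) (lam2 g rho) a"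
    by (rule g(5); (erule p | erule z))
qed

section \<open>The source model and its eigenvalues\<close>

locale gauss_src =
  fixes M :: "'a measure" and l :: nat and gX rX gZ rZ :: real and X Z :: "nat \<Rightarrow> nat \<Rightarrow> 'a \<Rightarrow> real"
  assumes l2: "2 \<le> l" and model: "gauss_model M l gX rX gZ rZ X Z"
    and psdX: "psd_mat l (equicov gX rX)" and psdZ: "psd_mat l (equicov gZ rZ)"

sublocale gauss_src \<subseteq> iid_pairs M l X Z
proof (rule iid_pairs.intro)
  show "prob_space M" using model unfolding gauss_model_def by (elim conjE)
  show "prob_space.indep_vars M (\<lambda>_. vecM l \<Otimes>\<^sub>M vecM l)
        (\<lambda>t \<omega>. (restrict (\<lambda>i. X t i \<omega>) {..<l}, restrict (\<lambda>i. Z t i \<omega>) {..<l})) UNIV"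
    using model unfolding gauss_model_def by (elim conjE)
  show "distr M (vecM l \<Otimes>\<^sub>M vecM l) (\<lambda>\<omega>. (restrict (\<lambda>i. X t i \<omega>) {..<l}, restrict (\<lambda>i. Z t i \<omega>) {..<l}))
      = distr M (vecM l \<Otimes>\<^sub>M vecM l) (\<lambda>\<omega>. (restrict (\<lambda>i. X 0 i \<omega>) {..<l}, restrict (\<lambda>i. Z 0 i \<omega>) {..<l}))" for t
    using model unfolding gauss_model_def by (elim conjE) (erule spec)
qed

context gauss_src
begin

abbreviation "x1 \<equiv> lam1 l gX rX"
abbreviation "x2 \<equiv> lam2 gX rX"
abbreviation "z1 \<equiv> lam1 l gZ rZ"
abbreviation "z2 \<equiv> lam2 gZ rZ"

lemma l0: "0 < l" using l2 by simp

lemma X_gauss: "gaussian_vec M l (\<lambda>\<omega> i. X t i \<omega>) (equicov gX rX)"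
  using model unfolding gauss_model_def by (elim conjE) (erule spec)

lemma Z_gauss: "gaussian_vec M l (\<lambda>\<omega> i. Z t i \<omega>) (equicov gZ rZ)"
  using model unfolding gauss_model_def by (elim conjE) (erule spec)

lemmas X_fun = gaussian_vec_functional[OF M l0 X_gauss psdX]
lemmas Z_fun = gaussian_vec_functional[OF M l0 Z_gauss psdZ]

lemma indep_XZ:
  fixes f g :: "(nat \<Rightarrow> real) \<Rightarrow> 'c::topological_space"
  assumes f[measurable]: "f \<in> borel_measurable (vecM l)" and g[measurable]: "g \<in> borel_measurable (vecM l)"
  shows "indep_var borel (\<lambda>\<omega>. f (\<lambda>i\<in>{..<l}. X t i \<omega>)) borel (\<lambda>\<omega>. g (\<lambda>i\<in>{..<l}. Z t i \<omega>))"
proof -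
  have "indep_var (vecM l) (\<lambda>\<omega>. restrict (\<lambda>i. X t i \<omega>) {..<l}) (vecM l) (\<lambda>\<omega>. restrict (\<lambda>i. Z t i \<omega>) {..<l})"
    using model unfolding gauss_model_def by (elim conjE) (erule spec)
  from indep_var_compose[OF this f g] show ?thesis by (simp add: comp_def)
qed

lemma lin_meas: "(\<lambda>x. \<Sum>i<l. a i * x i) \<in> borel_measurable (vecM l)"
  by (intro borel_measurable_sum borel_measurable_times measurable_component_singleton) auto

lemma lin_restrict: "(\<Sum>i<l. a i * (\<lambda>i\<in>{..<l}. f i) i) = (\<Sum>i<l. a i * f i)" for a f :: "nat \<Rightarrow> real"
  by (intro sum.cong) auto

lemma joint_char:
  "(CLINT \<omega>|M. iexp ((\<Sum>i<l. a i * X t i \<omega>) + (\<Sum>i<l. b i * Z t i \<omega>))) = exp (- (qf l x1 x2 a + qf l z1 z2 b) / 2)"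
proof -
  have mX[measurable]: "(\<lambda>\<omega>. \<Sum>i<l. a i * X t i \<omega>) \<in> borel_measurable M"
    and mZ[measurable]: "(\<lambda>\<omega>. \<Sum>i<l. b i * Z t i \<omega>) \<in> borel_measurable M"
    by measurable
  have "(\<lambda>x. iexp (\<Sum>i<l. a i * x i)) \<in> borel_measurable (vecM l)" "(\<lambda>x. iexp (\<Sum>i<l. b i * x i)) \<in> borel_measurable (vecM l)"
    using lin_meas[of a] lin_meas[of b] by measurable
  from indep_XZ[OF this, of t] have iv: "indep_var borel (\<lambda>\<omega>. iexp (\<Sum>i<l. a i * X t i \<omega>)) borel (\<lambda>\<omega>. iexp (\<Sum>i<l. b i * Z t i \<omega>))"
    unfolding lin_restrict .
  have "(CLINT \<omega>|M. iexp ((\<Sum>i<l. a i * X t i \<omega>) + (\<Sum>i<l. b i * Z t i \<omega>))) =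
    (CLINT \<omega>|M. iexp (\<Sum>i<l. a i * X t i \<omega>) * iexp (\<Sum>i<l. b i * Z t i \<omega>))"
    by (intro Bochner_Integration.integral_cong refl) (simp only: of_real_add ring_distribs exp_add)
  also have "\<dots> = (CLINT \<omega>|M. iexp (\<Sum>i<l. a i * X t i \<omega>)) * (CLINT \<omega>|M. iexp (\<Sum>i<l. b i * Z t i \<omega>))"
    by (intro indep_var_lebesgue_integral iv integrable_iexp) auto
  also have "\<dots> = exp (- (qf l x1 x2 a + qf l z1 z2 b) / 2)"
    unfolding X_fun(1) Z_fun(1) of_real_mult[symmetric] exp_add[symmetric] by (simp add: add_divide_distrib diff_divide_distrib)
  finally show ?thesis .
qed

lemma joint_moment:
  shows "integrable M (\<lambda>\<omega>. ((\<Sum>i<l. a i * X t i \<omega>) + (\<Sum>i<l. b i * Z t i \<omega>))\<^sup>2)"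
    and "(LINT \<omega>|M. ((\<Sum>i<l. a i * X t i \<omega>) + (\<Sum>i<l. b i * Z t i \<omega>))\<^sup>2) = qf l x1 x2 a + qf l z1 z2 b"
proof -
  let ?A = "\<lambda>\<omega>. \<Sum>i<l. a i * X t i \<omega>" and ?B = "\<lambda>\<omega>. \<Sum>i<l. b i * Z t i \<omega>"
  from indep_XZ[OF lin_meas[of a] lin_meas[of b], of t] have iv: "indep_var borel ?A borel ?B"
    unfolding lin_restrict .
  have i: "integrable M (\<lambda>\<omega>. ?A \<omega> * ?B \<omega>)" by (rule indep_var_integrable[OF iv X_fun(2) Z_fun(2)])
  have e: "(LINT \<omega>|M. ?A \<omega> * ?B \<omega>) = 0"
    using indep_var_lebesgue_integral[OF iv X_fun(2) Z_fun(2)] X_fun(3) by simp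
  have sq: "(?A \<omega> + ?B \<omega>)\<^sup>2 = (?A \<omega>)\<^sup>2 + (?B \<omega>)\<^sup>2 + 2 * (?A \<omega> * ?B \<omega>)" for \<omega>
    by (simp add: power2_sum)
  show "integrable M (\<lambda>\<omega>. (?A \<omega> + ?B \<omega>)\<^sup>2)"
    unfolding sq using i X_fun(4) Z_fun(4) by (intro Bochner_Integration.integrable_add integrable_mult_right)
  have "(LINT \<omega>|M. (?A \<omega>)\<^sup>2 + (?B \<omega>)\<^sup>2 + 2 * (?A \<omega> * ?B \<omega>)) = qf l x1 x2 a + qf l z1 z2 b + 2 * 0"
    using i X_fun(4)[of a t] Z_fun(4)[of b t] e X_fun(5)[of a t] Z_fun(5)[of b t]
    by (subst Bochner_Integration.integral_add, simp, simp, subst Bochner_Integration.integral_add, simp_all)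
  then show "(LINT \<omega>|M. (?A \<omega> + ?B \<omega>)\<^sup>2) = qf l x1 x2 a + qf l z1 z2 b" unfolding sq by simp
qed

lemma block_char:
  "(CLINT \<omega>|M. iexp (\<Sum>t<n. (\<Sum>i<l. a t i * X t i \<omega>) + (\<Sum>i<l. b t i * Z t i \<omega>))) =
    exp (- (\<Sum>t<n. qf l x1 x2 (a t) + qf l z1 z2 (b t)) / 2)"
proof -
  define h where "h t w = iexp ((\<Sum>i<l. a t i * fst w i) + (\<Sum>i<l. b t i * snd w i))" for t :: nat and w :: "(nat \<Rightarrow> real) \<times> (nat \<Rightarrow> real)"
  have hm: "h t \<in> borel_measurable pairM" for t unfolding h_def[abs_def] by measurable
  have hW: "h t (W s \<omega>) = iexp ((\<Sum>i<l. a t i * X s i \<omega>) + (\<Sum>i<l. b t i * Z s i \<omega>))" for t s \<omega>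
    unfolding h_def by (simp add: fst_W snd_W)
  have hi: "integrable M (\<lambda>\<omega>. h t (W 0 \<omega>))" for t
    unfolding hW by (intro integrable_iexp) auto
  have "(CLINT \<omega>|M. iexp (\<Sum>t<n. (\<Sum>i<l. a t i * X t i \<omega>) + (\<Sum>i<l. b t i * Z t i \<omega>))) = (CLINT \<omega>|M. (\<Prod>t<n. h t (W t \<omega>)))"
    unfolding hW by (simp only: of_real_sum sum_distrib_left exp_sum[OF finite_lessThan])
  also have "\<dots> = (\<Prod>t<n. CLINT \<omega>|M. h t (W 0 \<omega>))" by (rule iid_prod(1)[OF hm hi])
  also have "\<dots> = (\<Prod>t<n. complex_of_real (exp (- (qf l x1 x2 (a t) + qf l z1 z2 (b t)) / 2)))"
    unfolding hW joint_char ..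
  also have "\<dots> = exp (- (\<Sum>t<n. qf l x1 x2 (a t) + qf l z1 z2 (b t)) / 2)"
    unfolding of_real_prod[symmetric] exp_sum[OF finite_lessThan, symmetric] by (simp add: sum_negf[symmetric] sum_divide_distrib)
  finally show ?thesis .
qed

text \<open>Variances of the all-ones combination and of the difference of the first two
  coordinates; the latter is available because l is at least 2.\<close>

lemma eigen_nonneg: "0 \<le> x1" "0 \<le> x2" "0 \<le> z1" "0 \<le> z2"
proof -
  have e1: "qf l e1 e2 (\<lambda>_. 1) = e1 * real l" for e1 e2
    using l0 by (simp add: qf_def power2_eq_square field_simps)
  have e2: "qf l e1 e2 (\<lambda>i. if i = 0 then 1 else if i = 1 then - 1 else 0) = 2 * e2" for e1 e2
  proof -
    have "(\<Sum>i<l. (if i = 0 then 1 else if i = 1 then - 1 else 0)) = (\<Sum>i\<in>{0,1::nat}. (if i = 0 then 1 else if i = 1 then - 1 else (0::real)))"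
      using l2 by (intro sum.mono_neutral_cong_right) auto
    moreover have "(\<Sum>i<l. (if i = 0 then 1 else if i = 1 then - 1 else 0)\<^sup>2) = (\<Sum>i\<in>{0,1::nat}. (if i = 0 then 1 else if i = 1 then - 1 else (0::real))\<^sup>2)"
      using l2 by (intro sum.mono_neutral_cong_right) auto
    ultimately show ?thesis by (simp add: qf_def)
  qed
  show "0 \<le> x1" "0 \<le> x2" "0 \<le> z1" "0 \<le> z2"
    using X_fun(6)[of "\<lambda>_. 1"] X_fun(6)[of "\<lambda>i. if i = 0 then 1 else if i = 1 then - 1 else 0"]
      Z_fun(6)[of "\<lambda>_. 1"] Z_fun(6)[of "\<lambda>i. if i = 0 then 1 else if i = 1 then - 1 else 0"] l0
    by (auto simp: e1 e2 zero_le_mult_iff)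
qed

end

section \<open>Functions of a finite-valued message\<close>

text \<open>Doob-Dynkin factorisation: a set of the generated sigma-algebra is a union of fibres of
  g, so its level sets prevent f from separating two points of one fibre.\<close>

lemma vimage_count_factor:
  fixes f :: "'a \<Rightarrow> real"
  assumes f: "f \<in> borel_measurable (vimage_algebra \<Omega> g (count_space UNIV))"
  obtains k where "\<And>x. x \<in> \<Omega> \<Longrightarrow> f x = k (g x)"
proof
  fix x assume x: "x \<in> \<Omega>"
  define y where "y = (SOME y. y \<in> \<Omega> \<and> g y = g x)"
  have y: "y \<in> \<Omega>" "g y = g x" using someI[of "\<lambda>y. y \<in> \<Omega> \<and> g y = g x" x] x by (auto simp: y_def)
  have "f -` {f x} \<inter> \<Omega> \<in> sets (vimage_algebra \<Omega> g (count_space UNIV))"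
    using measurable_sets[OF f, of "{f x}"] by simp
  then obtain B where B: "f -` {f x} \<inter> \<Omega> = g -` B \<inter> \<Omega>"
    by (auto simp: sets_vimage_algebra2)
  have "x \<in> g -` B \<inter> \<Omega>" unfolding B[symmetric] using x by simp
  then have "y \<in> g -` B \<inter> \<Omega>" using y by simp
  then have "f y = f x" unfolding B[symmetric] by simp
  then show "f x = (\<lambda>b. f (SOME y. y \<in> \<Omega> \<and> g y = b)) (g x)" by (simp add: y_def)
qed

locale code = prob_space M for M :: "'a measure" +
  fixes g :: "'a \<Rightarrow> 'c" and B :: "'c set"
  assumes g: "g \<in> M \<rightarrow>\<^sub>M count_space UNIV" and B: "finite B" "\<And>\<omega>. \<omega> \<in> space M \<Longrightarrow> g \<omega> \<in> B"
begin

abbreviation "F \<equiv> vimage_algebra (space M) g (count_space UNIV)"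

lemma F_sub: "subalgebra M F"
  unfolding subalgebra_def using g by (auto simp: sets_vimage_algebra2 measurable_def)

sublocale sigma_finite_subalgebra M F
  by (rule finite_measure_subalgebra_is_sigma_finite) (unfold_locales, rule F_sub)

lemma code_fun_meas[measurable]: "(\<lambda>\<omega>. k (g \<omega>)) \<in> borel_measurable M" for k :: "'c \<Rightarrow> real"
  by (rule measurable_compose[OF g]) simp

lemma code_fun_F: "(\<lambda>\<omega>. k (g \<omega>)) \<in> borel_measurable F" for k :: "'c \<Rightarrow> real"
  by (rule measurable_compose[OF measurable_vimage_algebra1]) auto

lemma code_fun_bound: "\<omega> \<in> space M \<Longrightarrow> \<bar>k (g \<omega>)\<bar> \<le> (\<Sum>b\<in>B. \<bar>k b\<bar>)" for k :: "'c \<Rightarrow> real"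
  using B by (intro member_le_sum) auto

lemma code_fun_sq: "integrable M (\<lambda>\<omega>. (k (g \<omega>))\<^sup>2)" for k :: "'c \<Rightarrow> real"
  using code_fun_bound[of _ "\<lambda>b. (k b)\<^sup>2"] by (intro integrable_const_bound[where B="\<Sum>b\<in>B. \<bar>(k b)\<^sup>2\<bar>"]) auto

lemma code_fun_mult:
  fixes k :: "'c \<Rightarrow> real"
  assumes Y: "integrable M Y" shows "integrable M (\<lambda>\<omega>. k (g \<omega>) * Y \<omega>)"
proof (rule Bochner_Integration.integrable_bound)
  show "integrable M (\<lambda>\<omega>. (\<Sum>b\<in>B. \<bar>k b\<bar>) * \<bar>Y \<omega>\<bar>)" using Y by simp
  show "AE \<omega> in M. norm (k (g \<omega>) * Y \<omega>) \<le> norm ((\<Sum>b\<in>B. \<bar>k b\<bar>) * \<bar>Y \<omega>\<bar>)"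
  proof (intro AE_I2)
    fix \<omega> assume "\<omega> \<in> space M"
    from mult_right_mono[OF code_fun_bound[OF this, of k], of "\<bar>Y \<omega>\<bar>"]
    show "norm (k (g \<omega>) * Y \<omega>) \<le> norm ((\<Sum>b\<in>B. \<bar>k b\<bar>) * \<bar>Y \<omega>\<bar>)" by (simp add: abs_mult sum_nonneg)
  qed
qed (use Y in measurable)

lemma cond_exp_factor:
  assumes Y: "integrable M Y"
  obtains k :: "'c \<Rightarrow> real" where "\<And>\<omega>. \<omega> \<in> space M \<Longrightarrow> real_cond_exp M F Y \<omega> = k (g \<omega>)"
    "\<And>u. (LINT \<omega>|M. u (g \<omega>) * Y \<omega>) = (LINT \<omega>|M. u (g \<omega>) * k (g \<omega>))"
proof -
  obtain k where k: "\<And>\<omega>. \<omega> \<in> space M \<Longrightarrow> real_cond_exp M F Y \<omega> = k (g \<omega>)"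
    using vimage_count_factor[OF borel_measurable_cond_exp[of M F Y]] by blast
  have "(LINT \<omega>|M. u (g \<omega>) * Y \<omega>) = (LINT \<omega>|M. u (g \<omega>) * k (g \<omega>))" for u :: "'c \<Rightarrow> real"
  proof -
    have "(LINT \<omega>|M. u (g \<omega>) * Y \<omega>) = (LINT \<omega>|M. u (g \<omega>) * real_cond_exp M F Y \<omega>)"
      using real_cond_exp_intg(2)[OF code_fun_mult[OF Y, of u] code_fun_F[of u]] Y by simp
    also have "\<dots> = (LINT \<omega>|M. u (g \<omega>) * k (g \<omega>))"
      by (intro Bochner_Integration.integral_cong) (auto simp: k)
    finally show ?thesis .
  qed
  with k show thesis by (rule that)
qed

lemma code_fun_integrable: "integrable M (\<lambda>\<omega>. f (g \<omega>))" for f :: "'c \<Rightarrow> real"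
  using code_fun_bound[of _ f] by (intro integrable_const_bound[where B="\<Sum>b\<in>B. \<bar>f b\<bar>"]) auto

lemma message_mean:
  assumes Y: "integrable M Y"
  obtains k :: "'c \<Rightarrow> real" where "\<And>u. (LINT \<omega>|M. (Y \<omega> - k (g \<omega>)) * u (g \<omega>)) = 0"
proof -
  obtain k where k: "\<And>u. (LINT \<omega>|M. u (g \<omega>) * Y \<omega>) = (LINT \<omega>|M. u (g \<omega>) * k (g \<omega>))"
    using cond_exp_factor[OF Y] by metis
  show thesis
  proof (rule that[of k])
    fix u :: "'c \<Rightarrow> real"
    show "(LINT \<omega>|M. (Y \<omega> - k (g \<omega>)) * u (g \<omega>)) = 0"
      using code_fun_mult[OF Y, of u] code_fun_integrable[of "\<lambda>b. u b * k b"] k[of u] by (simp add: algebra_simps)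
  qed
qed

text \<open>Lets an explicit decoder be replaced by the conditional expectation that
  \<open>achievable\<close> prescribes. The two errors differ by the mean square of h - k, because Y
  - k is orthogonal to all functions of the message.\<close>

lemma cond_exp_mmse:
  assumes Y: "integrable M Y" "integrable M (\<lambda>\<omega>. (Y \<omega>)\<^sup>2)"
  shows "(LINT \<omega>|M. (Y \<omega> - real_cond_exp M F Y \<omega>)\<^sup>2) \<le> (LINT \<omega>|M. (Y \<omega> - h (g \<omega>))\<^sup>2)"
proof -
  obtain k where k: "\<And>\<omega>. \<omega> \<in> space M \<Longrightarrow> real_cond_exp M F Y \<omega> = k (g \<omega>)"
    and orth: "\<And>f. (LINT \<omega>|M. f (g \<omega>) * Y \<omega>) = (LINT \<omega>|M. f (g \<omega>) * k (g \<omega>))"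
    using cond_exp_factor[OF Y(1)] by metis
  have iY: "integrable M (\<lambda>\<omega>. f (g \<omega>) * Y \<omega>)" for f :: "'c \<Rightarrow> real" by (rule code_fun_mult[OF Y(1)])
  note ik = code_fun_integrable
  have sq: "(LINT \<omega>|M. (Y \<omega> - f (g \<omega>))\<^sup>2) = (LINT \<omega>|M. (Y \<omega>)\<^sup>2) - 2 * (LINT \<omega>|M. f (g \<omega>) * k (g \<omega>)) + (LINT \<omega>|M. (f (g \<omega>))\<^sup>2)" for f :: "'c \<Rightarrow> real"
  proof -
    have "(LINT \<omega>|M. (Y \<omega> - f (g \<omega>))\<^sup>2) = (LINT \<omega>|M. (Y \<omega>)\<^sup>2 - 2 * (f (g \<omega>) * Y \<omega>) + (f (g \<omega>))\<^sup>2)"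
      by (intro Bochner_Integration.integral_cong refl) (simp add: power2_diff)
    also have "\<dots> = (LINT \<omega>|M. (Y \<omega>)\<^sup>2) - 2 * (LINT \<omega>|M. f (g \<omega>) * Y \<omega>) + (LINT \<omega>|M. (f (g \<omega>))\<^sup>2)"
      using Y iY[of f] ik[of "\<lambda>b. (f b)\<^sup>2"] by simp
    finally show ?thesis unfolding orth .
  qed
  have "(LINT \<omega>|M. (Y \<omega> - real_cond_exp M F Y \<omega>)\<^sup>2) = (LINT \<omega>|M. (Y \<omega> - k (g \<omega>))\<^sup>2)"
    by (intro Bochner_Integration.integral_cong) (auto simp: k)
  moreover have "(LINT \<omega>|M. (Y \<omega> - h (g \<omega>))\<^sup>2) - (LINT \<omega>|M. (Y \<omega> - k (g \<omega>))\<^sup>2) = (LINT \<omega>|M. (h (g \<omega>) - k (g \<omega>))\<^sup>2)"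
  proof -
    have "(LINT \<omega>|M. (h (g \<omega>) - k (g \<omega>))\<^sup>2) = (LINT \<omega>|M. (h (g \<omega>))\<^sup>2 - 2 * (h (g \<omega>) * k (g \<omega>)) + (k (g \<omega>))\<^sup>2)"
      by (intro Bochner_Integration.integral_cong refl) (simp add: power2_diff)
    also have "\<dots> = (LINT \<omega>|M. (h (g \<omega>))\<^sup>2) - 2 * (LINT \<omega>|M. h (g \<omega>) * k (g \<omega>)) + (LINT \<omega>|M. (k (g \<omega>))\<^sup>2)"
      using ik[of "\<lambda>b. (h b)\<^sup>2"] ik[of "\<lambda>b. h b * k b"] ik[of "\<lambda>b. (k b)\<^sup>2"] by simp
    finally show ?thesis using sq[of h] sq[of k] by (simp add: power2_eq_square)
  qed
  moreover have "0 \<le> (LINT \<omega>|M. (h (g \<omega>) - k (g \<omega>))\<^sup>2)" by (intro Bochner_Integration.integral_nonneg) auto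
  ultimately show ?thesis by linarith
qed

text \<open>The density belonging to the actual message is at most the sum over all messages, hence
  its mean is at most card B. Jensen's inequality is used in the tangent form ln t \<le> t - 1 at t
  = exp w / card B.\<close>

lemma code_jensen:
  assumes [measurable]: "\<And>b. b \<in> B \<Longrightarrow> w b \<in> borel_measurable M"
    and w: "\<And>b. b \<in> B \<Longrightarrow> (\<integral>\<^sup>+\<omega>. ennreal (exp (w b \<omega>)) \<partial>M) \<le> 1"
    and int: "integrable M (\<lambda>\<omega>. w (g \<omega>) \<omega>)"
  shows "(LINT \<omega>|M. w (g \<omega>) \<omega>) \<le> ln (real (card B))"
proof -
  have "B \<noteq> {}" using B(2) not_empty by auto
  then have K: "0 < real (card B)" using B(1) by (simp add: card_gt_0_iff)
  have m: "(\<lambda>\<omega>. exp (w (g \<omega>) \<omega>)) \<in> borel_measurable M" using int by measurable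
  have "(\<integral>\<^sup>+\<omega>. ennreal (exp (w (g \<omega>) \<omega>)) \<partial>M) \<le> (\<integral>\<^sup>+\<omega>. (\<Sum>b\<in>B. ennreal (exp (w b \<omega>))) \<partial>M)"
    using B by (intro nn_integral_mono member_le_sum) auto
  also have "\<dots> = (\<Sum>b\<in>B. (\<integral>\<^sup>+\<omega>. ennreal (exp (w b \<omega>)) \<partial>M))"
    by (intro nn_integral_sum) auto
  also have "\<dots> \<le> (\<Sum>b\<in>B. 1)" using w by (intro sum_mono)
  finally have nn: "(\<integral>\<^sup>+\<omega>. ennreal (exp (w (g \<omega>) \<omega>)) \<partial>M) \<le> ennreal (real (card B))"
    by (simp add: ennreal_of_nat_eq_real_of_nat)
  have ie: "integrable M (\<lambda>\<omega>. exp (w (g \<omega>) \<omega>))"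
    using m nn by (intro integrableI_nonneg) (auto intro: le_less_trans ennreal_less_top)
  have "ennreal (LINT \<omega>|M. exp (w (g \<omega>) \<omega>)) \<le> ennreal (real (card B))"
    using nn nn_integral_eq_integral[OF ie] by simp
  then have le: "(LINT \<omega>|M. exp (w (g \<omega>) \<omega>)) \<le> real (card B)" by (simp add: ennreal_le_iff)
  have pw: "w (g \<omega>) \<omega> \<le> exp (w (g \<omega>) \<omega>) / real (card B) - 1 + ln (real (card B))" for \<omega>
    using ln_le_minus_one[of "exp (w (g \<omega>) \<omega>) / real (card B)"] K by (simp add: ln_div)
  have "(LINT \<omega>|M. w (g \<omega>) \<omega>) \<le> (LINT \<omega>|M. exp (w (g \<omega>) \<omega>) / real (card B) - 1 + ln (real (card B)))"
    using int ie pw by (intro integral_mono) auto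
  also have "\<dots> = (LINT \<omega>|M. exp (w (g \<omega>) \<omega>)) / real (card B) - 1 + ln (real (card B))"
    using ie by (simp add: prob_space)
  also have "\<dots> \<le> ln (real (card B))" using le K by simp
  finally show ?thesis .
qed

end

lemma measurable_restrict_count:
  fixes g :: "'i \<Rightarrow> 'a \<Rightarrow> 'b::countable"
  assumes A: "finite A" and C: "\<And>i. i \<in> A \<Longrightarrow> finite (C i)"
    and g: "\<And>i. i \<in> A \<Longrightarrow> g i \<in> M \<rightarrow>\<^sub>M count_space UNIV" and gC: "\<And>i \<omega>. i \<in> A \<Longrightarrow> \<omega> \<in> space M \<Longrightarrow> g i \<omega> \<in> C i"
  shows "(\<lambda>\<omega>. \<lambda>i\<in>A. g i \<omega>) \<in> M \<rightarrow>\<^sub>M count_space UNIV"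
proof -
  have fin: "finite (PiE A C)" using A C by (intro finite_PiE) auto
  have "(\<lambda>\<omega>. \<lambda>i\<in>A. g i \<omega>) \<in> M \<rightarrow>\<^sub>M count_space (PiE A C)"
  proof (subst measurable_count_space_eq2[OF fin], intro conjI ballI)
    fix b assume b: "b \<in> PiE A C"
    have "(\<lambda>\<omega>. \<lambda>i\<in>A. g i \<omega>) -` {b} \<inter> space M = {\<omega> \<in> space M. \<forall>i\<in>A. g i \<omega> = b i}"
      using b by (auto simp: fun_eq_iff restrict_def PiE_iff extensional_def)
    also have "\<dots> \<in> sets M"
      using g A by (intro sets.sets_Collect_finite_All' predE pred_eq_const1[where N="count_space UNIV"]) auto
    finally show "(\<lambda>\<omega>. \<lambda>i\<in>A. g i \<omega>) -` {b} \<inter> space M \<in> sets M" .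
  qed (use gC in auto)
  then show ?thesis by (rule measurable_compose) simp
qed

text \<open>\<open>a\<close> is row i of the exchangeable matrix with eigenvalues h1 and h2. The
  value is a diagonal entry of an exchangeable matrix with eigenvalues e1 h1^2 and e2 h2^2, that is,
  their mean with multiplicities.\<close>

lemma qf_circulant:
  assumes l: "0 < l" and i: "i < l" and a: "\<And>j. j < l \<Longrightarrow> a j = (h1 - h2) / real l + h2 * of_bool (j = i)"
  shows "qf l e1 e2 a = (e1 * h1\<^sup>2 + (real l - 1) * e2 * h2\<^sup>2) / real l"
proof -
  have s1: "(\<Sum>j<l. a j) = h1"
  proof -
    have "(\<Sum>j<l. a j) = (\<Sum>j<l. (h1 - h2) / real l + (if j = i then h2 else 0))"
      using a by (intro sum.cong) auto
    then show ?thesis using l i by (simp add: sum.distrib)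
  qed
  have s2: "(\<Sum>j<l. (a j)\<^sup>2) = (h1\<^sup>2 - h2\<^sup>2) / real l + h2\<^sup>2"
  proof -
    have "(\<Sum>j<l. (a j)\<^sup>2) = (\<Sum>j<l. ((h1 - h2) / real l)\<^sup>2 + (if j = i then 2 * ((h1 - h2) / real l) * h2 + h2\<^sup>2 else 0))"
      using a by (intro sum.cong) (auto simp: power2_sum)
    also have "\<dots> = real l * ((h1 - h2) / real l)\<^sup>2 + (2 * ((h1 - h2) / real l) * h2 + h2\<^sup>2)"
      using i by (simp add: sum.distrib)
    also have "\<dots> = (h1\<^sup>2 - h2\<^sup>2) / real l + h2\<^sup>2"
      using l by (simp add: power2_eq_square field_simps)
    finally show ?thesis .
  qed
  show ?thesis unfolding qf_def s1 s2 using l by (simp add: field_simps)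
qed

lemma Sblock_meas:
  assumes "\<And>t. X t i \<in> borel_measurable M" "\<And>t. Z t i \<in> borel_measurable M"
  shows "Sblock X Z n i \<in> M \<rightarrow>\<^sub>M vecM n"
  unfolding Sblock_def[abs_def] using assms by (intro measurable_restrict borel_measurable_add)

context gauss_src
begin

abbreviation "s1 \<equiv> x1 + z1"
abbreviation "s2 \<equiv> x2 + z2"

lemma component_sq: "i < l \<Longrightarrow> integrable M (\<lambda>\<omega>. (X t i \<omega>)\<^sup>2)" "i < l \<Longrightarrow> integrable M (\<lambda>\<omega>. (Z t i \<omega>)\<^sup>2)"
proof -
  assume i: "i < l"
  show "integrable M (\<lambda>\<omega>. (X t i \<omega>)\<^sup>2)" using X_fun(4)[of "\<lambda>j. of_bool (j = i)" t] unfolding sum_unit[OF i] .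
  show "integrable M (\<lambda>\<omega>. (Z t i \<omega>)\<^sup>2)" using Z_fun(4)[of "\<lambda>j. of_bool (j = i)" t] unfolding sum_unit[OF i] .
qed

lemma X_integrable: "i < l \<Longrightarrow> integrable M (X t i)"
  using square_integrable_imp_integrable[OF X_meas component_sq(1)] by simp

lemma code_block:
  assumes A: "A \<subseteq> {..<l}"
    and C: "\<And>i. i < l \<Longrightarrow> finite (C i)" and \<phi>: "\<And>i. i < l \<Longrightarrow> \<phi> i \<in> vecM n \<rightarrow>\<^sub>M count_space UNIV"
    and \<phi>C: "\<And>i x. i < l \<Longrightarrow> x \<in> space (vecM n) \<Longrightarrow> \<phi> i x \<in> C i"
  shows "code M (\<lambda>\<omega>. \<lambda>i\<in>A. \<phi> i (Sblock X Z n i \<omega>) :: nat) (PiE A C)"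
proof
  have fA: "finite A" using A by (rule finite_subset) simp
  show fin: "finite (PiE A C)" using fA A C by (intro finite_PiE) auto
  have S: "Sblock X Z n i \<in> M \<rightarrow>\<^sub>M vecM n" if "i < l" for i
    using that by (intro Sblock_meas) auto
  have m: "(\<lambda>\<omega>. \<phi> i (Sblock X Z n i \<omega>)) \<in> M \<rightarrow>\<^sub>M count_space UNIV" if "i \<in> A" for i
    using A that by (intro measurable_compose[OF S \<phi>]) auto
  show inB: "(\<lambda>i\<in>A. \<phi> i (Sblock X Z n i \<omega>)) \<in> PiE A C" if "\<omega> \<in> space M" for \<omega>
    using A \<phi>C measurable_space[OF S that] by auto
  show "(\<lambda>\<omega>. \<lambda>i\<in>A. \<phi> i (Sblock X Z n i \<omega>)) \<in> M \<rightarrow>\<^sub>M count_space UNIV"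
    by (rule measurable_restrict_count[where C=C]) (use fA A C m \<phi>C measurable_space[OF S] in auto)
qed

end

section \<open>Achievability\<close>

context gauss_src
begin

text \<open>Sequential Cholesky factorisation of the covariance \<open>\<Gamma>\<^sub>S + q I\<close>: the \<open>i\<close>-th component has
  regression coefficient \<open>chol_a q i\<close> on each predecessor and innovation variance \<open>chol_v q i\<close>.\<close>

definition chol_a :: "real \<Rightarrow> nat \<Rightarrow> real" where
  "chol_a q i = ((s1 - s2) / l) / ((s2 + q) + i * ((s1 - s2) / l))"

text \<open>A ratio of successive leading principal minors. The value 1 from l on keeps it positive
  at every index, as the locale \<open>gauss_channel\<close> asks.\<close>

definition chol_v :: "real \<Rightarrow> nat \<Rightarrow> real" where
  "chol_v q i = (if i < l then (s2 + q) * ((s2 + q) + (i + 1) * ((s1 - s2) / l)) / ((s2 + q) + i * ((s1 - s2) / l)) else 1)"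

lemma chol_pos:
  assumes q: "0 < q" and i: "i \<le> l" shows "0 < (s2 + q) + i * ((s1 - s2) / l)"
proof -
  have s: "0 \<le> s1" "0 \<le> s2" using eigen_nonneg by auto
  have "(s2 + q) + i * ((s1 - s2) / l) = q + (1 - i / l) * s2 + (i / l) * s1"
    using l0 by (simp add: field_simps)
  moreover have "0 \<le> (1 - i / l) * s2" "0 \<le> (i / l) * s1"
    using s i l0 by (auto intro!: mult_nonneg_nonneg)
  ultimately show ?thesis using q by linarith
qed

lemma chol_v_pos: "0 < q \<Longrightarrow> 0 < chol_v q i"
  using chol_pos[of q i] chol_pos[of q "i + 1"] chol_pos[of q 0] l0
  by (auto simp: chol_v_def add.commute)

text \<open>The innovation variances multiply to the determinant of the covariance of U; the factors
  s2 + q + i * (s1 - s2) / l telescope from s2 + q to s1 + q.\<close>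

lemma chol_v_prod:
  assumes q: "0 < q"
  shows "(\<Sum>i<l. ln (chol_v q i / q) / 2) = ln ((s1 + q) * (s2 + q) ^ (l - 1) / q ^ l) / 2"
proof -
  define d where "d i = (s2 + q) + real i * ((s1 - s2) / l)" for i
  have d: "0 < d i" if "i \<le> l" for i using chol_pos[OF q that] by (simp add: d_def)
  have b: "0 < s2 + q" using d[of 0] by (simp add: d_def)
  have dl: "d l = s1 + q" and d0: "d 0 = s2 + q" using l0 by (simp_all add: d_def)
  have "(\<Sum>i<l. ln (chol_v q i / q)) = (\<Sum>i<l. (ln (s2 + q) - ln q) + (ln (d (Suc i)) - ln (d i)))"
  proof (rule sum.cong[OF refl])
    fix i assume "i \<in> {..<l}"
    then have i: "i < l" by simp
    have "chol_v q i = (s2 + q) * d (Suc i) / d i" using i by (simp add: chol_v_def d_def add.commute)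
    then show "ln (chol_v q i / q) = (ln (s2 + q) - ln q) + (ln (d (Suc i)) - ln (d i))"
      using d[of i] d[of "Suc i"] i b q by (simp add: ln_mult ln_div)
  qed
  also have "\<dots> = real l * (ln (s2 + q) - ln q) + (ln (d l) - ln (d 0))"
    using sum_lessThan_telescope[of "\<lambda>i. ln (d i)" l] by (simp only: sum.distrib) simp
  also have "\<dots> = ln (s1 + q) + real (l - 1) * ln (s2 + q) - real l * ln q"
    using l0 by (simp add: dl d0 of_nat_diff algebra_simps)
  also have "\<dots> = ln ((s1 + q) * (s2 + q) ^ (l - 1) / q ^ l)"
    using d[of l] b q by (simp add: dl ln_mult ln_div ln_realpow)
  finally show ?thesis by (simp add: sum_divide_distrib[symmetric])
qed

lemma lin_S:
  "(\<Sum>j<l. b j * X t j \<omega>) + (\<Sum>j<l. a j * (X t j \<omega> + Z t j \<omega>)) =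
   (\<Sum>j<l. (b j + a j) * X t j \<omega>) + (\<Sum>j<l. a j * Z t j \<omega>)"
  by (simp add: ring_distribs sum.distrib)

text \<open>The innovation of U_i has variance \<open>chol_v q i\<close>. On the left S_i takes the
  place of U_i, so its own channel noise q is missing; the second summand is the channel noise of
  the predecessors.\<close>

lemma chol_innovation:
  assumes q: "0 < q" and i: "i < l"
  shows "(LINT \<omega>|M. ((X 0 i \<omega> + Z 0 i \<omega>) + (\<Sum>j<l. (if j < i then - chol_a q i else 0) * (X 0 j \<omega> + Z 0 j \<omega>)))\<^sup>2
      + q * (\<Sum>j<l. (if j < i then - chol_a q i else 0)\<^sup>2)) = chol_v q i - q"
proof -
  define \<alpha> where "\<alpha> = chol_a q i"
  define c where "c = (s1 - s2) / real l"
  define b where "b = s2 + q"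
  define \<beta> where "\<beta> j = (if j < i then - \<alpha> else 0)" for j
  define a where "a j = of_bool (j = i) + \<beta> j" for j
  have pos: "0 < b + real i * c" using chol_pos[OF q, of i] i by (simp add: b_def c_def)
  have bs: "(\<Sum>j<l. (\<beta> j)\<^sup>2) = real i * \<alpha>\<^sup>2"
  proof -
    have "(\<Sum>j<l. (\<beta> j)\<^sup>2) = (\<Sum>j<i. \<alpha>\<^sup>2)"
      using i by (intro sum.mono_neutral_cong_right) (auto simp: \<beta>_def)
    then show ?thesis by simp
  qed
  have "(X 0 i \<omega> + Z 0 i \<omega>) + (\<Sum>j<l. \<beta> j * (X 0 j \<omega> + Z 0 j \<omega>)) = (\<Sum>j<l. a j * X 0 j \<omega>) + (\<Sum>j<l. a j * Z 0 j \<omega>)" for \<omega>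
    unfolding a_def by (simp add: ring_distribs sum.distrib sum_unit[OF i])
  then have "(LINT \<omega>|M. ((X 0 i \<omega> + Z 0 i \<omega>) + (\<Sum>j<l. \<beta> j * (X 0 j \<omega> + Z 0 j \<omega>)))\<^sup>2 + q * (\<Sum>j<l. (\<beta> j)\<^sup>2)) = qf l s1 s2 a + q * (real i * \<alpha>\<^sup>2)"
    using joint_moment[of a 0 a] by (simp add: prob_space qf_coef_add bs)
  also have "qf l s1 s2 a = s2 * (1 + \<alpha>\<^sup>2 * real i) + c * (1 - \<alpha> * real i)\<^sup>2"
  proof -
    have \<beta>s: "(\<Sum>j<l. f (\<beta> j)) = real i * f (- \<alpha>)" if "f 0 = 0" for f :: "real \<Rightarrow> real"
    proof -
      have "(\<Sum>j<l. f (\<beta> j)) = (\<Sum>j<i. f (- \<alpha>))"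
        using i that by (intro sum.mono_neutral_cong_right) (auto simp: \<beta>_def)
      then show ?thesis by simp
    qed
    have u: "(\<Sum>j<l. of_bool (j = i)) = (1::real)" using sum_unit[OF i, of "\<lambda>_. 1"] by simp
    have "(\<Sum>j<l. a j) = 1 - \<alpha> * real i"
      unfolding a_def sum.distrib u using \<beta>s[of "\<lambda>x. x"] by simp
    moreover have "(\<Sum>j<l. (a j)\<^sup>2) = (\<Sum>j<l. of_bool (j = i) + (\<beta> j)\<^sup>2)"
      by (intro sum.cong) (auto simp: a_def \<beta>_def)
    then have "(\<Sum>j<l. (a j)\<^sup>2) = 1 + \<alpha>\<^sup>2 * real i"
      unfolding sum.distrib u using \<beta>s[of "\<lambda>x. x\<^sup>2"] by simp
    ultimately show ?thesis by (simp add: qf_def c_def)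
  qed
  also have "s2 * (1 + \<alpha>\<^sup>2 * real i) + c * (1 - \<alpha> * real i)\<^sup>2 + q * (real i * \<alpha>\<^sup>2) = b * (1 + \<alpha>\<^sup>2 * real i) + c * (1 - \<alpha> * real i)\<^sup>2 - q"
    by (simp add: b_def algebra_simps)
  also have "b * (1 + \<alpha>\<^sup>2 * real i) + c * (1 - \<alpha> * real i)\<^sup>2 = b * (b + (real i + 1) * c) / (b + real i * c)"
  proof -
    have al: "\<alpha> = c / (b + real i * c)" by (simp add: \<alpha>_def chol_a_def b_def c_def)
    define m where "m = b + real i * c"
    have m: "m \<noteq> 0" using pos by (simp add: m_def)
    have 1: "1 - \<alpha> * real i = b / m" using m by (simp add: al m_def field_simps)
    have bm: "b = m - real i * c" by (simp add: m_def)
    show ?thesis unfolding 1 al m_def[symmetric] using m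
      by (simp add: field_simps power2_eq_square) (simp add: bm algebra_simps)
  qed
  finally show ?thesis unfolding \<beta>_def \<alpha>_def using i by (simp add: chol_v_def b_def c_def add.commute)
qed

text \<open>The Wiener filter for X given U: an exchangeable matrix with eigenvalue x1 / (s1 + q) on
  the constant vectors and x2 / (s2 + q) on their complement.\<close>

definition mmse_coef :: "real \<Rightarrow> nat \<Rightarrow> nat \<Rightarrow> real" where
  "mmse_coef q i j = (x1 / (s1 + q) - x2 / (s2 + q)) / l + x2 / (s2 + q) * of_bool (j = i)"

lemma mmse_error:
  assumes q: "0 < q" and i: "i < l"
  shows "(LINT \<omega>|M. (X 0 i \<omega> + (\<Sum>j<l. - mmse_coef q i j * (X 0 j \<omega> + Z 0 j \<omega>)))\<^sup>2 + q * (\<Sum>j<l. (- mmse_coef q i j)\<^sup>2)) =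
    (x1 * (z1 + q) / (s1 + q) + (real l - 1) * (x2 * (z2 + q) / (s2 + q))) / l"
proof -
  define g1 where "g1 = x1 / (s1 + q)"
  define g2 where "g2 = x2 / (s2 + q)"
  define \<gamma> where "\<gamma> j = - mmse_coef q i j" for j
  have p: "0 < s1 + q" "0 < s2 + q" using eigen_nonneg q by auto
  have \<gamma>: "\<gamma> j = (- g1 - - g2) / real l + (- g2) * of_bool (j = i)" for j
    by (simp add: \<gamma>_def mmse_coef_def g1_def g2_def diff_divide_distrib)
  have gq: "q * (\<Sum>j<l. (\<gamma> j)\<^sup>2) = qf l q q \<gamma>" by (simp add: qf_def)
  have a: "of_bool (j = i) + \<gamma> j = ((1 - g1) - (1 - g2)) / real l + (1 - g2) * of_bool (j = i)" for j
    by (simp add: \<gamma> algebra_simps diff_divide_distrib)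
  have "X 0 i \<omega> + (\<Sum>j<l. \<gamma> j * (X 0 j \<omega> + Z 0 j \<omega>)) = (\<Sum>j<l. (of_bool (j = i) + \<gamma> j) * X 0 j \<omega>) + (\<Sum>j<l. \<gamma> j * Z 0 j \<omega>)" for \<omega>
    using lin_S[of "\<lambda>j. of_bool (j = i)" 0 \<omega> \<gamma>] by (simp add: sum_unit[OF i])
  then have "(LINT \<omega>|M. (X 0 i \<omega> + (\<Sum>j<l. \<gamma> j * (X 0 j \<omega> + Z 0 j \<omega>)))\<^sup>2 + q * (\<Sum>j<l. (\<gamma> j)\<^sup>2)) =
     qf l x1 x2 (\<lambda>j. of_bool (j = i) + \<gamma> j) + qf l z1 z2 \<gamma> + qf l q q \<gamma>"
    unfolding gq using joint_moment[of "\<lambda>j. of_bool (j = i) + \<gamma> j" 0 \<gamma>] by (simp add: prob_space)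
  also have "qf l x1 x2 (\<lambda>j. of_bool (j = i) + \<gamma> j) = (x1 * (1 - g1)\<^sup>2 + (real l - 1) * x2 * (1 - g2)\<^sup>2) / l"
    by (rule qf_circulant[OF l0 i a])
  also have "qf l z1 z2 \<gamma> = (z1 * (- g1)\<^sup>2 + (real l - 1) * z2 * (- g2)\<^sup>2) / l"
    by (rule qf_circulant[OF l0 i \<gamma>])
  also have "qf l q q \<gamma> = (q * (- g1)\<^sup>2 + (real l - 1) * q * (- g2)\<^sup>2) / l"
    by (rule qf_circulant[OF l0 i \<gamma>])
  also have "(x1 * (1 - g1)\<^sup>2 + (real l - 1) * x2 * (1 - g2)\<^sup>2) / l + (z1 * (- g1)\<^sup>2 + (real l - 1) * z2 * (- g2)\<^sup>2) / l
      + (q * (- g1)\<^sup>2 + (real l - 1) * q * (- g2)\<^sup>2) / l =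
     ((x1 * (1 - g1)\<^sup>2 + (z1 + q) * g1\<^sup>2) + (real l - 1) * (x2 * (1 - g2)\<^sup>2 + (z2 + q) * g2\<^sup>2)) / l"
    by (simp add: algebra_simps add_divide_distrib diff_divide_distrib)
  also have "x1 * (1 - g1)\<^sup>2 + (z1 + q) * g1\<^sup>2 = x1 * (z1 + q) / (s1 + q)"
    unfolding g1_def using mmse_scalar[of x1 z1 q] p by simp
  also have "x2 * (1 - g2)\<^sup>2 + (z2 + q) * g2\<^sup>2 = x2 * (z2 + q) / (s2 + q)"
    unfolding g2_def using mmse_scalar[of x2 z2 q] p by simp
  finally show ?thesis unfolding gq[symmetric] \<gamma>_def .
qed

theorem achievability:
  assumes q: "0 < q"
    and d: "d = (x1 * (z1 + q) / (s1 + q) + (real l - 1) * (x2 * (z2 + q) / (s2 + q))) / l"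
  shows "achievable M l X Z l (ln ((s1 + q) * (s2 + q) ^ (l - 1) / q ^ l) / (2 * l)) (\<lambda>_. d)"
  unfolding achievable_def
proof (intro allI impI)
  fix \<epsilon> :: real assume \<epsilon>: "0 < \<epsilon>"
  interpret gauss_channel M l X Z q "chol_a q" "chol_v q" "mmse_coef q"
    by unfold_locales (use q chol_v_pos component_sq in auto)
  have lc: "real l \<noteq> 0" "0 < real l" using l0 by auto
  define R where "R = ln ((s1 + q) * (s2 + q) ^ (l - 1) / q ^ l) / 2"
  have info: "(\<Sum>i<l. ln (chol_v q i / q) / 2 - 1 / 2 +
       (q + (LINT \<omega>|M. (S0 i \<omega> + (\<Sum>j<l. prevcoef i j * S0 j \<omega>))\<^sup>2 + q * (\<Sum>j<l. (prevcoef i j)\<^sup>2))) / (2 * chol_v q i)) = R"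
  proof -
    \<comment> \<open>Because \<open>chol_v\<close> is the true innovation variance, the last
      quotient is 1 / 2 and cancels the - 1 / 2.\<close>
    have "ln (chol_v q i / q) / 2 - 1 / 2 + (q + (LINT \<omega>|M. (S0 i \<omega> + (\<Sum>j<l. prevcoef i j * S0 j \<omega>))\<^sup>2 + q * (\<Sum>j<l. (prevcoef i j)\<^sup>2))) / (2 * chol_v q i)
       = ln (chol_v q i / q) / 2" if "i < l" for i
    proof -
      have "q + (LINT \<omega>|M. (S0 i \<omega> + (\<Sum>j<l. prevcoef i j * S0 j \<omega>))\<^sup>2 + q * (\<Sum>j<l. (prevcoef i j)\<^sup>2)) = chol_v q i"
        using chol_innovation[OF q that] unfolding prevcoef_def by simp
      then show ?thesis using chol_v_pos[OF q, of i] by (simp only:) simp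
    qed
    then show ?thesis unfolding R_def chol_v_prod[OF q, symmetric] by (intro sum.cong[OF refl]) (simp only: lessThan_iff)
  qed
  have dist: "(\<Sum>i<l. LINT \<omega>|M. (X 0 i \<omega> + (\<Sum>j<l. - mmse_coef q i j * S0 j \<omega>))\<^sup>2 + q * (\<Sum>j<l. (- mmse_coef q i j)\<^sup>2)) = l * d"
    using mmse_error[OF q] by (simp add: d)
  have "0 < real l * \<epsilon>" using \<epsilon> lc by simp
  from gaussian_coding[OF this l0, unfolded info dist]
  obtain n and \<phi> :: "nat \<Rightarrow> (nat \<Rightarrow> real) \<Rightarrow> nat" and C :: "nat \<Rightarrow> nat set" and h where n: "n > 0"
    and ok: "\<forall>i<l. finite (C i) \<and> \<phi> i \<in> vecM n \<rightarrow>\<^sub>M count_space UNIV \<and> (\<forall>x\<in>space (vecM n). \<phi> i x \<in> C i)"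
    and rate: "(\<Sum>i<l. ln (real (card (C i)))) \<le> real n * (R + real l * \<epsilon>)"
    and E: "(LINT \<omega>|M. (\<Sum>i<l. \<Sum>t<n. (X t i \<omega> - h i t (\<lambda>i\<in>{..<l}. \<phi> i (Sblock X Z n i \<omega>)))\<^sup>2)) \<le> real n * (real l * d + real l * \<epsilon>)"
    by (elim exE conjE) (rule that)
  \<comment> \<open>For k = l the constraints concern a single subset, the set of all
    encoders.\<close>
  have full: "A = {..<l}" if "A \<subseteq> {..<l}" "l \<le> card A" for A
    using that card_mono[OF finite_lessThan that(1)] by (intro card_subset_eq) auto
  interpret code M "\<lambda>\<omega>. \<lambda>i\<in>{..<l}. \<phi> i (Sblock X Z n i \<omega>)" "PiE {..<l} C"
    using ok by (intro code_block) auto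
  have F_eq: "code_sigma M X Z n \<phi> {..<l} = F" by (simp add: code_sigma_def)
  have "(\<Sum>i<l. \<Sum>t<n. LINT \<omega>|M. (X t i \<omega> - real_cond_exp M F (X t i) \<omega>)\<^sup>2) \<le>
     (\<Sum>i<l. \<Sum>t<n. LINT \<omega>|M. (X t i \<omega> - h i t (\<lambda>i\<in>{..<l}. \<phi> i (Sblock X Z n i \<omega>)))\<^sup>2)"
    using X_integrable component_sq by (intro sum_mono cond_exp_mmse) auto
  also have "\<dots> = (LINT \<omega>|M. (\<Sum>i<l. \<Sum>t<n. (X t i \<omega> - h i t (\<lambda>i\<in>{..<l}. \<phi> i (Sblock X Z n i \<omega>)))\<^sup>2))"
  proof -
    have "integrable M (\<lambda>\<omega>. (X t i \<omega> - h i t (\<lambda>i\<in>{..<l}. \<phi> i (Sblock X Z n i \<omega>)))\<^sup>2)" if "i < l" for i t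
    proof -
      have "integrable M (\<lambda>\<omega>. h i t (\<lambda>i\<in>{..<l}. \<phi> i (Sblock X Z n i \<omega>)) * X t i \<omega>)"
        by (rule code_fun_mult[OF X_integrable[OF that]])
      then have "integrable M (\<lambda>\<omega>. 2 * X t i \<omega> * h i t (\<lambda>i\<in>{..<l}. \<phi> i (Sblock X Z n i \<omega>)))"
        using integrable_mult_right[of 2 M] by (simp add: ac_simps)
      then show ?thesis unfolding power2_diff using component_sq(1)[OF that, of t] code_fun_sq[of "h i t"]
        by (intro Bochner_Integration.integrable_add Bochner_Integration.integrable_diff)
    qed
    then show ?thesis by (simp add: Bochner_Integration.integral_sum)
  qed
  finally have dist_le: "(\<Sum>i<l. \<Sum>t<n. LINT \<omega>|M. (X t i \<omega> - real_cond_exp M F (X t i) \<omega>)\<^sup>2) \<le> real n * (real l * d + real l * \<epsilon>)"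
    using E by linarith
  show "\<exists>n>0. \<exists>(\<phi> :: nat \<Rightarrow> (nat \<Rightarrow> real) \<Rightarrow> nat) (C :: nat \<Rightarrow> nat set).
        (\<forall>i<l. finite (C i) \<and> \<phi> i \<in> measurable (vecM n) (count_space UNIV) \<and>
               (\<forall>x \<in> space (vecM n). \<phi> i x \<in> C i)) \<and>
        (\<forall>A. A \<subseteq> {..<l} \<and> card A = l \<longrightarrow>
           1 / (real l * real n) * (\<Sum>i\<in>A. ln (real (card (C i)))) \<le> ln ((s1 + q) * (s2 + q) ^ (l - 1) / q ^ l) / (2 * l) + \<epsilon>) \<and>
        (\<forall>A. A \<subseteq> {..<l} \<and> l \<le> card A \<longrightarrow>
           1 / (real (card A) * real n) *
             (\<Sum>i\<in>A. \<Sum>t<n. integral\<^sup>L M (\<lambda>\<omega>.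
                (X t i \<omega> - real_cond_exp M (code_sigma M X Z n \<phi> A) (X t i) \<omega>)\<^sup>2))
           \<le> d + \<epsilon>)"
  proof (intro exI[of _ n] conjI exI[of _ \<phi>] exI[of _ C] allI impI)
    fix A assume "A \<subseteq> {..<l} \<and> card A = l"
    then have A: "A = {..<l}" using full[of A] by simp
    have "1 / (real l * real n) * (\<Sum>i<l. ln (real (card (C i)))) \<le> 1 / (real l * real n) * (real n * (R + real l * \<epsilon>))"
      using rate by (intro mult_left_mono) auto
    also have "\<dots> = R / real l + \<epsilon>" using n lc by (simp add: field_simps)
    finally show "1 / (real l * real n) * (\<Sum>i\<in>A. ln (real (card (C i)))) \<le> ln ((s1 + q) * (s2 + q) ^ (l - 1) / q ^ l) / (2 * l) + \<epsilon>"
      unfolding A R_def by simp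
  next
    fix A assume "A \<subseteq> {..<l} \<and> l \<le> card A"
    then have A: "A = {..<l}" using full[of A] by simp
    have "1 / (real l * real n) * (\<Sum>i<l. \<Sum>t<n. LINT \<omega>|M. (X t i \<omega> - real_cond_exp M F (X t i) \<omega>)\<^sup>2) \<le> 1 / (real l * real n) * (real n * (real l * d + real l * \<epsilon>))"
      using dist_le by (intro mult_left_mono) auto
    also have "\<dots> = d + \<epsilon>" using n lc by (simp add: field_simps)
    finally show "1 / (real (card A) * real n) * (\<Sum>i\<in>A. \<Sum>t<n. LINT \<omega>|M. (X t i \<omega> - real_cond_exp M (code_sigma M X Z n \<phi> A) (X t i) \<omega>)\<^sup>2) \<le> d + \<epsilon>"
      unfolding A F_eq by simp
  qed (use n ok in auto)
qed

end

section \<open>Tilted Gaussian laws\<close>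

abbreviation stdN :: "real measure" where "stdN \<equiv> std_normal_distribution"

lemma prob_space_stdN: "prob_space stdN"
  using real_dist_normal_dist by (simp add: real_distribution_def)

text \<open>Log-density of the normal law with mean a and variance v relative to the standard normal
  law.\<close>

definition tilt :: "real \<Rightarrow> real \<Rightarrow> real \<Rightarrow> real" where
  "tilt a v x = - ln v / 2 - (x - a)\<^sup>2 / (2 * v) + x\<^sup>2 / 2"

lemma tilt_meas[measurable]: "(\<lambda>x. tilt (a x) v (f x)) \<in> borel_measurable M"
  if [measurable]: "a \<in> borel_measurable M" "f \<in> borel_measurable M"
  unfolding tilt_def by measurable

lemma tilt_integral:
  assumes v: "0 < v" shows "(\<integral>\<^sup>+x. ennreal (exp (tilt a v x)) \<partial>stdN) = 1"
proof -
  interpret prob_space "density lborel (normal_density a (sqrt v))"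
    using v by (intro prob_space_normal_density) simp
  have e: "std_normal_density x * exp (tilt a v x) = normal_density a (sqrt v) x" for x
  proof -
    have "std_normal_density x * exp (tilt a v x) = 1 / sqrt (2 * pi) * exp (- x\<^sup>2 / 2 + tilt a v x)"
      by (simp only: std_normal_density_def exp_add mult.assoc)
    also have "- x\<^sup>2 / 2 + tilt a v x = - (ln v / 2) + - (x - a)\<^sup>2 / (2 * v)"
      by (simp add: tilt_def)
    also have "exp (- (ln v / 2) + - (x - a)\<^sup>2 / (2 * v)) = 1 / sqrt v * exp (- (x - a)\<^sup>2 / (2 * v))"
      using v unfolding exp_add by (simp add: exp_minus inverse_eq_divide powr_half_sqrt[symmetric] powr_def)
    finally show ?thesis using v unfolding normal_density_def by (simp add: real_sqrt_mult)
  qed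
  have "(\<integral>\<^sup>+x. ennreal (exp (tilt a v x)) \<partial>stdN) = (\<integral>\<^sup>+x. ennreal (normal_density a (sqrt v) x) \<partial>lborel)"
    unfolding e[symmetric] by (subst nn_integral_density) (auto intro!: nn_integral_cong simp: ennreal_mult')
  also have "\<dots> = 1" using emeasure_space_1 by (simp add: emeasure_density cong: nn_integral_cong)
  finally show ?thesis .
qed

text \<open>Coordinate i is normal given the earlier ones, with a mean that regresses on their
  deviations. Integrating out the last coordinate removes exactly its own factor.\<close>

lemma sequential_tilt:
  fixes k :: nat and v a \<alpha> :: "nat \<Rightarrow> real"
  assumes v: "\<And>i. i < k \<Longrightarrow> 0 < v i"
  shows "(\<integral>\<^sup>+x. ennreal (exp (\<Sum>i<k. tilt (a i + \<alpha> i * (\<Sum>j<i. x j - a j)) (v i) (x i))) \<partial>PiM {..<k} (\<lambda>_. stdN)) = 1"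
  using v
proof (induction k)
  case 0
  then show ?case by (simp add: PiM_empty nn_integral_count_space_finite)
next
  case (Suc k)
  interpret N: prob_space stdN by (rule prob_space_stdN)
  interpret P: product_sigma_finite "\<lambda>_::nat. stdN" by standard
  let ?f = "\<lambda>k x. exp (\<Sum>i<k. tilt (a i + \<alpha> i * (\<Sum>j<i. x j - a j)) (v i) (x i))"
  have comp: "(\<lambda>x. x i) \<in> borel_measurable (PiM {..<m} (\<lambda>_. stdN))" if "i < m" for i m
    using that measurable_component_singleton[of i "{..<m}" "\<lambda>_. stdN"] by simp
  have meas: "?f m \<in> borel_measurable (PiM {..<m} (\<lambda>_. stdN))" for m
  proof (intro borel_measurable_exp[THEN measurable_compose[rotated]] borel_measurable_sum tilt_meas borel_measurable_add borel_measurable_times borel_measurable_diff borel_measurable_const)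
    show "(\<lambda>x. x i) \<in> borel_measurable (PiM {..<m} (\<lambda>_. stdN))" if "i \<in> {..<m}" for i using comp that by simp
    show "(\<lambda>x. x j) \<in> borel_measurable (PiM {..<m} (\<lambda>_. stdN))" if "i \<in> {..<m}" "j \<in> {..<i}" for i j using comp[of j m] that by simp
  qed
  have "(\<integral>\<^sup>+x. ennreal (?f (Suc k) x) \<partial>PiM {..<Suc k} (\<lambda>_. stdN)) =
    (\<integral>\<^sup>+x. (\<integral>\<^sup>+y. ennreal (?f (Suc k) (x(k := y))) \<partial>stdN) \<partial>PiM {..<k} (\<lambda>_. stdN))"
    unfolding lessThan_Suc by (rule P.product_nn_integral_insert) (use meas[of "Suc k"] in \<open>auto simp: lessThan_Suc\<close>)
  also have "\<dots> = (\<integral>\<^sup>+x. (\<integral>\<^sup>+y. ennreal (?f k x) * ennreal (exp (tilt (a k + \<alpha> k * (\<Sum>j<k. x j - a j)) (v k) y)) \<partial>stdN) \<partial>PiM {..<k} (\<lambda>_. stdN))"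
  proof (intro nn_integral_cong)
    fix x y
    have 1: "(\<Sum>j<i. (x(k := y)) j - a j) = (\<Sum>j<i. x j - a j)" if "i \<le> k" for i
      using that by (intro sum.cong) auto
    have "(\<Sum>i<k. tilt (a i + \<alpha> i * (\<Sum>j<i. (x(k := y)) j - a j)) (v i) ((x(k := y)) i)) = (\<Sum>i<k. tilt (a i + \<alpha> i * (\<Sum>j<i. x j - a j)) (v i) (x i))"
      by (intro sum.cong refl) (simp add: 1)
    then show "ennreal (?f (Suc k) (x(k := y))) = ennreal (?f k x) * ennreal (exp (tilt (a k + \<alpha> k * (\<Sum>j<k. x j - a j)) (v k) y))"
      using 1[of k] by (simp add: exp_add ennreal_mult')
  qed
  also have "\<dots> = (\<integral>\<^sup>+x. ennreal (?f k x) \<partial>PiM {..<k} (\<lambda>_. stdN))"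
    using tilt_integral[of "v k"] Suc.prems by (intro nn_integral_cong) (simp add: nn_integral_cmult)
  also have "\<dots> = 1" using Suc by simp
  finally show ?case .
qed

text \<open>The left side sums the normalised squared innovations for the covariance b I + c J with
  J the all-ones matrix; the right side is the inverse quadratic form, which Sherman-Morrison gives
  in closed form. Appending a coordinate amounts to a rational identity.\<close>

lemma exchangeable_innovations:
  fixes b c :: real and y :: "nat \<Rightarrow> real"
  assumes b: "0 < b" and pos: "\<And>i. i \<le> k \<Longrightarrow> 0 < b + real i * c"
  shows "(\<Sum>i<k. (y i - c / (b + real i * c) * (\<Sum>j<i. y j))\<^sup>2 / (b * (b + (real i + 1) * c) / (b + real i * c))) =
     ((\<Sum>i<k. (y i)\<^sup>2) - c / (b + real k * c) * (\<Sum>i<k. y i)\<^sup>2) / b"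
  using pos
proof (induction k)
  case (Suc k)
  define m where "m = b + real k * c"
  have m: "0 < m" "0 < m + c" using Suc.prems[of k] Suc.prems[of "Suc k"] by (auto simp: m_def algebra_simps)
  have IH: "(\<Sum>i<k. (y i - c / (b + real i * c) * (\<Sum>j<i. y j))\<^sup>2 / (b * (b + (real i + 1) * c) / (b + real i * c))) =
     ((\<Sum>i<k. (y i)\<^sup>2) - c / m * (\<Sum>i<k. y i)\<^sup>2) / b"
    unfolding m_def using Suc.prems by (intro Suc.IH) auto
  have mc: "b + (real k + 1) * c = m + c" "b + real (Suc k) * c = m + c" by (auto simp: m_def algebra_simps)
  define T Y Q where "T = (\<Sum>i<k. y i)" and "Y = y k" and "Q = (\<Sum>i<k. (y i)\<^sup>2)"
  have "(Q - c / m * T\<^sup>2) / b + (Y - c / m * T)\<^sup>2 / (b * (m + c) / m) = (Q + Y\<^sup>2 - c / (m + c) * (T + Y)\<^sup>2) / b"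
  proof -
    have "(Y - c / m * T)\<^sup>2 / (b * (m + c) / m) = ((m * Y - c * T)\<^sup>2 / (m * (m + c))) / b"
    proof -
      have "(A / m)\<^sup>2 / (b * n / m) = (A\<^sup>2 / (m * n)) / b" for A n
        using b m by (simp add: power2_eq_square)
      moreover have "Y - c / m * T = (m * Y - c * T) / m" using m by (simp add: field_simps)
      ultimately show ?thesis by (simp only:)
    qed
    moreover have "Q - c / m * T\<^sup>2 + (m * Y - c * T)\<^sup>2 / (m * (m + c)) = Q + Y\<^sup>2 - c / (m + c) * (T + Y)\<^sup>2"
      using m by (simp add: divide_simps power2_eq_square) algebra
    ultimately show ?thesis by (simp only: add_divide_distrib[symmetric])
  qed
  then show ?case
    by (simp only: sum.lessThan_Suc IH mc) (simp only: m_def[symmetric] T_def[symmetric] Y_def[symmetric] Q_def[symmetric])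
qed simp

lemma exchangeable_innovation_logs:
  fixes b c :: real
  assumes b: "0 < b" and pos: "\<And>i. i \<le> k \<Longrightarrow> 0 < b + real i * c"
  shows "(\<Sum>i<k. ln (b * (b + (real i + 1) * c) / (b + real i * c))) = (real k - 1) * ln b + ln (b + real k * c)"
  using pos
proof (induction k)
  case (Suc k)
  define m where "m = b + real k * c"
  have m: "0 < m" "0 < m + c" using Suc.prems[of k] Suc.prems[of "Suc k"] by (auto simp: m_def algebra_simps)
  have IH: "(\<Sum>i<k. ln (b * (b + (real i + 1) * c) / (b + real i * c))) = (real k - 1) * ln b + ln m"
    unfolding m_def using Suc.prems by (intro Suc.IH) auto
  have mc: "b + (real k + 1) * c = m + c" "b + real (Suc k) * c = m + c" by (auto simp: m_def algebra_simps)
  have "ln (b * (m + c) / m) = ln b + ln (m + c) - ln m" using b m by (simp add: ln_mult ln_div)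
  then show ?case
    by (simp only: sum.lessThan_Suc IH mc m_def[symmetric]) (simp add: algebra_simps)
qed simp

text \<open>The integrand is the density, relative to white noise, of a normal vector with mean a
  and covariance eigenvalues v1, v2. Writing it as a chain of conditional densities replaces a
  linear change of variables in dimension l.\<close>

lemma qf_tilt:
  assumes l: "0 < l" and v: "0 < v1" "0 < v2"
  shows "(\<integral>\<^sup>+x. ennreal (exp (- (ln v1 + (real l - 1) * ln v2) / 2 - qf l (1 / v1) (1 / v2) (\<lambda>i. x i - a i) / 2 + (\<Sum>i<l. (x i)\<^sup>2) / 2))
    \<partial>PiM {..<l} (\<lambda>_. stdN)) = 1"
proof -
  define c where "c = (v1 - v2) / real l"
  have pos: "0 < v2 + real i * c" if "i \<le> l" for i
  proof -
    have "v2 + real i * c = (real (l - i) * v2 + real i * v1) / real l"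
      using l that by (simp add: c_def of_nat_diff field_simps)
    moreover have "0 < real (l - i) * v2 + real i * v1"
      using v l that by (cases "i = l") (auto intro!: add_pos_nonneg)
    ultimately show ?thesis using l by simp
  qed
  have vl: "v2 + real l * c = v1" using l by (simp add: c_def)
  define w where "w i = v2 * (v2 + (real i + 1) * c) / (v2 + real i * c)" for i
  have w: "0 < w i" if "i < l" for i using pos[of i] pos[of "Suc i"] v that unfolding w_def by (auto simp: add.commute)
  define \<alpha> where "\<alpha> i = c / (v2 + real i * c)" for i
  have e: "(\<Sum>i<l. tilt (a i + \<alpha> i * (\<Sum>j<i. x j - a j)) (w i) (x i)) =
    - (ln v1 + (real l - 1) * ln v2) / 2 - qf l (1 / v1) (1 / v2) (\<lambda>i. x i - a i) / 2 + (\<Sum>i<l. (x i)\<^sup>2) / 2" for x :: "nat \<Rightarrow> real"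
  proof -
    define y where "y i = x i - a i" for i
    have "(\<Sum>i<l. tilt (a i + \<alpha> i * (\<Sum>j<i. x j - a j)) (w i) (x i)) =
       (\<Sum>i<l. - (ln (w i) / 2) - ((y i - \<alpha> i * (\<Sum>j<i. y j))\<^sup>2 / w i) / 2 + (x i)\<^sup>2 / 2)"
      by (intro sum.cong refl) (simp add: tilt_def y_def algebra_simps)
    also have "\<dots> = - (\<Sum>i<l. ln (w i)) / 2 - (\<Sum>i<l. (y i - \<alpha> i * (\<Sum>j<i. y j))\<^sup>2 / w i) / 2 + (\<Sum>i<l. (x i)\<^sup>2) / 2"
      by (simp add: sum.distrib sum_subtractf sum_negf sum_divide_distrib)
    also have "(\<Sum>i<l. ln (w i)) = (real l - 1) * ln v2 + ln v1"
      unfolding w_def using exchangeable_innovation_logs[of v2 l c] v pos vl by simp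
    also have "(\<Sum>i<l. (y i - \<alpha> i * (\<Sum>j<i. y j))\<^sup>2 / w i) = ((\<Sum>i<l. (y i)\<^sup>2) - c / v1 * (\<Sum>i<l. y i)\<^sup>2) / v2"
      unfolding w_def \<alpha>_def using exchangeable_innovations[of v2 l c y] v pos vl by simp
    also have "\<dots> = qf l (1 / v1) (1 / v2) y"
      unfolding qf_def c_def using l v by (simp add: field_simps)
    finally show ?thesis unfolding y_def[abs_def] by (simp add: add.commute)
  qed
  show ?thesis using sequential_tilt[of l w a \<alpha>] w unfolding e by simp
qed

section \<open>Residuals of independent observations\<close>

text \<open>To be used for a frozen G and a single time: Q is the law of a user's whole H block, f
  reads one coordinate of it, and \<open>\<kappa> i\<close> is the message of user i. The message
  depends on the entire block although only one coordinate is estimated.\<close>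

locale users =
  fixes l :: nat and Q :: "'b measure" and f :: "'b \<Rightarrow> real" and \<kappa> :: "nat \<Rightarrow> 'b \<Rightarrow> nat" and C :: "nat \<Rightarrow> nat set"
  assumes Q: "prob_space Q" and f[measurable]: "f \<in> borel_measurable Q" and f2: "integrable Q (\<lambda>x. (f x)\<^sup>2)"
    and \<kappa>[measurable]: "\<And>i. i < l \<Longrightarrow> \<kappa> i \<in> Q \<rightarrow>\<^sub>M count_space UNIV"
    and C: "\<And>i. i < l \<Longrightarrow> finite (C i)" "\<And>i x. i < l \<Longrightarrow> x \<in> space Q \<Longrightarrow> \<kappa> i x \<in> C i"
begin

abbreviation "PH \<equiv> PiM {..<l} (\<lambda>_. Q)"

text \<open>The conditional mean of f given the i-th message; for a message of probability zero both
  integrals vanish and the value is 0.\<close>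

definition hat :: "nat \<Rightarrow> nat \<Rightarrow> real" where
  "hat i m = (LINT x|Q. f x * of_bool (\<kappa> i x = m)) / (LINT x|Q. of_bool (\<kappa> i x = m))"

definition res :: "nat \<Rightarrow> 'b \<Rightarrow> real" where
  "res i x = f x - hat i (\<kappa> i x)"

definition msgs :: "(nat \<Rightarrow> 'b) \<Rightarrow> nat \<Rightarrow> nat" where
  "msgs x = (\<lambda>i\<in>{..<l}. \<kappa> i (x i))"

sublocale Q: prob_space Q by (rule Q)

lemma code1: "i < l \<Longrightarrow> code Q (\<kappa> i) (C i)"
  using C by unfold_locales auto

lemma f_integrable: "integrable Q f"
  using Q.square_integrable_imp_integrable[OF f f2] .

lemma ind_integrable: "i < l \<Longrightarrow> integrable Q (\<lambda>x. of_bool (\<kappa> i x = m) :: real)"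
  by (rule Q.integrable_const_bound[where B=1]) auto

lemma f_ind_integrable: "i < l \<Longrightarrow> integrable Q (\<lambda>x. f x * of_bool (\<kappa> i x = m))"
  using code.code_fun_mult[OF code1 f_integrable, of i "\<lambda>b. of_bool (b = m)"] by (simp add: mult.commute)

lemma hat_centered:
  assumes i: "i < l" shows "(LINT x|Q. res i x * of_bool (\<kappa> i x = m)) = 0"
proof -
  have "(LINT x|Q. res i x * of_bool (\<kappa> i x = m)) = (LINT x|Q. f x * of_bool (\<kappa> i x = m) - hat i m * of_bool (\<kappa> i x = m))"
    by (intro Bochner_Integration.integral_cong refl) (auto simp: res_def of_bool_def)
  also have "\<dots> = (LINT x|Q. f x * of_bool (\<kappa> i x = m)) - hat i m * (LINT x|Q. of_bool (\<kappa> i x = m))"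
    using f_ind_integrable[OF i] ind_integrable[OF i] by simp
  also have "\<dots> = 0"
  proof (cases "(LINT x|Q. of_bool (\<kappa> i x = m) :: real) = 0")
    case True
    then have "AE x in Q. of_bool (\<kappa> i x = m) = (0::real)"
      using integral_nonneg_eq_0_iff_AE[OF ind_integrable[OF i]] by simp
    then have "(LINT x|Q. f x * of_bool (\<kappa> i x = m)) = 0"
      by (intro integral_eq_zero_AE) (auto elim: eventually_mono)
    with True show ?thesis by simp
  qed (simp add: hat_def)
  finally show ?thesis .
qed

lemma res_meas[measurable]: "i < l \<Longrightarrow> res i \<in> borel_measurable Q"
  unfolding res_def[abs_def] using code.code_fun_meas[OF code1, of i "hat i"] by measurable

lemma res_sq: "i < l \<Longrightarrow> integrable Q (\<lambda>x. (res i x)\<^sup>2)"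
proof -
  assume i: "i < l"
  have "integrable Q (\<lambda>x. 2 * (hat i (\<kappa> i x) * f x))" using code.code_fun_mult[OF code1[OF i] f_integrable, of "hat i"] by simp
  then have "integrable Q (\<lambda>x. (f x)\<^sup>2 + (hat i (\<kappa> i x))\<^sup>2 - 2 * (hat i (\<kappa> i x) * f x))"
    using f2 code.code_fun_sq[OF code1[OF i], of "hat i"] by simp
  then show ?thesis by (simp add: res_def power2_diff mult_ac)
qed

lemma res_integrable: "i < l \<Longrightarrow> integrable Q (res i)"
  using Q.square_integrable_imp_integrable[OF res_meas res_sq] .

lemma res_mean: assumes i: "i < l" shows "(LINT x|Q. res i x) = 0"
proof -
  have "(LINT x|Q. res i x) = (LINT x|Q. (\<Sum>m\<in>C i. res i x * of_bool (\<kappa> i x = m)))"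
  proof (intro Bochner_Integration.integral_cong refl)
    fix x assume "x \<in> space Q"
    then have "(\<Sum>m\<in>C i. res i x * of_bool (\<kappa> i x = m)) = (\<Sum>m\<in>C i. if m = \<kappa> i x then res i x else 0)"
      by (intro sum.cong) auto
    then show "res i x = (\<Sum>m\<in>C i. res i x * of_bool (\<kappa> i x = m))" using C(2)[OF i \<open>x \<in> space Q\<close>] C(1)[OF i] by simp
  qed
  also have "\<dots> = (\<Sum>m\<in>C i. LINT x|Q. res i x * of_bool (\<kappa> i x = m))"
    using code.code_fun_mult[OF code1[OF i] res_integrable[OF i], of "\<lambda>b. of_bool (b = m)" for m]
    by (intro Bochner_Integration.integral_sum) (simp add: mult.commute)
  finally show ?thesis by (simp add: hat_centered[OF i])
qed

sublocale PH: prob_space PH by (intro prob_space_PiM Q)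
sublocale P: product_sigma_finite "\<lambda>_::nat. Q" by standard

lemma comp[measurable]: "i < l \<Longrightarrow> (\<lambda>x. x i) \<in> PH \<rightarrow>\<^sub>M Q"
  by (rule measurable_component_singleton) simp

lemma coord_integral:
  fixes k :: "'b \<Rightarrow> real"
  assumes i: "i < l" and k: "integrable Q k"
  shows "integrable PH (\<lambda>x. k (x i))" "(LINT x|PH. k (x i)) = (LINT x|Q. k x)"
proof -
  have d: "distr PH Q (\<lambda>x. x i) = Q"
    using distr_PiM_component[of "{..<l}" "\<lambda>_. Q" i] i Q by simp
  have "integrable (distr PH Q (\<lambda>x. x i)) k" using k d by simp
  then show "integrable PH (\<lambda>x. k (x i))" using integrable_distr[OF comp[OF i]] by blast
  have "(LINT x|Q. k x) = (LINT x|distr PH Q (\<lambda>x. x i). k x)" using d by simp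
  also have "\<dots> = (LINT x|PH. k (x i))" using k by (intro integral_distr comp i) auto
  finally show "(LINT x|PH. k (x i)) = (LINT x|Q. k x)" ..
qed

lemma prod_integral_zero:
  fixes k :: "nat \<Rightarrow> 'b \<Rightarrow> real"
  assumes i: "i < l" and k: "\<And>j. j < l \<Longrightarrow> integrable Q (k j)" and z: "(LINT x|Q. k i x) = 0"
  shows "(LINT x|PH. (\<Prod>j<l. k j (x j))) = 0" "integrable PH (\<lambda>x. \<Prod>j<l. k j (x j))"
proof -
  have "(LINT x|PH. (\<Prod>j<l. k j (x j))) = (\<Prod>j<l. LINT x|Q. k j x)"
    using k by (intro P.product_integral_prod) auto
  also have "\<dots> = 0" using i z by (intro prod_zero) auto
  finally show "(LINT x|PH. (\<Prod>j<l. k j (x j))) = 0" .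
  show "integrable PH (\<lambda>x. \<Prod>j<l. k j (x j))" using k by (intro P.product_integrable_prod) auto
qed

lemma res_cross:
  assumes i: "i < l" and j: "j < l" and ij: "i \<noteq> j"
  shows "(LINT x|PH. res i (x i) * res j (x j)) = 0" "integrable PH (\<lambda>x. res i (x i) * res j (x j))"
proof -
  define k where "k m = (if m = i then res i else if m = j then res j else (\<lambda>_. 1))" for m
  have "(\<Prod>m<l. k m (x m)) = (\<Prod>m\<in>{i, j}. k m (x m))" for x
    using i j by (intro prod.mono_neutral_right) (auto simp: k_def)
  then have e: "(\<Prod>m<l. k m (x m)) = res i (x i) * res j (x j)" for x using ij by (simp add: k_def)
  have k1: "integrable Q (k m)" if "m < l" for m using i j res_integrable by (simp add: k_def)
  show "(LINT x|PH. res i (x i) * res j (x j)) = 0" "integrable PH (\<lambda>x. res i (x i) * res j (x j))"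
    using prod_integral_zero[of i k, OF i k1] res_mean[OF i] unfolding e by (simp_all add: k_def)
qed

lemma msgs_code: "code PH msgs (PiE {..<l} C)"
proof
  show fin: "finite (PiE {..<l} C)" using C by (intro finite_PiE) auto
  have m: "(\<lambda>x. \<kappa> i (x i)) \<in> PH \<rightarrow>\<^sub>M count_space UNIV" if "i < l" for i
    by (rule measurable_compose[OF comp[OF that] \<kappa>[OF that]])
  show inB: "msgs x \<in> PiE {..<l} C" if "x \<in> space PH" for x
    using C(2) measurable_space[OF comp that] by (auto simp: msgs_def)
  show "msgs \<in> PH \<rightarrow>\<^sub>M count_space UNIV"
    unfolding msgs_def[abs_def]
    by (rule measurable_restrict_count[where C=C]) (use C m measurable_space[OF comp] in auto)
qed

text \<open>For a fixed message tuple the indicator factors over the users, and the factor of user i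
  is its residual restricted to its own message, which integrates to 0 by
  \<open>hat_centered\<close>.\<close>

lemma res_msgs:
  fixes u :: "(nat \<Rightarrow> nat) \<Rightarrow> real"
  assumes i: "i < l"
  shows "(LINT x|PH. res i (x i) * u (msgs x)) = 0" "integrable PH (\<lambda>x. res i (x i) * u (msgs x))"
proof -
  let ?BB = "PiE {..<l} C"
  have fin: "finite ?BB" using C by (intro finite_PiE) auto
  define k where "k b j = (\<lambda>x. (if j = i then res i x else 1) * of_bool (\<kappa> j x = b j))" for b :: "nat \<Rightarrow> nat" and j
  have k1: "integrable Q (k b j)" if "j < l" for b j
    using code.code_fun_mult[OF code1[OF i] res_integrable[OF i], of "\<lambda>m. of_bool (m = b i)"] ind_integrable[OF that, of "b j"]
    by (cases "j = i") (simp_all add: k_def mult.commute)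
  have z: "(LINT x|Q. k b i x) = 0" for b using hat_centered[OF i] by (simp add: k_def)
  have e: "res i (x i) * u (msgs x) = (\<Sum>b\<in>?BB. u b * (\<Prod>j<l. k b j (x j)))" if x: "x \<in> space PH" for x
  proof -
    have "(\<Prod>j<l. k b j (x j)) = (if b = msgs x then res i (x i) else 0)" if b: "b \<in> ?BB" for b
    proof -
      have "(\<Prod>j<l. k b j (x j)) = (\<Prod>j<l. if j = i then res i (x j) else 1) * (\<Prod>j<l. of_bool (\<kappa> j (x j) = b j))"
        unfolding k_def prod.distrib ..
      also have "(\<Prod>j<l. if j = i then res i (x j) else 1) = res i (x i)" using i by (simp add: prod.delta)
      also have "(\<Prod>j<l. of_bool (\<kappa> j (x j) = b j)) = (of_bool (b = msgs x) :: real)"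
      proof -
        have "b = msgs x \<longleftrightarrow> (\<forall>j\<in>{..<l}. \<kappa> j (x j) = b j)"
          using b by (auto simp: msgs_def fun_eq_iff restrict_def PiE_iff extensional_def)
        then show ?thesis by (simp add: of_bool_def)
      qed
      finally show ?thesis by simp
    qed
    then have "(\<Sum>b\<in>?BB. u b * (\<Prod>j<l. k b j (x j))) = (\<Sum>b\<in>?BB. if b = msgs x then u b * res i (x i) else 0)"
      by (intro sum.cong) auto
    also have "\<dots> = u (msgs x) * res i (x i)" using fin code.B(2)[OF msgs_code x] by simp
    finally show ?thesis by simp
  qed
  have ints: "integrable PH (\<lambda>x. u b * (\<Prod>j<l. k b j (x j)))" for b
    using prod_integral_zero(2)[of i "k b", OF i k1 z] by simp
  show "integrable PH (\<lambda>x. res i (x i) * u (msgs x))"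
    by (subst Bochner_Integration.integrable_cong[OF refl e], assumption) (intro Bochner_Integration.integrable_sum ints)
  have "(LINT x|PH. res i (x i) * u (msgs x)) = (LINT x|PH. (\<Sum>b\<in>?BB. u b * (\<Prod>j<l. k b j (x j))))"
    by (rule Bochner_Integration.integral_cong[OF refl e])
  also have "\<dots> = (\<Sum>b\<in>?BB. LINT x|PH. u b * (\<Prod>j<l. k b j (x j)))" by (intro Bochner_Integration.integral_sum ints)
  also have "\<dots> = 0" using prod_integral_zero(1)[of i "k b" for b, OF i k1 z] by simp
  finally show "(LINT x|PH. res i (x i) * u (msgs x)) = 0" .
qed

text \<open>Distributed encoding: given the independent observations the residuals are uncorrelated, so
  any quadratic form with unit average weight on the diagonal bounds their total power.\<close>

theorem res_power_le:
  assumes w: "0 \<le> w1" "0 \<le> w2" "w1 + (real l - 1) * w2 = real l" and l: "0 < l"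
  shows "integrable PH (\<lambda>x. qf l w1 w2 (\<lambda>i. f (x i) - T (msgs x) i))"
    and "(\<Sum>i<l. LINT x|Q. (res i x)\<^sup>2) \<le> (LINT x|PH. qf l w1 w2 (\<lambda>i. f (x i) - T (msgs x) i))"
proof -
  define r where "r i b = hat i (b i) - T b i" for i b
  define e where "e i x = res i (x i)" for i and x :: "nat \<Rightarrow> 'b"
  define c where "c = (w1 - w2) / real l"
  have split: "f (x i) - T (msgs x) i = e i x + r i (msgs x)" if "i < l" for x i
    using that by (simp add: e_def r_def res_def msgs_def)
  \<comment> \<open>The diagonal entries of the weight matrix are w2 + c = 1, so each residual keeps
    its power with weight one, while the off-diagonal entries meet only uncorrelated residuals. The
    remainder is a non-negative form in functions of the messages.\<close>
  have wc: "w2 + c = 1" using w(3) l by (simp add: c_def field_simps)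
  have q: "qf l w1 w2 (\<lambda>i. f (x i) - T (msgs x) i) =
     (\<Sum>i<l. w2 * (e i x)\<^sup>2) + (\<Sum>i<l. \<Sum>j<l. c * (e i x * e j x)) + 2 * (\<Sum>i<l. w2 * (e i x * r i (msgs x))) +
     2 * (\<Sum>i<l. \<Sum>j<l. c * (e i x * r j (msgs x))) + qf l w1 w2 (\<lambda>i. r i (msgs x))" for x
  proof -
    have "qf l w1 w2 (\<lambda>i. f (x i) - T (msgs x) i) = w2 * (\<Sum>i<l. (e i x + r i (msgs x))\<^sup>2) + c * (\<Sum>i<l. e i x + r i (msgs x))\<^sup>2"
      by (simp add: qf_def split c_def)
    moreover have "(\<Sum>i<l. (e i x + r i (msgs x))\<^sup>2) = (\<Sum>i<l. (e i x)\<^sup>2) + (\<Sum>i<l. (r i (msgs x))\<^sup>2) + 2 * (\<Sum>i<l. e i x * r i (msgs x))"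
      by (simp add: power2_sum sum.distrib sum_distrib_left mult.assoc)
    moreover have "(\<Sum>i<l. e i x + r i (msgs x))\<^sup>2 = (\<Sum>i<l. e i x)\<^sup>2 + (\<Sum>i<l. r i (msgs x))\<^sup>2 + 2 * ((\<Sum>i<l. e i x) * (\<Sum>i<l. r i (msgs x)))"
      by (simp add: power2_sum sum.distrib)
    moreover have "(\<Sum>i<l. \<Sum>j<l. c * (e i x * e j x)) = c * (\<Sum>i<l. e i x)\<^sup>2"
    proof -
      have "(\<Sum>i<l. e i x)\<^sup>2 = (\<Sum>i<l. \<Sum>j<l. e i x * e j x)" by (simp only: power2_eq_square sum_product)
      then show ?thesis by (simp only: sum_distrib_left)
    qed
    moreover have "(\<Sum>i<l. \<Sum>j<l. c * (e i x * r j (msgs x))) = c * ((\<Sum>i<l. e i x) * (\<Sum>i<l. r i (msgs x)))"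
    proof -
      have "(\<Sum>i<l. e i x) * (\<Sum>j<l. r j (msgs x)) = (\<Sum>i<l. \<Sum>j<l. e i x * r j (msgs x))" by (simp only: sum_product)
      then show ?thesis by (simp only: sum_distrib_left)
    qed
    moreover have "qf l w1 w2 (\<lambda>i. r i (msgs x)) = w2 * (\<Sum>i<l. (r i (msgs x))\<^sup>2) + c * (\<Sum>i<l. r i (msgs x))\<^sup>2"
      by (simp add: qf_def c_def)
    moreover have "(\<Sum>i<l. w2 * (e i x)\<^sup>2) = w2 * (\<Sum>i<l. (e i x)\<^sup>2)" "(\<Sum>i<l. w2 * (e i x * r i (msgs x))) = w2 * (\<Sum>i<l. e i x * r i (msgs x))"
      by (simp_all add: sum_distrib_left)
    ultimately show ?thesis by (simp only:) (simp add: algebra_simps)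
  qed
  have ee: "integrable PH (\<lambda>x. (e i x)\<^sup>2)" "(LINT x|PH. (e i x)\<^sup>2) = (LINT x|Q. (res i x)\<^sup>2)" if "i < l" for i
    using coord_integral[OF that res_sq[OF that]] by (simp_all add: e_def)
  have ec: "integrable PH (\<lambda>x. e i x * e j x)" "(LINT x|PH. e i x * e j x) = (if i = j then (LINT x|Q. (res i x)\<^sup>2) else 0)" if "i < l" "j < l" for i j
    using res_cross[OF that] ee[OF that(1)] by (cases "i = j"; simp add: e_def power2_eq_square)+
  have er: "integrable PH (\<lambda>x. e i x * r j (msgs x))" "(LINT x|PH. e i x * r j (msgs x)) = 0" if "i < l" for i j
    using res_msgs[OF that, of "r j"] by (simp_all add: e_def)
  have rr: "integrable PH (\<lambda>x. qf l w1 w2 (\<lambda>i. r i (msgs x)))"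
    using code.code_fun_bound[OF msgs_code, of _ "\<lambda>b. qf l w1 w2 (\<lambda>i. r i b)"] code.code_fun_meas[OF msgs_code, of "\<lambda>b. qf l w1 w2 (\<lambda>i. r i b)"]
    by (intro PH.integrable_const_bound) auto
  note hbi = has_bochner_integral_iff
  have "has_bochner_integral PH (\<lambda>x. \<Sum>i<l. w2 * (e i x)\<^sup>2) (\<Sum>i<l. w2 * (LINT x|Q. (res i x)\<^sup>2))"
    by (intro has_bochner_integral_sum has_bochner_integral_mult_right) (simp add: hbi ee)
  moreover have "has_bochner_integral PH (\<lambda>x. \<Sum>i<l. \<Sum>j<l. c * (e i x * e j x)) (\<Sum>i<l. \<Sum>j<l. c * (if i = j then (LINT x|Q. (res i x)\<^sup>2) else 0))"
    by (intro has_bochner_integral_sum has_bochner_integral_mult_right) (simp add: hbi ec)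
  moreover have "has_bochner_integral PH (\<lambda>x. 2 * (\<Sum>i<l. w2 * (e i x * r i (msgs x)))) (2 * (\<Sum>i<l. w2 * 0))"
    by (intro has_bochner_integral_sum has_bochner_integral_mult_right) (simp add: hbi er)
  moreover have "has_bochner_integral PH (\<lambda>x. 2 * (\<Sum>i<l. \<Sum>j<l. c * (e i x * r j (msgs x)))) (2 * (\<Sum>i<l. \<Sum>j<l. c * 0))"
    by (intro has_bochner_integral_sum has_bochner_integral_mult_right) (simp add: hbi er)
  moreover have "has_bochner_integral PH (\<lambda>x. qf l w1 w2 (\<lambda>i. r i (msgs x))) (LINT x|PH. qf l w1 w2 (\<lambda>i. r i (msgs x)))"
    using rr by (simp add: hbi)
  ultimately have "has_bochner_integral PH
    (\<lambda>x. (\<Sum>i<l. w2 * (e i x)\<^sup>2) + (\<Sum>i<l. \<Sum>j<l. c * (e i x * e j x)) + 2 * (\<Sum>i<l. w2 * (e i x * r i (msgs x))) +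
   2 * (\<Sum>i<l. \<Sum>j<l. c * (e i x * r j (msgs x))) + qf l w1 w2 (\<lambda>i. r i (msgs x)))
    ((\<Sum>i<l. w2 * (LINT x|Q. (res i x)\<^sup>2)) + (\<Sum>i<l. \<Sum>j<l. c * (if i = j then (LINT x|Q. (res i x)\<^sup>2) else 0)) +
     2 * (\<Sum>i<l. w2 * 0) + 2 * (\<Sum>i<l. \<Sum>j<l. c * 0) + (LINT x|PH. qf l w1 w2 (\<lambda>i. r i (msgs x))))"
    by (intro has_bochner_integral_add)
  then have hb: "has_bochner_integral PH
    (\<lambda>x. (\<Sum>i<l. w2 * (e i x)\<^sup>2) + (\<Sum>i<l. \<Sum>j<l. c * (e i x * e j x)) + 2 * (\<Sum>i<l. w2 * (e i x * r i (msgs x))) +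
   2 * (\<Sum>i<l. \<Sum>j<l. c * (e i x * r j (msgs x))) + qf l w1 w2 (\<lambda>i. r i (msgs x)))
    ((\<Sum>i<l. w2 * (LINT x|Q. (res i x)\<^sup>2)) + (\<Sum>i<l. \<Sum>j<l. c * (if i = j then (LINT x|Q. (res i x)\<^sup>2) else 0)) +
     (LINT x|PH. qf l w1 w2 (\<lambda>i. r i (msgs x))))" by simp
  show "integrable PH (\<lambda>x. qf l w1 w2 (\<lambda>i. f (x i) - T (msgs x) i))"
    unfolding q using hb by (simp only: hbi)
  have "(LINT x|PH. qf l w1 w2 (\<lambda>i. f (x i) - T (msgs x) i)) =
     (\<Sum>i<l. w2 * (LINT x|Q. (res i x)\<^sup>2)) + (\<Sum>i<l. \<Sum>j<l. c * (if i = j then (LINT x|Q. (res i x)\<^sup>2) else 0)) + (LINT x|PH. qf l w1 w2 (\<lambda>i. r i (msgs x)))"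
    unfolding q using has_bochner_integral_integral_eq[OF hb] .
  also have "(\<Sum>i<l. \<Sum>j<l. c * (if i = j then (LINT x|Q. (res i x)\<^sup>2) else 0)) = (\<Sum>i<l. c * (LINT x|Q. (res i x)\<^sup>2))"
    by (intro sum.cong refl) (simp add: if_distrib[where f="\<lambda>y. c * y"] cong: if_cong)
  also have "(\<Sum>i<l. w2 * (LINT x|Q. (res i x)\<^sup>2)) + (\<Sum>i<l. c * (LINT x|Q. (res i x)\<^sup>2)) = (\<Sum>i<l. LINT x|Q. (res i x)\<^sup>2)"
    by (simp only: sum_distrib_left[symmetric] ring_distribs(2)[symmetric] wc mult_1)
  finally show "(\<Sum>i<l. LINT x|Q. (res i x)\<^sup>2) \<le> (LINT x|PH. qf l w1 w2 (\<lambda>i. f (x i) - T (msgs x) i))"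
    using Bochner_Integration.integral_nonneg[of PH "\<lambda>x. qf l w1 w2 (\<lambda>i. r i (msgs x))"] qf_nonneg[OF w(1,2)] by simp
qed

end

section \<open>The canonical source\<close>

definition circ :: "nat \<Rightarrow> real \<Rightarrow> real \<Rightarrow> (nat \<Rightarrow> real) \<Rightarrow> nat \<Rightarrow> real" where
  "circ l a1 a2 x i = a2 * x i + (a1 - a2) * (\<Sum>j<l. x j) / real l"

lemma circ_add: "circ l a1 a2 (\<lambda>i. x i + y i) i = circ l a1 a2 x i + circ l a1 a2 y i"
  by (simp add: circ_def sum.distrib algebra_simps add_divide_distrib diff_divide_distrib)

lemma circ_diff: "circ l a1 a2 (\<lambda>i. x i - y i) i = circ l a1 a2 x i - circ l a1 a2 y i"
  by (simp add: circ_def sum_subtractf algebra_simps add_divide_distrib diff_divide_distrib)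

lemma circ_scale: "circ l a1 a2 (\<lambda>i. c * x i) i = c * circ l a1 a2 x i"
  by (simp add: circ_def sum_distrib_left[symmetric] algebra_simps add_divide_distrib diff_divide_distrib)

lemma circ_id: "circ l a a x i = a * x i"
  by (simp add: circ_def)

lemma circ_coef_add: "circ l a1 a2 x i + circ l b1 b2 x i = circ l (a1 + b1) (a2 + b2) x i"
  by (simp add: circ_def algebra_simps add_divide_distrib diff_divide_distrib)

lemma circ_coef_scale: "c * circ l a1 a2 x i = circ l (c * a1) (c * a2) x i"
  by (simp add: circ_def algebra_simps add_divide_distrib diff_divide_distrib)

lemma circ_cong: "(\<And>i. i < l \<Longrightarrow> x i = y i) \<Longrightarrow> i < l \<Longrightarrow> circ l a1 a2 x i = circ l a1 a2 y i"
  using sum.cong[OF refl, of "{..<l}" x y] by (simp add: circ_def)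

lemma sum_circ: "0 < l \<Longrightarrow> (\<Sum>i<l. circ l a1 a2 x i) = a1 * (\<Sum>i<l. x i)"
  by (simp add: circ_def sum.distrib sum_distrib_left[symmetric] left_diff_distrib)

lemma circ_circ: "0 < l \<Longrightarrow> circ l a1 a2 (circ l b1 b2 x) i = circ l (a1 * b1) (a2 * b2) x i"
  unfolding circ_def[of l a1 a2 "circ l b1 b2 x"] sum_circ by (simp add: circ_def field_simps)

lemma circ_adjoint: "(\<Sum>i<l. a i * circ l a1 a2 x i) = (\<Sum>i<l. circ l a1 a2 a i * x i)"
proof -
  have 1: "a i * circ l a1 a2 x i = a2 * (a i * x i) + (a1 - a2) / real l * (\<Sum>j<l. x j) * a i" for i by (simp add: circ_def algebra_simps)
  have 2: "circ l a1 a2 a i * x i = a2 * (a i * x i) + (a1 - a2) / real l * (\<Sum>j<l. a j) * x i" for i by (simp add: circ_def algebra_simps)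
  show ?thesis unfolding 1 2 by (simp only: sum.distrib sum_distrib_left[symmetric]) (simp add: mult_ac)
qed

lemma qf_circ_form: "qf l e1 e2 a = (\<Sum>i<l. circ l e1 e2 a i * a i)"
proof -
  have "circ l e1 e2 a i * a i = e2 * (a i)\<^sup>2 + (e1 - e2) / real l * (\<Sum>j<l. a j) * a i" for i
    by (simp add: circ_def algebra_simps power2_eq_square)
  then show ?thesis unfolding qf_def by (simp only: sum.distrib sum_distrib_left[symmetric]) (simp add: power2_eq_square)
qed

lemma qf_circ: "0 < l \<Longrightarrow> qf l e1 e2 (circ l a1 a2 x) = qf l (e1 * a1\<^sup>2) (e2 * a2\<^sup>2) x"
  unfolding qf_circ_form by (subst circ_adjoint) (simp add: circ_circ power2_eq_square mult_ac)

lemma qf_plus: "qf l e1 e2 (\<lambda>i. x i + y i) = qf l e1 e2 x + qf l e1 e2 y + 2 * (\<Sum>i<l. circ l e1 e2 y i * x i)"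
proof -
  have "(\<Sum>i<l. circ l e1 e2 x i * y i) = (\<Sum>i<l. circ l e1 e2 y i * x i)"
    using circ_adjoint[of x l e1 e2 y] by (simp add: mult.commute)
  then show ?thesis by (simp add: qf_circ_form circ_add ring_distribs sum.distrib)
qed

text \<open>Levy's theorem identifies the law with that of sqrt v times a standard normal variable;
  this includes v = 0.\<close>

lemma gaussian_char_moments:
  fixes Y :: "'a \<Rightarrow> real"
  assumes P: "prob_space P" and Y[measurable]: "Y \<in> borel_measurable P" and v: "0 \<le> v"
    and c: "\<And>b. (CLINT x|P. iexp (b * Y x)) = exp (- (v * b\<^sup>2) / 2)"
  shows "integrable P (\<lambda>x. (Y x)\<^sup>2)" "(LINT x|P. (Y x)\<^sup>2) = v"
proof -
  interpret P: prob_space P by fact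
  interpret N: prob_space stdN by (rule prob_space_stdN)
  have 1: "char (distr P borel Y) b = exp (- (v * b\<^sup>2) / 2)" for b
    unfolding char_def using c[of b] by (subst integral_distr) auto
  have 2: "char (distr stdN borel (\<lambda>x. sqrt v * x)) b = exp (- (v * b\<^sup>2) / 2)" for b
  proof -
    have "char (distr stdN borel (\<lambda>x. sqrt v * x)) b = (CLINT x|stdN. iexp ((b * sqrt v) * x))"
      unfolding char_def by (subst integral_distr) (auto simp: mult_ac)
    also have "\<dots> = char stdN (b * sqrt v)" unfolding char_def ..
    also have "\<dots> = exp (- (v * b\<^sup>2) / 2)"
      unfolding char_std_normal_distribution using v by (simp add: power_mult_distrib mult_ac)
    finally show ?thesis .
  qed
  have d: "distr P borel Y = distr stdN borel (\<lambda>x. sqrt v * x)"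
    by (rule Levy_uniqueness)
       (auto simp: real_distribution_def real_distribution_axioms_def 1 2 intro!: P.prob_space_distr N.prob_space_distr)
  have i: "integrable (distr stdN borel (\<lambda>x. sqrt v * x)) (\<lambda>y. y\<^sup>2)"
    using integrable_std_normal_distribution_moment[of 2] by (simp add: integrable_distr_eq power_mult_distrib)
  then show "integrable P (\<lambda>x. (Y x)\<^sup>2)" unfolding d[symmetric] by (simp add: integrable_distr_eq)
  have "(LINT x|P. (Y x)\<^sup>2) = (LINT y|distr P borel Y. y\<^sup>2)" by (simp add: integral_distr)
  also have "\<dots> = v"
    unfolding d using v std_normal_distribution_even_moments(1)[of 1] by (simp add: integral_distr power_mult_distrib)
  finally show "(LINT x|P. (Y x)\<^sup>2) = v" .
qed

lemma PiM_iexp_sum: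
  fixes f :: "'i \<Rightarrow> 'a \<Rightarrow> real"
  assumes N: "prob_space N" and I: "finite I" and f[measurable]: "\<And>i. i \<in> I \<Longrightarrow> f i \<in> borel_measurable N"
  shows "(CLINT x|PiM I (\<lambda>_. N). iexp (\<Sum>i\<in>I. f i (x i))) = (\<Prod>i\<in>I. CLINT x|N. iexp (f i x))"
proof -
  interpret N: prob_space N by fact
  interpret P: product_sigma_finite "\<lambda>_::'i. N" by standard
  have "(CLINT x|PiM I (\<lambda>_. N). iexp (\<Sum>i\<in>I. f i (x i))) = (CLINT x|PiM I (\<lambda>_. N). (\<Prod>i\<in>I. iexp (f i (x i))))"
    by (simp only: of_real_sum sum_distrib_left exp_sum[OF I])
  also have "\<dots> = (\<Prod>i\<in>I. CLINT x|N. iexp (f i x))"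
    by (rule P.product_integral_prod[OF I]) (rule N.integrable_iexp; simp)
  finally show ?thesis .
qed

lemma std_linear_char:
  fixes a :: "nat \<Rightarrow> real"
  shows "(CLINT x|PiM {..<l} (\<lambda>_. stdN). iexp (\<Sum>i<l. a i * x i)) = complex_of_real (exp (- (\<Sum>i<l. (a i)\<^sup>2) / 2))"
proof -
  have "(CLINT x|PiM {..<l} (\<lambda>_. stdN). iexp (\<Sum>i<l. a i * x i)) = (\<Prod>i<l. CLINT x|stdN. iexp (a i * x))"
    by (rule PiM_iexp_sum[OF prob_space_stdN finite_lessThan, where f="\<lambda>i x. a i * x"]) simp
  also have "\<dots> = (\<Prod>i<l. complex_of_real (exp (- (a i)\<^sup>2 / 2)))"
    using char_std_normal_distribution unfolding char_def fun_eq_iff by simp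
  finally show ?thesis unfolding of_real_prod[symmetric] exp_sum[OF finite_lessThan, symmetric] by (simp add: sum_negf[symmetric] sum_divide_distrib)
qed

lemma std_array_char:
  fixes a :: "nat \<Rightarrow> nat \<Rightarrow> real"
  shows "(CLINT x|PiM {..<n} (\<lambda>_. PiM {..<l} (\<lambda>_. stdN)). iexp (\<Sum>t<n. \<Sum>i<l. a t i * x t i)) = complex_of_real (exp (- (\<Sum>t<n. \<Sum>i<l. (a t i)\<^sup>2) / 2))"
proof -
  have "(CLINT x|PiM {..<n} (\<lambda>_. PiM {..<l} (\<lambda>_. stdN)). iexp (\<Sum>t<n. \<Sum>i<l. a t i * x t i)) = (\<Prod>t<n. CLINT x|PiM {..<l} (\<lambda>_. stdN). iexp (\<Sum>i<l. a t i * x i))"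
    proof (rule PiM_iexp_sum[of _ "{..<n}" "\<lambda>t x. \<Sum>i<l. a t i * x i"])
    show "(\<lambda>x. \<Sum>i<l. a t i * x i) \<in> borel_measurable (PiM {..<l} (\<lambda>_. stdN))" for t
    proof (intro borel_measurable_sum borel_measurable_times borel_measurable_const)
      show "(\<lambda>x. x i) \<in> borel_measurable (PiM {..<l} (\<lambda>_. stdN))" if "i \<in> {..<l}" for i
        using measurable_component_singleton[OF that, of "\<lambda>_. stdN"] by simp
    qed
  qed (simp_all add: prob_space_PiM prob_space_stdN)
  also have "\<dots> = (\<Prod>t<n. complex_of_real (exp (- (\<Sum>i<l. (a t i)\<^sup>2) / 2)))" by (simp only: std_linear_char)
  finally show ?thesis unfolding of_real_prod[symmetric] exp_sum[OF finite_lessThan, symmetric] by (simp add: sum_negf[symmetric] sum_divide_distrib)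
qed

text \<open>Here \<open>r1\<^sup>2 + sg\<^sup>2\<close> and \<open>r2\<^sup>2 + sg\<^sup>2\<close> are the eigenvalues of the covariance of \<open>src\<close>. The white vector \<open>G\<close> is
  indexed by time first and \<open>H\<close> by user first, so that \<open>H\<close> splits into independent user blocks.\<close>

locale canon =
  fixes l n :: nat and r1 r2 sg :: real
  assumes l0: "0 < l"
begin

abbreviation "PG \<equiv> PiM {..<n} (\<lambda>_. PiM {..<l} (\<lambda>_. stdN))"
abbreviation "PQ \<equiv> PiM {..<n} (\<lambda>_. stdN)"
abbreviation "PH \<equiv> PiM {..<l} (\<lambda>_. PQ)"
abbreviation "can \<equiv> PG \<Otimes>\<^sub>M PH"

sublocale PG: prob_space PG by (intro prob_space_PiM prob_space_stdN)
sublocale PQ: prob_space PQ by (intro prob_space_PiM prob_space_stdN)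
sublocale PH: prob_space PH by (intro prob_space_PiM prob_space_stdN)
sublocale can: prob_space can by (intro prob_space_pair prob_space_PiM prob_space_stdN)
sublocale PGH: pair_prob_space PG PH ..

lemma PQ_coord[measurable]: "t < n \<Longrightarrow> (\<lambda>x. x t) \<in> borel_measurable PQ"
  using measurable_component_singleton[of t "{..<n}" "\<lambda>_. stdN"] by simp

lemma G_coord[measurable]: "t < n \<Longrightarrow> i < l \<Longrightarrow> (\<lambda>g. g t i) \<in> borel_measurable PG"
  using measurable_compose[OF measurable_component_singleton[of t "{..<n}" "\<lambda>_. PiM {..<l} (\<lambda>_. stdN)"]
      measurable_component_singleton[of i "{..<l}" "\<lambda>_. stdN"]] by simp

lemma H_coord[measurable]: "t < n \<Longrightarrow> i < l \<Longrightarrow> (\<lambda>h. h i t) \<in> borel_measurable PH"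
  using measurable_compose[OF measurable_component_singleton[of i "{..<l}" "\<lambda>_. PQ"]
      measurable_component_singleton[of t "{..<n}" "\<lambda>_. stdN"]] by simp

lemma can_coord[measurable]:
  "t < n \<Longrightarrow> i < l \<Longrightarrow> (\<lambda>\<omega>. fst \<omega> t i) \<in> borel_measurable can"
  "t < n \<Longrightarrow> i < l \<Longrightarrow> (\<lambda>\<omega>. snd \<omega> i t) \<in> borel_measurable can"
  using measurable_compose[OF measurable_fst G_coord] measurable_compose[OF measurable_snd H_coord] by auto

lemma can_char:
  fixes \<alpha> \<eta> :: "nat \<Rightarrow> nat \<Rightarrow> real"
  shows "(CLINT \<omega>|can. iexp ((\<Sum>t<n. \<Sum>i<l. \<alpha> t i * fst \<omega> t i) + (\<Sum>t<n. \<Sum>i<l. \<eta> t i * snd \<omega> i t))) =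
    complex_of_real (exp (- (\<Sum>t<n. (\<Sum>i<l. (\<alpha> t i)\<^sup>2) + (\<Sum>i<l. (\<eta> t i)\<^sup>2)) / 2))"
proof -
  define A where "A g = (\<Sum>t<n. \<Sum>i<l. \<alpha> t i * g t i)" for g :: "nat \<Rightarrow> nat \<Rightarrow> real"
  define B where "B h = (\<Sum>t<n. \<Sum>i<l. \<eta> t i * h i t)" for h :: "nat \<Rightarrow> nat \<Rightarrow> real"
  have A[measurable]: "A \<in> borel_measurable PG" unfolding A_def[abs_def] by (intro borel_measurable_sum borel_measurable_times borel_measurable_const G_coord) auto
  have B[measurable]: "B \<in> borel_measurable PH" unfolding B_def[abs_def] by (intro borel_measurable_sum borel_measurable_times borel_measurable_const H_coord) auto
  have m: "(\<lambda>\<omega>. A (fst \<omega>) + B (snd \<omega>)) \<in> borel_measurable can" by measurable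
  have "(CLINT \<omega>|can. iexp (A (fst \<omega>) + B (snd \<omega>))) = (CLINT \<omega>|can. case \<omega> of (g, h) \<Rightarrow> iexp (A g + B h))"
    by (simp add: case_prod_beta)
  also have "\<dots> = (CLINT g|PG. CLINT h|PH. iexp (A g + B h))"
    by (rule PGH.integral_fst[symmetric], unfold case_prod_beta) (rule can.integrable_iexp; use m in simp)
  also have "\<dots> = (CLINT g|PG. CLINT h|PH. iexp (A g) * iexp (B h))"
    by (simp only: of_real_add distrib_left exp_add)
  also have "\<dots> = (CLINT g|PG. iexp (A g)) * (CLINT h|PH. iexp (B h))"
    by simp
  also have "(CLINT g|PG. iexp (A g)) = complex_of_real (exp (- (\<Sum>t<n. \<Sum>i<l. (\<alpha> t i)\<^sup>2) / 2))"
    unfolding A_def by (rule std_array_char)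
  also have "(CLINT h|PH. iexp (B h)) = complex_of_real (exp (- (\<Sum>t<n. \<Sum>i<l. (\<eta> t i)\<^sup>2) / 2))"
    unfolding B_def using std_array_char[of l n "\<lambda>i t. \<eta> t i"]
    by (subst (1 2) sum.swap) simp
  finally show ?thesis unfolding A_def B_def of_real_mult[symmetric] exp_add[symmetric]
    by (simp add: sum.distrib add_divide_distrib diff_divide_distrib)
qed

abbreviation "I \<equiv> {..<n} \<times> {..<l}"

definition src :: "(nat \<Rightarrow> nat \<Rightarrow> real) \<times> (nat \<Rightarrow> nat \<Rightarrow> real) \<Rightarrow> nat \<Rightarrow> nat \<Rightarrow> real" where
  "src \<omega> t i = circ l r1 r2 (fst \<omega> t) i + sg * snd \<omega> i t"

definition form :: "nat \<Rightarrow> (nat \<Rightarrow> real) \<Rightarrow> (nat \<Rightarrow> real) \<Rightarrow> (nat \<Rightarrow> nat \<Rightarrow> real) \<times> (nat \<Rightarrow> nat \<Rightarrow> real) \<Rightarrow> real" where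
  "form t \<beta> \<eta> \<omega> = (\<Sum>i<l. \<beta> i * fst \<omega> t i) + (\<Sum>i<l. \<eta> i * snd \<omega> i t)"

lemma form_meas[measurable]: "t < n \<Longrightarrow> form t \<beta> \<eta> \<in> borel_measurable can"
  unfolding form_def[abs_def] by (intro borel_measurable_add borel_measurable_sum borel_measurable_times borel_measurable_const can_coord) auto

lemma src_meas[measurable]: "t < n \<Longrightarrow> i < l \<Longrightarrow> (\<lambda>\<omega>. src \<omega> t i) \<in> borel_measurable can"
  unfolding src_def circ_def by (intro borel_measurable_add borel_measurable_divide borel_measurable_sum borel_measurable_times borel_measurable_const can_coord) auto

text \<open>\<open>orth\<close> says that the linear form is uncorrelated with every coordinate of
  the source at its own time. The cross term then drops out of the total variance and b enters only
  through its square, as \<open>reflection_orthogonal\<close> needs.\<close>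

lemma src_char:
  assumes s: "s < n" and orth: "\<And>i. i < l \<Longrightarrow> circ l r1 r2 \<beta> i + sg * \<eta> i = 0"
  shows "(CLINT \<omega>|can. iexp (b * form s \<beta> \<eta> \<omega> + (\<Sum>p\<in>I. a p * src \<omega> (fst p) (snd p)))) =
    complex_of_real (exp (- (b\<^sup>2 * ((\<Sum>i<l. (\<beta> i)\<^sup>2) + (\<Sum>i<l. (\<eta> i)\<^sup>2)) + (\<Sum>t<n. qf l (r1\<^sup>2 + sg\<^sup>2) (r2\<^sup>2 + sg\<^sup>2) (\<lambda>i. a (t, i)))) / 2))"
proof -
  define \<alpha> where "\<alpha> t i = of_bool (t = s) * (b * \<beta> i) + circ l r1 r2 (\<lambda>i. a (t, i)) i" for t i
  define \<theta> where "\<theta> t i = of_bool (t = s) * (b * \<eta> i) + sg * a (t, i)" for t i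
  have unit: "(\<Sum>t<n. of_bool (t = s) * f t) = f s" for f :: "nat \<Rightarrow> real"
    using s by (rule sum_unit)
  have lin: "b * form s \<beta> \<eta> \<omega> + (\<Sum>p\<in>I. a p * src \<omega> (fst p) (snd p)) =
     (\<Sum>t<n. \<Sum>i<l. \<alpha> t i * fst \<omega> t i) + (\<Sum>t<n. \<Sum>i<l. \<theta> t i * snd \<omega> i t)" for \<omega>
  proof -
    have "(\<Sum>i<l. \<alpha> t i * fst \<omega> t i) + (\<Sum>i<l. \<theta> t i * snd \<omega> i t) =
       of_bool (t = s) * (b * form t \<beta> \<eta> \<omega>) + (\<Sum>i<l. a (t, i) * src \<omega> t i)" for t
    proof -
      have "(\<Sum>i<l. a (t, i) * src \<omega> t i) = (\<Sum>i<l. circ l r1 r2 (\<lambda>i. a (t, i)) i * fst \<omega> t i) + (\<Sum>i<l. sg * a (t, i) * snd \<omega> i t)"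
        using circ_adjoint[of "\<lambda>i. a (t, i)" l r1 r2 "fst \<omega> t"] by (simp add: src_def ring_distribs sum.distrib mult_ac)
      moreover have "of_bool (t = s) * (b * form t \<beta> \<eta> \<omega>) = (\<Sum>i<l. of_bool (t = s) * (b * \<beta> i) * fst \<omega> t i) + (\<Sum>i<l. of_bool (t = s) * (b * \<eta> i) * snd \<omega> i t)"
        by (simp add: form_def ring_distribs sum_distrib_left mult_ac)
      ultimately show ?thesis by (simp add: \<alpha>_def \<theta>_def distrib_right sum.distrib)
    qed
    then have "(\<Sum>t<n. \<Sum>i<l. \<alpha> t i * fst \<omega> t i) + (\<Sum>t<n. \<Sum>i<l. \<theta> t i * snd \<omega> i t) =
      (\<Sum>t<n. of_bool (t = s) * (b * form t \<beta> \<eta> \<omega>)) + (\<Sum>t<n. \<Sum>i<l. a (t, i) * src \<omega> t i)"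
      by (simp only: sum.distrib[symmetric])
    moreover have "(\<Sum>t<n. \<Sum>i<l. a (t, i) * src \<omega> t i) = (\<Sum>p\<in>I. a p * src \<omega> (fst p) (snd p))"
      by (simp add: sum.cartesian_product case_prod_beta)
    ultimately show ?thesis by (simp only: unit)
  qed
  have sq: "(\<Sum>i<l. (\<alpha> t i)\<^sup>2) + (\<Sum>i<l. (\<theta> t i)\<^sup>2) =
     of_bool (t = s) * (b\<^sup>2 * ((\<Sum>i<l. (\<beta> i)\<^sup>2) + (\<Sum>i<l. (\<eta> i)\<^sup>2))) + qf l (r1\<^sup>2 + sg\<^sup>2) (r2\<^sup>2 + sg\<^sup>2) (\<lambda>i. a (t, i))" for t
  proof -
    let ?a = "\<lambda>i. a (t, i)"
    let ?c = "of_bool (t = s) * b"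
    have x: "(\<alpha> t i)\<^sup>2 + (\<theta> t i)\<^sup>2 = of_bool (t = s) * (b\<^sup>2 * (\<beta> i)\<^sup>2) + of_bool (t = s) * (b\<^sup>2 * (\<eta> i)\<^sup>2) +
       (circ l r1 r2 ?a i)\<^sup>2 + sg\<^sup>2 * (?a i)\<^sup>2 + 2 * ?c * (\<beta> i * circ l r1 r2 ?a i + sg * \<eta> i * ?a i)" for i
      by (cases "t = s") (simp_all add: \<alpha>_def \<theta>_def power2_eq_square algebra_simps)
    have z: "(\<Sum>i<l. \<beta> i * circ l r1 r2 ?a i + sg * \<eta> i * ?a i) = 0"
    proof -
      have "(\<Sum>i<l. \<beta> i * circ l r1 r2 ?a i + sg * \<eta> i * ?a i) = (\<Sum>i<l. (circ l r1 r2 \<beta> i + sg * \<eta> i) * ?a i)"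
        by (simp add: sum.distrib circ_adjoint distrib_right)
      then show ?thesis using orth by simp
    qed
    have "(\<Sum>i<l. (circ l r1 r2 ?a i)\<^sup>2) + (\<Sum>i<l. sg\<^sup>2 * (?a i)\<^sup>2) = qf l (r1\<^sup>2 + sg\<^sup>2) (r2\<^sup>2 + sg\<^sup>2) ?a"
      using qf_circ[OF l0, of 1 1 r1 r2 ?a] by (simp add: qf_one sum_distrib_left[symmetric] qf_coef_add[symmetric])
    moreover have "(\<Sum>i<l. 2 * ?c * (\<beta> i * circ l r1 r2 ?a i + sg * \<eta> i * ?a i)) = 0"
      using z by (simp only: sum_distrib_left[symmetric] mult_zero_right)
    ultimately show ?thesis
      by (simp only: sum.distrib[symmetric] x) (simp only: sum.distrib sum_distrib_left[symmetric] distrib_left add.assoc add_0_right mult_zero_right)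
  qed
  show ?thesis unfolding lin can_char sq sum.distrib unit ..
qed

lemma form_moments:
  assumes s: "s < n"
  shows "integrable can (\<lambda>\<omega>. (form s \<beta> \<eta> \<omega>)\<^sup>2)" "(LINT \<omega>|can. (form s \<beta> \<eta> \<omega>)\<^sup>2) = (\<Sum>i<l. (\<beta> i)\<^sup>2) + (\<Sum>i<l. (\<eta> i)\<^sup>2)"
proof -
  have unit: "(\<Sum>t<n. of_bool (t = s) * f t) = f s" for f :: "nat \<Rightarrow> real"
    using s by (rule sum_unit)
  let ?V = "(\<Sum>i<l. (\<beta> i)\<^sup>2) + (\<Sum>i<l. (\<eta> i)\<^sup>2)"
  have c: "(CLINT \<omega>|can. iexp (b * form s \<beta> \<eta> \<omega>)) = exp (- (?V * b\<^sup>2) / 2)" for b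
  proof -
    have 1: "(\<Sum>t<n. \<Sum>i<l. of_bool (t = s) * (b * \<beta> i) * fst \<omega> t i) + (\<Sum>t<n. \<Sum>i<l. of_bool (t = s) * (b * \<eta> i) * snd \<omega> i t) = b * form s \<beta> \<eta> \<omega>" for \<omega>
      by (simp only: mult.assoc sum_distrib_left[symmetric] unit) (simp add: form_def distrib_left)
    have 2: "(\<Sum>t<n. (\<Sum>i<l. (of_bool (t = s) * (b * \<beta> i))\<^sup>2) + (\<Sum>i<l. (of_bool (t = s) * (b * \<eta> i))\<^sup>2)) = ?V * b\<^sup>2"
    proof -
      have "(\<Sum>i<l. (of_bool (t = s) * (b * \<beta> i))\<^sup>2) + (\<Sum>i<l. (of_bool (t = s) * (b * \<eta> i))\<^sup>2) = of_bool (t = s) * (?V * b\<^sup>2)" for t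
        by (cases "t = s") (simp_all add: power_mult_distrib sum_distrib_left[symmetric] distrib_left mult.commute)
      then show ?thesis by (simp only: unit)
    qed
    show ?thesis using can_char[of "\<lambda>t i. of_bool (t = s) * (b * \<beta> i)" "\<lambda>t i. of_bool (t = s) * (b * \<eta> i)"] unfolding 1 2 .
  qed
  have V: "0 \<le> ?V" by (simp add: sum_nonneg)
  show "integrable can (\<lambda>\<omega>. (form s \<beta> \<eta> \<omega>)\<^sup>2)" "(LINT \<omega>|can. (form s \<beta> \<eta> \<omega>)\<^sup>2) = ?V"
    using gaussian_char_moments[OF can.prob_space_axioms form_meas[OF s] V c] by blast+
qed

lemma form_orth:
  assumes s: "s < n" and orth: "\<And>i. i < l \<Longrightarrow> circ l r1 r2 \<beta> i + sg * \<eta> i = 0"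
    and k: "k \<in> borel_measurable (PiM I (\<lambda>_. borel))"
  shows "(LINT \<omega>|can. form s \<beta> \<eta> \<omega> * k (\<lambda>p\<in>I. src \<omega> (fst p) (snd p))) = 0"
proof (rule reflection_orthogonal[OF can.prob_space_axioms _ form_meas[OF s] _ _ k])
  show "(CLINT \<omega>|can. iexp (b * form s \<beta> \<eta> \<omega> + (\<Sum>p\<in>I. a p * src \<omega> (fst p) (snd p)))) =
     (CLINT \<omega>|can. iexp (- b * form s \<beta> \<eta> \<omega> + (\<Sum>p\<in>I. a p * src \<omega> (fst p) (snd p))))" for a b
    using src_char[OF s orth, of b a] src_char[OF s orth, of "- b" a] by (simp only: power2_minus)
qed auto

end

section \<open>Square-integrable vectors\<close>

lemma integrable_product:
  fixes f g :: "'a \<Rightarrow> real"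
  assumes [measurable]: "f \<in> borel_measurable M" "g \<in> borel_measurable M"
    and i: "integrable M (\<lambda>x. (f x)\<^sup>2)" "integrable M (\<lambda>x. (g x)\<^sup>2)"
  shows "integrable M (\<lambda>x. f x * g x)"
proof (rule Bochner_Integration.integrable_bound)
  show "integrable M (\<lambda>x. (f x)\<^sup>2 + (g x)\<^sup>2)" using i by simp
  have "\<bar>a * b\<bar> \<le> a\<^sup>2 + b\<^sup>2" for a b :: real
  proof -
    have "2 * \<bar>a * b\<bar> \<le> a\<^sup>2 + b\<^sup>2" using sum_squares_bound[of "\<bar>a\<bar>" "\<bar>b\<bar>"] by (simp add: abs_mult)
    then show ?thesis using abs_ge_zero[of "a * b"] by linarith
  qed
  then show "AE x in M. norm (f x * g x) \<le> norm ((f x)\<^sup>2 + (g x)\<^sup>2)"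
    by (auto intro: order_trans)
qed simp

lemma integrable_add_sq:
  fixes f g :: "'a \<Rightarrow> real"
  assumes m: "f \<in> borel_measurable M" "g \<in> borel_measurable M"
    and i: "integrable M (\<lambda>x. (f x)\<^sup>2)" "integrable M (\<lambda>x. (g x)\<^sup>2)"
  shows "integrable M (\<lambda>x. (f x + g x)\<^sup>2)"
  using integrable_product[OF m i] i by (simp add: power2_sum mult.assoc)

lemma integrable_sum_sq:
  fixes f :: "'i \<Rightarrow> 'a \<Rightarrow> real"
  assumes m: "\<And>i. i \<in> A \<Longrightarrow> f i \<in> borel_measurable M" and i: "\<And>i. i \<in> A \<Longrightarrow> integrable M (\<lambda>x. (f i x)\<^sup>2)"
  shows "integrable M (\<lambda>x. (\<Sum>i\<in>A. f i x)\<^sup>2)"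
  using m i
proof (induction A rule: infinite_finite_induct)
  case (insert a A)
  then show ?case using integrable_add_sq[of "f a" M "\<lambda>x. \<Sum>i\<in>A. f i x"] by simp
qed auto

lemma integrable_qf:
  assumes m: "\<And>i. i < l \<Longrightarrow> (\<lambda>x. f x i) \<in> borel_measurable M" and i: "\<And>i. i < l \<Longrightarrow> integrable M (\<lambda>x. (f x i)\<^sup>2)"
  shows "integrable M (\<lambda>x. qf l e1 e2 (f x))"
  unfolding qf_def
  by (intro Bochner_Integration.integrable_add integrable_mult_right integrable_divide_zero
      Bochner_Integration.integrable_sum integrable_sum_sq impI; use m i in simp)

lemma circ_square_integrable:
  assumes m: "\<And>i. i < l \<Longrightarrow> (\<lambda>x. f x i) \<in> borel_measurable M" and i: "\<And>i. i < l \<Longrightarrow> integrable M (\<lambda>x. (f x i)\<^sup>2)" and j: "j < l"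
  shows "(\<lambda>x. circ l a1 a2 (f x) j) \<in> borel_measurable M" "integrable M (\<lambda>x. (circ l a1 a2 (f x) j)\<^sup>2)"
proof -
  show "(\<lambda>x. circ l a1 a2 (f x) j) \<in> borel_measurable M" unfolding circ_def using m j by measurable
  have 1: "integrable M (\<lambda>x. ((a1 - a2) / real l * (\<Sum>i<l. f x i))\<^sup>2)"
    using integrable_sum_sq[of "{..<l}" "\<lambda>i x. f x i" M] m i unfolding power_mult_distrib by simp
  have 2: "integrable M (\<lambda>x. (a2 * f x j)\<^sup>2)" using i[OF j] by (simp add: power_mult_distrib)
  have "integrable M (\<lambda>x. (a2 * f x j + (a1 - a2) / real l * (\<Sum>i<l. f x i))\<^sup>2)"
    by (intro integrable_add_sq 1 2 borel_measurable_times borel_measurable_sum borel_measurable_const m j) auto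
  then show "integrable M (\<lambda>x. (circ l a1 a2 (f x) j)\<^sup>2)" by (simp add: circ_def)
qed

lemma circ_unit: "i < l \<Longrightarrow> (\<Sum>j<l. circ l a1 a2 (\<lambda>j. of_bool (j = i)) j * x j) = circ l a1 a2 x i"
  using circ_adjoint[of "\<lambda>j. of_bool (j = i)" l a1 a2 x] by (simp add: sum_unit)

lemma qf_unit: "0 < l \<Longrightarrow> i < l \<Longrightarrow> qf l e1 e2 (\<lambda>j. of_bool (j = i)) = (e1 + (real l - 1) * e2) / real l"
  using qf_circulant[of l i "\<lambda>j. of_bool (j = i)" 1 1 e1 e2] by simp

section \<open>Exchangeable linear forms in the white noise\<close>

context canon
begin

text \<open>Vector forms at time t with exchangeable coefficient matrices: b1, b2 act on G and e1,
  e2 on H. These matrices commute, so orthogonality to the source becomes one scalar equation per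
  eigenvalue.\<close>

definition cf :: "nat \<Rightarrow> real \<Rightarrow> real \<Rightarrow> real \<Rightarrow> real \<Rightarrow> (nat \<Rightarrow> nat \<Rightarrow> real) \<times> (nat \<Rightarrow> nat \<Rightarrow> real) \<Rightarrow> nat \<Rightarrow> real" where
  "cf t b1 b2 e1 e2 \<omega> i = circ l b1 b2 (fst \<omega> t) i + circ l e1 e2 (\<lambda>j. snd \<omega> j t) i"

lemma src_cf: "src \<omega> t i = cf t r1 r2 sg sg \<omega> i"
  by (simp add: src_def cf_def circ_id)

lemma circ_src: "circ l a1 a2 (src \<omega> t) i = cf t (a1 * r1) (a2 * r2) (a1 * sg) (a2 * sg) \<omega> i"
  unfolding src_cf[abs_def] cf_def[abs_def] circ_add circ_circ[OF l0] ..

lemma cf_form: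
  assumes i: "i < l"
  shows "cf t b1 b2 e1 e2 \<omega> i = form t (circ l b1 b2 (\<lambda>j. of_bool (j = i))) (circ l e1 e2 (\<lambda>j. of_bool (j = i))) \<omega>"
  unfolding form_def circ_unit[OF i] cf_def ..

lemma cf_meas[measurable]: "t < n \<Longrightarrow> i < l \<Longrightarrow> (\<lambda>\<omega>. cf t b1 b2 e1 e2 \<omega> i) \<in> borel_measurable can"
  using form_meas unfolding cf_form by simp

lemma circ_row_sq: "i < l \<Longrightarrow> (\<Sum>j<l. (circ l a1 a2 (\<lambda>j. of_bool (j = i)) j)\<^sup>2) = (a1\<^sup>2 + (real l - 1) * a2\<^sup>2) / real l"
  using qf_circ[OF l0, of 1 1 a1 a2 "\<lambda>j. of_bool (j = i)"] qf_unit[OF l0] by (simp add: qf_one)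

lemma cf_sq:
  assumes "t < n" "i < l"
  shows "integrable can (\<lambda>\<omega>. (cf t b1 b2 e1 e2 \<omega> i)\<^sup>2)"
    "(LINT \<omega>|can. (cf t b1 b2 e1 e2 \<omega> i)\<^sup>2) = (b1\<^sup>2 + e1\<^sup>2 + (real l - 1) * (b2\<^sup>2 + e2\<^sup>2)) / real l"
  unfolding cf_form[OF assms(2)] form_moments(2)[OF assms(1)] circ_row_sq[OF assms(2)] using form_moments(1)[OF assms(1)]
  by (simp_all add: add_divide_distrib[symmetric] algebra_simps)

lemma cf_qf_moment:
  assumes t: "t < n"
  shows "(LINT \<omega>|can. qf l f1 f2 (cf t b1 b2 e1 e2 \<omega>)) = f1 * (b1\<^sup>2 + e1\<^sup>2) + (real l - 1) * f2 * (b2\<^sup>2 + e2\<^sup>2)"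
proof -
  have s: "(\<Sum>i<l. cf t b1 b2 e1 e2 \<omega> i) = form t (\<lambda>_. b1) (\<lambda>_. e1) \<omega>" for \<omega>
    unfolding cf_def sum.distrib sum_circ[OF l0] form_def by (simp add: sum_distrib_left)
  have 1: "has_bochner_integral can (\<lambda>\<omega>. \<Sum>i<l. (cf t b1 b2 e1 e2 \<omega> i)\<^sup>2) (\<Sum>i<l. (b1\<^sup>2 + e1\<^sup>2 + (real l - 1) * (b2\<^sup>2 + e2\<^sup>2)) / real l)"
    by (intro has_bochner_integral_sum) (use cf_sq t in \<open>auto simp: has_bochner_integral_iff\<close>)
  have 2: "has_bochner_integral can (\<lambda>\<omega>. (\<Sum>i<l. cf t b1 b2 e1 e2 \<omega> i)\<^sup>2) (real l * (b1\<^sup>2 + e1\<^sup>2))"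
    unfolding s using form_moments[OF t] by (simp add: has_bochner_integral_iff distrib_left)
  have "has_bochner_integral can (\<lambda>\<omega>. qf l f1 f2 (cf t b1 b2 e1 e2 \<omega>))
     (f2 * (\<Sum>i<l. (b1\<^sup>2 + e1\<^sup>2 + (real l - 1) * (b2\<^sup>2 + e2\<^sup>2)) / real l) + (f1 - f2) * (real l * (b1\<^sup>2 + e1\<^sup>2)) / real l)"
    unfolding qf_def by (intro has_bochner_integral_add has_bochner_integral_mult_right has_bochner_integral_divide_zero 1 2)
  moreover have "f2 * (\<Sum>i<l. (u + (real l - 1) * v) / real l) + (f1 - f2) * (real l * u) / real l = f1 * u + (real l - 1) * f2 * v" for u v
  proof -
    have "(\<Sum>i<l. (u + (real l - 1) * v) / real l) = u + (real l - 1) * v" "(f1 - f2) * (real l * u) / real l = (f1 - f2) * u"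
      using l0 by simp_all
    then show ?thesis by (simp only:) (simp add: algebra_simps)
  qed
  ultimately show ?thesis by (simp only: has_bochner_integral_iff)
qed

lemma cf_orth:
  assumes t: "t < n" and i: "i < l" and o: "r1 * b1 + sg * e1 = 0" "r2 * b2 + sg * e2 = 0"
    and k: "k \<in> borel_measurable (PiM I (\<lambda>_. borel))"
  shows "(LINT \<omega>|can. cf t b1 b2 e1 e2 \<omega> i * k (\<lambda>p\<in>I. src \<omega> (fst p) (snd p))) = 0"
  unfolding cf_form[OF i]
proof (rule form_orth[OF t _ k])
  fix j
  show "circ l r1 r2 (circ l b1 b2 (\<lambda>j. of_bool (j = i))) j + sg * circ l e1 e2 (\<lambda>j. of_bool (j = i)) j = 0"
    unfolding circ_circ[OF l0] circ_coef_scale circ_coef_add o by (simp add: circ_id)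
qed

text \<open>The first summand is orthogonal to every function of the source block and the second is
  such a function, so the cross term vanishes under any exchangeable form.\<close>

lemma cf_pythagoras:
  assumes t: "t < n" and o: "r1 * b1 + sg * e1 = 0" "r2 * b2 + sg * e2 = 0"
    and D: "\<And>i. i < l \<Longrightarrow> D i \<in> borel_measurable (PiM I (\<lambda>_. borel))"
    and D2: "\<And>i. i < l \<Longrightarrow> integrable can (\<lambda>\<omega>. (D i (\<lambda>p\<in>I. src \<omega> (fst p) (snd p)))\<^sup>2)"
  shows "integrable can (\<lambda>\<omega>. qf l f1 f2 (\<lambda>i. cf t b1 b2 e1 e2 \<omega> i + D i (\<lambda>p\<in>I. src \<omega> (fst p) (snd p))))"
    "(LINT \<omega>|can. qf l f1 f2 (\<lambda>i. cf t b1 b2 e1 e2 \<omega> i + D i (\<lambda>p\<in>I. src \<omega> (fst p) (snd p)))) =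
     f1 * (b1\<^sup>2 + e1\<^sup>2) + (real l - 1) * f2 * (b2\<^sup>2 + e2\<^sup>2) + (LINT \<omega>|can. qf l f1 f2 (\<lambda>i. D i (\<lambda>p\<in>I. src \<omega> (fst p) (snd p))))"
proof -
  let ?S = "\<lambda>\<omega>. \<lambda>p\<in>I. src \<omega> (fst p) (snd p)"
  have S: "?S \<in> can \<rightarrow>\<^sub>M PiM I (\<lambda>_. borel)" by (intro measurable_restrict src_meas) auto
  have Dm: "(\<lambda>\<omega>. D i (?S \<omega>)) \<in> borel_measurable can" if "i < l" for i by (rule measurable_compose[OF S D[OF that]])
  note cs = circ_square_integrable[of l "\<lambda>\<omega> i. D i (?S \<omega>)" can, OF Dm D2]
  have "(\<lambda>s. circ l f1 f2 (\<lambda>i. D i s) i) \<in> borel_measurable (PiM I (\<lambda>_. borel))" if "i < l" for i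
    unfolding circ_def using D that by measurable
  then have x: "has_bochner_integral can (\<lambda>\<omega>. cf t b1 b2 e1 e2 \<omega> i * circ l f1 f2 (\<lambda>i. D i (?S \<omega>)) i) 0" if "i < l" for i
    using cf_orth[OF t that o, of "\<lambda>s. circ l f1 f2 (\<lambda>i. D i s) i"] that t
    by (auto simp: has_bochner_integral_iff intro!: integrable_product cs cf_sq cf_meas)
  have "has_bochner_integral can (\<lambda>\<omega>. qf l f1 f2 (cf t b1 b2 e1 e2 \<omega>) + qf l f1 f2 (\<lambda>i. D i (?S \<omega>)) +
      2 * (\<Sum>i<l. cf t b1 b2 e1 e2 \<omega> i * circ l f1 f2 (\<lambda>i. D i (?S \<omega>)) i))
     (f1 * (b1\<^sup>2 + e1\<^sup>2) + (real l - 1) * f2 * (b2\<^sup>2 + e2\<^sup>2) + (LINT \<omega>|can. qf l f1 f2 (\<lambda>i. D i (?S \<omega>))) + 2 * (\<Sum>i<l. 0))"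
    using x by (intro has_bochner_integral_add has_bochner_integral_mult_right has_bochner_integral_sum)
      (auto simp: has_bochner_integral_iff cf_qf_moment[OF t] intro!: integrable_qf cf_sq cf_meas t Dm D2)
  then have hb: "has_bochner_integral can (\<lambda>\<omega>. qf l f1 f2 (\<lambda>i. cf t b1 b2 e1 e2 \<omega> i + D i (?S \<omega>)))
     (f1 * (b1\<^sup>2 + e1\<^sup>2) + (real l - 1) * f2 * (b2\<^sup>2 + e2\<^sup>2) + (LINT \<omega>|can. qf l f1 f2 (\<lambda>i. D i (?S \<omega>))))"
    unfolding qf_plus by (simp add: mult.commute)
  show "integrable can (\<lambda>\<omega>. qf l f1 f2 (\<lambda>i. cf t b1 b2 e1 e2 \<omega> i + D i (?S \<omega>)))"
    using hb by (simp add: has_bochner_integral_iff)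
  show "(LINT \<omega>|can. qf l f1 f2 (\<lambda>i. cf t b1 b2 e1 e2 \<omega> i + D i (?S \<omega>))) =
     f1 * (b1\<^sup>2 + e1\<^sup>2) + (real l - 1) * f2 * (b2\<^sup>2 + e2\<^sup>2) + (LINT \<omega>|can. qf l f1 f2 (\<lambda>i. D i (?S \<omega>)))"
    using hb by (simp add: has_bochner_integral_iff)
qed

end

section \<open>The rate bound\<close>

lemma PiM_nn_exp_sum:
  fixes f :: "'i \<Rightarrow> 'a \<Rightarrow> real"
  assumes N: "prob_space N" and I: "finite I" and f[measurable]: "\<And>i. i \<in> I \<Longrightarrow> f i \<in> borel_measurable N"
  shows "(\<integral>\<^sup>+x. ennreal (exp (\<Sum>i\<in>I. f i (x i))) \<partial>PiM I (\<lambda>_. N)) = (\<Prod>i\<in>I. \<integral>\<^sup>+x. ennreal (exp (f i x)) \<partial>N)"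
proof -
  interpret N: prob_space N by fact
  interpret P: product_sigma_finite "\<lambda>_::'i. N" by standard
  have "(\<integral>\<^sup>+x. ennreal (exp (\<Sum>i\<in>I. f i (x i))) \<partial>PiM I (\<lambda>_. N)) = (\<integral>\<^sup>+x. (\<Prod>i\<in>I. ennreal (exp (f i (x i)))) \<partial>PiM I (\<lambda>_. N))"
    by (simp add: exp_sum[OF I] prod_ennreal)
  also have "\<dots> = (\<Prod>i\<in>I. \<integral>\<^sup>+x. ennreal (exp (f i x)) \<partial>N)"
    by (rule P.product_nn_integral_prod[OF I]) simp
  finally show ?thesis .
qed

locale canon_code = canon l n r1 r2 sg for l n r1 r2 sg +
  fixes \<phi> :: "nat \<Rightarrow> (nat \<Rightarrow> real) \<Rightarrow> nat" and C :: "nat \<Rightarrow> nat set" and q :: real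
  assumes C: "\<And>i. i < l \<Longrightarrow> finite (C i)" and \<phi>: "\<And>i. i < l \<Longrightarrow> \<phi> i \<in> vecM n \<rightarrow>\<^sub>M count_space UNIV"
    and \<phi>C: "\<And>i x. i < l \<Longrightarrow> x \<in> space (vecM n) \<Longrightarrow> \<phi> i x \<in> C i" and q: "0 < q"
begin

abbreviation "S1 \<equiv> r1\<^sup>2 + sg\<^sup>2"
abbreviation "S2 \<equiv> r2\<^sup>2 + sg\<^sup>2"
text \<open>\<open>c1\<close> and \<open>c2\<close> are the posterior eigenvalues of G given U =
  \<open>src\<close> + N(0, q), and \<open>cH\<close> below is the posterior variance of H_i given G
  and U_i. They serve as the covariances of the tilted laws.\<close>

abbreviation "c1 \<equiv> (sg\<^sup>2 + q) / (S1 + q)"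
abbreviation "c2 \<equiv> (sg\<^sup>2 + q) / (S2 + q)"
abbreviation "cH \<equiv> q / (sg\<^sup>2 + q)"

lemma pos: "0 < sg\<^sup>2 + q" "0 < S1 + q" "0 < S2 + q"
  using q by (simp_all add: add_nonneg_pos)

text \<open>The message tuple as a function of the flattened source block, the form in which the
  actual and the canonical source can be compared.\<close>

definition msgS :: "(nat \<times> nat \<Rightarrow> real) \<Rightarrow> nat \<Rightarrow> nat" where
  "msgS s = (\<lambda>i\<in>{..<l}. \<phi> i (\<lambda>t\<in>{..<n}. s (t, i)))"

definition msg :: "(nat \<Rightarrow> nat \<Rightarrow> real) \<times> (nat \<Rightarrow> nat \<Rightarrow> real) \<Rightarrow> nat \<Rightarrow> nat" where
  "msg \<omega> = (\<lambda>i\<in>{..<l}. \<phi> i (\<lambda>t\<in>{..<n}. src \<omega> t i))"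

text \<open>With G frozen, the message of user i is a function of its own block x of H alone; this
  is the independence that the locale \<open>users\<close> exploits.\<close>

definition \<kappa> :: "(nat \<Rightarrow> nat \<Rightarrow> real) \<Rightarrow> nat \<Rightarrow> (nat \<Rightarrow> real) \<Rightarrow> nat" where
  "\<kappa> g i x = \<phi> i (\<lambda>t\<in>{..<n}. circ l r1 r2 (g t) i + sg * x t)"

lemma msg_msgS: "msg \<omega> = msgS (\<lambda>p\<in>I. src \<omega> (fst p) (snd p))"
  by (auto simp: msg_def msgS_def fun_eq_iff intro!: arg_cong[where f="\<phi> _"])

lemma msg_\<kappa>: "msg (g, h) = (\<lambda>i\<in>{..<l}. \<kappa> g i (h i))"
  by (auto simp: msg_def \<kappa>_def src_def fun_eq_iff intro!: arg_cong[where f="\<phi> _"])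

lemma restrict_space: "restrict f {..<n} \<in> space (vecM n)"
  by (simp add: space_PiM)

lemma msgS_meas: "msgS \<in> PiM I (\<lambda>_. borel) \<rightarrow>\<^sub>M count_space UNIV"
  unfolding msgS_def[abs_def]
proof (rule measurable_restrict_count[where C=C])
  show "(\<lambda>s. \<phi> i (\<lambda>t\<in>{..<n}. s (t, i))) \<in> PiM I (\<lambda>_. borel) \<rightarrow>\<^sub>M count_space UNIV" if "i \<in> {..<l}" for i
    using that by (intro measurable_compose[OF _ \<phi>] measurable_restrict measurable_component_singleton) auto
qed (use C \<phi>C restrict_space in auto)

lemma src_block_meas: "(\<lambda>\<omega>. \<lambda>p\<in>I. src \<omega> (fst p) (snd p)) \<in> can \<rightarrow>\<^sub>M PiM I (\<lambda>_. borel)"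
  by (intro measurable_restrict src_meas) auto

lemma msg_code: "code can msg (PiE {..<l} C)"
proof
  show "msg \<in> can \<rightarrow>\<^sub>M count_space UNIV"
    unfolding msg_msgS[abs_def] by (rule measurable_compose[OF src_block_meas msgS_meas])
  show "finite (PiE {..<l} C)" using C by (intro finite_PiE) auto
  show "msg \<omega> \<in> PiE {..<l} C" for \<omega> using \<phi>C restrict_space by (auto simp: msg_def)
qed

lemma \<kappa>_joint: "i < l \<Longrightarrow> (\<lambda>(g, x). \<kappa> g i x) \<in> PG \<Otimes>\<^sub>M PQ \<rightarrow>\<^sub>M count_space UNIV"
  unfolding \<kappa>_def circ_def case_prod_beta
  by (intro measurable_compose[OF _ \<phi>] measurable_restrict borel_measurable_add borel_measurable_divide borel_measurable_sum borel_measurable_times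
     borel_measurable_const measurable_compose[OF measurable_fst G_coord] measurable_compose[OF measurable_snd PQ_coord]) auto

lemma \<kappa>_meas: "i < l \<Longrightarrow> \<kappa> g i \<in> PQ \<rightarrow>\<^sub>M count_space UNIV"
  unfolding \<kappa>_def[abs_def]
  by (intro measurable_compose[OF _ \<phi>] measurable_restrict borel_measurable_add borel_measurable_times borel_measurable_const PQ_coord) auto

lemma users: "t < n \<Longrightarrow> users l PQ (\<lambda>x. x t) (\<kappa> g) C"
proof (rule users.intro)
  assume t: "t < n"
  show "prob_space PQ" by (rule PQ.prob_space_axioms)
  show "(\<lambda>x. x t) \<in> borel_measurable PQ" using t by simp
  have d: "distr PQ stdN (\<lambda>x. x t) = stdN"
    using distr_PiM_component[of "{..<n}" "\<lambda>_. stdN" t] t prob_space_stdN by simp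
  have "integrable (distr PQ stdN (\<lambda>x. x t)) (\<lambda>x. x\<^sup>2)"
    unfolding d using integrable_std_normal_distribution_moment[of 2] by simp
  then show "integrable PQ (\<lambda>x. (x t)\<^sup>2)"
    using integrable_distr[of "\<lambda>x. x t" PQ stdN "\<lambda>x. x\<^sup>2"] t measurable_component_singleton[of t "{..<n}" "\<lambda>_. stdN"] by simp
  show "\<kappa> g i \<in> PQ \<rightarrow>\<^sub>M count_space UNIV" if "i < l" for i using \<kappa>_meas[OF that] .
  show "finite (C i)" if "i < l" for i using C[OF that] .
  show "\<kappa> g i x \<in> C i" if "i < l" for i x unfolding \<kappa>_def using \<phi>C[OF that restrict_space] .
qed

text \<open>The conditional mean of H_i at time t given G = g and the i-th message only; messages of
  the other users do not enter.\<close>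

definition hH :: "(nat \<Rightarrow> nat \<Rightarrow> real) \<Rightarrow> nat \<Rightarrow> nat \<Rightarrow> nat \<Rightarrow> real" where
  "hH g t = users.hat PQ (\<lambda>x. x t) (\<kappa> g)"

lemma hH_meas: "t < n \<Longrightarrow> i < l \<Longrightarrow> (\<lambda>g. hH g t i m) \<in> borel_measurable PG"
proof -
  assume t: "t < n" and i: "i < l"
  have 1: "(\<lambda>p. of_bool (\<kappa> (fst p) i (snd p) = m) :: real) \<in> borel_measurable (PG \<Otimes>\<^sub>M PQ)"
    using measurable_compose[OF \<kappa>_joint[OF i], of "\<lambda>k. of_bool (k = m) :: real" borel] by (simp add: case_prod_beta)
  have 2: "(\<lambda>p. snd p t * of_bool (\<kappa> (fst p) i (snd p) = m) :: real) \<in> borel_measurable (PG \<Otimes>\<^sub>M PQ)"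
    by (intro borel_measurable_times 1 measurable_compose[OF measurable_snd PQ_coord[OF t]])
  show ?thesis
    unfolding hH_def users.hat_def[OF users[OF t]]
    by (intro borel_measurable_divide PQ.borel_measurable_lebesgue_integral) (use 1 2 in \<open>simp_all add: case_prod_beta\<close>)
qed

definition gtilt :: "(nat \<Rightarrow> real) \<Rightarrow> (nat \<Rightarrow> real) \<Rightarrow> real" where
  "gtilt a x = - (ln c1 + (real l - 1) * ln c2) / 2 - qf l (1 / c1) (1 / c2) (\<lambda>i. x i - a i) / 2 + (\<Sum>i<l. (x i)\<^sup>2) / 2"

text \<open>Log-density of the tilted law for the message tuple b: G is centred at a, and given G
  the coordinates of H are independent with centres \<open>hH\<close>.\<close>

definition weight :: "(nat \<Rightarrow> nat \<Rightarrow> real) \<Rightarrow> (nat \<Rightarrow> nat) \<Rightarrow> (nat \<Rightarrow> nat \<Rightarrow> real) \<times> (nat \<Rightarrow> nat \<Rightarrow> real) \<Rightarrow> real" where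
  "weight a b \<omega> = (\<Sum>t<n. gtilt (a t) (fst \<omega> t)) + (\<Sum>i<l. \<Sum>t<n. tilt (hH (fst \<omega>) t i (b i)) cH (snd \<omega> i t))"

lemma gtilt_meas: "gtilt a \<in> borel_measurable (PiM {..<l} (\<lambda>_. stdN))"
proof -
  have [measurable]: "(\<lambda>x. x i) \<in> borel_measurable (PiM {..<l} (\<lambda>_. stdN))" if "i < l" for i
    using that measurable_component_singleton[of i "{..<l}" "\<lambda>_. stdN"] by simp
  show ?thesis unfolding gtilt_def[abs_def] qf_def by measurable
qed

lemma weight_meas: "weight a b \<in> borel_measurable can"
  unfolding weight_def[abs_def]
  by (intro borel_measurable_add borel_measurable_sum tilt_meas measurable_compose[OF _ gtilt_meas]
     measurable_compose[OF measurable_fst hH_meas] measurable_compose[OF measurable_fst measurable_component_singleton] can_coord) auto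

text \<open>H is integrated first with G frozen, because its centres depend on G. What remains is
  the tilt of G, which \<open>qf_tilt\<close> normalises.\<close>

lemma weight_integral: "(\<integral>\<^sup>+\<omega>. ennreal (exp (weight a b \<omega>)) \<partial>can) = 1"
proof -
  have cH: "0 < cH" using q pos by simp
  have inner: "(\<integral>\<^sup>+h. ennreal (exp (\<Sum>i<l. \<Sum>t<n. tilt (f i t) cH (h i t))) \<partial>PH) = 1" for f
  proof -
    have "(\<integral>\<^sup>+h. ennreal (exp (\<Sum>i<l. \<Sum>t<n. tilt (f i t) cH (h i t))) \<partial>PH) = (\<Prod>i<l. \<integral>\<^sup>+x. ennreal (exp (\<Sum>t<n. tilt (f i t) cH (x t))) \<partial>PQ)"
      by (rule PiM_nn_exp_sum[OF PQ.prob_space_axioms finite_lessThan, where f="\<lambda>i x. \<Sum>t<n. tilt (f i t) cH (x t)"])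
         (intro borel_measurable_sum tilt_meas PQ_coord; simp)
    also have "\<dots> = (\<Prod>i<l. \<Prod>t<n. \<integral>\<^sup>+x. ennreal (exp (tilt (f i t) cH x)) \<partial>stdN)"
      by (intro prod.cong refl PiM_nn_exp_sum[OF prob_space_stdN finite_lessThan]) (simp add: tilt_meas)
    also have "\<dots> = 1" by (simp add: tilt_integral[OF cH])
    finally show ?thesis .
  qed
  have "(\<integral>\<^sup>+\<omega>. ennreal (exp (weight a b \<omega>)) \<partial>can) = (\<integral>\<^sup>+g. \<integral>\<^sup>+h. ennreal (exp (weight a b (g, h))) \<partial>PH \<partial>PG)"
    using weight_meas[of a b] by (intro PH.nn_integral_fst[symmetric]) simp
  also have "\<dots> = (\<integral>\<^sup>+g. \<integral>\<^sup>+h. ennreal (exp (\<Sum>t<n. gtilt (a t) (g t))) * ennreal (exp (\<Sum>i<l. \<Sum>t<n. tilt (hH g t i (b i)) cH (h i t))) \<partial>PH \<partial>PG)"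
    by (simp add: weight_def exp_add ennreal_mult')
  also have "\<dots> = (\<integral>\<^sup>+g. ennreal (exp (\<Sum>t<n. gtilt (a t) (g t))) \<partial>PG)"
  proof (intro nn_integral_cong)
    fix g
    have "(\<lambda>h. \<Sum>i<l. \<Sum>t<n. tilt (hH g t i (b i)) cH (h i t)) \<in> borel_measurable PH"
      by (intro borel_measurable_sum tilt_meas H_coord) auto
    then show "(\<integral>\<^sup>+h. ennreal (exp (\<Sum>t<n. gtilt (a t) (g t))) * ennreal (exp (\<Sum>i<l. \<Sum>t<n. tilt (hH g t i (b i)) cH (h i t))) \<partial>PH) = ennreal (exp (\<Sum>t<n. gtilt (a t) (g t)))"
      by (subst nn_integral_cmult) (simp_all add: inner[of "\<lambda>i t. hH g t i (b i)"])
  qed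
  also have "\<dots> = (\<Prod>t<n. \<integral>\<^sup>+x. ennreal (exp (gtilt (a t) x)) \<partial>PiM {..<l} (\<lambda>_. stdN))"
    by (rule PiM_nn_exp_sum[OF prob_space_PiM[OF prob_space_stdN] finite_lessThan]) (simp add: gtilt_meas)
  also have "\<dots> = 1"
    unfolding gtilt_def using qf_tilt[OF l0, of c1 c2 "a t" for t] pos by simp
  finally show ?thesis .
qed

end

section \<open>Scalar identities for one eigenvalue\<close>

context
  fixes r sg q S c k \<rho> cH w A :: real
  assumes q: "0 < q" and S_def: "S = r\<^sup>2 + sg\<^sup>2" and c_def: "c = (sg\<^sup>2 + q) / (S + q)"
    and k_def: "k = sg / (sg\<^sup>2 + q)" and rho_def: "\<rho> = (S + q) / S" and cH_def: "cH = q / (sg\<^sup>2 + q)"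
    and A_def: "A = (S + q) / (sg\<^sup>2 + q) * (r\<^sup>2 + w * sg\<^sup>2 * (S + q) / q) / S\<^sup>2"
begin

lemma scalar_zero: "S = 0 \<Longrightarrow> r = 0 \<and> sg = 0"
  using S_def by (simp add: sum_power2_eq_zero_iff)

text \<open>r / S is the regression coefficient of G on the source r G + sg H, so the residual has
  the coefficients 1 - r^2 / S and - r sg / S. The sum is its covariance with the source.\<close>

lemma scalar_orth_G: "r * (1 - r\<^sup>2 / S) + sg * (- (r * sg / S)) = 0"
proof (cases "S = 0")
  case False
  then have "r * (1 - r\<^sup>2 / S) + sg * (- (r * sg / S)) = r * (S - (r\<^sup>2 + sg\<^sup>2)) / S" by (simp add: field_simps power2_eq_square)
  then show ?thesis by (simp add: S_def)
qed (simp add: scalar_zero)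

lemma scalar_var_G: "(1 - r\<^sup>2 / S)\<^sup>2 + (- (r * sg / S))\<^sup>2 = 1 - r\<^sup>2 / S"
proof (cases "S = 0")
  case False
  then have 1: "1 - r\<^sup>2 / S = sg\<^sup>2 / S" by (simp add: S_def field_simps)
  have "(sg\<^sup>2 / S)\<^sup>2 + (- (r * sg / S))\<^sup>2 = sg\<^sup>2 * (r\<^sup>2 + sg\<^sup>2) / S\<^sup>2" by (simp add: power_divide power_mult_distrib add_divide_distrib[symmetric] algebra_simps)
  then show ?thesis using False unfolding 1 S_def[symmetric] by (simp add: power2_eq_square)
qed (simp add: scalar_zero)

text \<open>H is compared with k * (\<rho> * source - r * G), where k is the regression coefficient
  of H on U - r G. An estimate of the source from U is U shrunk by S / (S + q); \<rho> undoes this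
  shrinkage and thereby makes the remaining error uncorrelated with the source.\<close>

lemma scalar_orth_H: "r * (k * r * (1 - \<rho>)) + sg * (1 - k * \<rho> * sg) = 0"
proof (cases "S = 0")
  case False
  have u: "sg\<^sup>2 + q \<noteq> 0" using q by (simp add: add_nonneg_pos order.strict_implies_not_eq[symmetric])
  have "r * (k * r * (1 - \<rho>)) + sg * (1 - k * \<rho> * sg) = k * (r\<^sup>2 - \<rho> * S) + sg" by (simp add: S_def power2_eq_square algebra_simps)
  also have "r\<^sup>2 - \<rho> * S = - (sg\<^sup>2 + q)" using False by (simp add: rho_def S_def)
  also have "k * - (sg\<^sup>2 + q) + sg = 0"
    using u by (simp add: k_def divide_simps) (simp add: algebra_simps)
  finally show ?thesis .
qed (simp add: scalar_zero)

text \<open>Collects the two multiples of the squared source error: one from the tilt of G and one,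
  weighted by w, from the tilt of H.\<close>

lemma scalar_A: "1 / c * (r / S)\<^sup>2 + w * (k * \<rho>)\<^sup>2 / cH = A"
proof (cases "S = 0")
  case False
  have p: "sg\<^sup>2 + q \<noteq> 0" "S + q \<noteq> 0" using q by (simp_all add: S_def add_nonneg_pos order.strict_implies_not_eq[symmetric])
  show ?thesis unfolding c_def k_def rho_def cH_def A_def using p q False
    by (simp add: power_divide power_mult_distrib divide_simps) (simp add: power2_eq_square algebra_simps)
qed (simp add: A_def rho_def)

text \<open>S q / (S + q) is the error of the source under the Gaussian channel. The constants of
  the two tilts add up to A times this error, so that the rate bound compares the actual error of
  the source with that of the channel.\<close>

lemma scalar_const:
  "(1 - 1 / c * (1 - r\<^sup>2 / S)) + w * (1 - ((k * r * (1 - \<rho>))\<^sup>2 + (1 - k * \<rho> * sg)\<^sup>2) / cH) = A * (S * q / (S + q))"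
proof (cases "S = 0")
  case True
  then show ?thesis using scalar_zero q by (simp add: c_def k_def cH_def)
next
  case False
  define u where "u = sg\<^sup>2 + q"
  have p: "u \<noteq> 0" "S + q \<noteq> 0" using q by (simp_all add: u_def S_def add_nonneg_pos order.strict_implies_not_eq[symmetric])
  have r2: "r\<^sup>2 = S - sg\<^sup>2" by (simp add: S_def)
  have a: "1 - 1 / c * (1 - r\<^sup>2 / S) = q * r\<^sup>2 / (S * u)"
    unfolding c_def u_def[symmetric] using p False by (simp add: field_simps r2) (simp add: u_def algebra_simps)
  have k1: "k * \<rho> * sg = sg\<^sup>2 * (S + q) / (S * u)" unfolding k_def rho_def u_def[symmetric] by (simp add: power2_eq_square mult_ac)
  have b: "1 - k * \<rho> * sg = q * r\<^sup>2 / (S * u)"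
    unfolding k1 using p False by (simp add: field_simps r2) (simp add: u_def algebra_simps)
  have "k * r * (1 - \<rho>) = - (sg * r * q / (S * u))"
    unfolding k_def rho_def u_def[symmetric] using p False by (simp add: field_simps)
  then have "(k * r * (1 - \<rho>))\<^sup>2 + (1 - k * \<rho> * sg)\<^sup>2 = q\<^sup>2 * r\<^sup>2 * (sg\<^sup>2 + r\<^sup>2) / (S * u)\<^sup>2"
    unfolding b by (simp add: power_divide power_mult_distrib add_divide_distrib[symmetric]) (simp add: power2_eq_square power4_eq_xxxx algebra_simps)
  also have "sg\<^sup>2 + r\<^sup>2 = S" by (simp add: S_def)
  also have "q\<^sup>2 * r\<^sup>2 * S / (S * u)\<^sup>2 = cH * (q * r\<^sup>2 / (S * u))"
    unfolding cH_def u_def[symmetric] using False by (simp add: power2_eq_square)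
  finally have V: "((k * r * (1 - \<rho>))\<^sup>2 + (1 - k * \<rho> * sg)\<^sup>2) / cH = q * r\<^sup>2 / (S * u)"
    using q p by (simp add: cH_def u_def[symmetric])
  have W: "1 - ((k * r * (1 - \<rho>))\<^sup>2 + (1 - k * \<rho> * sg)\<^sup>2) / cH = sg\<^sup>2 * (S + q) / (S * u)"
    unfolding V using b k1 by simp
  show ?thesis unfolding a W A_def u_def[symmetric] using p False q
    by (simp add: divide_simps) (simp add: power2_eq_square algebra_simps)
qed

end

context canon_code
begin

lemma hH_msg_meas: "t < n \<Longrightarrow> i < l \<Longrightarrow> (\<lambda>\<omega>. hH (fst \<omega>) t i (msg \<omega> i)) \<in> borel_measurable can"
  by (rule measurable_compose_countable[where g="\<lambda>\<omega>. msg \<omega> i" and f="\<lambda>m \<omega>. hH (fst \<omega>) t i m"])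
    (auto intro: measurable_compose[OF measurable_fst hH_meas] measurable_compose[OF code.g[OF msg_code]])

text \<open>For each frozen G this is \<open>users.res_power_le\<close>; T may use G and all
  messages. The integration over G is carried out with non-negative integrals, so that the
  integrability of the residual power comes out as a result.\<close>

lemma residual_power:
  assumes t: "t < n" and w: "0 \<le> w1" "0 \<le> w2" "w1 + (real l - 1) * w2 = real l"
    and K: "integrable can (\<lambda>\<omega>. qf l w1 w2 (\<lambda>i. snd \<omega> i t - T (fst \<omega>) (msg \<omega>) i))"
  shows "integrable can (\<lambda>\<omega>. \<Sum>i<l. (snd \<omega> i t - hH (fst \<omega>) t i (msg \<omega> i))\<^sup>2)" (is "integrable can ?R")
    "(LINT \<omega>|can. (\<Sum>i<l. (snd \<omega> i t - hH (fst \<omega>) t i (msg \<omega> i))\<^sup>2)) \<le> (LINT \<omega>|can. qf l w1 w2 (\<lambda>i. snd \<omega> i t - T (fst \<omega>) (msg \<omega>) i))"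
proof -
  let ?K = "\<lambda>\<omega>. qf l w1 w2 (\<lambda>i. snd \<omega> i t - T (fst \<omega>) (msg \<omega>) i)"
  have R: "?R \<in> borel_measurable can"
    by (intro borel_measurable_sum borel_measurable_power borel_measurable_diff can_coord hH_msg_meas t) auto
  have Km: "?K \<in> borel_measurable can" using K by (rule borel_measurable_integrable)
  have le: "(\<integral>\<^sup>+h. ennreal (?R (g, h)) \<partial>PH) \<le> (\<integral>\<^sup>+h. ennreal (?K (g, h)) \<partial>PH)" for g
  proof -
    interpret U: users l PQ "\<lambda>x. x t" "\<kappa> g" C by (rule users[OF t])
    have m: "msg (g, h) = U.msgs h" for h by (simp add: msg_\<kappa> U.msgs_def)
    have r: "h i t - hH g t i (msg (g, h) i) = U.res i (h i)" if "i < l" for h i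
      using that by (simp add: U.res_def hH_def msg_\<kappa>)
    have KU: "?K (g, h) = qf l w1 w2 (\<lambda>i. h i t - T g (U.msgs h) i)" for h by (simp add: m)
    have "(\<integral>\<^sup>+h. ennreal (?R (g, h)) \<partial>PH) = ennreal (LINT h|PH. ?R (g, h))"
    proof (rule nn_integral_eq_integral)
      have "integrable PH (\<lambda>h. \<Sum>i<l. (U.res i (h i))\<^sup>2)"
        by (intro Bochner_Integration.integrable_sum U.coord_integral U.res_sq) auto
      then show "integrable PH (\<lambda>h. ?R (g, h))" by (simp add: r)
    qed (simp add: sum_nonneg)
    also have "(LINT h|PH. ?R (g, h)) = (LINT h|PH. (\<Sum>i<l. (U.res i (h i))\<^sup>2))" by (simp add: r)
    also have "\<dots> = (\<Sum>i<l. LINT h|PH. (U.res i (h i))\<^sup>2)"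
      by (intro Bochner_Integration.integral_sum U.coord_integral U.res_sq) auto
    also have "\<dots> = (\<Sum>i<l. LINT x|PQ. (U.res i x)\<^sup>2)"
      by (intro sum.cong refl U.coord_integral U.res_sq) auto
    also have "ennreal \<dots> \<le> ennreal (LINT h|PH. ?K (g, h))"
      unfolding KU by (intro ennreal_leI U.res_power_le(2) w l0)
    also have "\<dots> = (\<integral>\<^sup>+h. ennreal (?K (g, h)) \<partial>PH)"
      unfolding KU using U.res_power_le(1)[OF w l0, of "T g"] by (intro nn_integral_eq_integral[symmetric]) (auto intro: qf_nonneg w)
    finally show ?thesis .
  qed
  have "(\<integral>\<^sup>+\<omega>. ennreal (?R \<omega>) \<partial>can) = (\<integral>\<^sup>+g. \<integral>\<^sup>+h. ennreal (?R (g, h)) \<partial>PH \<partial>PG)"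
    by (rule PH.nn_integral_fst[symmetric, of "\<lambda>\<omega>. ennreal (?R \<omega>)"]) (use R in measurable)
  also have "\<dots> \<le> (\<integral>\<^sup>+g. \<integral>\<^sup>+h. ennreal (?K (g, h)) \<partial>PH \<partial>PG)"
    by (intro nn_integral_mono le)
  also have "\<dots> = (\<integral>\<^sup>+\<omega>. ennreal (?K \<omega>) \<partial>can)"
    by (rule PH.nn_integral_fst[of "\<lambda>\<omega>. ennreal (?K \<omega>)"]) (use Km in measurable)
  also have "\<dots> = ennreal (LINT \<omega>|can. ?K \<omega>)"
    using K by (intro nn_integral_eq_integral) (auto intro: qf_nonneg w)
  finally have fin: "(\<integral>\<^sup>+\<omega>. ennreal (?R \<omega>) \<partial>can) \<le> ennreal (LINT \<omega>|can. ?K \<omega>)" .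
  show i: "integrable can ?R"
  proof (rule integrableI_nonneg[OF R])
    show "AE \<omega> in can. 0 \<le> ?R \<omega>" by (intro AE_I2 sum_nonneg) simp
    show "(\<integral>\<^sup>+\<omega>. ennreal (?R \<omega>) \<partial>can) < \<infinity>" using le_less_trans[OF fin ennreal_less_top] by simp
  qed
  have "ennreal (LINT \<omega>|can. ?R \<omega>) \<le> ennreal (LINT \<omega>|can. ?K \<omega>)"
    using fin nn_integral_eq_integral[OF i] by (simp add: sum_nonneg)
  moreover have "0 \<le> (LINT \<omega>|can. ?K \<omega>)" by (intro Bochner_Integration.integral_nonneg qf_nonneg w)
  ultimately show "(LINT \<omega>|can. ?R \<omega>) \<le> (LINT \<omega>|can. ?K \<omega>)" by (simp add: ennreal_le_iff)
qed

definition dl :: "(nat \<Rightarrow> nat \<Rightarrow> (nat \<Rightarrow> nat) \<Rightarrow> real) \<Rightarrow> nat \<Rightarrow> (nat \<Rightarrow> nat \<Rightarrow> real) \<times> (nat \<Rightarrow> nat \<Rightarrow> real) \<Rightarrow> nat \<Rightarrow> real" where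
  "dl sh t \<omega> i = src \<omega> t i - sh t i (msg \<omega>)"

definition rate_coef :: "real \<Rightarrow> real \<Rightarrow> real" where
  "rate_coef r w = (r\<^sup>2 + sg\<^sup>2 + q) / (sg\<^sup>2 + q) * (r\<^sup>2 + w * sg\<^sup>2 * (r\<^sup>2 + sg\<^sup>2 + q) / q) / (r\<^sup>2 + sg\<^sup>2)\<^sup>2"

lemma src_sq: "t < n \<Longrightarrow> i < l \<Longrightarrow> integrable can (\<lambda>\<omega>. (src \<omega> t i)\<^sup>2)"
  unfolding src_cf by (rule cf_sq)

lemma dl_sq:
  assumes "t < n" "i < l"
  shows "(\<lambda>\<omega>. dl sh t \<omega> i) \<in> borel_measurable can" "integrable can (\<lambda>\<omega>. (dl sh t \<omega> i)\<^sup>2)"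
proof -
  have m: "(\<lambda>\<omega>. - sh t i (msg \<omega>)) \<in> borel_measurable can" using code.code_fun_meas[OF msg_code, of "\<lambda>b. - sh t i b"] .
  then show "(\<lambda>\<omega>. dl sh t \<omega> i) \<in> borel_measurable can" unfolding dl_def using assms by simp
  show "integrable can (\<lambda>\<omega>. (dl sh t \<omega> i)\<^sup>2)"
    using integrable_add_sq[OF src_meas[OF assms] m src_sq[OF assms]] code.code_fun_sq[OF msg_code, of "\<lambda>b. - sh t i b"]
    by (simp add: dl_def)
qed

text \<open>\<open>cf_pythagoras\<close> with the filtered estimation error \<open>dl\<close> as D;
  it is a function of the source block because the messages are.\<close>

lemma error_pythagoras:
  assumes t: "t < n" and o: "r1 * b1 + sg * e1 = 0" "r2 * b2 + sg * e2 = 0"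
  shows "integrable can (\<lambda>\<omega>. qf l f1 f2 (\<lambda>i. cf t b1 b2 e1 e2 \<omega> i + circ l a1 a2 (dl sh t \<omega>) i))"
    "(LINT \<omega>|can. qf l f1 f2 (\<lambda>i. cf t b1 b2 e1 e2 \<omega> i + circ l a1 a2 (dl sh t \<omega>) i)) =
     f1 * (b1\<^sup>2 + e1\<^sup>2) + (real l - 1) * f2 * (b2\<^sup>2 + e2\<^sup>2) + (LINT \<omega>|can. qf l (f1 * a1\<^sup>2) (f2 * a2\<^sup>2) (dl sh t \<omega>))"
proof -
  define D where "D i s = circ l a1 a2 (\<lambda>j. s (t, j) - sh t j (msgS s)) i" for i s
  have m[measurable]: "(\<lambda>s. sh t j (msgS s)) \<in> borel_measurable (PiM I (\<lambda>_. borel))" for j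
    by (rule measurable_compose[OF msgS_meas]) simp
  have c[measurable]: "(\<lambda>s. s (t, j)) \<in> borel_measurable (PiM I (\<lambda>_. borel))" if "j < l" for j
    by (rule measurable_component_singleton) (use t that in simp)
  have D: "D i \<in> borel_measurable (PiM I (\<lambda>_. borel))" if "i < l" for i
    unfolding D_def[abs_def] circ_def
    by (intro borel_measurable_add borel_measurable_divide borel_measurable_times borel_measurable_sum borel_measurable_const borel_measurable_diff m c)
       (use that in auto)
  have e: "D i (\<lambda>p\<in>I. src \<omega> (fst p) (snd p)) = circ l a1 a2 (dl sh t \<omega>) i" if "i < l" for i \<omega>
    unfolding D_def msg_msgS[symmetric] by (rule circ_cong) (use t that in \<open>simp_all add: dl_def\<close>)
  have D2: "integrable can (\<lambda>\<omega>. (D i (\<lambda>p\<in>I. src \<omega> (fst p) (snd p)))\<^sup>2)" if "i < l" for i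
    unfolding e[OF that] using that t by (intro circ_square_integrable dl_sq)
  have q1: "qf l f1 f2 (\<lambda>i. cf t b1 b2 e1 e2 \<omega> i + D i (\<lambda>p\<in>I. src \<omega> (fst p) (snd p))) = qf l f1 f2 (\<lambda>i. cf t b1 b2 e1 e2 \<omega> i + circ l a1 a2 (dl sh t \<omega>) i)" for \<omega>
    by (rule qf_cong) (simp add: e)
  have q2: "qf l f1 f2 (\<lambda>i. D i (\<lambda>p\<in>I. src \<omega> (fst p) (snd p))) = qf l (f1 * a1\<^sup>2) (f2 * a2\<^sup>2) (dl sh t \<omega>)" for \<omega>
    unfolding qf_circ[OF l0, symmetric] by (rule qf_cong) (simp add: e)
  note p = cf_pythagoras[OF t o, of D, OF D D2, where ?f1.0=f1 and ?f2.0=f2]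
  show "integrable can (\<lambda>\<omega>. qf l f1 f2 (\<lambda>i. cf t b1 b2 e1 e2 \<omega> i + circ l a1 a2 (dl sh t \<omega>) i))"
    using p(1) unfolding q1 .
  show "(LINT \<omega>|can. qf l f1 f2 (\<lambda>i. cf t b1 b2 e1 e2 \<omega> i + circ l a1 a2 (dl sh t \<omega>) i)) =
     f1 * (b1\<^sup>2 + e1\<^sup>2) + (real l - 1) * f2 * (b2\<^sup>2 + e2\<^sup>2) + (LINT \<omega>|can. qf l (f1 * a1\<^sup>2) (f2 * a2\<^sup>2) (dl sh t \<omega>))"
    using p(2) unfolding q1 q2 .
qed

end

section \<open>Expected errors under the two tilts\<close>

context canon_code
begin

lemma coordinate_power:
  assumes t: "t < n"
  shows "has_bochner_integral can (\<lambda>\<omega>. \<Sum>i<l. (fst \<omega> t i)\<^sup>2) (real l)" "has_bochner_integral can (\<lambda>\<omega>. \<Sum>i<l. (snd \<omega> i t)\<^sup>2) (real l)"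
proof -
  have e: "(fst \<omega> t i)\<^sup>2 = (cf t 1 1 0 0 \<omega> i)\<^sup>2" "(snd \<omega> i t)\<^sup>2 = (cf t 0 0 1 1 \<omega> i)\<^sup>2" for \<omega> i
    by (simp_all add: cf_def circ_id)
  have "has_bochner_integral can (\<lambda>\<omega>. \<Sum>i<l. (cf t a a b b \<omega> i)\<^sup>2) (\<Sum>i<l. (a\<^sup>2 + b\<^sup>2 + (real l - 1) * (a\<^sup>2 + b\<^sup>2)) / real l)" for a b
    by (intro has_bochner_integral_sum) (use cf_sq t in \<open>auto simp: has_bochner_integral_iff\<close>)
  from this[of 1 0] this[of 0 1]
  show "has_bochner_integral can (\<lambda>\<omega>. \<Sum>i<l. (fst \<omega> t i)\<^sup>2) (real l)" "has_bochner_integral can (\<lambda>\<omega>. \<Sum>i<l. (snd \<omega> i t)\<^sup>2) (real l)"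
    unfolding e using l0 by (simp_all add: has_bochner_integral_iff)
qed

abbreviation "gain \<equiv> sg / (sg\<^sup>2 + q)"
abbreviation "\<rho>1 \<equiv> (S1 + q) / S1"
abbreviation "\<rho>2 \<equiv> (S2 + q) / S2"

text \<open>Applying the regression of G on the source to the estimate \<open>sh\<close> leaves the
  regression residual plus the filtered error of the source, and the two are orthogonal.\<close>

lemma G_error:
  assumes t: "t < n"
  shows "has_bochner_integral can (\<lambda>\<omega>. qf l (1 / c1) (1 / c2) (\<lambda>i. fst \<omega> t i - circ l (r1 / S1) (r2 / S2) (\<lambda>i. sh t i (msg \<omega>)) i))
    (1 / c1 * (1 - r1\<^sup>2 / S1) + (real l - 1) * (1 / c2 * (1 - r2\<^sup>2 / S2)) + (LINT \<omega>|can. qf l (1 / c1 * (r1 / S1)\<^sup>2) (1 / c2 * (r2 / S2)\<^sup>2) (dl sh t \<omega>)))"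
proof -
  have e: "fst \<omega> t i - circ l (r1 / S1) (r2 / S2) (\<lambda>i. sh t i (msg \<omega>)) i =
     cf t (1 - r1\<^sup>2 / S1) (1 - r2\<^sup>2 / S2) (- (r1 * sg / S1)) (- (r2 * sg / S2)) \<omega> i + circ l (r1 / S1) (r2 / S2) (dl sh t \<omega>) i" for \<omega> i
  proof -
    have "circ l (r1 / S1) (r2 / S2) (dl sh t \<omega>) i = circ l (r1 / S1) (r2 / S2) (src \<omega> t) i - circ l (r1 / S1) (r2 / S2) (\<lambda>i. sh t i (msg \<omega>)) i"
      unfolding dl_def[abs_def] by (rule circ_diff)
    moreover have "cf t (1 - r1\<^sup>2 / S1) (1 - r2\<^sup>2 / S2) (- (r1 * sg / S1)) (- (r2 * sg / S2)) \<omega> i + circ l (r1 / S1) (r2 / S2) (src \<omega> t) i = fst \<omega> t i"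
      unfolding circ_src unfolding cf_def
      using circ_coef_add[of l "1 - r1\<^sup>2 / S1" "1 - r2\<^sup>2 / S2" "fst \<omega> t" i "r1\<^sup>2 / S1" "r2\<^sup>2 / S2"]
         circ_coef_add[of l "- (r1 * sg / S1)" "- (r2 * sg / S2)" "\<lambda>j. snd \<omega> j t" i "r1 * sg / S1" "r2 * sg / S2"]
      by (simp add: circ_id power2_eq_square)
    ultimately show ?thesis by simp
  qed
  have o: "r1 * (1 - r1\<^sup>2 / S1) + sg * (- (r1 * sg / S1)) = 0" "r2 * (1 - r2\<^sup>2 / S2) + sg * (- (r2 * sg / S2)) = 0"
    by (rule scalar_orth_G[OF q refl refl refl refl refl refl])+
  have V: "(1 - r1\<^sup>2 / S1)\<^sup>2 + (- (r1 * sg / S1))\<^sup>2 = 1 - r1\<^sup>2 / S1" "(1 - r2\<^sup>2 / S2)\<^sup>2 + (- (r2 * sg / S2))\<^sup>2 = 1 - r2\<^sup>2 / S2"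
    by (rule scalar_var_G[OF q refl refl refl refl refl refl])+
  show ?thesis
    unfolding e using error_pythagoras[OF t o, where ?f1.0="1 / c1" and ?f2.0="1 / c2" and ?a1.0="r1 / S1" and ?a2.0="r2 / S2" and sh=sh] unfolding V
    by (simp only: has_bochner_integral_iff mult.assoc)
qed

lemma H_error:
  assumes t: "t < n" and w: "0 \<le> w1" "0 \<le> w2" "w1 + (real l - 1) * w2 = real l"
  shows "integrable can (\<lambda>\<omega>. \<Sum>i<l. (snd \<omega> i t - hH (fst \<omega>) t i (msg \<omega> i))\<^sup>2)"
    "(LINT \<omega>|can. (\<Sum>i<l. (snd \<omega> i t - hH (fst \<omega>) t i (msg \<omega> i))\<^sup>2)) \<le>
      w1 * ((gain * r1 * (1 - \<rho>1))\<^sup>2 + (1 - gain * \<rho>1 * sg)\<^sup>2) + (real l - 1) * (w2 * ((gain * r2 * (1 - \<rho>2))\<^sup>2 + (1 - gain * \<rho>2 * sg)\<^sup>2))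
      + (LINT \<omega>|can. qf l (w1 * (gain * \<rho>1)\<^sup>2) (w2 * (gain * \<rho>2)\<^sup>2) (dl sh t \<omega>))"
proof -
  \<comment> \<open>The competitor for \<open>residual_power\<close>: the regression of H on U - R
    G, with U replaced by the estimate of the source after its shrinkage has been undone. Unlike
    \<open>hH\<close> it uses the messages of all users.\<close>
  define T where "T g b i = circ l (gain * \<rho>1) (gain * \<rho>2) (\<lambda>i. sh t i b) i - gain * circ l r1 r2 (g t) i" for g :: "nat \<Rightarrow> nat \<Rightarrow> real" and b i
  have e: "snd \<omega> i t - T (fst \<omega>) (msg \<omega>) i =
     cf t (gain * r1 * (1 - \<rho>1)) (gain * r2 * (1 - \<rho>2)) (1 - gain * \<rho>1 * sg) (1 - gain * \<rho>2 * sg) \<omega> i + circ l (gain * \<rho>1) (gain * \<rho>2) (dl sh t \<omega>) i" for \<omega> i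
  proof -
    have "circ l (gain * \<rho>1) (gain * \<rho>2) (dl sh t \<omega>) i = circ l (gain * \<rho>1) (gain * \<rho>2) (src \<omega> t) i - circ l (gain * \<rho>1) (gain * \<rho>2) (\<lambda>i. sh t i (msg \<omega>)) i"
      unfolding dl_def[abs_def] by (rule circ_diff)
    moreover have "cf t (gain * r1 * (1 - \<rho>1)) (gain * r2 * (1 - \<rho>2)) (1 - gain * \<rho>1 * sg) (1 - gain * \<rho>2 * sg) \<omega> i
         + circ l (gain * \<rho>1) (gain * \<rho>2) (src \<omega> t) i = snd \<omega> i t + gain * circ l r1 r2 (fst \<omega> t) i"
    proof -
      have h1: "circ l (gain * r1 * (1 - \<rho>1)) (gain * r2 * (1 - \<rho>2)) x i + circ l (gain * \<rho>1 * r1) (gain * \<rho>2 * r2) x i = gain * circ l r1 r2 x i" for x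
      proof -
        have "k * r * (1 - \<rho>) + k * \<rho> * r = k * r" for k r \<rho> :: real by (simp add: algebra_simps)
        then show ?thesis by (simp only: circ_coef_add circ_coef_scale)
      qed
      have h2: "circ l (1 - gain * \<rho>1 * sg) (1 - gain * \<rho>2 * sg) x i + circ l (gain * \<rho>1 * sg) (gain * \<rho>2 * sg) x i = x i" for x
        unfolding circ_coef_add by (simp add: circ_id)
      show ?thesis unfolding circ_src unfolding cf_def using h1[of "fst \<omega> t"] h2[of "\<lambda>j. snd \<omega> j t"] by linarith
    qed
    ultimately show ?thesis by (simp add: T_def)
  qed
  have o: "r1 * (gain * r1 * (1 - \<rho>1)) + sg * (1 - gain * \<rho>1 * sg) = 0" "r2 * (gain * r2 * (1 - \<rho>2)) + sg * (1 - gain * \<rho>2 * sg) = 0"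
    by (rule scalar_orth_H[OF q refl refl refl refl refl refl])+
  note p = error_pythagoras[OF t o, where ?f1.0=w1 and ?f2.0=w2 and ?a1.0="gain * \<rho>1" and ?a2.0="gain * \<rho>2" and sh=sh]
  have K: "integrable can (\<lambda>\<omega>. qf l w1 w2 (\<lambda>i. snd \<omega> i t - T (fst \<omega>) (msg \<omega>) i))"
    using p(1) unfolding e .
  show "integrable can (\<lambda>\<omega>. \<Sum>i<l. (snd \<omega> i t - hH (fst \<omega>) t i (msg \<omega> i))\<^sup>2)" by (rule residual_power(1)[OF t w K])
  show "(LINT \<omega>|can. (\<Sum>i<l. (snd \<omega> i t - hH (fst \<omega>) t i (msg \<omega> i))\<^sup>2)) \<le>
      w1 * ((gain * r1 * (1 - \<rho>1))\<^sup>2 + (1 - gain * \<rho>1 * sg)\<^sup>2) + (real l - 1) * (w2 * ((gain * r2 * (1 - \<rho>2))\<^sup>2 + (1 - gain * \<rho>2 * sg)\<^sup>2))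
      + (LINT \<omega>|can. qf l (w1 * (gain * \<rho>1)\<^sup>2) (w2 * (gain * \<rho>2)\<^sup>2) (dl sh t \<omega>))"
    using residual_power(2)[OF t w K] p(2) unfolding e by (simp only: mult.assoc)
qed

text \<open>Log-determinants of the tilted covariances; the powers of sg^2 + q coming from G cancel
  those coming from H.\<close>

lemma log_det:
  "- (ln c1 + (real l - 1) * ln c2 + real l * ln cH) = ln ((S1 + q) * (S2 + q) ^ (l - 1) / q ^ l)"
proof -
  have d: "ln (a / b) = ln a - ln b" if "0 < a" "0 < b" for a b :: real using that by (simp add: ln_div)
  have "ln c1 = ln (sg\<^sup>2 + q) - ln (S1 + q)" "ln c2 = ln (sg\<^sup>2 + q) - ln (S2 + q)" "ln cH = ln q - ln (sg\<^sup>2 + q)"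
    by (intro d pos q)+
  moreover have "ln ((S1 + q) * (S2 + q) ^ (l - 1) / q ^ l) = ln (S1 + q) + (real l - 1) * ln (S2 + q) - real l * ln q"
  proof -
    have p: "0 < (S2 + q) ^ (l - 1)" "0 < q ^ l" using pos(3) q by (simp_all only: zero_less_power)
    have "ln ((S1 + q) * (S2 + q) ^ (l - 1) / q ^ l) = ln (S1 + q) + ln ((S2 + q) ^ (l - 1)) - ln (q ^ l)"
      by (simp only: d[OF mult_pos_pos[OF pos(2) p(1)] p(2)] ln_mult_pos[OF pos(2) p(1)])
    also have "ln ((S2 + q) ^ (l - 1)) = (real l - 1) * ln (S2 + q)"
      using pos(3) l0 by (simp only: ln_realpow) (simp add: of_nat_diff)
    also have "ln (q ^ l) = real l * ln q" using q by (simp add: ln_realpow)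
    finally show ?thesis .
  qed
  ultimately show ?thesis by (simp only:) (simp add: algebra_simps)
qed

text \<open>Evaluates the mean of the log-density \<open>weight\<close> at the actual message tuple,
  which \<open>code_jensen\<close> bounds by the sum rate. The estimator \<open>sh\<close> of the
  source is arbitrary here; it becomes the conditional mean only when the distortion enters.\<close>

theorem rate_bound:
  assumes w: "0 \<le> w1" "0 \<le> w2" "w1 + (real l - 1) * w2 = real l"
  defines "A1 \<equiv> rate_coef r1 w1" and "A2 \<equiv> rate_coef r2 w2"
  shows "real n * (ln ((S1 + q) * (S2 + q) ^ (l - 1) / q ^ l) + A1 * (S1 * q / (S1 + q)) + (real l - 1) * (A2 * (S2 * q / (S2 + q))))
     - (\<Sum>t<n. LINT \<omega>|can. qf l A1 A2 (dl sh t \<omega>)) \<le> 2 * (\<Sum>i<l. ln (real (card (C i))))"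
proof -
  interpret cd: code can msg "PiE {..<l} C" by (rule msg_code)
  have cH: "0 < cH" using q pos by simp
  \<comment> \<open>The tilt of G is centred at the regression on the source, applied to its
    estimate.\<close>
  define a where "a b t = circ l (r1 / S1) (r2 / S2) (\<lambda>i. sh t i b)" for b t
  define EG where "EG t \<omega> = qf l (1 / c1) (1 / c2) (\<lambda>i. fst \<omega> t i - a (msg \<omega>) t i)" for t \<omega>
  define R where "R t \<omega> = (\<Sum>i<l. (snd \<omega> i t - hH (fst \<omega>) t i (msg \<omega> i))\<^sup>2)" for t \<omega>
  have w_eq: "weight (a (msg \<omega>)) (msg \<omega>) \<omega> = (\<Sum>t<n. - (ln c1 + (real l - 1) * ln c2 + real l * ln cH) / 2 - EG t \<omega> / 2 - R t \<omega> / (2 * cH)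
      + (\<Sum>i<l. (fst \<omega> t i)\<^sup>2) / 2 + (\<Sum>i<l. (snd \<omega> i t)\<^sup>2) / 2)" for \<omega>
  proof -
    have "(\<Sum>i<l. \<Sum>t<n. tilt (hH (fst \<omega>) t i (msg \<omega> i)) cH (snd \<omega> i t)) = (\<Sum>t<n. \<Sum>i<l. tilt (hH (fst \<omega>) t i (msg \<omega> i)) cH (snd \<omega> i t))"
      by (rule sum.swap)
    moreover have "(\<Sum>i<l. tilt (hH (fst \<omega>) t i (msg \<omega> i)) cH (snd \<omega> i t)) = - (real l * ln cH) / 2 - R t \<omega> / (2 * cH) + (\<Sum>i<l. (snd \<omega> i t)\<^sup>2) / 2" for t
      unfolding tilt_def R_def sum.distrib sum_subtractf by (simp only: sum_divide_distrib[symmetric]) simp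
    ultimately show ?thesis
      unfolding weight_def gtilt_def EG_def by (simp only: sum.distrib[symmetric]) (intro sum.cong refl, simp add: field_simps)
  qed
  define EE where "EE t = 1 / c1 * (1 - r1\<^sup>2 / S1) + (real l - 1) * (1 / c2 * (1 - r2\<^sup>2 / S2)) + (LINT \<omega>|can. qf l (1 / c1 * (r1 / S1)\<^sup>2) (1 / c2 * (r2 / S2)\<^sup>2) (dl sh t \<omega>))" for t
  have hb: "has_bochner_integral can (\<lambda>\<omega>. weight (a (msg \<omega>)) (msg \<omega>) \<omega>)
     (\<Sum>t<n. - (ln c1 + (real l - 1) * ln c2 + real l * ln cH) / 2 - EE t / 2 - (LINT \<omega>|can. R t \<omega>) / (2 * cH) + real l / 2 + real l / 2)"
    unfolding w_eq
  proof (intro has_bochner_integral_sum has_bochner_integral_add has_bochner_integral_diff has_bochner_integral_divide_zero)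
    fix t assume "t \<in> {..<n}"
    then have t: "t < n" by simp
    show "has_bochner_integral can (EG t) (EE t)" unfolding EG_def[abs_def] EE_def a_def by (rule G_error[OF t])
    show "has_bochner_integral can (R t) (LINT \<omega>|can. R t \<omega>)"
      using H_error(1)[OF t w] unfolding R_def[abs_def] by (simp add: has_bochner_integral_iff)
    show "has_bochner_integral can (\<lambda>\<omega>. \<Sum>i<l. (fst \<omega> t i)\<^sup>2) (real l)" "has_bochner_integral can (\<lambda>\<omega>. \<Sum>i<l. (snd \<omega> i t)\<^sup>2) (real l)"
      by (rule coordinate_power[OF t])+
    show "has_bochner_integral can (\<lambda>\<omega>. - (ln c1 + (real l - 1) * ln c2 + real l * ln cH)) (- (ln c1 + (real l - 1) * ln c2 + real l * ln cH))"
      by (simp add: has_bochner_integral_iff can.prob_space)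
  qed
  have le: "(LINT \<omega>|can. weight (a (msg \<omega>)) (msg \<omega>) \<omega>) \<le> ln (real (card (PiE {..<l} C)))"
    by (rule cd.code_jensen) (use hb weight_integral weight_meas in \<open>simp_all add: has_bochner_integral_iff\<close>)
  have card: "ln (real (card (PiE {..<l} C))) = (\<Sum>i<l. ln (real (card (C i))))"
  proof -
    have "0 < card (C i)" if "i < l" for i
      using \<phi>C[OF that restrict_space] C[OF that] by (auto simp: card_gt_0_iff)
    then have "ln (\<Prod>i<l. real (card (C i))) = (\<Sum>i<l. ln (real (card (C i))))" by (intro ln_prod) auto
    then show ?thesis by (simp add: card_PiE)
  qed
  have per: "ln ((S1 + q) * (S2 + q) ^ (l - 1) / q ^ l) + A1 * (S1 * q / (S1 + q)) + (real l - 1) * (A2 * (S2 * q / (S2 + q))) - (LINT \<omega>|can. qf l A1 A2 (dl sh t \<omega>))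
     \<le> 2 * (- (ln c1 + (real l - 1) * ln c2 + real l * ln cH) / 2 - EE t / 2 - (LINT \<omega>|can. R t \<omega>) / (2 * cH) + real l / 2 + real l / 2)"
    if t: "t < n" for t
  proof -
    define V1 where "V1 = (gain * r1 * (1 - \<rho>1))\<^sup>2 + (1 - gain * \<rho>1 * sg)\<^sup>2"
    define V2 where "V2 = (gain * r2 * (1 - \<rho>2))\<^sup>2 + (1 - gain * \<rho>2 * sg)\<^sup>2"
    define D1 where "D1 = (LINT \<omega>|can. qf l (1 / c1 * (r1 / S1)\<^sup>2) (1 / c2 * (r2 / S2)\<^sup>2) (dl sh t \<omega>))"
    define D2 where "D2 = (LINT \<omega>|can. qf l (w1 * (gain * \<rho>1)\<^sup>2) (w2 * (gain * \<rho>2)\<^sup>2) (dl sh t \<omega>))"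
    have i: "integrable can (\<lambda>\<omega>. qf l x y (dl sh t \<omega>))" for x y
      by (intro integrable_qf dl_sq t)
    have A: "A1 = 1 / c1 * (r1 / S1)\<^sup>2 + w1 * (gain * \<rho>1)\<^sup>2 / cH" "A2 = 1 / c2 * (r2 / S2)\<^sup>2 + w2 * (gain * \<rho>2)\<^sup>2 / cH"
      unfolding A1_def A2_def rate_coef_def by (rule scalar_A[OF q refl refl refl refl refl refl, symmetric])+
    have D: "(LINT \<omega>|can. qf l A1 A2 (dl sh t \<omega>)) = D1 + D2 / cH"
      unfolding A qf_coef_add[symmetric] qf_divide D1_def D2_def using i by simp
    have c: "(1 - 1 / c1 * (1 - r1\<^sup>2 / S1)) + w1 * (1 - V1 / cH) = A1 * (S1 * q / (S1 + q))"
      "(1 - 1 / c2 * (1 - r2\<^sup>2 / S2)) + w2 * (1 - V2 / cH) = A2 * (S2 * q / (S2 + q))"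
      unfolding V1_def V2_def A1_def A2_def rate_coef_def by (rule scalar_const[OF q refl refl refl refl refl refl])+
    have "(LINT \<omega>|can. R t \<omega>) / cH \<le> (w1 * V1 + (real l - 1) * (w2 * V2) + D2) / cH"
      using H_error(2)[OF t w, of sh] cH unfolding R_def V1_def V2_def D2_def by (intro divide_right_mono) auto
    also have "\<dots> = w1 * (V1 / cH) + (real l - 1) * (w2 * (V2 / cH)) + D2 / cH" by (simp only: add_divide_distrib times_divide_eq_right)
    finally have "(LINT \<omega>|can. R t \<omega>) / cH \<le> w1 * (V1 / cH) + (real l - 1) * (w2 * (V2 / cH)) + D2 / cH" .
    then have R: "(LINT \<omega>|can. R t \<omega>) / (2 * cH) \<le> (w1 * (V1 / cH) + (real l - 1) * (w2 * (V2 / cH)) + D2 / cH) / 2" by simp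
    \<comment> \<open>The powers l + l of G and H are distributed over the eigenvalues as 1 + (l -
      1) for G and as w1 + (l - 1) * w2 for H, which is where the normalisation of the weights
      enters.\<close>
    have gen: "- lg + ((1 - p1) + w1 * (1 - a1)) + (real l - 1) * ((1 - p2) + w2 * (1 - a2)) - (D1 + e2)
       \<le> 2 * (- lg / 2 - (p1 + (real l - 1) * p2 + D1) / 2 - r + real l / 2 + real l / 2)"
      if "r \<le> (w1 * a1 + (real l - 1) * (w2 * a2) + e2) / 2" for lg p1 p2 a1 a2 e2 r
      using that w(3) by (simp add: algebra_simps add_divide_distrib diff_divide_distrib)
    show ?thesis
      unfolding log_det[symmetric] D c[symmetric] EE_def D1_def[symmetric] by (rule gen[OF R])
  qed
  have "real n * (ln ((S1 + q) * (S2 + q) ^ (l - 1) / q ^ l) + A1 * (S1 * q / (S1 + q)) + (real l - 1) * (A2 * (S2 * q / (S2 + q))))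
     - (\<Sum>t<n. LINT \<omega>|can. qf l A1 A2 (dl sh t \<omega>)) =
     (\<Sum>t<n. ln ((S1 + q) * (S2 + q) ^ (l - 1) / q ^ l) + A1 * (S1 * q / (S1 + q)) + (real l - 1) * (A2 * (S2 * q / (S2 + q))) - (LINT \<omega>|can. qf l A1 A2 (dl sh t \<omega>)))"
    by (simp add: sum_subtractf)
  also have "\<dots> \<le> (\<Sum>t<n. 2 * (- (ln c1 + (real l - 1) * ln c2 + real l * ln cH) / 2 - EE t / 2 - (LINT \<omega>|can. R t \<omega>) / (2 * cH) + real l / 2 + real l / 2))"
    by (intro sum_mono per) simp
  also have "\<dots> = 2 * (LINT \<omega>|can. weight (a (msg \<omega>)) (msg \<omega>) \<omega>)"
    unfolding has_bochner_integral_integral_eq[OF hb] by (rule sum_distrib_left[symmetric])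
  also have "\<dots> \<le> 2 * (\<Sum>i<l. ln (real (card (C i))))" using le card by simp
  finally show ?thesis .
qed

end

section \<open>The distortion bound\<close>

context canon_code
begin

text \<open>By \<open>sh\<close> the error \<open>dl\<close> is orthogonal to all functions of the
  messages, hence so is any exchangeable combination of its coordinates. Every other estimator k
  therefore adds the mean square of its deviation.\<close>

lemma projection_bound:
  assumes t: "t < n"
    and sh: "\<And>j u. j < l \<Longrightarrow> (LINT \<omega>|can. (src \<omega> t j - sh t j (msg \<omega>)) * u (msg \<omega>)) = 0"
  shows "(LINT \<omega>|can. qf l (a1\<^sup>2) (a2\<^sup>2) (dl sh t \<omega>)) \<le> (\<Sum>i<l. LINT \<omega>|can. (circ l a1 a2 (src \<omega> t) i - k i (msg \<omega>))\<^sup>2)"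
proof -
  interpret cd: code can msg "PiE {..<l} C" by (rule msg_code)
  let ?P = "\<lambda>i \<omega>. circ l a1 a2 (dl sh t \<omega>) i"
  define u where "u i b = circ l a1 a2 (\<lambda>j. sh t j b) i - k i b" for i b
  have Pm: "?P i \<in> borel_measurable can" and P2: "integrable can (\<lambda>\<omega>. (?P i \<omega>)\<^sup>2)" if "i < l" for i
    using circ_square_integrable[of l "\<lambda>\<omega>. dl sh t \<omega>" can i a1 a2] dl_sq[OF t] that by blast+
  have split: "circ l a1 a2 (src \<omega> t) i - k i (msg \<omega>) = ?P i \<omega> + u i (msg \<omega>)" for i \<omega>
    using circ_diff[of l a1 a2 "src \<omega> t" "\<lambda>j. sh t j (msg \<omega>)" i] unfolding u_def dl_def[abs_def] by simp
  have dlu: "has_bochner_integral can (\<lambda>\<omega>. dl sh t \<omega> j * v (msg \<omega>)) 0" if "j < l" for j v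
    using sh[OF that, of v] dl_sq[OF t that] cd.code_fun_sq[of v]
    by (auto simp: has_bochner_integral_iff dl_def intro!: integrable_product)
  have x: "has_bochner_integral can (\<lambda>\<omega>. ?P i \<omega> * u i (msg \<omega>)) 0" if i: "i < l" for i
  proof -
    have "has_bochner_integral can (\<lambda>\<omega>. a2 * (dl sh t \<omega> i * u i (msg \<omega>)) + (a1 - a2) * (\<Sum>j<l. dl sh t \<omega> j * u i (msg \<omega>)) / real l)
       (a2 * 0 + (a1 - a2) * (\<Sum>j<l. 0) / real l)"
      using i by (intro has_bochner_integral_add has_bochner_integral_mult_right has_bochner_integral_divide_zero has_bochner_integral_sum dlu) auto
    moreover have "?P i \<omega> * u i (msg \<omega>) = a2 * (dl sh t \<omega> i * u i (msg \<omega>)) + (a1 - a2) * (\<Sum>j<l. dl sh t \<omega> j * u i (msg \<omega>)) / real l" for \<omega>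
      by (simp add: circ_def distrib_right sum_distrib_right[symmetric])
    ultimately show ?thesis by simp
  qed
  have "(LINT \<omega>|can. (?P i \<omega>)\<^sup>2) \<le> (LINT \<omega>|can. (circ l a1 a2 (src \<omega> t) i - k i (msg \<omega>))\<^sup>2)" if i: "i < l" for i
  proof -
    have "has_bochner_integral can (\<lambda>\<omega>. (?P i \<omega>)\<^sup>2 + (u i (msg \<omega>))\<^sup>2 + 2 * (?P i \<omega> * u i (msg \<omega>)))
      ((LINT \<omega>|can. (?P i \<omega>)\<^sup>2) + (LINT \<omega>|can. (u i (msg \<omega>))\<^sup>2) + 2 * 0)"
      using i by (intro has_bochner_integral_add has_bochner_integral_mult_right x) (auto simp: has_bochner_integral_iff P2 cd.code_fun_sq)
    then have "(LINT \<omega>|can. (?P i \<omega> + u i (msg \<omega>))\<^sup>2) = (LINT \<omega>|can. (?P i \<omega>)\<^sup>2) + (LINT \<omega>|can. (u i (msg \<omega>))\<^sup>2)"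
      by (simp add: has_bochner_integral_iff power2_sum mult.assoc)
    then show ?thesis unfolding split by (simp add: integral_nonneg_AE)
  qed
  then have "(\<Sum>i<l. LINT \<omega>|can. (?P i \<omega>)\<^sup>2) \<le> (\<Sum>i<l. LINT \<omega>|can. (circ l a1 a2 (src \<omega> t) i - k i (msg \<omega>))\<^sup>2)"
    by (intro sum_mono) auto
  moreover have "(\<Sum>i<l. LINT \<omega>|can. (?P i \<omega>)\<^sup>2) = (LINT \<omega>|can. (\<Sum>i<l. (?P i \<omega>)\<^sup>2))"
    using P2 by (intro Bochner_Integration.integral_sum[symmetric]) auto
  moreover have "(\<Sum>i<l. (?P i \<omega>)\<^sup>2) = qf l (a1\<^sup>2) (a2\<^sup>2) (dl sh t \<omega>)" for \<omega>
    using qf_circ[OF l0, of 1 1 a1 a2 "dl sh t \<omega>"] by (simp add: qf_one)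
  ultimately show ?thesis by simp
qed

end

section \<open>The part of the target that the sources do not reveal\<close>

context gauss_src
begin

abbreviation "\<gamma>1 \<equiv> x1 / s1"
abbreviation "\<gamma>2 \<equiv> x2 / s2"

definition obs :: "nat \<Rightarrow> 'a \<Rightarrow> nat \<Rightarrow> real" where
  "obs t \<omega> i = X t i \<omega> + Z t i \<omega>"

text \<open>The target minus its Wiener estimate from the sources. At a vanishing source eigenvalue
  the gain is 0 / 0 = 0, which is right because the target has no power there either.\<close>

definition unobs :: "nat \<Rightarrow> nat \<Rightarrow> 'a \<Rightarrow> real" where
  "unobs t i \<omega> = X t i \<omega> - circ l \<gamma>1 \<gamma>2 (obs t \<omega>) i"

abbreviation "ei i \<equiv> (\<lambda>j. of_bool (j = i) :: real)"

lemma obs_meas[measurable]: "i < l \<Longrightarrow> (\<lambda>\<omega>. obs t \<omega> i) \<in> borel_measurable M"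
  unfolding obs_def by simp

lemma unobs_meas[measurable]: "i < l \<Longrightarrow> unobs t i \<in> borel_measurable M"
  unfolding unobs_def[abs_def] circ_def by measurable

lemma unobs_lin:
  assumes i: "i < l"
  shows "unobs t i \<omega> = (\<Sum>j<l. circ l (1 - \<gamma>1) (1 - \<gamma>2) (ei i) j * X t j \<omega>) + (\<Sum>j<l. circ l (- \<gamma>1) (- \<gamma>2) (ei i) j * Z t j \<omega>)"
proof -
  have "circ l \<gamma>1 \<gamma>2 (obs t \<omega>) i = circ l \<gamma>1 \<gamma>2 (\<lambda>j. X t j \<omega>) i + circ l \<gamma>1 \<gamma>2 (\<lambda>j. Z t j \<omega>) i"
    unfolding obs_def[abs_def] by (rule circ_add)
  moreover have "circ l (1 - \<gamma>1) (1 - \<gamma>2) (\<lambda>j. X t j \<omega>) i + circ l \<gamma>1 \<gamma>2 (\<lambda>j. X t j \<omega>) i = X t i \<omega>"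
    unfolding circ_coef_add by (simp add: circ_id)
  moreover have "circ l (- \<gamma>1) (- \<gamma>2) (\<lambda>j. Z t j \<omega>) i + circ l \<gamma>1 \<gamma>2 (\<lambda>j. Z t j \<omega>) i = 0"
    unfolding circ_coef_add by (simp add: circ_id)
  ultimately show ?thesis unfolding circ_unit[OF i] unobs_def by simp
qed

lemma unobs_sq:
  assumes i: "i < l"
  shows "integrable M (\<lambda>\<omega>. (unobs t i \<omega>)\<^sup>2)" "(LINT \<omega>|M. (unobs t i \<omega>)\<^sup>2) = (x1 * z1 / s1 + (real l - 1) * (x2 * z2 / s2)) / l"
proof -
  show "integrable M (\<lambda>\<omega>. (unobs t i \<omega>)\<^sup>2)" unfolding unobs_lin[OF i] by (rule joint_moment)
  have "(LINT \<omega>|M. (unobs t i \<omega>)\<^sup>2) = qf l x1 x2 (circ l (1 - \<gamma>1) (1 - \<gamma>2) (ei i)) + qf l z1 z2 (circ l (- \<gamma>1) (- \<gamma>2) (ei i))"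
    unfolding unobs_lin[OF i] by (rule joint_moment)
  also have "\<dots> = (x1 * (1 - \<gamma>1)\<^sup>2 + (real l - 1) * (x2 * (1 - \<gamma>2)\<^sup>2)) / l + (z1 * (- \<gamma>1)\<^sup>2 + (real l - 1) * (z2 * (- \<gamma>2)\<^sup>2)) / l"
    unfolding qf_circ[OF l0] qf_unit[OF l0 i] ..
  also have "\<dots> = ((x1 * (1 - \<gamma>1)\<^sup>2 + z1 * (- \<gamma>1)\<^sup>2) + (real l - 1) * (x2 * (1 - \<gamma>2)\<^sup>2 + z2 * (- \<gamma>2)\<^sup>2)) / l"
    by (simp only: add_divide_distrib[symmetric]) (simp add: algebra_simps)
  also have "\<dots> = (x1 * z1 / s1 + (real l - 1) * (x2 * z2 / s2)) / l"
    unfolding mmse_zero(2)[OF eigen_nonneg(1,3)] mmse_zero(2)[OF eigen_nonneg(2,4)] ..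
  finally show "(LINT \<omega>|M. (unobs t i \<omega>)\<^sup>2) = (x1 * z1 / s1 + (real l - 1) * (x2 * z2 / s2)) / l" .
qed

lemma unobs_char:
  assumes t: "t < n" and i: "i < l"
  shows "(CLINT \<omega>|M. iexp (b * unobs t i \<omega> + (\<Sum>p\<in>{..<n} \<times> {..<l}. a p * obs (fst p) \<omega> (snd p)))) =
    complex_of_real (exp (- (b\<^sup>2 * (qf l x1 x2 (circ l (1 - \<gamma>1) (1 - \<gamma>2) (ei i)) + qf l z1 z2 (circ l (- \<gamma>1) (- \<gamma>2) (ei i)))
       + (\<Sum>t<n. qf l s1 s2 (\<lambda>j. a (t, j)))) / 2))"
proof -
  define u where "u = circ l (1 - \<gamma>1) (1 - \<gamma>2) (ei i)"
  define v where "v = circ l (- \<gamma>1) (- \<gamma>2) (ei i)"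
  define A where "A s j = of_bool (s = t) * (b * u j) + a (s, j)" for s j
  define B where "B s j = of_bool (s = t) * (b * v j) + a (s, j)" for s j
  have unit: "(\<Sum>s<n. of_bool (s = t) * f s) = f t" for f :: "nat \<Rightarrow> real"
    using t by (rule sum_unit)
  have lin: "b * unobs t i \<omega> + (\<Sum>p\<in>{..<n} \<times> {..<l}. a p * obs (fst p) \<omega> (snd p)) =
     (\<Sum>s<n. (\<Sum>j<l. A s j * X s j \<omega>) + (\<Sum>j<l. B s j * Z s j \<omega>))" for \<omega>
  proof -
    have "(\<Sum>j<l. A s j * X s j \<omega>) + (\<Sum>j<l. B s j * Z s j \<omega>) =
      of_bool (s = t) * (b * ((\<Sum>j<l. u j * X s j \<omega>) + (\<Sum>j<l. v j * Z s j \<omega>))) + (\<Sum>j<l. a (s, j) * obs s \<omega> j)" for s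
      by (simp add: A_def B_def obs_def distrib_right distrib_left sum.distrib sum_distrib_left mult.assoc)
    then have "(\<Sum>s<n. (\<Sum>j<l. A s j * X s j \<omega>) + (\<Sum>j<l. B s j * Z s j \<omega>)) =
      (\<Sum>s<n. of_bool (s = t) * (b * ((\<Sum>j<l. u j * X s j \<omega>) + (\<Sum>j<l. v j * Z s j \<omega>)))) + (\<Sum>s<n. \<Sum>j<l. a (s, j) * obs s \<omega> j)"
      by (simp only: sum.distrib[symmetric])
    then show ?thesis
      unfolding unit unobs_lin[OF i] u_def[symmetric] v_def[symmetric] by (simp add: sum.cartesian_product case_prod_beta)
  qed
  have sq: "qf l x1 x2 (A s) + qf l z1 z2 (B s) = of_bool (s = t) * (b\<^sup>2 * (qf l x1 x2 u + qf l z1 z2 v)) + qf l s1 s2 (\<lambda>j. a (s, j))" for s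
  proof (cases "s = t")
    case False
    then show ?thesis by (simp add: A_def[abs_def] B_def[abs_def] qf_coef_add)
  next
    case True
    \<comment> \<open>The covariance between \<open>unobs\<close> and the sources vanishes
      eigenvalue by eigenvalue, by \<open>mmse_zero\<close>.\<close>
    have z: "(\<Sum>j<l. circ l x1 x2 (\<lambda>j. a (s, j)) j * (b * u j)) + (\<Sum>j<l. circ l z1 z2 (\<lambda>j. a (s, j)) j * (b * v j)) = 0"
    proof -
      have "circ l x1 x2 u j + circ l z1 z2 v j = 0" for j
        unfolding u_def v_def circ_circ[OF l0] circ_coef_add mmse_zero(1)[OF eigen_nonneg(1,3)] mmse_zero(1)[OF eigen_nonneg(2,4)]
        by (simp add: circ_id)
      then have "circ l x1 x2 (\<lambda>j. b * u j) j + circ l z1 z2 (\<lambda>j. b * v j) j = 0" for j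
        unfolding circ_scale distrib_left[symmetric] by simp
      then show ?thesis
        unfolding circ_adjoint[symmetric] by (simp add: sum.distrib[symmetric] distrib_left[symmetric])
    qed
    have b: "qf l e1 e2 (\<lambda>j. b * y j) = b\<^sup>2 * qf l e1 e2 y" for e1 e2 y
      by (simp add: qf_def power_mult_distrib sum_distrib_left[symmetric] algebra_simps)
    have "A s = (\<lambda>j. b * u j + a (s, j))" "B s = (\<lambda>j. b * v j + a (s, j))" using True by (simp_all add: A_def B_def fun_eq_iff)
    then show ?thesis
      using True z unfolding qf_coef_add[symmetric] by (simp only: qf_plus b) (simp add: algebra_simps)
  qed
  have S: "(\<Sum>s<n. qf l x1 x2 (A s) + qf l z1 z2 (B s)) = b\<^sup>2 * (qf l x1 x2 u + qf l z1 z2 v) + (\<Sum>s<n. qf l s1 s2 (\<lambda>j. a (s, j)))"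
    by (simp only: sq sum.distrib unit)
  show ?thesis unfolding lin block_char S unfolding u_def v_def ..
qed

lemma unobs_orth:
  assumes t: "t < n" and i: "i < l" and k: "k \<in> borel_measurable (PiM ({..<n} \<times> {..<l}) (\<lambda>_. borel))"
  shows "(LINT \<omega>|M. unobs t i \<omega> * k (\<lambda>p\<in>{..<n} \<times> {..<l}. obs (fst p) \<omega> (snd p))) = 0"
proof (rule reflection_orthogonal[OF prob_space_axioms _ unobs_meas[OF i] _ _ k])
  show "(CLINT \<omega>|M. iexp (b * unobs t i \<omega> + (\<Sum>p\<in>{..<n} \<times> {..<l}. a p * obs (fst p) \<omega> (snd p)))) =
     (CLINT \<omega>|M. iexp (- b * unobs t i \<omega> + (\<Sum>p\<in>{..<n} \<times> {..<l}. a p * obs (fst p) \<omega> (snd p))))" for a b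
    using unobs_char[OF t i, of b a] unobs_char[OF t i, of "- b" a] by (simp only: power2_minus)
qed auto

text \<open>Both blocks are Gaussian with the same covariance at each time and independent over
  time. The case b = 0 of \<open>unobs_char\<close> supplies the characteristic function of the
  actual block.\<close>

lemma canonical_law:
  assumes K: "canon_code l n \<phi> C q" and n: "0 < n" and s: "r1\<^sup>2 + sg\<^sup>2 = s1" "r2\<^sup>2 + sg\<^sup>2 = s2"
  shows "distr M (PiM ({..<n} \<times> {..<l}) (\<lambda>_. borel)) (\<lambda>\<omega>. \<lambda>p\<in>{..<n} \<times> {..<l}. obs (fst p) \<omega> (snd p)) =
    distr (PiM {..<n} (\<lambda>_. PiM {..<l} (\<lambda>_. stdN)) \<Otimes>\<^sub>M PiM {..<l} (\<lambda>_. PiM {..<n} (\<lambda>_. stdN))) (PiM ({..<n} \<times> {..<l}) (\<lambda>_. borel))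
      (\<lambda>\<omega>. \<lambda>p\<in>{..<n} \<times> {..<l}. canon.src l r1 r2 sg \<omega> (fst p) (snd p))"
proof -
  interpret K: canon_code l n r1 r2 sg \<phi> C q by fact
  show ?thesis
  proof (rule char_family_unique[OF prob_space_axioms K.can.prob_space_axioms])
    fix a :: "nat \<times> nat \<Rightarrow> real"
    have "(CLINT \<omega>|M. iexp (\<Sum>p\<in>{..<n} \<times> {..<l}. a p * obs (fst p) \<omega> (snd p))) = complex_of_real (exp (- (\<Sum>t<n. qf l s1 s2 (\<lambda>j. a (t, j))) / 2))"
      using unobs_char[OF n l0, of 0 a] by simp
    moreover have "(CLINT \<omega>|K.can. iexp (\<Sum>p\<in>{..<n} \<times> {..<l}. a p * K.src \<omega> (fst p) (snd p))) = complex_of_real (exp (- (\<Sum>t<n. qf l s1 s2 (\<lambda>j. a (t, j))) / 2))"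
      using K.src_char[OF n, of "\<lambda>_. 0" "\<lambda>_. 0" 0 a] by (simp add: circ_def s)
    ultimately show "(CLINT \<omega>|M. iexp (\<Sum>p\<in>{..<n} \<times> {..<l}. a p * obs (fst p) \<omega> (snd p))) =
      (CLINT \<omega>|K.can. iexp (\<Sum>p\<in>{..<n} \<times> {..<l}. a p * K.src \<omega> (fst p) (snd p)))" by simp
  qed auto
qed

lemma obs_block_meas: "(\<lambda>\<omega>. \<lambda>p\<in>{..<n} \<times> {..<l}. obs (fst p) \<omega> (snd p)) \<in> M \<rightarrow>\<^sub>M PiM ({..<n} \<times> {..<l}) (\<lambda>_. borel)"
  by (intro measurable_restrict obs_meas) auto

lemma obs_sq: "i < l \<Longrightarrow> integrable M (\<lambda>\<omega>. (obs t \<omega> i)\<^sup>2)"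
  unfolding obs_def using component_sq by (intro integrable_add_sq) auto

text \<open>The error splits into \<open>unobs\<close>, orthogonal to everything the decoder sees,
  and a function of the source block. The second part depends only on the law of the block, so it
  may be computed on the canonical source, where \<open>projection_bound\<close> applies.\<close>

lemma distortion_bound:
  assumes K: "canon_code l n \<phi> C q" and t: "t < n" and s: "r1\<^sup>2 + sg\<^sup>2 = s1" "r2\<^sup>2 + sg\<^sup>2 = s2"
    and sh: "\<And>j u. j < l \<Longrightarrow>
      (LINT \<omega>|(PiM {..<n} (\<lambda>_. PiM {..<l} (\<lambda>_. stdN)) \<Otimes>\<^sub>M PiM {..<l} (\<lambda>_. PiM {..<n} (\<lambda>_. stdN))).
        (canon.src l r1 r2 sg \<omega> t j - sh t j (canon_code.msg l n r1 r2 sg \<phi> \<omega>)) * u (canon_code.msg l n r1 r2 sg \<phi> \<omega>)) = 0"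
  shows "x1 * z1 / s1 + (real l - 1) * (x2 * z2 / s2) +
    (LINT \<omega>|(PiM {..<n} (\<lambda>_. PiM {..<l} (\<lambda>_. stdN)) \<Otimes>\<^sub>M PiM {..<l} (\<lambda>_. PiM {..<n} (\<lambda>_. stdN))).
      qf l (\<gamma>1\<^sup>2) (\<gamma>2\<^sup>2) (canon_code.dl l n r1 r2 sg \<phi> sh t \<omega>))
    \<le> (\<Sum>i<l. LINT \<omega>|M. (X t i \<omega> - k i (\<lambda>i\<in>{..<l}. \<phi> i (Sblock X Z n i \<omega>)))\<^sup>2)"
proof -
  interpret K: canon_code l n r1 r2 sg \<phi> C q by fact
  let ?J = "{..<n} \<times> {..<l}"
  let ?S = "\<lambda>\<omega>. \<lambda>p\<in>?J. obs (fst p) \<omega> (snd p)"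
  let ?m = "\<lambda>\<omega>. \<lambda>i\<in>{..<l}. \<phi> i (Sblock X Z n i \<omega>)"
  have cb: "code M ?m (PiE {..<l} C)" using K.C K.\<phi> K.\<phi>C by (intro code_block) auto
  interpret cb: code M ?m "PiE {..<l} C" by fact
  have m: "?m \<omega> = K.msgS (?S \<omega>)" for \<omega>
    by (auto simp: K.msgS_def Sblock_def obs_def fun_eq_iff intro!: arg_cong[where f="\<phi> _"])
  define D where "D i s = circ l \<gamma>1 \<gamma>2 (\<lambda>j. s (t, j)) i - k i (K.msgS s)" for i s
  have Dm: "D i \<in> borel_measurable (PiM ?J (\<lambda>_. borel))" if "i < l" for i
  proof -
    have [measurable]: "(\<lambda>s. k i (K.msgS s)) \<in> borel_measurable (PiM ?J (\<lambda>_. borel))"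
      by (rule measurable_compose[OF K.msgS_meas]) simp
    have [measurable]: "(\<lambda>s. s (t, j)) \<in> borel_measurable (PiM ?J (\<lambda>_. borel))" if "j < l" for j
      by (rule measurable_component_singleton) (use t that in simp)
    show ?thesis unfolding D_def[abs_def] circ_def using that by measurable
  qed
  have DS: "D i (?S \<omega>) = circ l \<gamma>1 \<gamma>2 (obs t \<omega>) i - k i (?m \<omega>)" if "i < l" for i \<omega>
  proof -
    have "circ l \<gamma>1 \<gamma>2 (\<lambda>j. ?S \<omega> (t, j)) i = circ l \<gamma>1 \<gamma>2 (obs t \<omega>) i"
      by (rule circ_cong) (use t that in simp_all)
    then show ?thesis unfolding D_def m by simp
  qed
  have per: "(LINT \<omega>|M. (X t i \<omega> - k i (?m \<omega>))\<^sup>2) = (x1 * z1 / s1 + (real l - 1) * (x2 * z2 / s2)) / l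
     + (LINT \<omega>|K.can. (circ l \<gamma>1 \<gamma>2 (K.src \<omega> t) i - k i (K.msg \<omega>))\<^sup>2)" if i: "i < l" for i
  proof -
    have DSm: "(\<lambda>\<omega>. D i (?S \<omega>)) \<in> borel_measurable M" by (rule measurable_compose[OF obs_block_meas Dm[OF i]])
    have "integrable M (\<lambda>\<omega>. (circ l \<gamma>1 \<gamma>2 (obs t \<omega>) i + - k i (?m \<omega>))\<^sup>2)"
    proof (rule integrable_add_sq)
      note cs = circ_square_integrable[of l "\<lambda>\<omega>. obs t \<omega>" M i \<gamma>1 \<gamma>2, OF obs_meas obs_sq i]
      show "(\<lambda>\<omega>. circ l \<gamma>1 \<gamma>2 (obs t \<omega>) i) \<in> borel_measurable M" by (rule cs(1))
      show "integrable M (\<lambda>\<omega>. (circ l \<gamma>1 \<gamma>2 (obs t \<omega>) i)\<^sup>2)" by (rule cs(2))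
      show "(\<lambda>\<omega>. - k i (?m \<omega>)) \<in> borel_measurable M" by (rule cb.code_fun_meas[of "\<lambda>b. - k i b"])
      show "integrable M (\<lambda>\<omega>. (- k i (?m \<omega>))\<^sup>2)" by (rule cb.code_fun_sq[of "\<lambda>b. - k i b"])
    qed
    then have D2: "integrable M (\<lambda>\<omega>. (D i (?S \<omega>))\<^sup>2)" unfolding DS[OF i] by simp
    have x: "has_bochner_integral M (\<lambda>\<omega>. unobs t i \<omega> * D i (?S \<omega>)) 0"
      using unobs_orth[OF t i Dm[OF i]] integrable_product[OF unobs_meas[OF i] DSm unobs_sq(1)[OF i] D2] by (simp add: has_bochner_integral_iff)
    have e: "X t i \<omega> - k i (?m \<omega>) = unobs t i \<omega> + D i (?S \<omega>)" for \<omega>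
      unfolding DS[OF i] unobs_def by simp
    have "has_bochner_integral M (\<lambda>\<omega>. (unobs t i \<omega>)\<^sup>2 + (D i (?S \<omega>))\<^sup>2 + 2 * (unobs t i \<omega> * D i (?S \<omega>)))
       ((x1 * z1 / s1 + (real l - 1) * (x2 * z2 / s2)) / l + (LINT \<omega>|M. (D i (?S \<omega>))\<^sup>2) + 2 * 0)"
      by (intro has_bochner_integral_add has_bochner_integral_mult_right x) (simp_all add: has_bochner_integral_iff D2 unobs_sq[OF i])
    then have "(LINT \<omega>|M. (X t i \<omega> - k i (?m \<omega>))\<^sup>2) = (x1 * z1 / s1 + (real l - 1) * (x2 * z2 / s2)) / l + (LINT \<omega>|M. (D i (?S \<omega>))\<^sup>2)"
      unfolding e by (simp add: has_bochner_integral_iff power2_sum mult.assoc)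
    also have "(LINT \<omega>|M. (D i (?S \<omega>))\<^sup>2) = (LINT v|distr M (PiM ?J (\<lambda>_. borel)) ?S. (D i v)\<^sup>2)"
      using Dm[OF i] by (intro integral_distr[symmetric] obs_block_meas) simp
    also have "\<dots> = (LINT \<omega>|K.can. (D i (\<lambda>p\<in>?J. K.src \<omega> (fst p) (snd p)))\<^sup>2)"
      unfolding canonical_law[OF K _ s, of, OF order.strict_trans1[OF le0 t]]
      using Dm[OF i] by (intro integral_distr K.src_block_meas) simp
    also have "\<dots> = (LINT \<omega>|K.can. (circ l \<gamma>1 \<gamma>2 (K.src \<omega> t) i - k i (K.msg \<omega>))\<^sup>2)"
    proof -
      have "circ l \<gamma>1 \<gamma>2 (\<lambda>j. (\<lambda>p\<in>?J. K.src \<omega> (fst p) (snd p)) (t, j)) i = circ l \<gamma>1 \<gamma>2 (K.src \<omega> t) i" for \<omega>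
        by (rule circ_cong) (use t i in simp_all)
      then show ?thesis unfolding D_def K.msg_msgS by simp
    qed
    finally show ?thesis .
  qed
  have "(\<Sum>i<l. LINT \<omega>|M. (X t i \<omega> - k i (?m \<omega>))\<^sup>2) = x1 * z1 / s1 + (real l - 1) * (x2 * z2 / s2) +
      (\<Sum>i<l. LINT \<omega>|K.can. (circ l \<gamma>1 \<gamma>2 (K.src \<omega> t) i - k i (K.msg \<omega>))\<^sup>2)"
    using l0 by (simp add: per sum.distrib)
  then show ?thesis using K.projection_bound[OF t, of sh \<gamma>1 \<gamma>2 k, OF sh] by simp
qed

text \<open>The equations \<open>A\<close> make the source error in the rate bound equal to
  \<Lambda> times the source error in the distortion bound. The latter is limited by the distortion
  constraint, and d is exactly the level at which the terms carrying \<Lambda> cancel.\<close>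

theorem converse:
  assumes q: "0 < q" and w: "0 \<le> w1" "0 \<le> w2" "w1 + (real l - 1) * w2 = real l" and lam: "0 \<le> \<Lambda>"
    and sg: "0 \<le> \<sigma>" "\<sigma> \<le> s1" "\<sigma> \<le> s2"
    and A: "(s1 + q) / (\<sigma> + q) * (s1 - \<sigma> + w1 * \<sigma> * (s1 + q) / q) / s1\<^sup>2 = \<Lambda> * \<gamma>1\<^sup>2"
      "(s2 + q) / (\<sigma> + q) * (s2 - \<sigma> + w2 * \<sigma> * (s2 + q) / q) / s2\<^sup>2 = \<Lambda> * \<gamma>2\<^sup>2"
    and d: "d = (x1 * (z1 + q) / (s1 + q) + (real l - 1) * (x2 * (z2 + q) / (s2 + q))) / l"
    and ach: "achievable M l X Z l r (\<lambda>_. d)"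
  shows "ln ((s1 + q) * (s2 + q) ^ (l - 1) / q ^ l) / (2 * l) \<le> r"
proof -
  define r1 where "r1 = sqrt (s1 - \<sigma>)"
  define r2 where "r2 = sqrt (s2 - \<sigma>)"
  define sg' where "sg' = sqrt \<sigma>"
  have sq: "r1\<^sup>2 = s1 - \<sigma>" "r2\<^sup>2 = s2 - \<sigma>" "sg'\<^sup>2 = \<sigma>" using sg by (simp_all add: r1_def r2_def sg'_def)
  have s: "r1\<^sup>2 + sg'\<^sup>2 = s1" "r2\<^sup>2 + sg'\<^sup>2 = s2" by (simp_all add: sq)
  define lnV where "lnV = ln ((s1 + q) * (s2 + q) ^ (l - 1) / q ^ l)"
  define c0 where "c0 = x1 * z1 / s1 + (real l - 1) * (x2 * z2 / s2)"
  \<comment> \<open>The excess of the channel's distortion over the unavoidable part c0, in the form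
    that \<open>rate_bound\<close> also contains; their cancellation leaves only terms with
    \<epsilon>.\<close>
  have gap: "real l * d - c0 = \<gamma>1\<^sup>2 * (s1 * q / (s1 + q)) + (real l - 1) * (\<gamma>2\<^sup>2 * (s2 * q / (s2 + q)))"
  proof -
    have "real l * d = x1 * (z1 + q) / (s1 + q) + (real l - 1) * (x2 * (z2 + q) / (s2 + q))"
      unfolding d using l0 by (simp only: nonzero_mult_div_cancel_left times_divide_eq_right of_nat_eq_0_iff)
    then have "real l * d - c0 = (x1 * (z1 + q) / (s1 + q) - x1 * z1 / s1) + (real l - 1) * (x2 * (z2 + q) / (s2 + q) - x2 * z2 / s2)"
      unfolding c0_def by (simp only:) (simp add: algebra_simps)
    then show ?thesis
      unfolding gap_identity[OF eigen_nonneg(1,3) q] gap_identity[OF eigen_nonneg(2,4) q] .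
  qed
  have main: "lnV \<le> 2 * real l * (r + \<epsilon>) + \<Lambda> * real l * \<epsilon>" if e: "0 < \<epsilon>" for \<epsilon>
  proof -
    obtain n and \<phi> :: "nat \<Rightarrow> (nat \<Rightarrow> real) \<Rightarrow> nat" and C :: "nat \<Rightarrow> nat set" where n: "0 < n"
      and code: "\<forall>i<l. finite (C i) \<and> \<phi> i \<in> measurable (vecM n) (count_space UNIV) \<and> (\<forall>x \<in> space (vecM n). \<phi> i x \<in> C i)"
      and rate: "\<forall>A. A \<subseteq> {..<l} \<and> card A = l \<longrightarrow> 1 / (real l * real n) * (\<Sum>i\<in>A. ln (real (card (C i)))) \<le> r + \<epsilon>"
      and dist: "\<forall>A. A \<subseteq> {..<l} \<and> l \<le> card A \<longrightarrow> 1 / (real (card A) * real n) *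
             (\<Sum>i\<in>A. \<Sum>t<n. LINT \<omega>|M. (X t i \<omega> - real_cond_exp M (code_sigma M X Z n \<phi> A) (X t i) \<omega>)\<^sup>2) \<le> d + \<epsilon>"
      using ach[unfolded achievable_def, rule_format, OF e] by (elim exE conjE) (rule that; assumption)
    have K: "canon_code l n \<phi> C q"
      using code q l0 by unfold_locales auto
    interpret K: canon_code l n r1 r2 sg' \<phi> C q by fact
    interpret cc: code K.can K.msg "PiE {..<l} C" by (rule K.msg_code)
    let ?m = "\<lambda>\<omega>. \<lambda>i\<in>{..<l}. \<phi> i (Sblock X Z n i \<omega>)"
    \<comment> \<open>The conditional mean of a canonical source coordinate given all messages, in
      the form of \<open>message_mean\<close>.\<close>
    define sh where "sh t j = (SOME k. \<forall>u. (LINT \<omega>|K.can. (K.src \<omega> t j - k (K.msg \<omega>)) * u (K.msg \<omega>)) = 0)" for t j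
    have sh: "(LINT \<omega>|K.can. (K.src \<omega> t j - sh t j (K.msg \<omega>)) * u (K.msg \<omega>)) = 0" if "t < n" "j < l" for t j u
    proof -
      have "integrable K.can (\<lambda>\<omega>. K.src \<omega> t j)"
        using K.can.square_integrable_imp_integrable[OF K.src_meas[OF that] K.src_sq[OF that]] .
      from cc.message_mean[OF this] obtain k where "\<forall>u. (LINT \<omega>|K.can. (K.src \<omega> t j - k (K.msg \<omega>)) * u (K.msg \<omega>)) = 0"
        by blast
      from someI[of "\<lambda>k. \<forall>u. (LINT \<omega>|K.can. (K.src \<omega> t j - k (K.msg \<omega>)) * u (K.msg \<omega>)) = 0", OF this]
      show ?thesis unfolding sh_def by (rule spec)
    qed
    define E where "E t = (LINT \<omega>|K.can. qf l (\<gamma>1\<^sup>2) (\<gamma>2\<^sup>2) (K.dl sh t \<omega>))" for t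
    have scale: "x \<le> real l * real n * y" if "1 / (real l * real n) * x \<le> y" for x y
      using that n l0 by (simp add: pos_divide_le_eq mult.commute)
    have rates: "(\<Sum>i<l. ln (real (card (C i)))) \<le> real l * real n * (r + \<epsilon>)"
    proof (rule scale)
      show "1 / (real l * real n) * (\<Sum>i<l. ln (real (card (C i)))) \<le> r + \<epsilon>" using rate[THEN spec, of "{..<l}"] by simp
    qed
    define ce where "ce t i = real_cond_exp M (code_sigma M X Z n \<phi> {..<l}) (X t i)" for t i
    have dists: "(\<Sum>i<l. \<Sum>t<n. LINT \<omega>|M. (X t i \<omega> - ce t i \<omega>)\<^sup>2) \<le> real l * real n * (d + \<epsilon>)"
    proof (rule scale)
      show "1 / (real l * real n) * (\<Sum>i<l. \<Sum>t<n. LINT \<omega>|M. (X t i \<omega> - ce t i \<omega>)\<^sup>2) \<le> d + \<epsilon>"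
        using dist[THEN spec, of "{..<l}"] by (simp add: ce_def)
    qed
    \<comment> \<open>The conditional expectation factors through the messages and thus counts as a
      decoder for \<open>distortion_bound\<close>; only its dependence on the messages is carried
      over to the canonical source.\<close>
    define k where "k t i = (SOME k. \<forall>\<omega>\<in>space M. ce t i \<omega> = k (?m \<omega>))" for t i
    have k: "ce t i \<omega> = k t i (?m \<omega>)" if "\<omega> \<in> space M" for t i \<omega>
    proof -
      have "ce t i \<in> borel_measurable (vimage_algebra (space M) ?m (count_space UNIV))"
        unfolding ce_def code_sigma_def by (rule borel_measurable_cond_exp)
      then have "\<exists>k. \<forall>\<omega>\<in>space M. ce t i \<omega> = k (?m \<omega>)" by (rule vimage_count_factor) blast
      then have "\<forall>\<omega>\<in>space M. ce t i \<omega> = k t i (?m \<omega>)" unfolding k_def by (rule someI_ex)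
      then show ?thesis using that by (rule bspec)
    qed
    have "(\<Sum>i<l. \<Sum>t<n. LINT \<omega>|M. (X t i \<omega> - ce t i \<omega>)\<^sup>2) =
      (\<Sum>t<n. \<Sum>i<l. LINT \<omega>|M. (X t i \<omega> - k t i (?m \<omega>))\<^sup>2)"
      by (subst sum.swap, intro sum.cong refl Bochner_Integration.integral_cong) (simp_all add: k)
    moreover have "(\<Sum>t<n. c0 + E t) \<le> (\<Sum>t<n. \<Sum>i<l. LINT \<omega>|M. (X t i \<omega> - k t i (?m \<omega>))\<^sup>2)"
    proof (rule sum_mono)
      fix t assume "t \<in> {..<n}"
      then have t: "t < n" by simp
      show "c0 + E t \<le> (\<Sum>i<l. LINT \<omega>|M. (X t i \<omega> - k t i (?m \<omega>))\<^sup>2)"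
        unfolding c0_def E_def by (rule distortion_bound[OF K t s]) (rule sh[OF t])
    qed
    ultimately have Eb: "(\<Sum>t<n. E t) \<le> real n * (real l * (d + \<epsilon>) - c0)"
      using dists by (simp add: sum.distrib algebra_simps)
    have rc: "K.rate_coef r1 w1 = \<Lambda> * \<gamma>1\<^sup>2" "K.rate_coef r2 w2 = \<Lambda> * \<gamma>2\<^sup>2"
      unfolding K.rate_coef_def sq using A by simp_all
    have qs: "qf l (\<Lambda> * \<gamma>1\<^sup>2) (\<Lambda> * \<gamma>2\<^sup>2) y = \<Lambda> * qf l (\<gamma>1\<^sup>2) (\<gamma>2\<^sup>2) y" for y
      by (simp add: qf_def algebra_simps)
    have "real n * (lnV + \<Lambda> * \<gamma>1\<^sup>2 * (s1 * q / (s1 + q)) + (real l - 1) * (\<Lambda> * \<gamma>2\<^sup>2 * (s2 * q / (s2 + q)))) - (\<Sum>t<n. \<Lambda> * E t)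
      \<le> 2 * (\<Sum>i<l. ln (real (card (C i))))"
      using K.rate_bound[OF w, of sh] unfolding rc s qs lnV_def E_def by simp
    moreover have "\<Lambda> * \<gamma>1\<^sup>2 * (s1 * q / (s1 + q)) + (real l - 1) * (\<Lambda> * \<gamma>2\<^sup>2 * (s2 * q / (s2 + q))) = \<Lambda> * (real l * d - c0)"
      unfolding gap by (simp add: algebra_simps)
    moreover have "(\<Sum>t<n. \<Lambda> * E t) \<le> \<Lambda> * (real n * (real l * (d + \<epsilon>) - c0))"
      unfolding sum_distrib_left[symmetric] using Eb lam by (rule mult_left_mono)
    ultimately have "real n * (lnV + \<Lambda> * (real l * d - c0)) - \<Lambda> * (real n * (real l * (d + \<epsilon>) - c0)) \<le> 2 * (real l * real n * (r + \<epsilon>))"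
      using rates by (simp only: add.assoc)
    then have "real n * lnV \<le> real n * (2 * real l * (r + \<epsilon>) + \<Lambda> * real l * \<epsilon>)" by (simp add: algebra_simps)
    then show ?thesis using n by simp
  qed
  show ?thesis
  proof (rule field_le_epsilon)
    fix e :: real assume e: "0 < e"
    \<comment> \<open>Solves 2 \<epsilon> + \<Lambda> \<epsilon> = 2 e, so that the losses in rate
      and in distortion together cost exactly 2 * l * e.\<close>
    define \<epsilon> where "\<epsilon> = e / (1 + \<Lambda> / 2)"
    have \<epsilon>: "0 < \<epsilon>" using e lam by (simp add: \<epsilon>_def add_pos_nonneg)
    have "e = \<epsilon> * (1 + \<Lambda> / 2)" using lam by (simp add: \<epsilon>_def add_nonneg_eq_0_iff)
    then have "2 * real l * (r + \<epsilon>) + \<Lambda> * real l * \<epsilon> = 2 * real l * (r + e)" by (simp add: algebra_simps)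
    then have "lnV \<le> 2 * real l * (r + e)" using main[OF \<epsilon>] by simp
    then show "ln ((s1 + q) * (s2 + q) ^ (l - 1) / q ^ l) / (2 * l) \<le> r + e"
      unfolding lnV_def[symmetric] using l0 by (simp add: field_simps)
  qed
qed

end

section \<open>The multiplier and the water level\<close>

text \<open>Here \<open>b\<close> indexes the smaller eigenvalue of the source covariance; the stationarity
  equations for the two eigenvalues are linear in the weights and in the multiplier.\<close>

lemma multiplier_exists:
  fixes xa xb sa sb ma mb q :: real
  assumes s: "0 < sb" "sb \<le> sa" and q: "0 < q" and m: "0 < ma" "0 < mb" and x: "xa \<noteq> 0 \<or> xb \<noteq> 0"
    and cond: "mb * xb\<^sup>2 * q * (sa - sb) * (sa + q) \<le> (ma + mb) * sb * xa\<^sup>2 * (sb + q)\<^sup>2"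
  obtains wa wb \<Lambda> where "0 \<le> wa" "0 \<le> wb" "ma * wa + mb * wb = ma + mb" "0 \<le> \<Lambda>"
    "(sa + q) / (sb + q) * (sa - sb + wa * sb * (sa + q) / q) = \<Lambda> * xa\<^sup>2"
    "(sb + q) / (sb + q) * (sb - sb + wb * sb * (sb + q) / q) = \<Lambda> * xb\<^sup>2"
proof -
  define u where "u = sa + q"
  define v where "v = sb + q"
  have uv: "0 < u" "0 < v" using s q by (simp_all add: u_def v_def)
  define num where "num = ma * (sa - sb) + (ma + mb) * sb * u / q"
  define den where "den = ma * xa\<^sup>2 * v / u + mb * xb\<^sup>2 * u / v"
  define \<Lambda> where "\<Lambda> = num / den"
  define wb where "wb = \<Lambda> * xb\<^sup>2 * q / (sb * v)"
  define wa where "wa = (ma + mb - mb * wb) / ma"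
  have num0: "0 \<le> num" using s q m uv by (simp add: num_def)
  have den0: "0 < den"
  proof -
    have "0 \<le> ma * xa\<^sup>2 * v / u" "0 \<le> mb * xb\<^sup>2 * u / v" using m uv by simp_all
    moreover have "0 < ma * xa\<^sup>2 * v / u \<or> 0 < mb * xb\<^sup>2 * u / v" using x m uv by auto
    ultimately show ?thesis unfolding den_def by linarith
  qed
  have \<Lambda>0: "0 \<le> \<Lambda>" using num0 den0 by (simp add: \<Lambda>_def)
  have Ld: "\<Lambda> * den = num" using den0 by (simp add: \<Lambda>_def)
  have wb0: "0 \<le> wb" using \<Lambda>0 q s uv by (simp add: wb_def)
  \<comment> \<open>The inequality mb * wb \<le> ma + mb, equivalently wa \<ge> 0, cleared of
    denominators. This is the only place where \<open>cond\<close> enters.\<close>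
  have "mb * xb\<^sup>2 * q * num \<le> (ma + mb) * sb * v * den"
  proof -
    have "mb * xb\<^sup>2 * q * num = ma * (mb * xb\<^sup>2 * q * (sa - sb)) + (ma + mb) * sb * mb * xb\<^sup>2 * u"
      using q by (simp add: num_def field_simps)
    moreover have "(ma + mb) * sb * v * den = ma * ((ma + mb) * sb * xa\<^sup>2 * v\<^sup>2 / u) + (ma + mb) * sb * mb * xb\<^sup>2 * u"
      using uv by (simp add: den_def distrib_left power2_eq_square)
    moreover have "mb * xb\<^sup>2 * q * (sa - sb) \<le> (ma + mb) * sb * xa\<^sup>2 * v\<^sup>2 / u"
      using cond uv by (simp add: u_def[symmetric] v_def[symmetric] pos_le_divide_eq)
    ultimately show ?thesis using mult_left_mono[of "mb * xb\<^sup>2 * q * (sa - sb)" "(ma + mb) * sb * xa\<^sup>2 * v\<^sup>2 / u" ma] m by linarith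
  qed
  then have "mb * wb \<le> ma + mb"
    using den0 s uv by (simp add: wb_def \<Lambda>_def field_simps)
  then have wa0: "0 \<le> wa" using m by (simp add: wa_def)
  have ws: "ma * wa + mb * wb = ma + mb" using m by (simp add: wa_def)
  have B: "wb * sb * v / q = \<Lambda> * xb\<^sup>2" using q s uv by (simp add: wb_def)
  have A: "u / v * (sa - sb + wa * sb * u / q) = \<Lambda> * xa\<^sup>2"
  proof -
    have "ma * (sa - sb + wa * sb * u / q) = num - mb * u / v * (wb * sb * v / q)"
    proof -
      have "ma * wa = ma + mb - mb * wb" using ws by simp
      then have "ma * (sa - sb + wa * sb * u / q) = ma * (sa - sb) + (ma + mb - mb * wb) * sb * u / q"
        by (simp add: distrib_left mult.assoc[symmetric])
      also have "\<dots> = num - mb * u / v * (wb * sb * v / q)"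
        using uv q by (simp add: num_def field_simps)
      finally show ?thesis .
    qed
    also have "\<dots> = \<Lambda> * (ma * xa\<^sup>2 * v / u)"
      unfolding B Ld[symmetric] den_def by (simp add: algebra_simps)
    also have "\<dots> = ma * (\<Lambda> * (xa\<^sup>2 * v / u))" by simp
    finally have "sa - sb + wa * sb * u / q = \<Lambda> * (xa\<^sup>2 * v / u)" using m by (simp only: mult_cancel_left) auto
    then show ?thesis using uv by simp
  qed
  show thesis
  proof (rule that[OF wa0 wb0 ws \<Lambda>0])
    show "(sa + q) / (sb + q) * (sa - sb + wa * sb * (sa + q) / q) = \<Lambda> * xa\<^sup>2" using A by (simp add: u_def v_def)
    show "(sb + q) / (sb + q) * (sb - sb + wb * sb * (sb + q) / q) = \<Lambda> * xb\<^sup>2" using B uv by (simp add: v_def)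
  qed
qed

lemma posterior_spread: "s - s * inverse (s + q) * s = s * q / (s + q)" if "0 < s + q" for s q :: real
  using that by (simp add: field_simps)

text \<open>\<mu> compares the variances that the channel leaves in the two eigenspaces, and \<mu> -
  1 = - q (sa - sb) / (sa (sb + q)). After clearing fractions a common factor sb cancels.\<close>

lemma ratio_condition:
  fixes xa xb sa sb ma mb q :: real
  assumes s: "0 < sb" "sb \<le> sa" and q: "0 < q"
    and mu: "\<mu> = (sb * q / (sb + q)) / (sa * q / (sa + q))"
    and c: "0 \<le> mb * xb\<^sup>2 * sa\<^sup>2 * \<mu> * (\<mu> - 1) + m * xa\<^sup>2 * sb\<^sup>2"
  shows "mb * xb\<^sup>2 * q * (sa - sb) * (sa + q) \<le> m * sb * xa\<^sup>2 * (sb + q)\<^sup>2"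
proof -
  define u where "u = sa + q"
  define v where "v = sb + q"
  have uv: "0 < u" "0 < v" using s q by (simp_all add: u_def v_def)
  have sa: "0 < sa" using s by simp
  have 1: "\<mu> = sb * u / (sa * v)" unfolding mu u_def[symmetric] v_def[symmetric] using q by simp
  have "sb * u - sa * v = - (q * (sa - sb))" by (simp add: u_def v_def algebra_simps)
  then have 2: "\<mu> - 1 = - (q * (sa - sb)) / (sa * v)" unfolding 1 using sa uv by (simp add: field_simps)
  have "sa\<^sup>2 * \<mu> * (\<mu> - 1) = - (sb * u * q * (sa - sb)) / v\<^sup>2"
    unfolding 2 unfolding 1 using sa uv by (simp add: power2_eq_square)
  then have "0 \<le> mb * xb\<^sup>2 * (- (sb * u * q * (sa - sb)) / v\<^sup>2) + m * xa\<^sup>2 * sb\<^sup>2"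
    using c by (simp only: mult.assoc)
  then have "mb * xb\<^sup>2 * (sb * u * q * (sa - sb)) / v\<^sup>2 \<le> m * xa\<^sup>2 * sb\<^sup>2" by simp
  then have "mb * xb\<^sup>2 * (sb * u * q * (sa - sb)) \<le> m * xa\<^sup>2 * sb\<^sup>2 * v\<^sup>2" using uv by (simp add: pos_divide_le_eq)
  then have "sb * (mb * xb\<^sup>2 * q * (sa - sb) * u) \<le> sb * (m * sb * xa\<^sup>2 * v\<^sup>2)" by (simp add: power2_eq_square mult_ac)
  then show ?thesis using s by (simp add: u_def v_def)
qed

text \<open>The order of s1 and s2 decides which condition applies, and the multiplicities 1 and L -
  1 trade places accordingly. A vanishing smaller eigenvalue needs a separate solution, since the
  general one divides by it.\<close>

lemma stationary_multiplier:
  fixes x1 x2 s1 s2 q L :: real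
  assumes x: "0 \<le> x1" "x1 \<le> s1" "0 \<le> x2" "x2 \<le> s2" and x0: "x1 \<noteq> 0 \<or> x2 \<noteq> 0" and q: "0 < q" and L: "1 < L"
    and mu: "\<mu> = (s2 - s2 * inverse (s2 + q) * s2) / (s1 - s1 * inverse (s1 + q) * s1)"
    and nu: "\<nu> = (s1 - s1 * inverse (s1 + q) * s1) / (s2 - s2 * inverse (s2 + q) * s2)"
    and c: "(s2 \<le> s1 \<and> 0 \<le> (L - 1) * x2\<^sup>2 * s1\<^sup>2 * \<mu> * (\<mu> - 1) + L * x1\<^sup>2 * s2\<^sup>2) \<or>
      (s1 \<le> s2 \<and> 0 \<le> x1\<^sup>2 * s2\<^sup>2 * \<nu> * (\<nu> - 1) + L * x2\<^sup>2 * s1\<^sup>2)"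
  obtains w1 w2 \<Lambda> where "0 \<le> w1" "0 \<le> w2" "w1 + (L - 1) * w2 = L" "0 \<le> \<Lambda>"
    "(s1 + q) / (min s1 s2 + q) * (s1 - min s1 s2 + w1 * min s1 s2 * (s1 + q) / q) / s1\<^sup>2 = \<Lambda> * (x1 / s1)\<^sup>2"
    "(s2 + q) / (min s1 s2 + q) * (s2 - min s1 s2 + w2 * min s1 s2 * (s2 + q) / q) / s2\<^sup>2 = \<Lambda> * (x2 / s2)\<^sup>2"
proof -
  have p: "0 < s1 + q" "0 < s2 + q" using x q by auto
  have mu': "\<mu> = (s2 * q / (s2 + q)) / (s1 * q / (s1 + q))" and nu': "\<nu> = (s1 * q / (s1 + q)) / (s2 * q / (s2 + q))"
    unfolding mu nu posterior_spread[OF p(1)] posterior_spread[OF p(2)] by simp_all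
  have div: "y / s\<^sup>2 = \<Lambda> * (z / s)\<^sup>2" if "y = \<Lambda> * z\<^sup>2" for y s z \<Lambda> :: real
    using that by (simp add: power_divide)
  consider "min s1 s2 = 0" | "0 < s2" "s2 \<le> s1" "0 \<le> (L - 1) * x2\<^sup>2 * s1\<^sup>2 * \<mu> * (\<mu> - 1) + L * x1\<^sup>2 * s2\<^sup>2"
    | "0 < s1" "s1 \<le> s2" "0 \<le> x1\<^sup>2 * s2\<^sup>2 * \<nu> * (\<nu> - 1) + L * x2\<^sup>2 * s1\<^sup>2"
    using c x by (cases "min s1 s2 = 0") (auto simp: min_def split: if_splits)
  then show thesis
  proof cases
    case 1
    have z: "(s1 = 0 \<and> x1 = 0 \<and> x2 \<noteq> 0) \<or> (s2 = 0 \<and> x2 = 0 \<and> x1 \<noteq> 0)"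
      using 1 x x0 by (auto simp: min_def split: if_splits)
    \<comment> \<open>With smaller eigenvalue 0 the weights drop out of both equations and are set
      to 1. One equation reads 0 = 0 and the other is solved for \<Lambda>; only the summand with a
      nonzero target eigenvalue survives.\<close>
    define \<Lambda> where "\<Lambda> = (s1 + q) * s1 / q / (if x1 = 0 then 1 else x1\<^sup>2) + (s2 + q) * s2 / q / (if x2 = 0 then 1 else x2\<^sup>2)"
    have "0 \<le> \<Lambda>" using x q p unfolding \<Lambda>_def by (intro add_nonneg_nonneg divide_nonneg_nonneg mult_nonneg_nonneg) auto
    then show thesis
      by (intro that[of 1 1 \<Lambda>]) (use z q 1 in \<open>auto simp: \<Lambda>_def power_divide\<close>)
  next
    case 2
    have m: "min s1 s2 = s2" using 2 by simp
    from ratio_condition[OF 2(1,2) q mu' 2(3)]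
    have "(L - 1) * x2\<^sup>2 * q * (s1 - s2) * (s1 + q) \<le> (1 + (L - 1)) * s2 * x1\<^sup>2 * (s2 + q)\<^sup>2" by simp
    from multiplier_exists[OF 2(1,2) q _ _ x0 this] L
    obtain wa wb \<Lambda> where w: "0 \<le> wa" "0 \<le> wb" "1 * wa + (L - 1) * wb = 1 + (L - 1)" "0 \<le> \<Lambda>"
      "(s1 + q) / (s2 + q) * (s1 - s2 + wa * s2 * (s1 + q) / q) = \<Lambda> * x1\<^sup>2"
      "(s2 + q) / (s2 + q) * (s2 - s2 + wb * s2 * (s2 + q) / q) = \<Lambda> * x2\<^sup>2"
      by (metis diff_gt_0_iff_gt zero_less_one)
    have ws: "wa + (L - 1) * wb = L" using w(3) by simp
    show thesis
      by (rule that[OF w(1,2) ws w(4)]) (unfold m, (rule div, rule w)+)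
  next
    case 3
    have m: "min s1 s2 = s1" using 3 by simp
    have "0 \<le> 1 * x1\<^sup>2 * s2\<^sup>2 * \<nu> * (\<nu> - 1) + L * x2\<^sup>2 * s1\<^sup>2" using 3(3) by simp
    from ratio_condition[OF 3(1,2) q nu' this]
    have "1 * x1\<^sup>2 * q * (s2 - s1) * (s2 + q) \<le> ((L - 1) + 1) * s1 * x2\<^sup>2 * (s1 + q)\<^sup>2" by simp
    from multiplier_exists[OF 3(1,2) q _ _ _ this] L x0
    obtain wa wb \<Lambda> where w: "0 \<le> wa" "0 \<le> wb" "(L - 1) * wa + 1 * wb = (L - 1) + 1" "0 \<le> \<Lambda>"
      "(s2 + q) / (s1 + q) * (s2 - s1 + wa * s1 * (s2 + q) / q) = \<Lambda> * x2\<^sup>2"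
      "(s1 + q) / (s1 + q) * (s1 - s1 + wb * s1 * (s1 + q) / q) = \<Lambda> * x1\<^sup>2"
      by (metis diff_gt_0_iff_gt zero_less_one)
    have ws: "wb + (L - 1) * wa = L" using w(3) by simp
    show thesis
      by (rule that[OF w(2,1) ws w(4)]) (unfold m, (rule div, rule w)+)
  qed
qed

section \<open>The water level as the solution of a monotone equation\<close>

context gauss_src
begin

lemma total_eigen: "x1 + (real l - 1) * x2 = real l * gX" "z1 + (real l - 1) * z2 = real l * gZ"
  by (simp_all add: lam1_def lam2_def algebra_simps)

lemma gZ_nonneg: "0 \<le> gZ"
proof -
  have "0 \<le> real l * gZ" unfolding total_eigen(2)[symmetric] using eigen_nonneg l2 by simp
  then show ?thesis using l0 by (simp add: zero_le_mult_iff)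
qed

lemma source_eigen:
  assumes "0 < gX"
  shows "lam1 l (gS gX gZ) (rS gX rX gZ rZ) = s1" "lam2 (gS gX gZ) (rS gX rX gZ rZ) = s2"
proof -
  have "rS gX rX gZ rZ * gS gX gZ = rX * gX + rZ * gZ" using assms gZ_nonneg by (simp add: rS_def gS_def)
  then show "lam1 l (gS gX gZ) (rS gX rX gZ rZ) = s1" "lam2 (gS gX gZ) (rS gX rX gZ rZ) = s2"
    unfolding lam1_def lam2_def distrib_right mult.assoc left_diff_distrib by (simp_all add: gS_def algebra_simps)
qed

text \<open>The left side of the defining equation of the water level, with each fraction written as
  x - x^2 / (s + q). This form shows the monotonicity in q and remains meaningful at q = 0 when s
  vanishes.\<close>

definition dist_fun :: "real \<Rightarrow> real" where
  "dist_fun q = (x1 - x1\<^sup>2 / (s1 + q) + (real l - 1) * (x2 - x2\<^sup>2 / (s2 + q))) / l"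

lemma dist_fun_eq:
  assumes "0 < q"
  shows "dist_fun q = (x1 * (z1 + q) / (s1 + q) + (real l - 1) * (x2 * (z2 + q) / (s2 + q))) / l"
  using mmse_form[of x1 z1 q] mmse_form[of x2 z2 q] assms eigen_nonneg by (simp add: dist_fun_def add_pos_nonneg)

text \<open>Each correction x^2 / (s + q) decreases with q, strictly so if x is nonzero; the
  positive trace l * gX provides a nonzero eigenvalue.\<close>

lemma dist_fun_mono:
  assumes g: "0 < gX" and q: "0 < q" "q < q'"
  shows "dist_fun q < dist_fun q'"
proof -
  have le: "x\<^sup>2 / (s + q') \<le> x\<^sup>2 / (s + q)" if "0 \<le> s" for x s :: real using that q by (intro divide_left_mono) auto
  have less: "x\<^sup>2 / (s + q') < x\<^sup>2 / (s + q)" if "0 \<le> s" "x \<noteq> 0" for x s :: real using that q by (intro divide_strict_left_mono) auto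
  have "x1 \<noteq> 0 \<or> x2 \<noteq> 0" using total_eigen(1) g l0 by auto
  moreover define m where "m = real l - 1"
  moreover have m: "0 < m" using l2 by (simp add: m_def)
  ultimately have "x1\<^sup>2 / (s1 + q') + m * (x2\<^sup>2 / (s2 + q')) < x1\<^sup>2 / (s1 + q) + m * (x2\<^sup>2 / (s2 + q))"
  proof (elim disjE)
    assume "x1 \<noteq> 0"
    then show ?thesis using le[of s2 x2] less[of s1 x1] eigen_nonneg m by (intro add_less_le_mono mult_left_mono) auto
  next
    assume "x2 \<noteq> 0"
    then show ?thesis using le[of s1 x1] less[of s2 x2] eigen_nonneg m by (intro add_le_less_mono mult_strict_left_mono) auto
  qed
  then show ?thesis using l0 unfolding dist_fun_def m_def by (intro divide_strict_right_mono) (simp_all add: right_diff_distrib)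
qed

lemma dist_fun_zero:
  assumes g: "0 < gX" shows "dist_fun 0 = dmin l gX rX gZ rZ"
proof -
  have 1: "x - x\<^sup>2 / (x + z) = (if x + z = 0 then 0 else x * z / (x + z))" if "0 \<le> x" "0 \<le> z" for x z :: real
    using that by (auto simp: divide_simps power2_eq_square algebra_simps)
  show ?thesis
    using 1[OF eigen_nonneg(1,3)] 1[OF eigen_nonneg(2,4)]
    by (simp add: dmin_def Let_def source_eigen[OF g] dist_fun_def add_divide_distrib)
qed

lemma dist_fun_onto:
  assumes g: "0 < gX" and d: "dmin l gX rX gZ rZ < d" "d < gX"
  obtains q where "0 < q" "dist_fun q = d"
proof -
  define B where "B = (x1\<^sup>2 + (real l - 1) * x2\<^sup>2) / l"
  \<comment> \<open>Replacing s + Q by Q gives \<open>dist_fun Q\<close> \<ge> gX - B / Q, and this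
    choice of Q makes B / Q < gX - d.\<close>
  define Q where "Q = B / (gX - d) + 1"
  have B: "0 \<le> B" using l2 by (simp add: B_def)
  have Q: "0 < Q" using B d by (simp add: Q_def add_nonneg_pos)
  have "B < Q * (gX - d)" using d by (simp add: Q_def distrib_right)
  then have BQ: "B / Q < gX - d" using Q by (simp add: pos_divide_less_eq mult.commute)
  have "d < dist_fun Q"
  proof -
    have le: "x\<^sup>2 / (s + Q) \<le> x\<^sup>2 / Q" if "0 \<le> s" for x s :: real using that Q by (intro divide_left_mono) auto
    have "(x1 - x1\<^sup>2 / Q + (real l - 1) * (x2 - x2\<^sup>2 / Q)) / l \<le> dist_fun Q"
      unfolding dist_fun_def using le[of s1 x1] le[of s2 x2] eigen_nonneg l2
      by (intro divide_right_mono add_mono mult_left_mono) auto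
    also have "(x1 - x1\<^sup>2 / Q + (real l - 1) * (x2 - x2\<^sup>2 / Q)) / l = (x1 + (real l - 1) * x2) / l - B / Q"
      by (simp add: B_def algebra_simps add_divide_distrib diff_divide_distrib)
    also have "\<dots> = gX - B / Q" unfolding total_eigen(1) using l0 by simp
    finally show ?thesis using BQ by simp
  qed
  moreover have "continuous_on {0..Q} dist_fun"
  proof -
    \<comment> \<open>The fraction could fail to be continuous at q = 0 only for s = 0, and then x =
      0 as well.\<close>
    have c: "continuous_on {0..Q} (\<lambda>q. x\<^sup>2 / (s + q))" if "0 \<le> x" "x \<le> s" for x s :: real
    proof (cases "x = 0")
      case False
      then show ?thesis using that by (intro continuous_intros) auto
    qed simp
    define f1 where "f1 q = x1\<^sup>2 / (s1 + q)" for q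
    define f2 where "f2 q = x2\<^sup>2 / (s2 + q)" for q
    have f: "continuous_on {0..Q} f1" "continuous_on {0..Q} f2"
      unfolding f1_def f2_def using eigen_nonneg by (simp_all add: c)
    have "dist_fun = (\<lambda>q. (x1 - f1 q + (real l - 1) * (x2 - f2 q)) / l)" by (simp add: fun_eq_iff dist_fun_def f1_def f2_def)
    then show ?thesis using l0 by (simp only:) (intro continuous_intros f, simp)
  qed
  moreover have "dist_fun 0 < d" using dist_fun_zero[OF g] d by simp
  ultimately obtain q where q: "0 \<le> q" "q \<le> Q" "dist_fun q = d"
    using IVT'[of dist_fun 0 d Q] Q by auto
  with \<open>dist_fun 0 < d\<close> have "0 < q" by (cases "q = 0") auto
  with q show thesis by (intro that)
qed

lemma lamQ_char:
  assumes g: "0 < gX" and d: "dmin l gX rX gZ rZ < d" "d < gX"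
  shows "0 < lamQ l gX rX gZ rZ d" "dist_fun (lamQ l gX rX gZ rZ d) = d"
proof -
  obtain q where q: "0 < q" "dist_fun q = d" using dist_fun_onto[OF g d] .
  have e: "x1 * (z1 + p) / (real l * (s1 + p)) + (real l - 1) * x2 * (z2 + p) / (real l * (s2 + p)) = dist_fun p" if "0 < p" for p
    unfolding dist_fun_eq[OF that] by (simp add: add_divide_distrib mult_ac)
  have "lamQ l gX rX gZ rZ d = q"
    unfolding lamQ_def source_eigen[OF g]
  proof (rule the_equality)
    show "0 < q \<and> x1 * (z1 + q) / (real l * (s1 + q)) + (real l - 1) * x2 * (z2 + q) / (real l * (s2 + q)) = d"
      using q e by simp
    fix p assume "0 < p \<and> x1 * (z1 + p) / (real l * (s1 + p)) + (real l - 1) * x2 * (z2 + p) / (real l * (s2 + p)) = d"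
    then have p: "0 < p" "dist_fun p = d" using e by auto
    show "p = q" using dist_fun_mono[OF g, of p q] dist_fun_mono[OF g, of q p] p q by (cases p q rule: linorder_cases) auto
  qed
  with q show "0 < lamQ l gX rX gZ rZ d" "dist_fun (lamQ l gX rX gZ rZ d) = d" by simp_all
qed

text \<open>s1 - s2 is a positive multiple of the correlation coefficient of the sources, so its
  sign tells which eigenvalue is the white part \<sigma>.\<close>

lemma eigen_order:
  assumes g: "0 < gX"
  shows "0 \<le> rS gX rX gZ rZ \<longleftrightarrow> s2 \<le> s1" "rS gX rX gZ rZ \<le> 0 \<longleftrightarrow> s1 \<le> s2"
proof -
  have "s1 - s2 = (real l * gS gX gZ) * rS gX rX gZ rZ"
    unfolding source_eigen[OF g, symmetric] by (simp add: lam1_def lam2_def algebra_simps)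
  then obtain c where "s1 - s2 = c * rS gX rX gZ rZ" "0 < c"
    using g gZ_nonneg l0 by (auto intro!: that simp: gS_def)
  then have "0 \<le> rS gX rX gZ rZ \<longleftrightarrow> 0 \<le> s1 - s2" "rS gX rX gZ rZ \<le> 0 \<longleftrightarrow> s1 - s2 \<le> 0"
    by (auto simp: zero_le_mult_iff mult_le_0_iff)
  then show "0 \<le> rS gX rX gZ rZ \<longleftrightarrow> s2 \<le> s1" "rS gX rX gZ rZ \<le> 0 \<longleftrightarrow> s1 \<le> s2" by simp_all
qed

end

text \<open>The minimum is expressed by attainment together with the lower bound. For k = l only one
  distortion level matters, so it is passed as a constant function.\<close>

theorem theorem1:
  fixes M :: "'a measure" and l :: nat and gX rX gZ rZ dl :: real
    and X Z :: "nat \<Rightarrow> nat \<Rightarrow> 'a \<Rightarrow> real"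
  assumes l2: "2 \<le> l"
    and gX_pos: "0 < gX"
    and psdX: "psd_mat l (equicov gX rX)"
    and psdZ: "psd_mat l (equicov gZ rZ)"
    and psdS: "psd_mat l (equicov (gS gX gZ) (rS gX rX gZ rZ))"
    and model: "gauss_model M l gX rX gZ rZ X Z"
    and d_range: "dmin l gX rX gZ rZ < dl" "dl < gX"
    and cond:
      "let q = lamQ l gX rX gZ rZ dl;
           x1 = lam1 l gX rX; x2 = lam2 gX rX;
           s1 = lam1 l (gS gX gZ) (rS gX rX gZ rZ); s2 = lam2 (gS gX gZ) (rS gX rX gZ rZ);
           \<mu> = (s2 - s2 * inverse (s2 + q) * s2) / (s1 - s1 * inverse (s1 + q) * s1);
           \<nu> = (s1 - s1 * inverse (s1 + q) * s1) / (s2 - s2 * inverse (s2 + q) * s2)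
       in (0 \<le> rS gX rX gZ rZ \<and>
             0 \<le> (real l - 1) * x2\<^sup>2 * s1\<^sup>2 * \<mu> * (\<mu> - 1) + real l * x1\<^sup>2 * s2\<^sup>2)
        \<or> (rS gX rX gZ rZ \<le> 0 \<and>
             0 \<le> x1\<^sup>2 * s2\<^sup>2 * \<nu> * (\<nu> - 1) + real l * x2\<^sup>2 * s1\<^sup>2)"
  shows "achievable M l X Z l (rbar l gX rX gZ rZ dl) (\<lambda>_. dl) \<and>
         (\<forall>r. achievable M l X Z l r (\<lambda>_. dl) \<longrightarrow> rbar l gX rX gZ rZ dl \<le> r)"
proof -
  interpret gauss_src M l gX rX gZ rZ X Z
    by (rule gauss_src.intro[OF l2 model psdX psdZ])
  define q where "q = lamQ l gX rX gZ rZ dl"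
  have q: "0 < q" "dist_fun q = dl" unfolding q_def by (rule lamQ_char[OF gX_pos d_range])+
  have d: "dl = (x1 * (z1 + q) / (s1 + q) + (real l - 1) * (x2 * (z2 + q) / (s2 + q))) / l"
    using dist_fun_eq[OF q(1)] q(2) by simp
  have r: "rbar l gX rX gZ rZ dl = ln ((s1 + q) * (s2 + q) ^ (l - 1) / q ^ l) / (2 * l)"
    by (simp add: rbar_def Let_def source_eigen[OF gX_pos] q_def)
  define \<mu> where "\<mu> = (s2 - s2 * inverse (s2 + q) * s2) / (s1 - s1 * inverse (s1 + q) * s1)"
  define \<nu> where "\<nu> = (s1 - s1 * inverse (s1 + q) * s1) / (s2 - s2 * inverse (s2 + q) * s2)"
  have c: "(s2 \<le> s1 \<and> 0 \<le> (real l - 1) * x2\<^sup>2 * s1\<^sup>2 * \<mu> * (\<mu> - 1) + real l * x1\<^sup>2 * s2\<^sup>2) \<or>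
      (s1 \<le> s2 \<and> 0 \<le> x1\<^sup>2 * s2\<^sup>2 * \<nu> * (\<nu> - 1) + real l * x2\<^sup>2 * s1\<^sup>2)"
    using cond unfolding Let_def source_eigen[OF gX_pos] eigen_order[OF gX_pos] q_def[symmetric] \<mu>_def[symmetric] \<nu>_def[symmetric] .
  have x: "0 \<le> x1" "x1 \<le> s1" "0 \<le> x2" "x2 \<le> s2" using eigen_nonneg by simp_all
  have x0: "x1 \<noteq> 0 \<or> x2 \<noteq> 0" using total_eigen(1) gX_pos l0 by auto
  have L: "1 < real l" using l2 by simp
  \<comment> \<open>The white part split off in the converse is \<sigma> = min s1 s2, which lets
    both orderings of the eigenvalues share one argument.\<close>
  obtain w1 w2 \<Lambda> where w: "0 \<le> w1" "0 \<le> w2" "w1 + (real l - 1) * w2 = real l" and lam: "0 \<le> \<Lambda>"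
    and A: "(s1 + q) / (min s1 s2 + q) * (s1 - min s1 s2 + w1 * min s1 s2 * (s1 + q) / q) / s1\<^sup>2 = \<Lambda> * (x1 / s1)\<^sup>2"
      "(s2 + q) / (min s1 s2 + q) * (s2 - min s1 s2 + w2 * min s1 s2 * (s2 + q) / q) / s2\<^sup>2 = \<Lambda> * (x2 / s2)\<^sup>2"
    using stationary_multiplier[OF x x0 q(1) L \<mu>_def \<nu>_def c] .
  show ?thesis
    unfolding r
  proof (intro conjI allI impI)
    show "achievable M l X Z l (ln ((s1 + q) * (s2 + q) ^ (l - 1) / q ^ l) / (2 * l)) (\<lambda>_. dl)"
      by (rule achievability[OF q(1) d])
    fix r assume a: "achievable M l X Z l r (\<lambda>_. dl)"
    show "ln ((s1 + q) * (s2 + q) ^ (l - 1) / q ^ l) / (2 * l) \<le> r"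
      by (rule converse[OF q(1) w lam _ _ _ A d a]) (use eigen_nonneg in auto)
  qed
qed

end
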